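(* The following statements hold. (i) Let $\omega>0$ and $0<\gamma<(1-\sqrt3/2)^{1/3}\sqrt\omega$. Then there exists $L^*>0$ such that, for all $0<L<L^*$, there exists an action ground state on $\mathcal G_L$, i.e. a function $u\in\mathcal N_{\omega,\gamma,L}$ with $S_{\omega,\gamma,L}(u)=s_{\omega,\gamma,L}$. (ii) Let $\omega>0$ and $0<\gamma<\sqrt\omega$. Then there exists $L^{**}>0$ such that, for all $L\ge L^{**}$, there exists an action ground state on $\mathcal G_L$. Furthermore, in each of these situations, the (non-negative) action ground state $u=(u_c,u_h)$ has one of the following shapes, where $P=(u_c(-L),u_c'(-L))$ and $E_0=(\sqrt{2\omega},q_{\omega,\gamma,+}(\sqrt{2\omega}))$. (A) $u_c$ is even on $[-L,L]$, $P\in\Gamma^1_{\omega,\gamma}\cup\Gamma^2_{\omega,\gamma}\cup\Gamma^3_{\omega,\gamma}$, and: (A-i) if $P\in\Gamma^1_{\omega,\gamma}\setminus\{E_0\}$, then $u_h$ is a tail-type solution and: (a) if $u_c(-L)<\sqrt{2(\omega-\gamma^2)}$, then $u_c$ is a dnoidal-type solution; (b) if $u_c(-L)=\sqrt{2(\omega-\gamma^2)}$, then $u_c$ is a hyperbolic secant; (c) if $\sqrt{2(\omega-\gamma^2)}<u_c(-L)<\sqrt{2\omega}$, then $u_c$ is a cnoidal-type solution; (A-ii) if $P=E_0$, then $u_h$ is a half soliton-type solution and $u_c$ is a cnoidal-type solution; (A-iii) if $P\in\Gamma^2_{\omega,\gamma}\setminus\{E_0\}$, then $u_h$ is a bump-type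 solution and: (a) if $u_c(-L)>\sqrt{2(\omega-\gamma^2/9)}$, then $u_c$ is a cnoidal-type solution; (b) if $u_c(-L)=\sqrt{2(\omega-\gamma^2/9)}$, then $u_c$ is a hyperbolic secant; (c) if $\sqrt{2(\omega-\gamma^2)}<u_c(-L)<\sqrt{2(\omega-\gamma^2/9)}$, then $u_c$ is a dnoidal-type solution; (A-iv) if $P=(\sqrt{2(\omega-\gamma^2)},0)$, then $u_h$ is a bump-type solution and $u_c$ is a dnoidal-type solution; in particular, if $\gamma=\sqrt{\omega/2}$, then $u_c\equiv\sqrt\omega$; (A-v) if $P\in\Gamma^3_{\omega,\gamma}$, then $u_h$ is a bump-type solution and $u_c$ is a dnoidal-type solution. Moreover, in the cases (A-i)(a), (A-iii)(c) and (A-v), the translation parameter $a$ of $u_c$ is either $a=0$ or $a=\sqrt{(2-k^2)/\omega}\,K(k)$; in the cases (A-i)(b) and (A-iii)(b), the translation parameter of $u_c$ is $0$; in the cases (A-i)(c), (A-ii) and (A-iii)(a), the translation parameter of $u_c$ is $a=0$ and its parameter $k$ satisfies $\sqrt{(2k^2-1)/\omega}\,K(k)>L$; and in the case (A-iv), the translation parameter of $u_h$ is $b=-\operatorname{arctanh}(\gamma/\sqrt\omega)$, the translation parameter $a$ of $u_c$ is either $a=0$ or $a=\sqrt{(2-k^2)/\omega}\,K(k)$, and $L=n\sqrt{(2-k^2)/\omega}\,K(k)$ for some $n\in\mathbb N$. (B) $u_c$ is not even on $[-L,L]$, and $$u_c(x)=\sqrt{\tfrac{2\omega}{2-k^2}}\,\operatorname{dn}\Big(\sqrt{\tfrac{\omega}{2-k^2}}\,x+a;k\Big)\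 (x\in[-L,L]),\qquad u_h(x)=\sqrt{2\omega}\,\operatorname{sech}\Big(\sqrt\omega\,x-\operatorname{arctanh}\big(\tfrac{\gamma}{\sqrt\omega}\big)\Big)\ (x\ge0),$$ with $a\in\mathbb R$ and $k\in(0,1)$ satisfying $u_c(-L)=u_c(L)=u_h(0)$ and $n\sqrt{(2-k^2)/\omega}\,K(k)=L$ for some $n\in\mathbb N$.
   Context: Here $\mathbb N=\{0,1,2,\dots\}$. For $L>0$, the tadpole graph $\mathcal G_L$ consists of a compact edge $c$ identified with $[-L,L]$ and a half-line $h$ identified with $[0,\infty)$, the points $-L,L$ of $c$ and $0$ of $h$ being identified with a single vertex $\mathrm v$. A function $v:\mathcal G_L\to\mathbb C$ is a pair $v=(v_c,v_h)$ of functions on $[-L,L]$ and $[0,\infty)$; it is non-negative if $v_c$ and $v_h$ are real-valued and $\ge0$. Set $\|v\|_{L^p(\mathcal G_L)}^p=\|v_c\|_{L^p(-L,L)}^p+\|v_h\|_{L^p(0,\infty)}^p$, $v'=(v_c',v_h')$, and $H^1_D(\mathcal G_L)=\{(v_c,v_h)\in H^1(-L,L)\times H^1(0,\infty): v_c(-L)=v_c(L)=v_h(0)\}$; for such $v$ the common value is denoted $v(\mathrm v)$. For $\omega>0$, $\gamma>0$ and $v\in H^1_D(\mathcal G_L)$, define $S_{\omega,\gamma,L}(v)=\frac12\|v'\|_{L^2(\mathcal G_L)}^2+\frac\gamma2|v(\mathrm v)|^2+\frac\omega2\|v\|_{L^2(\mathcal G_L)}^2-\frac14\|v\|_{L^4(\mathcal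 G_L)}^4$, $I_{\omega,\gamma,L}(v)=\|v'\|_{L^2(\mathcal G_L)}^2+\gamma|v(\mathrm v)|^2+\omega\|v\|_{L^2(\mathcal G_L)}^2-\|v\|_{L^4(\mathcal G_L)}^4$, $\mathcal N_{\omega,\gamma,L}=\{v\in H^1_D(\mathcal G_L): v\not\equiv0,\ I_{\omega,\gamma,L}(v)=0\}$ and $s_{\omega,\gamma,L}=\inf\{S_{\omega,\gamma,L}(v):v\in\mathcal N_{\omega,\gamma,L}\}$. An action ground state is a minimizer of this problem. For $p\in[0,\sqrt{2\omega}]$ set $q_{\omega,\gamma,\pm}(p)=\frac p2\big(\gamma\pm\sqrt{\omega-p^2/2}\big)$, and, for $0<\gamma<\sqrt\omega$, $\Gamma^1_{\omega,\gamma}=\{(p,q_{\omega,\gamma,+}(p)):0<p\le\sqrt{2\omega}\}$, $\Gamma^2_{\omega,\gamma}=\{(p,q_{\omega,\gamma,-}(p)):\sqrt{2(\omega-\gamma^2)}\le p\le\sqrt{2\omega}\}$, $\Gamma^3_{\omega,\gamma}=\{(p,q_{\omega,\gamma,-}(p)):0<p\le\sqrt{2(\omega-\gamma^2)}\}$. $\operatorname{dn}(\cdot;k),\operatorname{cn}(\cdot;k)$ are the Jacobi elliptic functions of modulus $k$ and $K(k)=\int_0^{\pi/2}\frac{d\theta}{\sqrt{1-k^2\sin^2\theta}}$. A function $\phi$ on an interval is: a dnoidal-type solution with parameter $k\in[0,1)$ and translation parameter $a\in[-\sqrt{(2-k^2)/\omega}\,K(k),\sqrt{(2-k^2)/\omega}\,K(k))$,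 or $a=\sqrt{(2-k^2)/\omega}\,K(k)$, if $\phi(x)=\sqrt{\frac{2\omega}{2-k^2}}\operatorname{dn}\big(\sqrt{\frac{\omega}{2-k^2}}x+a;k\big)$; a cnoidal-type solution with parameter $k\in(1/\sqrt2,1)$ and translation parameter $a\in[-2\sqrt{(2k^2-1)/\omega}\,K(k),2\sqrt{(2k^2-1)/\omega}\,K(k))$ if $\phi(x)=\sqrt{\frac{2\omega k^2}{2k^2-1}}\operatorname{cn}\big(\sqrt{\frac{\omega}{2k^2-1}}x+a;k\big)$; a hyperbolic secant with translation parameter $b\in\mathbb R$ if $\phi(x)=\sqrt{2\omega}\operatorname{sech}(\sqrt\omega x+b)$. On $[0,\infty)$, a hyperbolic secant with translation parameter $b$ is called tail-type if $b>0$, half soliton-type if $b=0$, bump-type if $b<0$. *)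

theory Defs
  imports "HOL-Analysis.Analysis"
begin

section \<open>Sobolev spaces on intervals\<close>

text \<open>
  Throughout, \<open>J\<close> is an open interval. The space \<open>L\<^sup>2(J)\<close> consists of total functions of which only
  the restriction to \<open>J\<close> matters.
\<close>

definition L2_on :: "real set \<Rightarrow> (real \<Rightarrow> complex) \<Rightarrow> bool" where
  "L2_on J f \<longleftrightarrow>
     set_borel_measurable lebesgue J f \<and> set_integrable lebesgue J (\<lambda>x. (cmod (f x))\<^sup>2)"

text \<open>The \<open>p\<close>-th power of the \<open>L\<^sup>p(J)\<close>-norm.\<close>

definition Lp_norm_pow :: "nat \<Rightarrow> real set \<Rightarrow> (real \<Rightarrow> complex) \<Rightarrow> real" where
  "Lp_norm_pow p J f = (LINT x:J|lebesgue. cmod (f x) ^ p)"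

text \<open>
  Weak derivatives are tested against \<open>C\<^sup>1\<close> functions with compact support in \<open>J\<close>, as in Brezis'
  textbook; real-valued test functions suffice by linearity.
\<close>

definition test_function :: "real set \<Rightarrow> (real \<Rightarrow> real) \<Rightarrow> bool" where
  "test_function J \<phi> \<longleftrightarrow>
     \<phi> C1_differentiable_on UNIV \<and> (\<exists>K. compact K \<and> K \<subseteq> J \<and> (\<forall>x. x \<notin> K \<longrightarrow> \<phi> x = 0))"

definition has_weak_deriv :: "real set \<Rightarrow> (real \<Rightarrow> complex) \<Rightarrow> (real \<Rightarrow> complex) \<Rightarrow> bool" where
  "has_weak_deriv J f g \<longleftrightarrow>
     (\<forall>\<phi>. test_function J \<phi> \<longrightarrow>
        (LINT x:J|lebesgue. deriv \<phi> x *\<^sub>R f x) = - (LINT x:J|lebesgue. \<phi> x *\<^sub>R g x))"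

text \<open>
  Elements of \<open>H\<^sup>1(J)\<close> are identified with their continuous representatives on the closed interval,
  so that the values at the end points make sense.
\<close>

definition H1_on :: "real set \<Rightarrow> (real \<Rightarrow> complex) \<Rightarrow> bool" where
  "H1_on J f \<longleftrightarrow>
     continuous_on (closure J) f \<and> L2_on J f \<and> (\<exists>g. L2_on J g \<and> has_weak_deriv J f g)"

text \<open>The weak derivative is unique up to null sets, so its \<open>L\<^sup>2\<close>-norm is independent of the choice.\<close>

definition weak_deriv :: "real set \<Rightarrow> (real \<Rightarrow> complex) \<Rightarrow> real \<Rightarrow> complex" where
  "weak_deriv J f = (SOME g. L2_on J g \<and> has_weak_deriv J f g)"


section \<open>The tadpole graph\<close>

text \<open>
  A function on the graph is a pair \<open>(v\<^sub>c, v\<^sub>h)\<close>, of which only the restrictions of \<open>v\<^sub>c\<close> to \<open>[-L, L]\<close>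
  and of \<open>v\<^sub>h\<close> to \<open>[0, \<infinity>)\<close> matter.
\<close>

type_synonym tadpole_fun = "(real \<Rightarrow> complex) \<times> (real \<Rightarrow> complex)"

definition tadpole_norm_pow :: "nat \<Rightarrow> real \<Rightarrow> tadpole_fun \<Rightarrow> real" where
  "tadpole_norm_pow p L v = Lp_norm_pow p {-L<..<L} (fst v) + Lp_norm_pow p {0<..} (snd v)"

definition tadpole_deriv :: "real \<Rightarrow> tadpole_fun \<Rightarrow> tadpole_fun" where
  "tadpole_deriv L v = (weak_deriv {-L<..<L} (fst v), weak_deriv {0<..} (snd v))"

definition H1D :: "real \<Rightarrow> tadpole_fun set" where
  "H1D L = {v. H1_on {-L<..<L} (fst v) \<and> H1_on {0<..} (snd v) \<and>
               fst v (-L) = fst v L \<and> fst v L = snd v 0}"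

definition vertex_value :: "tadpole_fun \<Rightarrow> complex" where
  "vertex_value v = snd v 0"

definition tadpole_nonneg :: "real \<Rightarrow> tadpole_fun \<Rightarrow> bool" where
  "tadpole_nonneg L v \<longleftrightarrow>
     (\<forall>x\<in>{-L..L}. fst v x \<in> \<real>\<^sub>\<ge>\<^sub>0) \<and> (\<forall>x\<in>{0..}. snd v x \<in> \<real>\<^sub>\<ge>\<^sub>0)"

definition tadpole_nonzero :: "real \<Rightarrow> tadpole_fun \<Rightarrow> bool" where
  "tadpole_nonzero L v \<longleftrightarrow> (\<exists>x\<in>{-L..L}. fst v x \<noteq> 0) \<or> (\<exists>x\<in>{0..}. snd v x \<noteq> 0)"

definition action :: "real \<Rightarrow> real \<Rightarrow> real \<Rightarrow> tadpole_fun \<Rightarrow> real" where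
  "action \<omega> \<gamma> L v =
     1/2 * tadpole_norm_pow 2 L (tadpole_deriv L v) + \<gamma>/2 * (cmod (vertex_value v))\<^sup>2
     + \<omega>/2 * tadpole_norm_pow 2 L v - 1/4 * tadpole_norm_pow 4 L v"

definition nehari_functional :: "real \<Rightarrow> real \<Rightarrow> real \<Rightarrow> tadpole_fun \<Rightarrow> real" where
  "nehari_functional \<omega> \<gamma> L v =
     tadpole_norm_pow 2 L (tadpole_deriv L v) + \<gamma> * (cmod (vertex_value v))\<^sup>2
     + \<omega> * tadpole_norm_pow 2 L v - tadpole_norm_pow 4 L v"

definition nehari_set :: "real \<Rightarrow> real \<Rightarrow> real \<Rightarrow> tadpole_fun set" where
  "nehari_set \<omega> \<gamma> L = {v \<in> H1D L. tadpole_nonzero L v \<and> nehari_functional \<omega> \<gamma> L v = 0}"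

definition action_inf :: "real \<Rightarrow> real \<Rightarrow> real \<Rightarrow> real" where
  "action_inf \<omega> \<gamma> L = (INF v\<in>nehari_set \<omega> \<gamma> L. action \<omega> \<gamma> L v)"

definition action_ground_state :: "real \<Rightarrow> real \<Rightarrow> real \<Rightarrow> tadpole_fun \<Rightarrow> bool" where
  "action_ground_state \<omega> \<gamma> L u \<longleftrightarrow>
     u \<in> nehari_set \<omega> \<gamma> L \<and> action \<omega> \<gamma> L u = action_inf \<omega> \<gamma> L"


section \<open>The curves in the phase plane\<close>

definition q_plus :: "real \<Rightarrow> real \<Rightarrow> real \<Rightarrow> real" where
  "q_plus \<omega> \<gamma> p = p/2 * (\<gamma> + sqrt (\<omega> - p\<^sup>2/2))"

definition q_minus :: "real \<Rightarrow> real \<Rightarrow> real \<Rightarrow> real" where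
  "q_minus \<omega> \<gamma> p = p/2 * (\<gamma> - sqrt (\<omega> - p\<^sup>2/2))"

definition Gamma1 :: "real \<Rightarrow> real \<Rightarrow> (real \<times> real) set" where
  "Gamma1 \<omega> \<gamma> = {(p, q_plus \<omega> \<gamma> p) |p. 0 < p \<and> p \<le> sqrt (2*\<omega>)}"

definition Gamma2 :: "real \<Rightarrow> real \<Rightarrow> (real \<times> real) set" where
  "Gamma2 \<omega> \<gamma> = {(p, q_minus \<omega> \<gamma> p) |p. sqrt (2*(\<omega> - \<gamma>\<^sup>2)) \<le> p \<and> p \<le> sqrt (2*\<omega>)}"

definition Gamma3 :: "real \<Rightarrow> real \<Rightarrow> (real \<times> real) set" where
  "Gamma3 \<omega> \<gamma> = {(p, q_minus \<omega> \<gamma> p) |p. 0 < p \<and> p \<le> sqrt (2*(\<omega> - \<gamma>\<^sup>2))}"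

definition E0 :: "real \<Rightarrow> real \<Rightarrow> real \<times> real" where
  "E0 \<omega> \<gamma> = (sqrt (2*\<omega>), q_plus \<omega> \<gamma> (sqrt (2*\<omega>)))"


section \<open>Jacobi elliptic functions\<close>

text \<open>
  All functions are parametrised by the modulus \<open>k \<in> [0, 1)\<close> (not by \<open>m = k\<^sup>2\<close>). The amplitude
  \<open>jacobi_am k\<close> is the inverse of the incomplete integral \<open>ellF k\<close>, which is an increasing
  bijection of the real line; the interval integral is oriented, so \<open>ellF k\<close> is odd.
\<close>

definition ellF :: "real \<Rightarrow> real \<Rightarrow> real" where
  "ellF k \<phi> = (LBINT \<theta>=0..\<phi>. 1 / sqrt (1 - k\<^sup>2 * (sin \<theta>)\<^sup>2))"

definition ellK :: "real \<Rightarrow> real" where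
  "ellK k = ellF k (pi/2)"

definition jacobi_am :: "real \<Rightarrow> real \<Rightarrow> real" where
  "jacobi_am k x = (THE \<phi>. ellF k \<phi> = x)"

definition jacobi_cn :: "real \<Rightarrow> real \<Rightarrow> real" where
  "jacobi_cn k x = cos (jacobi_am k x)"

definition jacobi_dn :: "real \<Rightarrow> real \<Rightarrow> real" where
  "jacobi_dn k x = sqrt (1 - k\<^sup>2 * (sin (jacobi_am k x))\<^sup>2)"


section \<open>Types of solutions\<close>

definition dn_length :: "real \<Rightarrow> real \<Rightarrow> real" where
  "dn_length \<omega> k = sqrt ((2 - k\<^sup>2) / \<omega>) * ellK k"

definition cn_length :: "real \<Rightarrow> real \<Rightarrow> real" where
  "cn_length \<omega> k = sqrt ((2 * k\<^sup>2 - 1) / \<omega>) * ellK k"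

definition dn_profile :: "real \<Rightarrow> real \<Rightarrow> real \<Rightarrow> real \<Rightarrow> real" where
  "dn_profile \<omega> k a x =
     sqrt (2 * \<omega> / (2 - k\<^sup>2)) * jacobi_dn k (sqrt (\<omega> / (2 - k\<^sup>2)) * x + a)"

definition cn_profile :: "real \<Rightarrow> real \<Rightarrow> real \<Rightarrow> real \<Rightarrow> real" where
  "cn_profile \<omega> k a x =
     sqrt (2 * \<omega> * k\<^sup>2 / (2 * k\<^sup>2 - 1)) * jacobi_cn k (sqrt (\<omega> / (2 * k\<^sup>2 - 1)) * x + a)"

definition sech_profile :: "real \<Rightarrow> real \<Rightarrow> real \<Rightarrow> real" where
  "sech_profile \<omega> b x = sqrt (2 * \<omega>) * (1 / cosh (sqrt \<omega> * x + b))"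

text \<open>
  The translation \<open>a\<close> is added inside the argument of \<open>dn\<close> and \<open>cn\<close>, whereas the bounds on it are
  half periods of the profiles in the variable \<open>x\<close>; this is the paper's normalisation.
\<close>

definition dnoidal_type :: "real \<Rightarrow> real set \<Rightarrow> (real \<Rightarrow> real) \<Rightarrow> real \<Rightarrow> real \<Rightarrow> bool" where
  "dnoidal_type \<omega> X f k a \<longleftrightarrow>
     0 \<le> k \<and> k < 1 \<and> - dn_length \<omega> k \<le> a \<and> a \<le> dn_length \<omega> k \<and>
     (\<forall>x\<in>X. f x = dn_profile \<omega> k a x)"

definition cnoidal_type :: "real \<Rightarrow> real set \<Rightarrow> (real \<Rightarrow> real) \<Rightarrow> real \<Rightarrow> real \<Rightarrow> bool" where
  "cnoidal_type \<omega> X f k a \<longleftrightarrow>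
     1 / sqrt 2 < k \<and> k < 1 \<and> - (2 * cn_length \<omega> k) \<le> a \<and> a < 2 * cn_length \<omega> k \<and>
     (\<forall>x\<in>X. f x = cn_profile \<omega> k a x)"

definition sech_type :: "real \<Rightarrow> real set \<Rightarrow> (real \<Rightarrow> real) \<Rightarrow> real \<Rightarrow> bool" where
  "sech_type \<omega> X f b \<longleftrightarrow> (\<forall>x\<in>X. f x = sech_profile \<omega> b x)"

definition tail_type :: "real \<Rightarrow> (real \<Rightarrow> real) \<Rightarrow> bool" where
  "tail_type \<omega> f \<longleftrightarrow> (\<exists>b>0. sech_type \<omega> {0..} f b)"

definition half_soliton_type :: "real \<Rightarrow> (real \<Rightarrow> real) \<Rightarrow> bool" where
  "half_soliton_type \<omega> f \<longleftrightarrow> sech_type \<omega> {0..} f 0"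

definition bump_type :: "real \<Rightarrow> (real \<Rightarrow> real) \<Rightarrow> bool" where
  "bump_type \<omega> f \<longleftrightarrow> (\<exists>b<0. sech_type \<omega> {0..} f b)"


section \<open>The possible shapes of a ground state\<close>

text \<open>
  The next two predicates combine the type of \<open>u\<^sub>c\<close> with the restriction on its parameters that the
  classification gives in the respective cases.
\<close>

definition even_dnoidal :: "real \<Rightarrow> real \<Rightarrow> (real \<Rightarrow> real) \<Rightarrow> bool" where
  "even_dnoidal \<omega> L f \<longleftrightarrow>
     (\<exists>k a. dnoidal_type \<omega> {-L..L} f k a \<and> (a = 0 \<or> a = dn_length \<omega> k))"

definition even_cnoidal :: "real \<Rightarrow> real \<Rightarrow> (real \<Rightarrow> real) \<Rightarrow> bool" where
  "even_cnoidal \<omega> L f \<longleftrightarrow>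
     (\<exists>k a. cnoidal_type \<omega> {-L..L} f k a \<and> a = 0 \<and> cn_length \<omega> k > L)"

definition even_on_loop :: "real \<Rightarrow> (real \<Rightarrow> real) \<Rightarrow> bool" where
  "even_on_loop L f \<longleftrightarrow> (\<forall>x\<in>{-L..L}. f (-x) = f x)"

text \<open>Here \<open>q\<close> is the one-sided derivative \<open>u\<^sub>c'(-L)\<close>.\<close>

definition shape_A :: "real \<Rightarrow> real \<Rightarrow> real \<Rightarrow> (real \<Rightarrow> real) \<Rightarrow> (real \<Rightarrow> real) \<Rightarrow> bool" where
  "shape_A \<omega> \<gamma> L u\<^sub>c u\<^sub>h \<longleftrightarrow>
     even_on_loop L u\<^sub>c \<and>
     (\<exists>q. (u\<^sub>c has_real_derivative q) (at (-L) within {-L..L}) \<and>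
       (let p = u\<^sub>c (-L); P = (p, q) in
          P \<in> Gamma1 \<omega> \<gamma> \<union> Gamma2 \<omega> \<gamma> \<union> Gamma3 \<omega> \<gamma> \<and>
          (P \<in> Gamma1 \<omega> \<gamma> - {E0 \<omega> \<gamma>} \<longrightarrow>
             tail_type \<omega> u\<^sub>h \<and>
             (p < sqrt (2*(\<omega> - \<gamma>\<^sup>2)) \<longrightarrow> even_dnoidal \<omega> L u\<^sub>c) \<and>
             (p = sqrt (2*(\<omega> - \<gamma>\<^sup>2)) \<longrightarrow> sech_type \<omega> {-L..L} u\<^sub>c 0) \<and>
             (sqrt (2*(\<omega> - \<gamma>\<^sup>2)) < p \<and> p < sqrt (2*\<omega>) \<longrightarrow> even_cnoidal \<omega> L u\<^sub>c)) \<and>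
          (P = E0 \<omega> \<gamma> \<longrightarrow> half_soliton_type \<omega> u\<^sub>h \<and> even_cnoidal \<omega> L u\<^sub>c) \<and>
          (P \<in> Gamma2 \<omega> \<gamma> - {E0 \<omega> \<gamma>} \<longrightarrow>
             bump_type \<omega> u\<^sub>h \<and>
             (p > sqrt (2*(\<omega> - \<gamma>\<^sup>2/9)) \<longrightarrow> even_cnoidal \<omega> L u\<^sub>c) \<and>
             (p = sqrt (2*(\<omega> - \<gamma>\<^sup>2/9)) \<longrightarrow> sech_type \<omega> {-L..L} u\<^sub>c 0) \<and>
             (sqrt (2*(\<omega> - \<gamma>\<^sup>2)) < p \<and> p < sqrt (2*(\<omega> - \<gamma>\<^sup>2/9)) \<longrightarrow> even_dnoidal \<omega> L u\<^sub>c)) \<and>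
          (P = (sqrt (2*(\<omega> - \<gamma>\<^sup>2)), 0) \<longrightarrow>
             bump_type \<omega> u\<^sub>h \<and>
             sech_type \<omega> {0..} u\<^sub>h (- artanh (\<gamma> / sqrt \<omega>)) \<and>
             (\<exists>k a. dnoidal_type \<omega> {-L..L} u\<^sub>c k a \<and> (a = 0 \<or> a = dn_length \<omega> k) \<and>
                    (\<exists>n::nat. L = real n * dn_length \<omega> k)) \<and>
             (\<gamma> = sqrt (\<omega>/2) \<longrightarrow> (\<forall>x\<in>{-L..L}. u\<^sub>c x = sqrt \<omega>))) \<and>
          (P \<in> Gamma3 \<omega> \<gamma> \<longrightarrow> bump_type \<omega> u\<^sub>h \<and> even_dnoidal \<omega> L u\<^sub>c)))"

definition shape_B :: "real \<Rightarrow> real \<Rightarrow> real \<Rightarrow> (real \<Rightarrow> real) \<Rightarrow> (real \<Rightarrow> real) \<Rightarrow> bool" where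
  "shape_B \<omega> \<gamma> L u\<^sub>c u\<^sub>h \<longleftrightarrow>
     \<not> even_on_loop L u\<^sub>c \<and>
     (\<exists>a k. 0 < k \<and> k < 1 \<and>
        (\<forall>x\<in>{-L..L}. u\<^sub>c x = dn_profile \<omega> k a x) \<and>
        (\<forall>x\<in>{0..}. u\<^sub>h x = sech_profile \<omega> (- artanh (\<gamma> / sqrt \<omega>)) x) \<and>
        u\<^sub>c (-L) = u\<^sub>c L \<and> u\<^sub>c L = u\<^sub>h 0 \<and>
        (\<exists>n::nat. real n * dn_length \<omega> k = L))"

definition ground_state_shape :: "real \<Rightarrow> real \<Rightarrow> real \<Rightarrow> tadpole_fun \<Rightarrow> bool" where
  "ground_state_shape \<omega> \<gamma> L u \<longleftrightarrow>
     (let u\<^sub>c = (\<lambda>x. Re (fst u x)); u\<^sub>h = (\<lambda>x. Re (snd u x))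
      in shape_A \<omega> \<gamma> L u\<^sub>c u\<^sub>h \<or> shape_B \<omega> \<gamma> L u\<^sub>c u\<^sub>h)"

end

theory Submission
  imports Defs "HOL-Complex_Analysis.Great_Picard"
begin

text \<open>
  A function on the tadpole is encoded by one function \<open>w\<close> on \<open>[-L, \<infinity>)\<close> with \<open>w (-L) = w L\<close>. Let
  \<open>Q\<close> be the quadratic part of the action and \<open>B\<close> the fourth power of the \<open>L\<^sup>4\<close>-norm; then
  \<open>4 inf S = \<Lambda> := inf Q\<^sup>2 / B\<close>. Put \<open>\<mu> = sqrt \<omega>\<close>.

  Existence: on the line the corresponding constant is \<open>16/3 \<mu>\<^sup>3\<close>. If \<open>\<Lambda>\<close> is smaller, a calibration
  argument on half-lines shows that no mass escapes to infinity, and minimising sequences converge.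
  The inequality \<open>\<Lambda> < 16/3 \<mu>\<^sup>3\<close> is tested with a constant plateau on the loop followed by half a
  soliton (small \<open>L\<close>) or with a soliton centred on the loop (large \<open>L\<close>).

  Shape: on the half-line \<open>w\<close> is a piece of a soliton; let \<open>T\<close> be the hyperbolic tangent of its
  translation parameter. Since the total quartic mass is below \<open>16/3 \<mu>\<^sup>3\<close>, only two of the possible
  configurations survive. For small \<open>L\<close> the loop is almost constant, Kirchhoff's condition forces
  \<open>-\<gamma> < \<mu> T < -\<gamma>/3\<close>, and \<open>w > \<mu>\<close> makes the loop part strictly concave, hence even: case (A-iii)(c).
  For large \<open>L\<close> the minimum on the loop is small, and an interior minimum would cost too much quartic
  mass; so the minimum is at the vertex, whence \<open>\<gamma> < \<mu> T\<close>: case (A-i)(a).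
\<close>


section \<open>Square-integrable functions and absolute continuity\<close>

text \<open>On the Nehari set Q = B, hence S = B / 4 = Q^2 / (4 B); the last expression is invariant
  under scaling, which frees the problem from its constraint. The number 16/3 \<open>\<mu>^3\<close>
  is also the quartic mass of the whole soliton. The obstacle is loss of mass along the half-line.
  The strict inequality makes tails expensive, and the parallelogram law then turns near-minimality
  into strong convergence of the derivatives. The thresholds for L may be chosen, so in each regime
  a single configuration has to be identified instead of all stationary states. The constant (1 -
  sqrt 3 / 2)^(1/3) is about 0.512 and is used through the bound 0.53. The plateau beats the line
  for \<open>\<gamma> / \<mu>\<close> up to about 0.552 as L tends to 0, and on a short loop T is
  close to \<open>- \<gamma> / \<mu>\<close>, so that T^2 < 1/2 with a margin; this is what gives
  \<open>w > \<mu>\<close> there. Complex functions are split into real and imaginary parts.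
  Derivatives are carried along as explicit second components, so a weak derivative is chosen only
  in the translation to the graph.\<close>

definition sq_integrable :: "real set \<Rightarrow> (real \<Rightarrow> real) \<Rightarrow> bool" where
  "sq_integrable X f \<longleftrightarrow>
     f \<in> borel_measurable (lebesgue_on X) \<and> integrable (lebesgue_on X) (\<lambda>x. (f x)\<^sup>2)"

text \<open>Absolute continuity in integral form: only increments between points of X enter, so the
  notion restricts to subsets and passes to pointwise limits of f, and g is determined by f only up
  to null sets.\<close>

definition ac_on :: "real set \<Rightarrow> (real \<Rightarrow> real) \<Rightarrow> (real \<Rightarrow> real) \<Rightarrow> bool" where
  "ac_on X f g \<longleftrightarrow>
     (\<forall>x\<in>X. \<forall>y\<in>X. x \<le> y \<longrightarrow> g absolutely_integrable_on {x..y} \<and> integral {x..y} g = f y - f x)"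

section \<open>Integrals over measurable subsets of the line\<close>

lemma integrable_lebesgue_on_subset:
  fixes f :: "real \<Rightarrow> 'a::{banach, second_countable_topology}"
  assumes "integrable (lebesgue_on X) f" "Y \<subseteq> X" "X \<in> sets lebesgue" "Y \<in> sets lebesgue"
  shows "integrable (lebesgue_on Y) f"
proof -
  have "set_integrable lebesgue X f"
    using assms by (simp add: set_integrable_def integrable_restrict_space)
  then have "set_integrable lebesgue Y f"
    using assms set_integrable_subset by blast
  then show ?thesis
    using assms by (simp add: set_integrable_def integrable_restrict_space)
qed

lemma lebesgue_on_integral_set:
  fixes f :: "real \<Rightarrow> 'a::{banach, second_countable_topology}"
  assumes "X \<in> sets lebesgue"
  shows "integral\<^sup>L (lebesgue_on X) f = (LINT x:X|lebesgue. f x)"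
  using assms by (simp add: set_lebesgue_integral_def integral_restrict_space)

lemma lebesgue_on_integral_mono_set:
  fixes f :: "real \<Rightarrow> real"
  assumes "integrable (lebesgue_on X) f" "Y \<subseteq> X" "X \<in> sets lebesgue" "Y \<in> sets lebesgue"
    "\<And>x. x \<in> X \<Longrightarrow> 0 \<le> f x"
  shows "integral\<^sup>L (lebesgue_on Y) f \<le> integral\<^sup>L (lebesgue_on X) f"
proof -
  have 1: "set_integrable lebesgue X f"
    using assms by (simp add: set_integrable_def integrable_restrict_space)
  then have 2: "set_integrable lebesgue Y f"
    using assms set_integrable_subset by blast
  show ?thesis
    unfolding lebesgue_on_integral_set[OF assms(3)] lebesgue_on_integral_set[OF assms(4)]
      set_lebesgue_integral_def
    by (rule integral_mono) (use 1 2 assms in \<open>auto simp: set_integrable_def indicator_def\<close>)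
qed

lemma lebesgue_on_integral_Un:
  fixes f :: "real \<Rightarrow> real"
  assumes "integrable (lebesgue_on X) f" "integrable (lebesgue_on Y) f" "X \<inter> Y \<in> null_sets lebesgue"
    "X \<in> sets lebesgue" "Y \<in> sets lebesgue"
  shows "integrable (lebesgue_on (X \<union> Y)) f"
    "integral\<^sup>L (lebesgue_on (X \<union> Y)) f = integral\<^sup>L (lebesgue_on X) f + integral\<^sup>L (lebesgue_on Y) f"
proof -
  have 1: "set_integrable lebesgue X f" "set_integrable lebesgue Y f"
    using assms by (simp_all add: set_integrable_def integrable_restrict_space)
  have 2: "set_integrable lebesgue (X \<union> Y) f"
    using 1 assms by (intro set_integrable_Un) auto
  then show "integrable (lebesgue_on (X \<union> Y)) f"
    using assms by (simp add: set_integrable_def integrable_restrict_space)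
  have "AE x in lebesgue. \<not> (x \<in> X \<and> x \<in> Y)"
    using AE_not_in[OF assms(3)] by eventually_elim auto
  then show "integral\<^sup>L (lebesgue_on (X \<union> Y)) f = integral\<^sup>L (lebesgue_on X) f + integral\<^sup>L (lebesgue_on Y) f"
    using assms 1 2 by (simp add: lebesgue_on_integral_set set_integral_Un_AE)
qed

section \<open>Square-integrable functions and the Cauchy-Schwarz inequality\<close>

lemma sq_integrable_mult:
  assumes "sq_integrable X f" "sq_integrable X g"
  shows "integrable (lebesgue_on X) (\<lambda>x. f x * g x)"
proof (rule Bochner_Integration.integrable_bound)
  show "integrable (lebesgue_on X) (\<lambda>x. (f x)\<^sup>2 + (g x)\<^sup>2)"
    using assms by (auto simp: sq_integrable_def)
  show "(\<lambda>x. f x * g x) \<in> borel_measurable (lebesgue_on X)"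
    using assms by (auto simp: sq_integrable_def)
  have "\<bar>f x * g x\<bar> \<le> (f x)\<^sup>2 + (g x)\<^sup>2" for x
    using sum_squares_bound[of "\<bar>f x\<bar>" "\<bar>g x\<bar>"] zero_le_power2[of "f x"] zero_le_power2[of "g x"]
      mult_nonneg_nonneg[of "\<bar>f x\<bar>" "\<bar>g x\<bar>"]
    unfolding abs_mult power2_abs by linarith
  then show "AE x in lebesgue_on X. norm (f x * g x) \<le> norm ((f x)\<^sup>2 + (g x)\<^sup>2)"
    by (auto simp: abs_mult intro!: AE_I2 order_trans[OF _ abs_ge_self])
qed

lemma sq_integrable_lincomb:
  assumes "sq_integrable X f" "sq_integrable X g"
  shows "sq_integrable X (\<lambda>x. s * f x + t * g x)"
proof -
  have "integrable (lebesgue_on X) (\<lambda>x. s\<^sup>2 * (f x)\<^sup>2 + 2 * s * t * (f x * g x) + t\<^sup>2 * (g x)\<^sup>2)"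
    using assms sq_integrable_mult[OF assms] by (auto simp: sq_integrable_def)
  moreover have "s\<^sup>2 * (f x)\<^sup>2 + 2 * s * t * (f x * g x) + t\<^sup>2 * (g x)\<^sup>2 = (s * f x + t * g x)\<^sup>2" for x
    by (simp add: power2_eq_square algebra_simps)
  ultimately show ?thesis
    using assms by (auto simp: sq_integrable_def)
qed

lemma sq_integrable_subset:
  assumes "sq_integrable X f" "Y \<subseteq> X" "X \<in> sets lebesgue" "Y \<in> sets lebesgue"
  shows "sq_integrable Y f"
  using assms integrable_lebesgue_on_subset[of X _ Y] measurable_restrict_mono
  unfolding sq_integrable_def by blast

text \<open>The discriminant of a non-negative quadratic form is non-positive. With integrals as
  coefficients this is the Cauchy-Schwarz inequality.\<close>

lemma square_form_nonneg_imp: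
  fixes a b c :: real
  assumes "\<And>s t. 0 \<le> s\<^sup>2 * a + 2 * s * t * b + t\<^sup>2 * c"
  shows "b\<^sup>2 \<le> a * c"
proof -
  have a: "0 \<le> a" and c: "0 \<le> c" using assms[of 1 0] assms[of 0 1] by auto
  show ?thesis
  proof (cases "a = 0")
    case True
    have "0 \<le> 2 * s * b + c" for s using assms[of s 1] True by simp
    \<comment> \<open>For b \<noteq> 0 this argument gives the form the value -1.\<close>
    from this[of "-(c+1)/(2*b)"] have "b = 0" by (cases "b=0") (auto simp: field_simps)
    then show ?thesis using True by simp
  next
    case False
    have "0 \<le> b\<^sup>2 * a + 2*b*(-a)*b + a\<^sup>2*c" using assms[of b "-a"] by simp
    also have "\<dots> = a * (a*c - b\<^sup>2)" by (simp add: power2_eq_square algebra_simps)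
    finally show ?thesis using False a by (simp add: zero_le_mult_iff)
  qed
qed

lemma sq_integrable_Cauchy_Schwarz:
  assumes "sq_integrable X f" "sq_integrable X g"
  shows "(integral\<^sup>L (lebesgue_on X) (\<lambda>x. f x * g x))\<^sup>2
    \<le> integral\<^sup>L (lebesgue_on X) (\<lambda>x. (f x)\<^sup>2) * integral\<^sup>L (lebesgue_on X) (\<lambda>x. (g x)\<^sup>2)"
proof (rule square_form_nonneg_imp)
  fix s t :: real
  have i: "integrable (lebesgue_on X) (\<lambda>x. (f x)\<^sup>2)" "integrable (lebesgue_on X) (\<lambda>x. (g x)\<^sup>2)"
    "integrable (lebesgue_on X) (\<lambda>x. f x * g x)"
    using assms sq_integrable_mult[OF assms] by (auto simp: sq_integrable_def)
  have "0 \<le> integral\<^sup>L (lebesgue_on X) (\<lambda>x. (s * f x + t * g x)\<^sup>2)" by simp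
  also have "(\<lambda>x. (s * f x + t * g x)\<^sup>2) = (\<lambda>x. s\<^sup>2 * (f x)\<^sup>2 + 2 * s * t * (f x * g x) + t\<^sup>2 * (g x)\<^sup>2)"
    by (simp add: power2_eq_square algebra_simps fun_eq_iff)
  also have "integral\<^sup>L (lebesgue_on X) \<dots> = s\<^sup>2 * integral\<^sup>L (lebesgue_on X) (\<lambda>x. (f x)\<^sup>2)
      + 2 * s * t * integral\<^sup>L (lebesgue_on X) (\<lambda>x. f x * g x) + t\<^sup>2 * integral\<^sup>L (lebesgue_on X) (\<lambda>x. (g x)\<^sup>2)"
    using i by (simp add: mult.assoc)
  finally show "0 \<le> \<dots>" .
qed

lemma sq_integrable_const: "sq_integrable {a..b} (\<lambda>x. c)"
  by (simp add: sq_integrable_def)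

lemma sq_integrable_imp_integrable:
  assumes "sq_integrable {a..b} f"
  shows "integrable (lebesgue_on {a..b}) f"
  using sq_integrable_mult[OF assms sq_integrable_const[of _ _ 1]] by simp

lemma sq_integrable_imp_absolutely_integrable:
  assumes "sq_integrable {a..b} f"
  shows "f absolutely_integrable_on {a..b}"
  using sq_integrable_imp_integrable[OF assms]
  by (simp add: set_integrable_def integrable_restrict_space)

lemma sq_integrable_integral_bound:
  assumes "sq_integrable {a..b} f" "a \<le> b"
  shows "(integral {a..b} f)\<^sup>2 \<le> (b - a) * integral\<^sup>L (lebesgue_on {a..b}) (\<lambda>x. (f x)\<^sup>2)"
  using sq_integrable_Cauchy_Schwarz[OF sq_integrable_const[of _ _ 1] assms(1)] assms(2)
    lebesgue_integral_eq_integral[OF sq_integrable_imp_integrable[OF assms(1)]]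
  by (simp add: measure_restrict_space)

section \<open>Absolutely continuous functions\<close>

lemma ac_onD:
  assumes "ac_on X f g" "x \<in> X" "y \<in> X" "x \<le> y"
  shows "g absolutely_integrable_on {x..y}" "integral {x..y} g = f y - f x" "g integrable_on {x..y}"
  using assms set_lebesgue_integral_eq_integral(1) unfolding ac_on_def by blast+

text \<open>Cauchy-Schwarz against the constant 1. The estimate serves the pointwise bound on
  half-lines and the equicontinuity of minimising sequences.\<close>

lemma ac_on_Hoelder:
  assumes "ac_on X f g" "sq_integrable X g" "X \<in> sets lebesgue" "{x..y} \<subseteq> X" "x \<le> y"
  shows "(f y - f x)\<^sup>2 \<le> (y - x) * integral\<^sup>L (lebesgue_on {x..y}) (\<lambda>x. (g x)\<^sup>2)"
proof -
  have "sq_integrable {x..y} g" using assms sq_integrable_subset by auto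
  then have "(integral {x..y} g)\<^sup>2 \<le> (y - x) * integral\<^sup>L (lebesgue_on {x..y}) (\<lambda>x. (g x)\<^sup>2)"
    using assms sq_integrable_integral_bound by auto
  moreover have "integral {x..y} g = f y - f x"
    by (rule ac_onD) (use assms in auto)
  ultimately show ?thesis by simp
qed

text \<open>Indefinite integrals are continuous on compact intervals; a general interval X is
  reduced to this by enclosing x in some [l, u] inside X that is a neighbourhood of x relative to
  X.\<close>

lemma ac_on_continuous:
  assumes "ac_on X f g" "is_interval X"
  shows "continuous_on X f"
proof -
  have *: "continuous_on {x..y} f" if "x \<in> X" "y \<in> X" "x \<le> y" for x y
  proof -
    have "continuous_on {x..y} (\<lambda>z. f x + integral {x..z} g)"
      using ac_onD(3)[OF assms(1) that] by (intro continuous_on_add continuous_on_const indefinite_integral_continuous_1)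
    moreover have "f x + integral {x..z} g = f z" if "z \<in> {x..y}" for z
    proof -
      have "z \<in> X" using assms(2) that \<open>x \<in> X\<close> \<open>y \<in> X\<close> unfolding is_interval_1 by (meson atLeastAtMost_iff)
      then show ?thesis using ac_onD(2)[OF assms(1) \<open>x\<in>X\<close> \<open>z \<in> X\<close>] that by auto
    qed
    ultimately show ?thesis using continuous_on_eq by blast
  qed
  show ?thesis
    unfolding continuous_on_eq_continuous_within
  proof
    fix x assume x: "x \<in> X"
    \<comment> \<open>If x is an end point of X, then l or u is x itself and X lies entirely on the
      other side.\<close>
    obtain l u where lu: "l \<in> X" "u \<in> X" "l \<le> x" "x \<le> u" "l < x \<or> X \<subseteq> {x..}" "x < u \<or> X \<subseteq> {..x}"
    proof -
      have "\<exists>l\<in>X. l \<le> x \<and> (l < x \<or> X \<subseteq> {x..})" using x by (metis atLeast_iff less_imp_le not_less order_refl subsetI)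
      moreover have "\<exists>u\<in>X. x \<le> u \<and> (x < u \<or> X \<subseteq> {..x})" using x by (metis atMost_iff less_imp_le not_less order_refl subsetI)
      ultimately show ?thesis using that by blast
    qed
    have c: "continuous (at x within {l..u}) f"
      using *[of l u] lu unfolding continuous_on_eq_continuous_within by simp
    have "\<exists>e>0. X \<inter> ball x e \<subseteq> {l..u}"
    proof -
      define e where "e = min (if l < x then x - l else 1) (if x < u then u - x else 1)"
      have "e > 0" unfolding e_def by auto
      moreover have "X \<inter> ball x e \<subseteq> {l..u}"
      proof
        fix y assume "y \<in> X \<inter> ball x e"
        then have y: "y \<in> X" "\<bar>x - y\<bar> < e" by (auto simp: dist_real_def)
        have "l \<le> y" using lu(3,5) y unfolding e_def by (cases "l < x") auto
        moreover have "y \<le> u" using lu(4,6) y unfolding e_def by (cases "x < u") auto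
        ultimately show "y \<in> {l..u}" by simp
      qed
      ultimately show ?thesis by blast
    qed
    then obtain e where e: "e > 0" "X \<inter> ball x e \<subseteq> {l..u}" by blast
    have "(f \<longlongrightarrow> f x) (at x within (X \<inter> ball x e))"
      using c e(2) unfolding continuous_within by (rule tendsto_within_subset)
    moreover have "at x within (X \<inter> ball x e) = at x within X"
      by (rule at_within_nhd[of _ "ball x e"]) (use e in auto)
    ultimately show "continuous (at x within X) f" unfolding continuous_within by simp
  qed
qed

lemma ac_on_subset: "ac_on X f g \<Longrightarrow> Y \<subseteq> X \<Longrightarrow> ac_on Y f g"
  unfolding ac_on_def by blast

lemma ac_on_lincomb:
  assumes "ac_on X f g" "ac_on X f' g'"
  shows "ac_on X (\<lambda>x. s * f x + t * f' x) (\<lambda>x. s * g x + t * g' x)"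
  unfolding ac_on_def
proof (intro ballI impI conjI)
  fix x y assume xy: "x \<in> X" "y \<in> X" "x \<le> y"
  note 1 = ac_onD[OF assms(1) xy] and 2 = ac_onD[OF assms(2) xy]
  show "(\<lambda>x. s * g x + t * g' x) absolutely_integrable_on {x..y}"
    using 1 2 by (intro set_integral_add set_integrable_mult_right) auto
  show "integral {x..y} (\<lambda>x. s * g x + t * g' x) = s * f y + t * f' y - (s * f x + t * f' x)"
  proof (rule integral_unique)
    have "(g has_integral (f y - f x)) {x..y}" "(g' has_integral (f' y - f' x)) {x..y}"
      using 1 2 by (auto simp: has_integral_integrable_integral)
    then have "((\<lambda>x. s * g x + t * g' x) has_integral s * (f y - f x) + t * (f' y - f' x)) {x..y}"
      by (intro has_integral_add has_integral_mult_right)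
    then show "((\<lambda>x. s * g x + t * g' x) has_integral s * f y + t * f' y - (s * f x + t * f' x)) {x..y}"
      by (simp add: algebra_simps)
  qed
qed

text \<open>Products are handled by a subdivision argument, which avoids Fubini's theorem.\<close>

lemma ac_on_mult_C1:
  fixes \<phi> \<phi>' :: "real \<Rightarrow> real"
  assumes ac: "ac_on {a..b} f g" and "a \<le> b"
    and \<phi>: "\<And>x. x \<in> {a..b} \<Longrightarrow> (\<phi> has_real_derivative \<phi>' x) (at x within {a..b})"
    and c: "continuous_on {a..b} \<phi>'"
  shows "((\<lambda>x. \<phi>' x * f x + \<phi> x * g x) has_integral (\<phi> b * f b - \<phi> a * f a)) {a..b}"
    (is "(?h has_integral _) _")
proof -
  have fc: "continuous_on {a..b} f" using ac_on_continuous[OF ac] by (auto simp: is_interval_cc)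
  have \<phi>c: "continuous_on {a..b} \<phi>"
    using \<phi> by (meson DERIV_continuous_on)
  have gi: "g absolutely_integrable_on {x..y}" "g integrable_on {x..y}" if "a \<le> x" "x \<le> y" "y \<le> b" for x y
    using ac_onD[OF ac, of x y] that by auto
  have ga: "(\<lambda>x. \<bar>g x\<bar>) integrable_on {x..y}" if "a \<le> x" "x \<le> y" "y \<le> b" for x y
    using gi(1)[OF that] by (simp add: absolutely_integrable_on_def)
  have ci: "h integrable_on {x..y}" if "a \<le> x" "x \<le> y" "y \<le> b" "continuous_on {a..b} h" for x y and h :: "real \<Rightarrow> real"
    using that by (intro integrable_continuous_real continuous_on_subset[OF that(4)]) auto
  have cg: "(\<lambda>t. h t * g t) integrable_on {x..y}" if "a \<le> x" "x \<le> y" "y \<le> b" "continuous_on {a..b} h" for x y and h :: "real \<Rightarrow> real"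
  proof -
    have "(\<lambda>t. h t * g t) absolutely_integrable_on {x..y}"
    proof (rule absolutely_integrable_bounded_measurable_product_real)
      have ch: "continuous_on {x..y} h" using continuous_on_subset[OF that(4)] that by auto
      then show "h \<in> borel_measurable (lebesgue_on {x..y})"
        by (intro continuous_imp_measurable_on_sets_lebesgue) auto
      show "bounded (h ` {x..y})"
        using ch compact_continuous_image compact_imp_bounded compact_Icc by blast
    qed (use gi that in auto)
    then show ?thesis by (simp add: absolutely_integrable_on_def)
  qed
  define m where "m = (\<lambda>t. \<bar>g t\<bar> + \<bar>\<phi>' t\<bar>)"
  have mi: "m integrable_on {x..y}" if "a \<le> x" "x \<le> y" "y \<le> b" for x y
    unfolding m_def using ga[OF that] ci[OF that, of "\<lambda>t. \<bar>\<phi>' t\<bar>"] c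
    by (intro integrable_add) (auto intro: continuous_intros)
  have hi: "?h integrable_on {x..y}" if "a \<le> x" "x \<le> y" "y \<le> b" for x y
    using ci[OF that, of "\<lambda>x. \<phi>' x * f x"] cg[OF that, of \<phi>] fc \<phi>c c
    by (intro integrable_add) (auto intro: continuous_intros)
  \<comment> \<open>The defect of the product rule. It is additive over adjacent intervals, so by
    bisection a bound on short intervals by e times the integral of m extends to [a, b].\<close>
  define \<Delta> where "\<Delta> = (\<lambda>x y. \<phi> y * f y - \<phi> x * f x - integral {x..y} ?h)"
  have main: "\<bar>\<Delta> a b\<bar> \<le> e * integral {a..b} m" if e: "e > 0" for e
  proof -
    have uc: "uniformly_continuous_on {a..b} f" "uniformly_continuous_on {a..b} \<phi>"
      using fc \<phi>c by (auto intro: compact_uniformly_continuous)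
    obtain d1 where d1: "d1 > 0" "\<And>x y. x \<in> {a..b} \<Longrightarrow> y \<in> {a..b} \<Longrightarrow> \<bar>x - y\<bar> < d1 \<Longrightarrow> \<bar>f x - f y\<bar> < e"
      using uniformly_continuous_onE[OF uc(1) e] unfolding dist_real_def by (metis abs_minus_commute)
    obtain d2 where d2: "d2 > 0" "\<And>x y. x \<in> {a..b} \<Longrightarrow> y \<in> {a..b} \<Longrightarrow> \<bar>x - y\<bar> < d2 \<Longrightarrow> \<bar>\<phi> x - \<phi> y\<bar> < e"
      using uniformly_continuous_onE[OF uc(2) e] unfolding dist_real_def by (metis abs_minus_commute)
    have "a \<le> a \<and> a \<le> b \<and> b \<le> b \<longrightarrow> \<bar>\<Delta> a b\<bar> \<le> e * integral {a..b} m"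
    proof (rule Bolzano[where P = "\<lambda>x y. a \<le> x \<and> x \<le> y \<and> y \<le> b \<longrightarrow> \<bar>\<Delta> x y\<bar> \<le> e * integral {x..y} m"], goal_cases)
      case (2 x y z)
      show ?case
      proof
        assume *: "a \<le> x \<and> x \<le> z \<and> z \<le> b"
        have "integral {x..y} ?h + integral {y..z} ?h = integral {x..z} ?h"
          using 2 * hi by (intro Henstock_Kurzweil_Integration.integral_combine) auto
        moreover have "integral {x..y} m + integral {y..z} m = integral {x..z} m"
          using 2 * mi by (intro Henstock_Kurzweil_Integration.integral_combine) auto
        ultimately have "\<Delta> x z = \<Delta> x y + \<Delta> y z" and "e * integral {x..z} m = e * integral {x..y} m + e * integral {y..z} m"
          unfolding \<Delta>_def by (linarith, metis distrib_left)
        moreover have "\<bar>\<Delta> x y\<bar> \<le> e * integral {x..y} m" "\<bar>\<Delta> y z\<bar> \<le> e * integral {y..z} m"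
          using 2 * by auto
        ultimately show "\<bar>\<Delta> x z\<bar> \<le> e * integral {x..z} m" by linarith
      qed
    next
      case (3 x)
      show ?case
      proof (intro exI[of _ "min d1 d2"] conjI allI impI)
        show "0 < min d1 d2" using d1 d2 by auto
        fix u v assume uv: "u \<le> x \<and> x \<le> v \<and> v - u < min d1 d2" and ab: "a \<le> u \<and> u \<le> v \<and> v \<le> b"
        have uv': "a \<le> u" "u \<le> v" "v \<le> b" using uv ab by auto
        have fi: "f v - f u = integral {u..v} g" using ac_onD(2)[OF ac, of u v] uv' by auto
        have \<phi>i: "(\<phi>' has_integral \<phi> v - \<phi> u) {u..v}"
       proof (rule fundamental_theorem_of_calculus)
          fix t assume "t \<in> {u..v}"
          then have "(\<phi> has_real_derivative \<phi>' t) (at t within {u..v})"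
            using \<phi>[of t] uv' DERIV_subset[of \<phi> _ t "{a..b}" "{u..v}"] by auto
          then show "(\<phi> has_vector_derivative \<phi>' t) (at t within {u..v})"
            by (simp add: has_real_derivative_iff_has_vector_derivative)
        qed (use uv' in auto)
        have i1: "((\<lambda>t. \<phi> v * g t) has_integral \<phi> v * (f v - f u)) {u..v}"
          unfolding fi using gi(2)[OF uv'] by (intro has_integral_mult_right) (simp add: has_integral_integral)
        have i2: "((\<lambda>t. \<phi>' t * f u) has_integral (\<phi> v - \<phi> u) * f u) {u..v}"
          using \<phi>i by (rule has_integral_mult_left)
        have i3: "((\<lambda>t. (\<phi> v * g t + \<phi>' t * f u) - ?h t) has_integral
              (\<phi> v * (f v - f u) + (\<phi> v - \<phi> u) * f u) - integral {u..v} ?h) {u..v}"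
          using i1 i2 hi[OF uv'] by (intro has_integral_diff has_integral_add) (auto simp: has_integral_integral)
        have "(\<phi> v * (f v - f u) + (\<phi> v - \<phi> u) * f u) - integral {u..v} ?h = \<Delta> u v"
          unfolding \<Delta>_def by (simp add: algebra_simps)
        then have eq: "\<Delta> u v = integral {u..v} (\<lambda>t. (\<phi> v * g t + \<phi>' t * f u) - ?h t)"
          using i3 by (metis (no_types, lifting) integral_unique)
        have "norm (integral {u..v} (\<lambda>t. (\<phi> v * g t + \<phi>' t * f u) - ?h t)) \<le> integral {u..v} (\<lambda>t. e * m t)"
        proof (rule integral_norm_bound_integral)
          show "(\<lambda>t. (\<phi> v * g t + \<phi>' t * f u) - ?h t) integrable_on {u..v}" using i3 by blast
          show "(\<lambda>t. e * m t) integrable_on {u..v}" using integrable_cmul[OF mi[OF uv'], of e] by simp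
          fix t assume t: "t \<in> {u..v}"
          have "\<bar>f u - f t\<bar> \<le> e" using d1(2)[of u t] t uv uv' by (auto intro!: less_imp_le)
          moreover have "\<bar>\<phi> v - \<phi> t\<bar> \<le> e" using d2(2)[of v t] t uv uv' by (auto intro!: less_imp_le)
          moreover have "(\<phi> v * g t + \<phi>' t * f u) - ?h t = (\<phi> v - \<phi> t) * g t + \<phi>' t * (f u - f t)"
            by (simp add: algebra_simps)
          moreover have "\<bar>(\<phi> v - \<phi> t) * g t + \<phi>' t * (f u - f t)\<bar>
              \<le> \<bar>\<phi> v - \<phi> t\<bar> * \<bar>g t\<bar> + \<bar>\<phi>' t\<bar> * \<bar>f u - f t\<bar>"
            unfolding abs_mult[symmetric] by (rule abs_triangle_ineq)
          moreover have "\<bar>\<phi> v - \<phi> t\<bar> * \<bar>g t\<bar> + \<bar>\<phi>' t\<bar> * \<bar>f u - f t\<bar> \<le> e * \<bar>g t\<bar> + \<bar>\<phi>' t\<bar> * e"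
            using calculation(1,2) by (intro add_mono mult_right_mono mult_left_mono) auto
          ultimately have "\<bar>(\<phi> v * g t + \<phi>' t * f u) - ?h t\<bar> \<le> e * \<bar>g t\<bar> + \<bar>\<phi>' t\<bar> * e"
            by linarith
          then show "norm ((\<phi> v * g t + \<phi>' t * f u) - ?h t) \<le> e * m t"
            by (simp add: m_def algebra_simps)
        qed
        then show "\<bar>\<Delta> u v\<bar> \<le> e * integral {u..v} m" unfolding eq by simp
      qed
    qed (use \<open>a \<le> b\<close> in auto)
    then show ?thesis using \<open>a \<le> b\<close> by auto
  qed
  have "\<bar>\<Delta> a b\<bar> \<le> 0"
  proof (rule field_le_epsilon)
    fix e :: real assume e: "e > 0"
    define I where "I = integral {a..b} m"
    have I: "I \<ge> 0" unfolding I_def m_def using mi[of a b] \<open>a \<le> b\<close> by (intro integral_nonneg) (auto simp: m_def)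
    have "\<bar>\<Delta> a b\<bar> \<le> e / (I + 1) * I" using main[of "e/(I+1)"] e I unfolding I_def[symmetric] by simp
    also have "\<dots> \<le> e" using e I by (simp add: field_simps)
    finally show "\<bar>\<Delta> a b\<bar> \<le> 0 + e" by simp
  qed
  then have "\<Delta> a b = 0" by simp
  then show ?thesis using hi[of a b] \<open>a \<le> b\<close> unfolding \<Delta>_def by (simp add: has_integral_integrable_integral)
qed

section \<open>Weak derivatives on intervals\<close>

lemma compact_in_open_interval:
  fixes J :: "real set"
  assumes "open J" "is_interval J" "J \<noteq> {}" "compact K" "K \<subseteq> J"
  obtains a b where "a < b" "a \<in> J" "b \<in> J" "{a..b} \<subseteq> J" "K \<subseteq> {a<..<b}"
proof -
  obtain x0 where x0: "x0 \<in> J" using assms(3) by blast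
  \<comment> \<open>Adding a point of J makes the minimum and the maximum exist even when K is
    empty.\<close>
  define K' where "K' = insert x0 K"
  have K': "compact K'" "K' \<noteq> {}" "K' \<subseteq> J" using assms x0 by (auto simp: K'_def)
  obtain l where l: "l \<in> K'" "\<And>x. x \<in> K' \<Longrightarrow> l \<le> x" using compact_attains_inf[OF K'(1,2)] by blast
  obtain u where u: "u \<in> K'" "\<And>x. x \<in> K' \<Longrightarrow> x \<le> u" using compact_attains_sup[OF K'(1,2)] by blast
  obtain e where e: "e > 0" "ball l e \<subseteq> J" using assms(1) l K' open_contains_ball by blast
  obtain e' where e': "e' > 0" "ball u e' \<subseteq> J" using assms(1) u K' open_contains_ball by blast
  have a: "l - e/2 \<in> J" using e by (auto simp: subset_iff dist_real_def)
  have b: "u + e'/2 \<in> J" using e' by (auto simp: subset_iff dist_real_def)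
  have "l \<le> u" using l u by blast
  have "{l - e/2..u + e'/2} \<subseteq> J"
    using a b assms(2) unfolding is_interval_1 by (meson atLeastAtMost_iff subsetI)
  moreover have "K \<subseteq> {l - e/2<..<u+e'/2}"
  proof
    fix x assume "x \<in> K"
    then have "l \<le> x" "x \<le> u" using l u by (auto simp: K'_def)
    then show "x \<in> {l - e/2<..<u+e'/2}" using e(1) e'(1) by auto
  qed
  ultimately show ?thesis using that[of "l - e/2" "u + e'/2"] a b e(1) e'(1) \<open>l \<le> u\<close> by auto
qed

text \<open>The compact support is enclosed with room to spare, so \<phi> vanishes at a and b too
  and boundary terms disappear. Outside K the derivative is zero because \<phi> is zero near each
  such point.\<close>

lemma test_function_interval:
  assumes "open J" "is_interval J" "J \<noteq> {}" "test_function J \<phi>"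
  obtains a b where "a < b" "a \<in> J" "b \<in> J" "{a..b} \<subseteq> J" "\<And>x. x \<notin> {a<..<b} \<Longrightarrow> \<phi> x = 0"
    "\<And>x. x \<notin> {a<..<b} \<Longrightarrow> deriv \<phi> x = 0" "\<And>x. (\<phi> has_real_derivative deriv \<phi> x) (at x)"
    "continuous_on UNIV (deriv \<phi>)" "continuous_on UNIV \<phi>"
proof -
  obtain K where K: "compact K" "K \<subseteq> J" "\<And>x. x \<notin> K \<Longrightarrow> \<phi> x = 0"
    using assms(4) unfolding test_function_def by blast
  obtain a b where ab: "a < b" "a \<in> J" "b \<in> J" "{a..b} \<subseteq> J" "K \<subseteq> {a<..<b}"
    using compact_in_open_interval[OF assms(1-3) K(1,2)] .
  obtain D where D: "\<And>x. (\<phi> has_vector_derivative D x) (at x)" "continuous_on UNIV D"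
    using assms(4) unfolding test_function_def C1_differentiable_on_def by auto
  have d: "(\<phi> has_real_derivative D x) (at x)" for x
    using D(1) by (simp add: has_real_derivative_iff_has_vector_derivative)
  have dD: "deriv \<phi> = D" using d by (auto intro: DERIV_imp_deriv)
  have z: "\<phi> x = 0" if "x \<notin> {a<..<b}" for x
    by (rule K(3)) (use ab(5) that in auto)
  have dz: "D x = 0" if "x \<notin> {a<..<b}" for x
  proof -
    have "x \<in> - K" using that ab(5) by auto
    moreover have "open (- K)" using K(1) compact_imp_closed by auto
    ultimately have "eventually (\<lambda>y. \<phi> y = 0) (nhds x)"
      unfolding eventually_nhds using K(3) by (intro exI[of _ "- K"]) auto
    then have "((\<lambda>_. 0) has_real_derivative D x) (at x)"
      using d[of x] DERIV_cong_ev[of x x \<phi> "\<lambda>_. 0" "D x" "D x"] by simp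
    then show ?thesis using DERIV_const DERIV_unique by blast
  qed
  have pc: "continuous_on UNIV \<phi>"
    by (intro continuous_at_imp_continuous_on ballI) (rule DERIV_isCont[OF d])
  show ?thesis
    by (rule that[OF ab(1-4)]) (simp_all add: z dz d D(2) dD pc)
qed

lemma set_integral_eq_on_interval:
  fixes h :: "real \<Rightarrow> 'a::{banach, second_countable_topology}"
  assumes "{a..b} \<subseteq> J" "\<And>x. x \<notin> {a<..<b} \<Longrightarrow> h x = 0"
  shows "(LINT x:J|lebesgue. h x) = (LINT x:{a..b}|lebesgue. h x)"
  unfolding set_lebesgue_integral_def
  by (rule Bochner_Integration.integral_cong) (use assms in \<open>auto simp: indicator_def\<close>)

text \<open>Integration by parts against a test function, whose boundary terms are zero.\<close>

lemma ac_on_has_weak_deriv: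
  assumes J: "open J" "is_interval J" "J \<noteq> {}" and ac: "ac_on J f g"
  shows "has_weak_deriv J (\<lambda>x. complex_of_real (f x)) (\<lambda>x. complex_of_real (g x))"
  unfolding has_weak_deriv_def
proof (intro allI impI)
  fix \<phi> assume "test_function J \<phi>"
  then obtain a b where ab: "a < b" "a \<in> J" "b \<in> J" "{a..b} \<subseteq> J" "\<And>x. x \<notin> {a<..<b} \<Longrightarrow> \<phi> x = 0"
    "\<And>x. x \<notin> {a<..<b} \<Longrightarrow> deriv \<phi> x = 0" and d: "\<And>x. (\<phi> has_real_derivative deriv \<phi> x) (at x)"
    "continuous_on UNIV (deriv \<phi>)" "continuous_on UNIV \<phi>"
    using test_function_interval[OF J, of \<phi> thesis] by blast
  have acab: "ac_on {a..b} f g" using ac ab(4) ac_on_subset by blast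
  have fc: "continuous_on {a..b} f" using ac_on_continuous[OF acab] by (simp add: is_interval_cc)
  have "((\<lambda>x. deriv \<phi> x * f x + \<phi> x * g x) has_integral (\<phi> b * f b - \<phi> a * f a)) {a..b}"
    using d ab(1) by (intro ac_on_mult_C1[OF acab]) (auto intro: DERIV_subset continuous_on_subset)
  then have I0: "((\<lambda>x. deriv \<phi> x * f x + \<phi> x * g x) has_integral 0) {a..b}"
    using ab(5)[of a] ab(5)[of b] by simp
  have i1: "set_integrable lebesgue {a..b} (\<lambda>x. deriv \<phi> x * f x)"
    using d(2) fc by (intro absolutely_integrable_continuous_real continuous_on_mult) (auto intro: continuous_on_subset)
  have i2: "set_integrable lebesgue {a..b} (\<lambda>x. \<phi> x * g x)"
  proof (rule absolutely_integrable_bounded_measurable_product_real)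
    have c: "continuous_on {a..b} \<phi>" using d(3) continuous_on_subset by blast
    then show "\<phi> \<in> borel_measurable (lebesgue_on {a..b})"
      by (intro continuous_imp_measurable_on_sets_lebesgue) auto
    show "bounded (\<phi> ` {a..b})"
      using c compact_continuous_image compact_imp_bounded compact_Icc by blast
    show "g absolutely_integrable_on {a..b}" using ac_onD(1)[OF acab, of a b] ab(1) by simp
  qed simp
  have "(LINT x:{a..b}|lebesgue. deriv \<phi> x * f x) + (LINT x:{a..b}|lebesgue. \<phi> x * g x) = 0"
    using has_integral_unique[OF I0 has_integral_set_lebesgue[OF set_integral_add(1)[OF i1 i2]]]
      set_integral_add(2)[OF i1 i2] by simp
  then have e: "(LINT x:J|lebesgue. deriv \<phi> x * f x) = - (LINT x:J|lebesgue. \<phi> x * g x)"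
    using ab by (subst (1 2) set_integral_eq_on_interval[of a b J]) auto
  have r1: "(LINT x:J|lebesgue. deriv \<phi> x *\<^sub>R complex_of_real (f x)) = complex_of_real (LINT x:J|lebesgue. deriv \<phi> x * f x)"
    unfolding scaleR_conv_of_real of_real_mult[symmetric] by (rule set_integral_complex_of_real)
  have r2: "(LINT x:J|lebesgue. \<phi> x *\<^sub>R complex_of_real (g x)) = complex_of_real (LINT x:J|lebesgue. \<phi> x * g x)"
    unfolding scaleR_conv_of_real of_real_mult[symmetric] by (rule set_integral_complex_of_real)
  show "(LINT x:J|lebesgue. deriv \<phi> x *\<^sub>R complex_of_real (f x)) =
      - (LINT x:J|lebesgue. \<phi> x *\<^sub>R complex_of_real (g x))"
    unfolding r1 r2 e by simp
qed

text \<open>Test functions with derivative \<open>\<theta> (z - c)\<close>, where \<open>c\<close> is the \<open>\<theta>\<close>-weighted mean of \<open>z\<close>.\<close>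

lemma weak_deriv_zero_imp_constant:
  fixes z :: "real \<Rightarrow> real"
  assumes J: "open J" "is_interval J" and zc: "continuous_on J z"
    and w: "\<And>\<phi>. test_function J \<phi> \<Longrightarrow> (LINT x:J|lebesgue. deriv \<phi> x * z x) = 0"
    and xy: "x \<in> J" "y \<in> J"
  shows "z x = z y"
proof -
  have "J \<noteq> {}" using xy by auto
  obtain a b where ab: "a < b" "a \<in> J" "b \<in> J" "{a..b} \<subseteq> J" "{x,y} \<subseteq> {a<..<b}"
    using compact_in_open_interval[OF J \<open>J \<noteq> {}\<close>, of "{x,y}"] xy by auto
  define \<theta> where "\<theta> = (\<lambda>t. max 0 ((t - a) * (b - t)))"
  \<comment> \<open>Clamping to [a, b] extends z continuously beyond the interval, so that D is
    continuous on the whole line.\<close>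
  define cl where "cl = (\<lambda>t. max a (min b t))"
  define I where "I = integral {a..b} \<theta>"
  \<comment> \<open>This value makes the integral of D vanish, hence the primitive \<phi> of D is
    zero again beyond b.\<close>
  define c where "c = integral {a..b} (\<lambda>t. \<theta> t * z t) / I"
  define D where "D = (\<lambda>t. \<theta> t * (z (cl t) - c))"
  have \<theta>c: "continuous_on S \<theta>" for S unfolding \<theta>_def by (intro continuous_intros)
  have \<theta>pos: "\<theta> t > 0" if "t \<in> {a<..<b}" for t using that by (auto simp: \<theta>_def)
  have \<theta>0: "\<theta> t = 0" if "t \<notin> {a<..<b}" for t
    using that ab(1) by (auto simp: \<theta>_def max_def mult_le_0_iff not_less zero_le_mult_iff)
  have zab: "continuous_on {a..b} z" using zc ab(4) continuous_on_subset by blast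
  have clab: "cl t \<in> {a..b}" for t using ab(1) by (auto simp: cl_def)
  have cl_id: "cl t = t" if "t \<in> {a..b}" for t using that by (auto simp: cl_def)
  have "continuous_on UNIV cl" unfolding cl_def by (intro continuous_intros)
  then have "continuous_on UNIV (\<lambda>t. z (cl t))"
    by (rule continuous_on_compose2[OF zab]) (use clab in auto)
  then have Dc: "continuous_on S D" for S
    unfolding D_def by (intro continuous_on_mult continuous_on_diff continuous_on_const \<theta>c) (auto intro: continuous_on_subset)
  have D0: "D t = 0" if "t \<notin> {a<..<b}" for t using \<theta>0[OF that] by (simp add: D_def)
  have Di: "D integrable_on {s..t}" for s t by (intro integrable_continuous_real Dc)
  have Iz: "I > 0"
  proof -
    have "I \<ge> 0" unfolding I_def \<theta>_def by (intro integral_nonneg integrable_continuous_real continuous_intros) auto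
    moreover have "I \<noteq> 0"
    proof
      assume "I = 0"
      then have "\<forall>t\<in>{a..b}. \<theta> t = 0"
        using integral_eq_0_iff[OF \<theta>c[of "{a..b}"] ab(1)] by (auto simp: I_def \<theta>_def)
      moreover have "(a+b)/2 \<in> {a<..<b}" using ab(1) by auto
      ultimately show False using \<theta>pos[of "(a+b)/2"] ab(1) by fastforce
    qed
    ultimately show ?thesis by simp
  qed
  have \<theta>zi: "(\<lambda>t. \<theta> t * z t) integrable_on {a..b}"
    by (intro integrable_continuous_real continuous_on_mult \<theta>c zab)
  have "integral {a..b} D = integral {a..b} (\<lambda>t. \<theta> t * z t - \<theta> t * c)"
    by (rule integral_cong) (simp add: D_def cl_id algebra_simps)
  also have "\<dots> = integral {a..b} (\<lambda>t. \<theta> t * z t) - I * c"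
    using \<theta>zi integrable_continuous_real[OF continuous_on_mult[OF \<theta>c[of "{a..b}"] continuous_on_const[of _ c]]]
    by (subst Henstock_Kurzweil_Integration.integral_diff) (auto simp: I_def)
  also have "\<dots> = 0" using Iz by (simp add: c_def)
  finally have Dint: "integral {a..b} D = 0" .
  define \<phi> where "\<phi> = (\<lambda>t. integral {a..t} D)"
  have \<phi>d: "(\<phi> has_real_derivative D t) (at t)" for t
  proof -
    \<comment> \<open>A base point left of both a and t gives one formula for \<phi> on both sides
      of a and hence a two-sided derivative.\<close>
    define N where "N = min a t - 1"
    have eq: "\<phi> s = integral {N..s} D" for s
    proof (cases "a \<le> s")
      case True
      have "integral {N..a} D + integral {a..s} D = integral {N..s} D"
        using True by (intro Henstock_Kurzweil_Integration.integral_combine Di) (auto simp: N_def)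
      moreover have "integral {N..a} D = 0"
        by (rule integral_unique, rule has_integral_is_0) (auto intro: D0)
      ultimately show ?thesis by (simp add: \<phi>_def)
    next
      case False
      have "integral {N..s} D = 0"
        by (rule integral_unique, rule has_integral_is_0) (use False in \<open>auto intro: D0\<close>)
      then show ?thesis using False by (simp add: \<phi>_def)
    qed
    have "((\<lambda>s. integral {N..s} D) has_real_derivative D t) (at t within {N..t+1})"
      by (rule integral_has_real_derivative[OF Dc]) (auto simp: N_def)
    moreover have "at t within {N..t+1} = at t"
      by (rule at_within_interior) (auto simp: N_def interior_atLeastAtMost_real)
    moreover have "\<phi> = (\<lambda>s. integral {N..s} D)" using eq by (rule ext)
    ultimately show ?thesis by simp
  qed
  have \<phi>0: "\<phi> t = 0" if "t \<notin> {a..b}" for t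
  proof (cases "t < a")
    case True then show ?thesis by (simp add: \<phi>_def)
  next
    case False
    then have "b \<le> t" "a \<le> b" using that ab(1) by auto
    then have "integral {a..b} D + integral {b..t} D = integral {a..t} D"
      by (intro Henstock_Kurzweil_Integration.integral_combine Di) auto
    moreover have "integral {b..t} D = 0"
      by (rule integral_unique, rule has_integral_is_0) (auto intro: D0)
    ultimately show ?thesis using Dint by (simp add: \<phi>_def)
  qed
  have "test_function J \<phi>"
    unfolding test_function_def C1_differentiable_on_def
    using \<phi>d Dc \<phi>0 ab(4)
    by (auto simp: has_real_derivative_iff_has_vector_derivative intro!: exI[of _ "{a..b}"] exI[of _ D])
  moreover have "deriv \<phi> = D" using \<phi>d by (intro ext DERIV_imp_deriv)
  ultimately have "(LINT x:J|lebesgue. D x * z x) = 0"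
    using w[of \<phi>] by simp
  then have "(LINT x:{a..b}|lebesgue. D x * z x) = 0"
    using set_integral_eq_on_interval[OF ab(4), of "\<lambda>x. D x * z x"] D0 by simp
  moreover have Dzc: "continuous_on {a..b} (\<lambda>x. D x * z x)" by (intro continuous_on_mult Dc zab)
  ultimately have 1: "integral {a..b} (\<lambda>x. D x * z x) = 0"
    using set_lebesgue_integral_eq_integral(2)[OF absolutely_integrable_continuous_real[OF Dzc]] by simp
  \<comment> \<open>As D has integral zero, z may be replaced by z - c in the tested integral, which
    turns it into a weighted square.\<close>
  have "integral {a..b} (\<lambda>t. \<theta> t * (z t - c)\<^sup>2) = integral {a..b} (\<lambda>t. D t * z t - c * D t)"
    by (rule integral_cong) (simp add: D_def cl_id algebra_simps power2_eq_square)
  also have "\<dots> = 0"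
    using integrable_continuous_real[OF Dzc] integrable_continuous_real[OF continuous_on_mult[OF continuous_on_const[of _ c] Dc[of "{a..b}"]]] 1 Dint
    by (subst Henstock_Kurzweil_Integration.integral_diff) auto
  finally have 2: "integral {a..b} (\<lambda>t. \<theta> t * (z t - c)\<^sup>2) = 0" .
  have "continuous_on {a..b} (\<lambda>t. \<theta> t * (z t - c)\<^sup>2)"
    by (intro continuous_on_mult \<theta>c continuous_on_power continuous_on_diff zab continuous_on_const)
  then have tz: "\<forall>t\<in>{a..b}. \<theta> t * (z t - c)\<^sup>2 = 0"
    using integral_eq_0_iff[of a b "\<lambda>t. \<theta> t * (z t - c)\<^sup>2"] ab(1) 2 by (auto simp: \<theta>_def)
  have "z t = c" if "t \<in> {a<..<b}" for t
    using \<theta>pos[OF that] bspec[OF tz, of t] that by auto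
  then show ?thesis using ab(5) by auto
qed


lemma sq_integrable_continuous_compact_support:
  assumes "J \<in> sets lebesgue" "{a..b} \<subseteq> J" "continuous_on UNIV h" "\<And>x. x \<notin> {a<..<b} \<Longrightarrow> h x = 0"
  shows "sq_integrable J h"
proof -
  have c: "continuous_on {a..b} (\<lambda>x. (h x)\<^sup>2)"
    using assms(3) by (intro continuous_on_power) (rule continuous_on_subset, auto)
  have "set_integrable lebesgue {a..b} (\<lambda>x. (h x)\<^sup>2)"
    by (rule absolutely_integrable_continuous_real[OF c])
  moreover have "(\<lambda>x. indicator J x *\<^sub>R (h x)\<^sup>2) = (\<lambda>x. indicator {a..b} x *\<^sub>R (h x)\<^sup>2)"
    using assms(2,4) by (force simp: indicator_def fun_eq_iff)
  ultimately have "integrable (lebesgue_on J) (\<lambda>x. (h x)\<^sup>2)"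
    using assms(1) by (simp add: set_integrable_def integrable_restrict_space)
  moreover have "h \<in> borel_measurable (lebesgue_on J)"
    using assms(1,3) by (intro continuous_imp_measurable_on_sets_lebesgue) (auto intro: continuous_on_subset)
  ultimately show ?thesis by (simp add: sq_integrable_def)
qed

lemma L2_on_iff_Re_Im:
  assumes "J \<in> sets lebesgue"
  shows "L2_on J F \<longleftrightarrow> sq_integrable J (\<lambda>x. Re (F x)) \<and> sq_integrable J (\<lambda>x. Im (F x))"
proof -
  have m: "set_borel_measurable lebesgue J F \<longleftrightarrow> F \<in> borel_measurable (lebesgue_on J)"
    using assms by (simp add: set_borel_measurable_def borel_measurable_restrict_space_iff)
  have i: "set_integrable lebesgue J h \<longleftrightarrow> integrable (lebesgue_on J) h" for h :: "real \<Rightarrow> real"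
    using assms by (simp add: set_integrable_def integrable_restrict_space)
  have mc: "F \<in> borel_measurable (lebesgue_on J) \<longleftrightarrow>
    (\<lambda>x. Re (F x)) \<in> borel_measurable (lebesgue_on J) \<and> (\<lambda>x. Im (F x)) \<in> borel_measurable (lebesgue_on J)"
    by (simp add: borel_measurable_complex_iff)
  show ?thesis
  proof
    assume L: "L2_on J F"
    then have Fm: "F \<in> borel_measurable (lebesgue_on J)" and Fi: "integrable (lebesgue_on J) (\<lambda>x. (cmod (F x))\<^sup>2)"
      using m i by (auto simp: L2_on_def)
    have "integrable (lebesgue_on J) (\<lambda>x. (Re (F x))\<^sup>2)"
      by (rule Bochner_Integration.integrable_bound[OF Fi]) (use Fm mc in \<open>auto simp: cmod_power2\<close>)
    moreover have "integrable (lebesgue_on J) (\<lambda>x. (Im (F x))\<^sup>2)"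
      by (rule Bochner_Integration.integrable_bound[OF Fi]) (use Fm mc in \<open>auto simp: cmod_power2\<close>)
    ultimately show "sq_integrable J (\<lambda>x. Re (F x)) \<and> sq_integrable J (\<lambda>x. Im (F x))"
      using Fm mc by (simp add: sq_integrable_def)
  next
    assume "sq_integrable J (\<lambda>x. Re (F x)) \<and> sq_integrable J (\<lambda>x. Im (F x))"
    then show "L2_on J F"
      using m i mc by (simp add: L2_on_def sq_integrable_def cmod_power2)
  qed
qed

lemma ac_on_indefinite_integral:
  assumes "is_interval J" "x0 \<in> J" "\<And>x y. x \<in> J \<Longrightarrow> y \<in> J \<Longrightarrow> x \<le> y \<Longrightarrow> g absolutely_integrable_on {x..y}"
  obtains W where "ac_on J W g"
proof -
  \<comment> \<open>An integral over a reversed interval is zero, so this difference is the oriented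
    integral from x0 to x.\<close>
  define W where "W = (\<lambda>x. integral {x0..x} g - integral {x..x0} g)"
  have gi: "g integrable_on {x..y}" if "x \<in> J" "y \<in> J" "x \<le> y" for x y
    using assms(3)[OF that] set_lebesgue_integral_eq_integral(1) by blast
  have z: "integral {u..v} g = 0" if "v \<le> u" for u v
    using that by (cases "u = v") auto
  have "integral {x..y} g = W y - W x" if xy: "x \<in> J" "y \<in> J" "x \<le> y" for x y
  proof -
    consider "x0 \<le> x" | "x \<le> x0" "x0 \<le> y" | "y \<le> x0" by linarith
    then show ?thesis
    proof cases
      case 1
      have "integral {x0..x} g + integral {x..y} g = integral {x0..y} g"
        using 1 xy gi[of x0 y] assms(2) by (intro Henstock_Kurzweil_Integration.integral_combine) auto
      then show ?thesis using 1 xy z[of x0 x] z[of x0 y] by (simp add: W_def)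
    next
      case 2
      have "integral {x..x0} g + integral {x0..y} g = integral {x..y} g"
        using 2 xy gi[of x y] by (intro Henstock_Kurzweil_Integration.integral_combine) auto
      then show ?thesis using 2 xy z[of x x0] z[of x0 y] by (simp add: W_def)
    next
      case 3
      have "integral {x..y} g + integral {y..x0} g = integral {x..x0} g"
        using 3 xy gi[of x x0] assms(2) by (intro Henstock_Kurzweil_Integration.integral_combine) auto
      then show ?thesis using 3 xy z[of x x0] z[of y x0] by (simp add: W_def)
    qed
  qed
  then have "ac_on J W g" using assms(3) by (simp add: ac_on_def)
  then show ?thesis by (rule that)
qed

text \<open>The difference of f and the indefinite integral of g is constant in the open interval
  and continuous up to its ends.\<close>

lemma ac_on_interior_to_closure:
  assumes J: "open J" "is_interval J" and ac: "ac_on J f g" and g: "sq_integrable J g"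
    and c: "continuous_on (closure J) f"
  shows "ac_on (closure J) f g"
  unfolding ac_on_def
proof (intro ballI impI)
  fix x y assume xy: "x \<in> closure J" "y \<in> closure J" "x \<le> y"
  show "g absolutely_integrable_on {x..y} \<and> integral {x..y} g = f y - f x"
  proof (cases "x = y")
    case True then show ?thesis using absolutely_integrable_on_null[of x x g] by (simp add: cbox_interval)
  next
    case False
    then have "x < y" using xy by simp
    have ci: "is_interval (closure J)"
      using J(2) by (simp add: is_interval_convex_1 convex_closure)
    \<comment> \<open>An open convex set is the interior of its closure; hence the open interval
      between two points of the closure lies in J.\<close>
    have Jint: "J = interior (closure J)"
      using J by (metis convex_interior_closure interior_open is_interval_convex_1)
    have "{x<..<y} \<subseteq> interior (closure J)"
    proof (rule interior_maximal)
      show "{x<..<y} \<subseteq> closure J" using ci xy unfolding is_interval_1 by (meson greaterThanLessThan_iff less_imp_le subsetI)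
    qed simp
    then have sub: "{x<..<y} \<subseteq> J" using Jint by simp
    have sub': "{x..y} \<subseteq> closure J" using ci xy unfolding is_interval_1 by (meson atLeastAtMost_iff subsetI)
    have "sq_integrable {x<..<y} g"
      using sq_integrable_subset[OF g sub] J(1) by auto
    moreover have "sq_integrable {x<..<y} (\<lambda>_. 1)"
      by (rule sq_integrable_subset[OF sq_integrable_const[of x y 1]]) auto
    ultimately have "integrable (lebesgue_on {x<..<y}) g"
      using sq_integrable_mult[of "{x<..<y}" g "\<lambda>_. 1"] by simp
    then have "g absolutely_integrable_on box x y"
      by (simp add: set_integrable_def integrable_restrict_space)
    then have ga: "g absolutely_integrable_on {x..y}"
      using absolutely_integrable_on_open_interval[where f = g and a = x and b = y] by simp
    then have gi: "g integrable_on {x..y}" using set_lebesgue_integral_eq_integral(1) by blast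
    define h where "h = (\<lambda>t. f t - integral {x..t} g)"
    have "continuous_on {x..y} f" using c sub' continuous_on_subset by blast
    then have hc: "continuous_on {x..y} h"
      unfolding h_def by (intro continuous_on_diff indefinite_integral_continuous_1 gi)
    define m where "m = (x + y)/2"
    have m: "m \<in> {x<..<y}" using \<open>x < y\<close> by (auto simp: m_def)
    have le: "h s = h t" if "s \<in> {x<..<y}" "t \<in> {x<..<y}" "s \<le> t" for s t
    proof -
      have "integral {x..s} g + integral {s..t} g = integral {x..t} g"
        using that integrable_on_subinterval[OF gi, of x t]
        by (intro Henstock_Kurzweil_Integration.integral_combine) auto
      moreover have "integral {s..t} g = f t - f s"
        using ac_onD(2)[OF ac, of s t] that subsetD[OF sub] by blast
      ultimately show ?thesis by (simp add: h_def)
    qed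
    have hm: "h t = h m" if "t \<in> {x<..<y}" for t
      using le[OF that m] le[OF m that] by linarith
    have cl: "closure {x<..<y} = {x..y}" using \<open>x < y\<close> by (simp add: closure_greaterThanLessThan)
    have "h x = h m" "h y = h m"
      using continuous_constant_on_closure[of "{x<..<y}" h "h m"] hc hm cl \<open>x < y\<close> by auto
    then show ?thesis using ga by (simp add: h_def)
  qed
qed

lemma Lebesgue_differentiation_real:
  fixes d :: "real \<Rightarrow> real"
  assumes "\<And>u v. d integrable_on {u..v}"
  obtains N where "negligible N" "\<And>x e. x \<notin> N \<Longrightarrow> 0 < e \<Longrightarrow>
      \<exists>k>0. \<forall>h. 0 < h \<and> h < k \<longrightarrow> \<bar>integral {x..x + h} d / h - d x\<bar> < e"
proof -
  obtain N where N: "negligible N" "\<And>x e. x \<notin> N \<Longrightarrow> 0 < e \<Longrightarrow>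
      \<exists>k>0. \<forall>h. 0 < h \<and> h < k \<longrightarrow> norm (integral (cbox x (x + h *\<^sub>R One)) d /\<^sub>R h ^ DIM(real) - d x) < e"
    by (rule integrable_ccontinuous_explicit[of d]) (use assms in \<open>auto simp: cbox_interval\<close>)
  have eq: "integral (cbox x (x + h *\<^sub>R One)) d /\<^sub>R h ^ DIM(real) = integral {x..x + h} d / h" for x h :: real
    by (simp add: cbox_interval divide_inverse)
  show ?thesis
    by (rule that[OF N(1)]) (use N(2) in \<open>simp only: eq real_norm_def\<close>)
qed

text \<open>Lebesgue's differentiation theorem identifies the derivative up to null sets.\<close>

lemma ac_on_derivative_unique:
  assumes X: "is_interval X" "closed X" and ac: "ac_on X f g" "ac_on X f g'"
  shows "negligible {x \<in> X. g x \<noteq> g' x}"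
proof -
  \<comment> \<open>The difference is extended by zero, since the differentiation theorem is
    formulated on the whole line.\<close>
  define d where "d = (\<lambda>x. if x \<in> X then g x - g' x else 0)"
  have dX: "d integrable_on {u..v} \<and> integral {u..v} d = 0" if "u \<in> X" "v \<in> X" "u \<le> v" for u v
  proof -
    have uv: "{u..v} \<subseteq> X" using X(1) that unfolding is_interval_1 by (meson atLeastAtMost_iff subsetI)
    have "(g has_integral f v - f u) {u..v}" "(g' has_integral f v - f u) {u..v}"
      using ac_onD[OF ac(1) that] ac_onD[OF ac(2) that] by (simp_all add: has_integral_integrable_integral)
    from has_integral_diff[OF this] have "((\<lambda>x. g x - g' x) has_integral 0) {u..v}" by simp
    then have "(d has_integral 0) {u..v}"
      by (rule has_integral_eq[rotated]) (use uv in \<open>auto simp: d_def\<close>)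
    then show ?thesis by blast
  qed
  have int: "d integrable_on cbox u v" for u v
  proof -
    \<comment> \<open>The part of X in a compact interval is again a compact interval, possibly
      empty, with end points in X.\<close>
    have "is_interval (X \<inter> cbox u v) \<and> compact (X \<inter> cbox u v)"
      using is_interval_Int[OF X(1) is_interval_cbox] closed_Int_compact[OF X(2) compact_cbox] by simp
    then obtain a b where ab: "X \<inter> cbox u v = cbox a b" unfolding is_interval_compact by (elim exE)
    have "d integrable_on cbox a b"
    proof (cases "a \<le> b")
      case True
      then have "a \<in> X \<inter> cbox u v" "b \<in> X \<inter> cbox u v" unfolding ab by simp_all
      then show ?thesis using dX[of a b] True by (simp add: cbox_interval)
    qed (simp add: integrable_on_empty)
    then have "(\<lambda>x. if x \<in> cbox a b then d x else 0) integrable_on UNIV"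
      by (simp only: integrable_restrict_UNIV)
    moreover have "(\<lambda>x. if x \<in> cbox a b then d x else 0) = (\<lambda>x. if x \<in> cbox u v then d x else 0)"
      unfolding ab[symmetric] by (auto simp: d_def fun_eq_iff)
    ultimately show ?thesis by (simp only: integrable_restrict_UNIV)
  qed
  obtain N where N: "negligible N" "\<And>x e. x \<notin> N \<Longrightarrow> 0 < e \<Longrightarrow>
      \<exists>k>0. \<forall>h. 0 < h \<and> h < k \<longrightarrow> \<bar>integral {x..x + h} d / h - d x\<bar> < e"
    by (rule Lebesgue_differentiation_real[of d]) (use int in \<open>auto simp: cbox_interval\<close>)
  have dz: "d x = 0" if x: "x \<in> interior X" "x \<notin> N" for x
  proof (rule ccontr)
    assume "d x \<noteq> 0"
    then obtain k where k: "k > 0" "\<forall>h. 0 < h \<and> h < k \<longrightarrow> \<bar>integral {x..x + h} d / h - d x\<bar> < \<bar>d x\<bar>"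
      using N(2)[OF x(2), of "\<bar>d x\<bar>"] by auto
    obtain e where e: "e > 0" "ball x e \<subseteq> X" using x(1) mem_interior by blast
    define h where "h = min k e / 2"
    have h: "0 < h" "h < k" "h < e" using k(1) e(1) by (auto simp: h_def)
    have "x \<in> X" "x + h \<in> X" using e h by (auto simp: subset_iff dist_real_def)
    then have "integral {x..x+h} d = 0" using dX[of x "x+h"] h(1) by simp
    moreover have "\<bar>integral {x..x + h} d / h - d x\<bar> < \<bar>d x\<bar>" using k(2) h(1,2) by simp
    ultimately show False by simp
  qed
  have "x \<in> N \<union> (X - interior X)" if "x \<in> {x \<in> X. g x \<noteq> g' x}" for x
    using that dz[of x] by (cases "x \<in> N"; cases "x \<in> interior X") (simp_all add: d_def)
  then have "{x \<in> X. g x \<noteq> g' x} \<subseteq> N \<union> (X - interior X)" by (rule subsetI)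
  moreover have "X - interior X \<subseteq> frontier X" using closure_subset[of X] by (auto simp: frontier_def)
  then have "negligible (N \<union> (X - interior X))"
    using N(1) X(1) negligible_convex_frontier[of X] by (intro negligible_Un) (auto simp: is_interval_convex_1 intro: negligible_subset)
  ultimately have "negligible {x \<in> X. g x \<noteq> g' x}" by (rule negligible_subset[rotated])
  then show ?thesis .
qed


text \<open>F minus a primitive of its weak derivative has weak derivative zero and is therefore
  constant. Real and imaginary part are treated together through a bounded linear map P.\<close>

lemma H1_on_ac_on:
  assumes J: "open J" "is_interval J" "J \<noteq> {}" and cF: "continuous_on (closure J) F"
    and F: "L2_on J F" and G: "L2_on J G" and w: "has_weak_deriv J F G"
  shows "ac_on (closure J) (\<lambda>x. Re (F x)) (\<lambda>x. Re (G x))" "ac_on (closure J) (\<lambda>x. Im (F x)) (\<lambda>x. Im (G x))"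
proof -
  have Jl: "J \<in> sets lebesgue" using J(1) by auto
  note sqF = F[unfolded L2_on_iff_Re_Im[OF Jl]] and sqG = G[unfolded L2_on_iff_Re_Im[OF Jl]]
  have main: "ac_on (closure J) (\<lambda>x. P (F x)) (\<lambda>x. P (G x))"
    if P: "bounded_linear P" and PF: "sq_integrable J (\<lambda>x. P (F x))" and PG: "sq_integrable J (\<lambda>x. P (G x))"
    for P :: "complex \<Rightarrow> real"
  proof -
    have cPF: "continuous_on (closure J) (\<lambda>x. P (F x))"
      using linear_continuous_on[OF P] cF by (rule continuous_on_compose2) auto
    have gai: "(\<lambda>x. P (G x)) absolutely_integrable_on {x..y}" if "x \<in> J" "y \<in> J" "x \<le> y" for x y
    proof (rule sq_integrable_imp_absolutely_integrable, rule sq_integrable_subset[OF PG _ Jl])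
      show "{x..y} \<subseteq> J" using J(2) that unfolding is_interval_1 by (meson atLeastAtMost_iff subsetI)
    qed simp
    obtain x0 where x0: "x0 \<in> J" using J(3) by blast
    obtain W where W: "ac_on J W (\<lambda>x. P (G x))"
      by (rule ac_on_indefinite_integral[OF J(2) x0 gai])
    have Wc: "continuous_on J W" by (rule ac_on_continuous[OF W J(2)])
    define z where "z = (\<lambda>x. P (F x) - W x)"
    have zc: "continuous_on J z"
      unfolding z_def by (intro continuous_on_diff Wc continuous_on_subset[OF cPF] closure_subset)
    have zw: "(LINT x:J|lebesgue. deriv \<phi> x * z x) = 0" if t: "test_function J \<phi>" for \<phi>
    proof -
      obtain a b where ab: "a < b" "a \<in> J" "b \<in> J" "{a..b} \<subseteq> J" "\<And>x. x \<notin> {a<..<b} \<Longrightarrow> \<phi> x = 0"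
        "\<And>x. x \<notin> {a<..<b} \<Longrightarrow> deriv \<phi> x = 0"
        and d: "continuous_on UNIV (deriv \<phi>)" "continuous_on UNIV \<phi>"
        using test_function_interval[OF J t, of thesis] by blast
      have s: "sq_integrable J \<phi>" "sq_integrable J (deriv \<phi>)"
        using sq_integrable_continuous_compact_support[OF Jl ab(4)] ab d by auto
      \<comment> \<open>Integrals against real test functions commute with P, which turns the
        complex identity into a real one.\<close>
      have iP: "(LINT x:J|lebesgue. h x * P (H x)) = P (LINT x:J|lebesgue. h x *\<^sub>R H x)"
        if h: "sq_integrable J h" and H: "L2_on J H" for h H
      proof -
        have 1: "integrable (lebesgue_on J) (\<lambda>x. h x * Re (H x))" "integrable (lebesgue_on J) (\<lambda>x. h x * Im (H x))"
          using H sq_integrable_mult[OF h] unfolding L2_on_iff_Re_Im[OF Jl] by auto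
        have "integrable (lebesgue_on J) (\<lambda>x. h x *\<^sub>R H x)"
        proof (rule Bochner_Integration.integrable_bound)
          show "integrable (lebesgue_on J) (\<lambda>x. \<bar>h x * Re (H x)\<bar> + \<bar>h x * Im (H x)\<bar>)"
            using 1 by auto
          have "(\<lambda>x. Re (h x *\<^sub>R H x)) \<in> borel_measurable (lebesgue_on J)" "(\<lambda>x. Im (h x *\<^sub>R H x)) \<in> borel_measurable (lebesgue_on J)"
            using 1 by (auto dest: borel_measurable_integrable)
          then show "(\<lambda>x. h x *\<^sub>R H x) \<in> borel_measurable (lebesgue_on J)"
            by (simp add: borel_measurable_complex_iff)
          show "AE x in lebesgue_on J. norm (h x *\<^sub>R H x) \<le> norm (\<bar>h x * Re (H x)\<bar> + \<bar>h x * Im (H x)\<bar>)"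
            using cmod_le[of "h x *\<^sub>R H x" for x] by (intro AE_I2) (auto simp: abs_mult intro: order_trans[OF cmod_le])
        qed
        then have "set_integrable lebesgue J (\<lambda>x. h x *\<^sub>R H x)"
          using Jl by (simp add: set_integrable_def integrable_restrict_space)
        then have "P (LINT x:J|lebesgue. h x *\<^sub>R H x) = (LINT x:J|lebesgue. P (h x *\<^sub>R H x))"
          unfolding set_lebesgue_integral_def set_integrable_def
          using integral_bounded_linear[OF P, of lebesgue "\<lambda>x. indicator J x *\<^sub>R h x *\<^sub>R H x"]
          by (simp add: linear_simps[OF P] mult.assoc)
        then show ?thesis by (simp add: linear_simps[OF P])
      qed
      have "has_weak_deriv J (\<lambda>x. complex_of_real (W x)) (\<lambda>x. complex_of_real (P (G x)))"
        by (rule ac_on_has_weak_deriv[OF J W])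
      then have "(LINT x:J|lebesgue. deriv \<phi> x *\<^sub>R complex_of_real (W x)) = - (LINT x:J|lebesgue. \<phi> x *\<^sub>R complex_of_real (P (G x)))"
        using t unfolding has_weak_deriv_def by blast
      then have eW: "(LINT x:J|lebesgue. deriv \<phi> x * W x) = - (LINT x:J|lebesgue. \<phi> x * P (G x))"
        unfolding scaleR_conv_of_real of_real_mult[symmetric] set_integral_complex_of_real of_real_minus[symmetric] of_real_eq_iff .
      have "(LINT x:J|lebesgue. deriv \<phi> x * P (F x)) = P (- (LINT x:J|lebesgue. \<phi> x *\<^sub>R G x))"
        using iP[OF s(2) F] w t unfolding has_weak_deriv_def by simp
      also have "\<dots> = - (LINT x:J|lebesgue. \<phi> x * P (G x))"
        using iP[OF s(1) G] by (simp add: linear_simps[OF P])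
      finally have eF: "(LINT x:J|lebesgue. deriv \<phi> x * P (F x)) = (LINT x:J|lebesgue. deriv \<phi> x * W x)" using eW by simp
      have i1: "set_integrable lebesgue J (\<lambda>x. deriv \<phi> x * P (F x))"
        using sq_integrable_mult[OF s(2) PF] Jl by (simp add: set_integrable_def integrable_restrict_space)
      have "set_integrable lebesgue {a..b} (\<lambda>x. deriv \<phi> x * W x)"
        by (intro absolutely_integrable_continuous_real continuous_on_mult continuous_on_subset[OF d(1)] continuous_on_subset[OF Wc] ab(4)) auto
      moreover have "(\<lambda>x. indicator J x *\<^sub>R (deriv \<phi> x * W x)) = (\<lambda>x. indicator {a..b} x *\<^sub>R (deriv \<phi> x * W x))"
        using ab(4) ab(6) by (intro ext) (auto simp: indicator_def)
      ultimately have i2: "set_integrable lebesgue J (\<lambda>x. deriv \<phi> x * W x)"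
        unfolding set_integrable_def by simp
      show ?thesis
        unfolding z_def right_diff_distrib using set_integral_diff(2)[OF i1 i2] eF by simp
    qed
    have const: "z x = z y" if "x \<in> J" "y \<in> J" for x y
      by (rule weak_deriv_zero_imp_constant[OF J(1,2) zc zw that])
    have "ac_on J (\<lambda>x. P (F x)) (\<lambda>x. P (G x))"
      unfolding ac_on_def
    proof (intro ballI impI conjI gai)
      fix x y assume xy: "x \<in> J" "y \<in> J" "x \<le> y"
      show "integral {x..y} (\<lambda>x. P (G x)) = P (F y) - P (F x)"
        using ac_onD(2)[OF W xy] const[OF xy(1,2)] by (simp add: z_def)
    qed
    then show ?thesis by (rule ac_on_interior_to_closure[OF J(1,2) _ PG cPF])
  qed
  show "ac_on (closure J) (\<lambda>x. Re (F x)) (\<lambda>x. Re (G x))"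
    by (rule main) (use sqF sqG in \<open>auto intro: bounded_linear_Re\<close>)
  show "ac_on (closure J) (\<lambda>x. Im (F x)) (\<lambda>x. Im (G x))"
    by (rule main) (use sqF sqG in \<open>auto intro: bounded_linear_Im\<close>)
qed

lemma weak_deriv_props:
  assumes "H1_on J F"
  shows "L2_on J (weak_deriv J F)" "has_weak_deriv J F (weak_deriv J F)"
  using assms someI_ex[of "\<lambda>g. L2_on J g \<and> has_weak_deriv J F g"]
  unfolding H1_on_def weak_deriv_def by blast+

lemma H1_on_weak_deriv_ac_on:
  assumes J: "open J" "is_interval J" "J \<noteq> {}" and "H1_on J F"
  shows "ac_on (closure J) (\<lambda>x. Re (F x)) (\<lambda>x. Re (weak_deriv J F x))"
    "ac_on (closure J) (\<lambda>x. Im (F x)) (\<lambda>x. Im (weak_deriv J F x))"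
  using H1_on_ac_on[OF J _ _ weak_deriv_props[OF assms(4)]] assms(4) by (auto simp: H1_on_def)

lemma H1_on_of_real:
  assumes J: "open J" "is_interval J" "J \<noteq> {}" and ac: "ac_on (closure J) f g"
    and f: "sq_integrable J f" and g: "sq_integrable J g"
  shows "H1_on J (\<lambda>x. complex_of_real (f x))"
proof -
  have Jl: "J \<in> sets lebesgue" using J(1) by auto
  have z: "sq_integrable J (\<lambda>x. 0)" by (simp add: sq_integrable_def)
  have "continuous_on (closure J) f"
    using J(2) ac by (intro ac_on_continuous) (auto simp: is_interval_convex_1 convex_closure)
  then have "continuous_on (closure J) (\<lambda>x. complex_of_real (f x))" by (intro continuous_on_of_real)
  moreover have "has_weak_deriv J (\<lambda>x. complex_of_real (f x)) (\<lambda>x. complex_of_real (g x))"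
    by (rule ac_on_has_weak_deriv[OF J ac_on_subset[OF ac closure_subset]])
  ultimately show ?thesis
    unfolding H1_on_def using f g z by (auto simp: L2_on_iff_Re_Im[OF Jl] intro!: exI[of _ "\<lambda>x. complex_of_real (g x)"])
qed

lemma Lp_norm_pow_lebesgue_on:
  assumes "J \<in> sets lebesgue"
  shows "Lp_norm_pow p J f = integral\<^sup>L (lebesgue_on J) (\<lambda>x. cmod (f x) ^ p)"
  unfolding Lp_norm_pow_def lebesgue_on_integral_set[OF assms] ..

text \<open>The chosen weak derivative and g both belong to the same absolutely continuous function
  and so agree almost everywhere; the norm in the action can be computed from any explicit
  derivative.\<close>

lemma Lp_norm_pow_weak_deriv_of_real:
  assumes J: "open J" "is_interval J" "J \<noteq> {}" and ac: "ac_on (closure J) f g"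
    and f: "sq_integrable J f" and g: "sq_integrable J g"
  shows "Lp_norm_pow 2 J (weak_deriv J (\<lambda>x. complex_of_real (f x))) = integral\<^sup>L (lebesgue_on J) (\<lambda>x. (g x)\<^sup>2)"
proof -
  have Jl: "J \<in> sets lebesgue" using J(1) by auto
  define G where "G = weak_deriv J (\<lambda>x. complex_of_real (f x))"
  have H: "H1_on J (\<lambda>x. complex_of_real (f x))" by (rule H1_on_of_real[OF assms])
  have Gm: "sq_integrable J (\<lambda>x. Re (G x))" "sq_integrable J (\<lambda>x. Im (G x))"
    using weak_deriv_props(1)[OF H] unfolding G_def L2_on_iff_Re_Im[OF Jl] by auto
  have acG: "ac_on (closure J) f (\<lambda>x. Re (G x))" "ac_on (closure J) (\<lambda>x. 0) (\<lambda>x. Im (G x))"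
    using H1_on_weak_deriv_ac_on[OF J H] by (auto simp: G_def)
  have ci: "is_interval (closure J)" using J(2) by (simp add: is_interval_convex_1 convex_closure)
  have ac0: "ac_on (closure J) (\<lambda>x. 0) (\<lambda>x. 0)" by (simp add: ac_on_def)
  have "negligible ({x \<in> closure J. Re (G x) \<noteq> g x} \<union> {x \<in> closure J. Im (G x) \<noteq> 0})"
    using ac_on_derivative_unique[OF ci closed_closure acG(1) ac] ac_on_derivative_unique[OF ci closed_closure acG(2) ac0]
    by (rule negligible_Un)
  then have n: "{x \<in> closure J. Re (G x) \<noteq> g x} \<union> {x \<in> closure J. Im (G x) \<noteq> 0} \<in> null_sets lebesgue"
    by (simp add: negligible_iff_null_sets)
  have "AE x in lebesgue. x \<in> J \<longrightarrow> (cmod (G x))\<^sup>2 = (g x)\<^sup>2"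
    using AE_not_in[OF n] by eventually_elim (use closure_subset[of J] in \<open>auto simp: cmod_power2\<close>)
  then have "AE x in lebesgue_on J. (cmod (G x))\<^sup>2 = (g x)\<^sup>2"
    using Jl by (simp add: AE_restrict_space_iff)
  moreover have "(\<lambda>x. (cmod (G x))\<^sup>2) \<in> borel_measurable (lebesgue_on J)"
    using Gm by (auto simp: sq_integrable_def cmod_power2)
  moreover have "(\<lambda>x. (g x)\<^sup>2) \<in> borel_measurable (lebesgue_on J)"
    using g by (auto simp: sq_integrable_def)
  ultimately have "integral\<^sup>L (lebesgue_on J) (\<lambda>x. (cmod (G x))\<^sup>2) = integral\<^sup>L (lebesgue_on J) (\<lambda>x. (g x)\<^sup>2)"
    by (intro integral_cong_AE)
  then show ?thesis unfolding G_def[symmetric] Lp_norm_pow_lebesgue_on[OF Jl] .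
qed

section \<open>Completeness and the calibration inequality\<close>

text \<open>Fatou's lemma for real-valued integrals. It provides square integrability of limits,
  lower semicontinuity of the quadratic part and completeness of \<open>L\<^sup>2\<close>.\<close>

lemma Fatou_bound:
  fixes h :: "nat \<Rightarrow> 'a \<Rightarrow> real"
  assumes "\<And>n. integrable M (h n)" "H \<in> borel_measurable M" "\<And>n x. 0 \<le> h n x" "\<And>x. 0 \<le> H x"
    and lim: "AE x in M. (\<lambda>n. h n x) \<longlonglongrightarrow> H x" and C: "\<And>n. integral\<^sup>L M (h n) \<le> C"
  shows "integrable M H" "integral\<^sup>L M H \<le> C"
proof -
  have "0 \<le> integral\<^sup>L M (h 0)" by (rule Bochner_Integration.integral_nonneg) (rule assms(3))
  then have C0: "0 \<le> C" using C[of 0] by linarith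
  have "(\<integral>\<^sup>+x. ennreal (H x) \<partial>M) = (\<integral>\<^sup>+x. liminf (\<lambda>n. ennreal (h n x)) \<partial>M)"
  proof (rule nn_integral_cong_AE)
    show "AE x in M. ennreal (H x) = liminf (\<lambda>n. ennreal (h n x))"
      using lim
    proof eventually_elim
      case (elim x)
      have *: "(\<lambda>n. ennreal (h n x)) \<longlonglongrightarrow> ennreal (H x)"
        by (intro tendsto_ennrealI elim)
      show ?case by (rule lim_imp_Liminf[OF _ *, symmetric]) simp
    qed
  qed
  also have "\<dots> \<le> liminf (\<lambda>n. \<integral>\<^sup>+x. ennreal (h n x) \<partial>M)"
    using assms(1) by (intro nn_integral_liminf) auto
  also have "\<dots> \<le> ennreal C"
  proof (rule Liminf_le)
    show "\<forall>\<^sub>F n in sequentially. (\<integral>\<^sup>+x. ennreal (h n x) \<partial>M) \<le> ennreal C"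
      using assms(1,3) C by (intro always_eventually allI) (simp add: nn_integral_eq_integral C0)
  qed simp
  finally have b: "(\<integral>\<^sup>+x. ennreal (H x) \<partial>M) \<le> ennreal C" .
  then have "(\<integral>\<^sup>+x. ennreal (H x) \<partial>M) < \<infinity>" by (simp add: order_le_less_trans)
  then show ii: "integrable M H"
    using assms(2,4) by (intro integrableI_nonneg) auto
  show "integral\<^sup>L M H \<le> C"
    using b nn_integral_eq_integral[OF ii] assms(4) C0 by simp
qed

text \<open>The Riesz-Fischer argument: along a subsequence the squared increments have integrals
  below 4^(-j), so their series with weights 2^j is finite almost everywhere, and there the
  increments are dominated by a geometric series.\<close>

lemma L2_Cauchy_AE_subsequence:
  fixes g :: "nat \<Rightarrow> 'a \<Rightarrow> real"
  assumes m: "\<And>n. g n \<in> borel_measurable M"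
    and i: "\<And>n k. integrable M (\<lambda>x. (g n x - g k x)\<^sup>2)"
    and C: "\<And>e. e > 0 \<Longrightarrow> \<exists>N. \<forall>n\<ge>N. \<forall>k\<ge>N. (\<integral>x. (g n x - g k x)\<^sup>2 \<partial>M) < e"
  obtains r G where "strict_mono (r :: nat \<Rightarrow> nat)" "G \<in> borel_measurable M"
    "AE x in M. (\<lambda>n. g (r n) x) \<longlonglongrightarrow> G x"
proof -
  have "\<forall>j::nat. \<exists>N. \<forall>n\<ge>N. \<forall>k\<ge>N. (\<integral>x. (g n x - g k x)\<^sup>2 \<partial>M) < (1/4)^j"
    by (intro allI C) simp
  then obtain N where N: "\<And>j n k. n \<ge> N j \<Longrightarrow> k \<ge> N j \<Longrightarrow> (\<integral>x. (g n x - g k x)\<^sup>2 \<partial>M) < (1/4)^j"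
    unfolding choice_iff by blast
  \<comment> \<open>The summand 1 makes r strictly increasing, and r j is at least N j.\<close>
  define r where "r = (\<lambda>j. \<Sum>i\<le>j. N i + 1)"
  have r: "strict_mono r" unfolding strict_mono_Suc_iff r_def by simp
  have rN: "N j \<le> r j" for j unfolding r_def by (cases j) auto
  define d where "d = (\<lambda>j x. g (r (Suc j)) x - g (r j) x)"
  have dm: "d j \<in> borel_measurable M" for j unfolding d_def using m by auto
  have dn: "(\<integral>\<^sup>+x. ennreal (2^j * (d j x)\<^sup>2) \<partial>M) \<le> ennreal ((1/2)^j)" for j
  proof -
    have "r j \<le> r (Suc j)" using r by (simp add: strict_mono_less_eq)
    then have le: "(\<integral>x. (d j x)\<^sup>2 \<partial>M) \<le> (1/4)^j"
      unfolding d_def using N[of j "r (Suc j)" "r j"] rN[of j] by simp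
    have "(\<integral>\<^sup>+x. ennreal (2^j * (d j x)\<^sup>2) \<partial>M) = ennreal (\<integral>x. 2^j * (d j x)\<^sup>2 \<partial>M)"
      using i by (intro nn_integral_eq_integral) (auto simp: d_def)
    also have "(\<integral>x. 2^j * (d j x)\<^sup>2 \<partial>M) = 2^j * (\<integral>x. (d j x)\<^sup>2 \<partial>M)" by simp
    also have "\<dots> \<le> 2^j * (1/4)^j" using le by (intro mult_left_mono) auto
    also have "2^j * (1/4)^j = (1/2::real)^j" unfolding power_mult_distrib[symmetric] by simp
    finally show ?thesis by (simp add: ennreal_leI)
  qed
  have "(\<integral>\<^sup>+x. (\<Sum>j. ennreal (2^j * (d j x)\<^sup>2)) \<partial>M) = (\<Sum>j. \<integral>\<^sup>+x. ennreal (2^j * (d j x)\<^sup>2) \<partial>M)"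
    using dm by (intro nn_integral_suminf) auto
  also have "\<dots> \<le> (\<Sum>j. ennreal ((1/2)^j))"
    by (intro suminf_le dn) auto
  also have "\<dots> = ennreal (\<Sum>j. (1/2)^j)"
    by (intro suminf_ennreal2) (auto intro: summable_geometric)
  finally have le: "(\<integral>\<^sup>+x. (\<Sum>j. ennreal (2^j * (d j x)\<^sup>2)) \<partial>M) \<le> ennreal (\<Sum>j. (1/2)^j)" .
  have "(\<integral>\<^sup>+x. (\<Sum>j. ennreal (2^j * (d j x)\<^sup>2)) \<partial>M) \<noteq> \<infinity>"
    unfolding infinity_ennreal_def by (rule neq_top_trans[OF ennreal_neq_top le])
  then have fin: "AE x in M. (\<Sum>j. ennreal (2^j * (d j x)\<^sup>2)) \<noteq> \<infinity>"
    using dm by (intro nn_integral_noteq_infinite) auto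
  define G where "G = (\<lambda>x. lim (\<lambda>n. g (r n) x))"
  have "AE x in M. (\<lambda>n. g (r n) x) \<longlonglongrightarrow> G x"
    using fin
  proof eventually_elim
    case (elim x)
    define F where "F = (\<lambda>j. ennreal (2^j * (d j x)\<^sup>2))"
    have "suminf F \<noteq> \<infinity>" using elim unfolding F_def .
    then obtain S where S: "suminf F = ennreal S" "S \<ge> 0"
      unfolding infinity_ennreal_def by (cases "suminf F") auto
    have le: "2^j * (d j x)\<^sup>2 \<le> S" for j
    proof -
      have "sum F {j} \<le> suminf F" by (rule sum_le_suminf) auto
      then have "ennreal (2^j * (d j x)\<^sup>2) \<le> ennreal S" unfolding S(1) by (simp add: F_def)
      then show ?thesis using ennreal_le_iff[OF S(2)] by blast
    qed
    have nb: "norm (d j x) \<le> sqrt S * (1 / sqrt 2)^j" for j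
    proof -
      have "(d j x)\<^sup>2 \<le> S * (1/2)^j" using le[of j] by (simp add: field_simps power_divide)
      then have "\<bar>d j x\<bar> \<le> sqrt (S * (1/2)^j)" by (intro real_le_rsqrt) simp
      also have "\<dots> = sqrt S * (1 / sqrt 2)^j"
        by (simp add: real_sqrt_mult real_sqrt_power real_sqrt_divide)
      finally show ?thesis by simp
    qed
    have sm: "summable (\<lambda>j. sqrt S * (1 / sqrt 2)^j)"
      by (intro summable_mult summable_geometric) simp
    have "summable (\<lambda>j. d j x)"
      by (rule summable_comparison_test'[OF sm]) (rule nb)
    then have "(\<lambda>n. \<Sum>j<n. d j x) \<longlonglongrightarrow> suminf (\<lambda>j. d j x)" by (rule summable_LIMSEQ)
    moreover have "(\<Sum>j<n. d j x) = g (r n) x - g (r 0) x" for n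
      unfolding d_def by (rule sum_lessThan_telescope)
    ultimately have "(\<lambda>n. g (r n) x - g (r 0) x) \<longlonglongrightarrow> suminf (\<lambda>j. d j x)" by simp
    from tendsto_add[OF this tendsto_const[of "g (r 0) x"]]
    have "convergent (\<lambda>n. g (r n) x)" unfolding convergent_def by (intro exI) simp
    then show ?case unfolding G_def by (simp only: convergent_LIMSEQ_iff)
  qed
  moreover have "G \<in> borel_measurable M"
    unfolding G_def by (rule borel_measurable_lim_metric) (rule m)
  ultimately show ?thesis by (intro that[OF r])
qed

text \<open>Both sides are additive over adjacent intervals, so bisection carries the estimate from
  short intervals to the whole one.\<close>

lemma increment_le_integral_local:
  fixes F m :: "real \<Rightarrow> real"
  assumes "a \<le> b" "m integrable_on {a..b}"
    and loc: "\<And>x. x \<in> {a..b} \<Longrightarrow> \<exists>d>0. \<forall>u v. a \<le> u \<and> u \<le> x \<and> x \<le> v \<and> v \<le> b \<and> v - u < d \<longrightarrow> F v - F u \<le> integral {u..v} m"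
  shows "F b - F a \<le> integral {a..b} m"
proof -
  have mi: "m integrable_on {x..y}" if "a \<le> x" "y \<le> b" for x y
    using assms(2) that integrable_on_subinterval[of m "{a..b}" x y] by auto
  have "a \<le> a \<and> a \<le> b \<and> b \<le> b \<longrightarrow> F b - F a \<le> integral {a..b} m"
  proof (rule Bolzano[where P = "\<lambda>x y. a \<le> x \<and> x \<le> y \<and> y \<le> b \<longrightarrow> F y - F x \<le> integral {x..y} m"], goal_cases)
    case 1 then show ?case by (rule assms(1))
  next
    case (2 x y z)
    show ?case
    proof
      assume *: "a \<le> x \<and> x \<le> z \<and> z \<le> b"
      have "integral {x..y} m + integral {y..z} m = integral {x..z} m"
        using 2 * mi by (intro Henstock_Kurzweil_Integration.integral_combine) auto
      then show "F z - F x \<le> integral {x..z} m" using 2 * by auto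
    qed
  next
    case (3 x)
    from loc[of x] 3 obtain d where d: "d > 0" "\<forall>u v. a \<le> u \<and> u \<le> x \<and> x \<le> v \<and> v \<le> b \<and> v - u < d \<longrightarrow> F v - F u \<le> integral {u..v} m"
      by auto
    show ?case
      by (rule exI[of _ d]) (use d in simp)
  qed
  then show ?thesis using assms(1) by simp
qed

text \<open>The primitive, zero at u = 0 for non-negative \<mu>, of
  \<open>u * sqrt (\<mu>\<^sup>2 - u\<^sup>2/2)\<close>, which is the speed at height u on the
  homoclinic orbit of \<open>u'' = \<mu>\<^sup>2 u - u\<^sup>3\<close>.\<close>

definition calib :: "real \<Rightarrow> real \<Rightarrow> real" where
  "calib \<mu> u = 2/3 * (\<mu>^3 - (sqrt (\<mu>\<^sup>2 - u\<^sup>2/2))^3)"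

lemma calib_continuous: "continuous_on S (calib \<mu>)"
  unfolding calib_def by (intro continuous_intros) simp

lemma calib_abs [simp]: "calib \<mu> \<bar>u\<bar> = calib \<mu> u"
  by (simp add: calib_def)

lemma calib_deriv:
  assumes "u\<^sup>2 < 2 * \<mu>\<^sup>2"
  shows "(calib \<mu> has_real_derivative u * sqrt (\<mu>\<^sup>2 - u\<^sup>2/2)) (at u)"
proof -
  define s where "s = sqrt (\<mu>\<^sup>2 - u\<^sup>2/2)"
  have s: "s > 0" using assms by (simp add: s_def)
  have "(calib \<mu> has_real_derivative 2/3 * (- (3 * s\<^sup>2 * (inverse s / 2 * (- (2 * u / 2)))))) (at u)"
    unfolding calib_def s_def using assms
    by (auto intro!: derivative_eq_intros simp: power2_eq_square)
  moreover have "2/3 * (- (3 * s\<^sup>2 * (inverse s / 2 * (- (2 * u / 2))))) = u * s"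
    using s by (simp add: power2_eq_square field_simps)
  ultimately have "(calib \<mu> has_real_derivative u * s) (at u)" by (simp only:)
  then show ?thesis unfolding s_def .
qed

text \<open>The mean value theorem; the derivative formula holds strictly inside the admissible
  heights, and continuity covers the extreme ones.\<close>

lemma calib_lipschitz:
  assumes "a < b" "\<bar>a\<bar> \<le> sqrt 2 * \<mu>" "\<bar>b\<bar> \<le> sqrt 2 * \<mu>"
  obtains \<xi> where "a < \<xi>" "\<xi> < b" "calib \<mu> b - calib \<mu> a = (b - a) * (\<xi> * sqrt (\<mu>\<^sup>2 - \<xi>\<^sup>2/2))"
proof -
  have d: "(calib \<mu> has_real_derivative x * sqrt (\<mu>\<^sup>2 - x\<^sup>2/2)) (at x)" if "a < x" "x < b" for x
  proof (rule calib_deriv)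
    have "\<bar>x\<bar> < sqrt 2 * \<mu>" using assms that by linarith
    then have "\<bar>x\<bar>\<^sup>2 < (sqrt 2 * \<mu>)\<^sup>2" by (intro power_strict_mono) auto
    then show "x\<^sup>2 < 2 * \<mu>\<^sup>2" by (simp add: power_mult_distrib)
  qed
  obtain l z where z: "a < z" "z < b" "DERIV (calib \<mu>) z :> l" "calib \<mu> b - calib \<mu> a = (b - a) * l"
    using MVT[OF assms(1) calib_continuous] d by (metis real_differentiable_def)
  then have "l = z * sqrt (\<mu>\<^sup>2 - z\<^sup>2/2)" using d[of z] DERIV_unique by blast
  then show ?thesis using that z by blast
qed

lemma calib_max: "0 \<le> \<mu> \<Longrightarrow> calib \<mu> (sqrt 2 * \<mu>) = 2/3 * \<mu>^3"
  by (simp add: calib_def power_mult_distrib)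

text \<open>With \<open>s = sqrt (\<mu>\<^sup>2 - u\<^sup>2/2)\<close> the difference of the two
  sides is \<open>(\<mu> - s)\<^sup>2 * (\<mu> + 2 * s) / 3\<close>. The bound converts the
  calibration at the end points of a path into vertex terms.\<close>

lemma calib_le:
  assumes "0 \<le> \<mu>" "\<bar>u\<bar> \<le> sqrt 2 * \<mu>"
  shows "calib \<mu> u \<le> \<mu>/2 * u\<^sup>2"
proof -
  define s where "s = sqrt (\<mu>\<^sup>2 - u\<^sup>2/2)"
  have "u\<^sup>2 \<le> (sqrt 2 * \<mu>)\<^sup>2" using assms(2) by (rule abs_le_square_iff[THEN iffD1, OF order_trans[OF _ abs_ge_self]])
  then have u: "u\<^sup>2 \<le> 2 * \<mu>\<^sup>2" by (simp add: power_mult_distrib)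
  have s: "s\<^sup>2 = \<mu>\<^sup>2 - u\<^sup>2/2" "0 \<le> s" using u by (auto simp: s_def)
  have "s\<^sup>2 \<le> \<mu>\<^sup>2" using s by simp
  then have "s \<le> \<mu>" using assms(1) by (rule power2_le_imp_le)
  have e: "u\<^sup>2 = 2 * (\<mu>\<^sup>2 - s\<^sup>2)" using s by simp
  have "0 \<le> (\<mu> - s)\<^sup>2 * (\<mu> + 2 * s)" using s(2) assms(1) by simp
  moreover have c: "calib \<mu> u = 2/3 * (\<mu>^3 - s^3)" by (simp add: calib_def s_def)
  ultimately show ?thesis unfolding c e by (simp add: power2_eq_square power3_eq_cube algebra_simps)
qed

text \<open>Young's inequality with weight \<open>\<kappa> = |f| sqrt (\<mu>\<^sup>2 - f\<^sup>2/2)\<close>, integrated along the path.\<close>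

lemma calibration:
  assumes ac: "ac_on {a..b} f g" and g: "sq_integrable {a..b} g" and "a \<le> b"
    and bd: "\<And>x. x \<in> {a..b} \<Longrightarrow> \<bar>f x\<bar> \<le> sqrt 2 * \<mu>"
  shows "\<bar>calib \<mu> (f b) - calib \<mu> (f a)\<bar> \<le> 1/2 * integral {a..b} (\<lambda>x. (g x)\<^sup>2 + \<mu>\<^sup>2 * (f x)\<^sup>2 - (f x)^4 / 2)"
proof -
  define \<kappa> where "\<kappa> = (\<lambda>x. \<bar>f x\<bar> * sqrt (\<mu>\<^sup>2 - (f x)\<^sup>2/2))"
  have fc: "continuous_on {a..b} f" using ac_on_continuous[OF ac] by (simp add: is_interval_cc)
  have f2: "(f y)\<^sup>2 \<le> 2 * \<mu>\<^sup>2" if "y \<in> {a..b}" for y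
  proof -
    have "(f y)\<^sup>2 \<le> (sqrt 2 * \<mu>)\<^sup>2" using bd[OF that] by (rule abs_le_square_iff[THEN iffD1, OF order_trans[OF _ abs_ge_self]])
    then show ?thesis by (simp add: power_mult_distrib)
  qed
  have \<kappa>abs: "\<kappa> y = \<bar>f y * sqrt (\<mu>\<^sup>2 - (f y)\<^sup>2/2)\<bar>" if "y \<in> {a..b}" for y
    using f2[OF that] by (simp add: \<kappa>_def abs_mult)
  have \<kappa>c: "continuous_on {a..b} \<kappa>" unfolding \<kappa>_def by (intro continuous_intros fc) auto
  have \<kappa>2: "(\<kappa> x)\<^sup>2 = \<mu>\<^sup>2 * (f x)\<^sup>2 - (f x)^4 / 2" if "x \<in> {a..b}" for x
  proof -
    have "(f x)\<^sup>2 \<le> (sqrt 2 * \<mu>)\<^sup>2" using bd[OF that] by (rule abs_le_square_iff[THEN iffD1, OF order_trans[OF _ abs_ge_self]])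
    then have "(f x)\<^sup>2 \<le> 2 * \<mu>\<^sup>2" by (simp add: power_mult_distrib)
    then show ?thesis by (simp add: \<kappa>_def power_mult_distrib algebra_simps power2_eq_square power4_eq_xxxx)
  qed
  have g2: "(\<lambda>x. (g x)\<^sup>2) integrable_on {a..b}"
    using g integrable_on_lebesgue_on[of "{a..b}" "\<lambda>x. (g x)\<^sup>2"] by (simp add: sq_integrable_def)
  have ga: "(\<lambda>x. \<bar>g x\<bar>) integrable_on {a..b}"
    using sq_integrable_imp_absolutely_integrable[OF g] by (simp add: absolutely_integrable_on_def)
  have \<kappa>i: "(\<lambda>x. (\<kappa> x)\<^sup>2) integrable_on {a..b}"
    by (intro integrable_continuous_real continuous_on_power \<kappa>c)
  \<comment> \<open>The sign \<sigma> treats both directions at once; the term with e absorbs the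
    oscillation of \<kappa> on short intervals.\<close>
  have main: "\<sigma> * (calib \<mu> (f b) - calib \<mu> (f a)) \<le> integral {a..b} (\<lambda>x. 1/2 * ((g x)\<^sup>2 + (\<kappa> x)\<^sup>2) + e * \<bar>g x\<bar>)"
    if e: "e > 0" and \<sigma>: "\<sigma> = 1 \<or> \<sigma> = -1" for e \<sigma> :: real
  proof -
    define m where "m = (\<lambda>x. 1/2 * ((g x)\<^sup>2 + (\<kappa> x)\<^sup>2) + e * \<bar>g x\<bar>)"
    have mi: "m integrable_on {a..b}"
      unfolding m_def by (intro integrable_add integrable_on_cmult_left[OF _, where 'b=real, simplified] integrable_on_mult_right g2 ga \<kappa>i)
    have "uniformly_continuous_on {a..b} \<kappa>"
      using \<kappa>c by (intro compact_uniformly_continuous) auto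
    then obtain d where d: "d > 0" "\<And>x y. x \<in> {a..b} \<Longrightarrow> y \<in> {a..b} \<Longrightarrow> \<bar>y - x\<bar> < d \<Longrightarrow> \<bar>\<kappa> y - \<kappa> x\<bar> < e"
      unfolding uniformly_continuous_on_def dist_real_def using e by meson
    have "\<sigma> * calib \<mu> (f b) - \<sigma> * calib \<mu> (f a) \<le> integral {a..b} m"
    proof (rule increment_le_integral_local[OF \<open>a \<le> b\<close> mi, where F = "\<lambda>x. \<sigma> * calib \<mu> (f x)"])
      fix x assume "x \<in> {a..b}"
      have "\<sigma> * calib \<mu> (f v) - \<sigma> * calib \<mu> (f u) \<le> integral {u..v} m"
        if uv: "a \<le> u" "u \<le> x" "x \<le> v" "v \<le> b" "v - u < d" for u v
      proof -
        have sub: "{u..v} \<subseteq> {a..b}" using uv by auto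
        have fi: "f v - f u = integral {u..v} g" using ac_onD(2)[OF ac, of u v] uv by auto
        have gi: "(\<lambda>x. \<bar>g x\<bar>) integrable_on {u..v}" "g integrable_on {u..v}"
          using integrable_on_subinterval[OF ga sub] ac_onD(3)[OF ac, of u v] uv by auto
        have fle: "\<bar>f v - f u\<bar> \<le> integral {u..v} (\<lambda>x. \<bar>g x\<bar>)"
          unfolding fi using integral_norm_bound_integral[OF gi(2,1)] by simp
        have fuv: "continuous_on {u..v} f" using fc sub continuous_on_subset by blast
        \<comment> \<open>The mean value theorem yields a height between f u and f v, which is a
          value f \<tau> by the intermediate value theorem; the slope of \<open>calib\<close> there
          has modulus \<kappa> \<tau>.\<close>
        have "\<exists>\<tau>\<in>{u..v}. \<bar>calib \<mu> (f v) - calib \<mu> (f u)\<bar> \<le> \<bar>f v - f u\<bar> * \<kappa> \<tau>"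
        proof -
          consider "f u = f v" | "f u < f v" | "f v < f u" by linarith
          then show ?thesis
          proof cases
            case 1 then show ?thesis using uv by (intro bexI[of _ u]) auto
          next
            case 2
            obtain \<xi> where \<xi>: "f u < \<xi>" "\<xi> < f v" "calib \<mu> (f v) - calib \<mu> (f u) = (f v - f u) * (\<xi> * sqrt (\<mu>\<^sup>2 - \<xi>\<^sup>2/2))"
              using calib_lipschitz[OF 2, of \<mu> thesis] bd uv by auto
            obtain \<tau> where "u \<le> \<tau>" "\<tau> \<le> v" "f \<tau> = \<xi>"
              using IVT'[of f u \<xi> v] \<xi> uv fuv by auto
            then show ?thesis using uv unfolding \<xi>(3) by (intro bexI[of _ \<tau>]) (auto simp: \<kappa>abs abs_mult)
          next
            case 3
            obtain \<xi> where \<xi>: "f v < \<xi>" "\<xi> < f u" "calib \<mu> (f u) - calib \<mu> (f v) = (f u - f v) * (\<xi> * sqrt (\<mu>\<^sup>2 - \<xi>\<^sup>2/2))"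
              using calib_lipschitz[OF 3, of \<mu> thesis] bd uv by auto
            obtain \<tau> where t: "u \<le> \<tau>" "\<tau> \<le> v" "f \<tau> = \<xi>"
              using IVT2'[of f v \<xi> u] \<xi> uv fuv by auto
            have "\<bar>calib \<mu> (f v) - calib \<mu> (f u)\<bar> = \<bar>calib \<mu> (f u) - calib \<mu> (f v)\<bar>" by simp
            moreover have "\<tau> \<in> {a..b}" using t uv by auto
            ultimately show ?thesis unfolding \<xi>(3) using t
              by (intro bexI[of _ \<tau>]) (auto simp: \<kappa>abs abs_mult abs_minus_commute[of "f u" "f v"])
          qed
        qed
        then obtain \<tau> where \<tau>: "\<tau> \<in> {u..v}" "\<bar>calib \<mu> (f v) - calib \<mu> (f u)\<bar> \<le> \<bar>f v - f u\<bar> * \<kappa> \<tau>" by blast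
        have \<kappa>0: "\<kappa> y \<ge> 0" if "y \<in> {a..b}" for y
        proof -
          have "(f y)\<^sup>2 \<le> (sqrt 2 * \<mu>)\<^sup>2" using bd[OF that] by (rule abs_le_square_iff[THEN iffD1, OF order_trans[OF _ abs_ge_self]])
          then show ?thesis by (simp add: \<kappa>_def power_mult_distrib)
        qed
        have "\<sigma> * calib \<mu> (f v) - \<sigma> * calib \<mu> (f u) \<le> \<bar>calib \<mu> (f v) - calib \<mu> (f u)\<bar>"
          using \<sigma> by auto
        also have "\<dots> \<le> \<bar>f v - f u\<bar> * \<kappa> \<tau>" by (rule \<tau>)
        also have "\<dots> \<le> integral {u..v} (\<lambda>x. \<bar>g x\<bar>) * \<kappa> \<tau>"
          using fle \<kappa>0[of \<tau>] \<tau>(1) sub by (intro mult_right_mono) auto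
        also have "\<dots> = integral {u..v} (\<lambda>x. \<bar>g x\<bar> * \<kappa> \<tau>)" by simp
        also have "\<dots> \<le> integral {u..v} m"
        proof (rule integral_le)
          show "(\<lambda>x. \<bar>g x\<bar> * \<kappa> \<tau>) integrable_on {u..v}" using gi(1) by (rule integrable_on_mult_left)
          show "m integrable_on {u..v}" using mi sub by (rule integrable_on_subinterval)
          fix t assume t: "t \<in> {u..v}"
          have "\<bar>\<kappa> \<tau> - \<kappa> t\<bar> < e" using d(2)[of t \<tau>] t \<tau>(1) sub uv by auto
          then have "\<bar>g t\<bar> * \<kappa> \<tau> \<le> \<bar>g t\<bar> * (\<kappa> t + e)" by (intro mult_left_mono) auto
          moreover have "\<bar>g t\<bar> * \<kappa> t \<le> 1/2 * ((g t)\<^sup>2 + (\<kappa> t)\<^sup>2)"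
            using sum_squares_bound[of "\<bar>g t\<bar>" "\<kappa> t"] by simp
          ultimately show "\<bar>g t\<bar> * \<kappa> \<tau> \<le> m t" by (simp add: m_def algebra_simps)
        qed
        finally show ?thesis .
      qed
      then show "\<exists>d>0. \<forall>u v. a \<le> u \<and> u \<le> x \<and> x \<le> v \<and> v \<le> b \<and> v - u < d \<longrightarrow> \<sigma> * calib \<mu> (f v) - \<sigma> * calib \<mu> (f u) \<le> integral {u..v} m"
        using d(1) by (intro exI[of _ d]) simp
    qed
    then show ?thesis by (simp add: m_def right_diff_distrib)
  qed
  define I where "I = integral {a..b} (\<lambda>x. 1/2 * ((g x)\<^sup>2 + (\<kappa> x)\<^sup>2))"
  define J where "J = integral {a..b} (\<lambda>x. \<bar>g x\<bar>)"
  have J0: "J \<ge> 0" unfolding J_def using ga by (intro integral_nonneg) auto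
  have Ie: "integral {a..b} (\<lambda>x. 1/2 * ((g x)\<^sup>2 + (\<kappa> x)\<^sup>2) + e * \<bar>g x\<bar>) = I + e * J" for e
    unfolding I_def J_def using integrable_on_mult_right[OF integrable_add[OF g2 \<kappa>i], of "1/2"] integrable_on_mult_right[OF ga, of e]
    by (subst Henstock_Kurzweil_Integration.integral_add[OF integrable_on_mult_right[OF integrable_add[OF g2 \<kappa>i]] integrable_on_mult_right[OF ga]]) simp
  have fin: "\<sigma> * (calib \<mu> (f b) - calib \<mu> (f a)) \<le> I" if \<sigma>: "\<sigma> = 1 \<or> \<sigma> = -1" for \<sigma> :: real
  proof (rule field_le_epsilon)
    fix e :: real assume e: "e > 0"
    have "\<sigma> * (calib \<mu> (f b) - calib \<mu> (f a)) \<le> I + e / (J + 1) * J"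
      using main[OF _ \<sigma>, of "e/(J+1)"] e J0 unfolding Ie by simp
    also have "e / (J + 1) * J \<le> e" using e J0 by (simp add: field_simps)
    finally show "\<sigma> * (calib \<mu> (f b) - calib \<mu> (f a)) \<le> I + e" by simp
  qed
  have "I = integral {a..b} (\<lambda>x. 1/2 * ((g x)\<^sup>2 + \<mu>\<^sup>2 * (f x)\<^sup>2 - (f x)^4 / 2))"
    unfolding I_def by (rule integral_cong) (simp add: \<kappa>2)
  then have Ieq: "I = 1/2 * integral {a..b} (\<lambda>x. (g x)\<^sup>2 + \<mu>\<^sup>2 * (f x)\<^sup>2 - (f x)^4 / 2)" by simp
  show ?thesis
    unfolding Ieq[symmetric] using fin[OF disjI1[OF refl]] fin[OF disjI2[OF refl]] by (simp add: abs_le_iff)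
qed


section \<open>Sobolev functions on half-lines and the sharp inequality\<close>

definition H1_pair :: "real set \<Rightarrow> (real \<Rightarrow> real) \<Rightarrow> (real \<Rightarrow> real) \<Rightarrow> bool" where
  "H1_pair X f g \<longleftrightarrow> ac_on X f g \<and> sq_integrable X f \<and> sq_integrable X g"

lemma H1_pair_lincomb:
  "H1_pair X f g \<Longrightarrow> H1_pair X f' g' \<Longrightarrow> H1_pair X (\<lambda>x. s * f x + t * f' x) (\<lambda>x. s * g x + t * g' x)"
  unfolding H1_pair_def using ac_on_lincomb sq_integrable_lincomb by blast

lemma H1_pair_scale: "H1_pair X f g \<Longrightarrow> H1_pair X (\<lambda>x. s * f x) (\<lambda>x. s * g x)"
  using H1_pair_lincomb[of X f g f g s 0] by simp

lemma H1_pair_subset: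
  assumes "H1_pair X f g" "Y \<subseteq> X" "X \<in> sets lebesgue" "Y \<in> sets lebesgue"
  shows "H1_pair Y f g"
  using assms ac_on_subset sq_integrable_subset unfolding H1_pair_def by blast

text \<open>Within distance 1 to the right, f changes by at most the square root of the Dirichlet
  integral; averaging \<open>(f x)\<^sup>2 \<le> 2 * (f y)\<^sup>2 + 2 * (f y - f x)\<^sup>2\<close>
  over these y gives the bound.\<close>

lemma H1_pair_bound:
  assumes H: "H1_pair {c..} f g" and x: "c \<le> x"
  shows "(f x)\<^sup>2 \<le> 2 * (integral\<^sup>L (lebesgue_on {c..}) (\<lambda>x. (f x)\<^sup>2) + integral\<^sup>L (lebesgue_on {c..}) (\<lambda>x. (g x)\<^sup>2))"
proof -
  have ac: "ac_on {c..} f g" and f: "sq_integrable {c..} f" and g: "sq_integrable {c..} g"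
    using H by (auto simp: H1_pair_def)
  define G where "G = integral\<^sup>L (lebesgue_on {c..}) (\<lambda>x. (g x)\<^sup>2)"
  have sub: "{x..y} \<subseteq> {c..}" for y using x by auto
  have fi: "integrable (lebesgue_on {x..x+1}) (\<lambda>x. (f x)\<^sup>2)"
    using sq_integrable_subset[OF f sub[of "x+1"]] by (simp add: sq_integrable_def)
  have le: "(f x)\<^sup>2 \<le> 2 * (f y)\<^sup>2 + 2 * G" if y: "y \<in> {x..x+1}" for y
  proof -
    have xy: "x \<le> y" "y - x \<le> 1" using y by auto
    have "(f y - f x)\<^sup>2 \<le> (y - x) * integral\<^sup>L (lebesgue_on {x..y}) (\<lambda>x. (g x)\<^sup>2)"
      by (rule ac_on_Hoelder[OF ac g _ sub xy(1)]) simp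
    also have "\<dots> \<le> 1 * integral\<^sup>L (lebesgue_on {x..y}) (\<lambda>x. (g x)\<^sup>2)"
      using xy by (intro mult_right_mono) auto
    also have "\<dots> \<le> G" unfolding G_def using g sub[of y]
      by (simp, intro lebesgue_on_integral_mono_set) (auto simp: sq_integrable_def)
    finally have 1: "(f y - f x)\<^sup>2 \<le> G" .
    have "0 \<le> (2 * f y - f x)\<^sup>2" by simp
    then have "(f x)\<^sup>2 \<le> 2 * (f y)\<^sup>2 + 2 * (f y - f x)\<^sup>2" by (simp add: power2_eq_square algebra_simps)
    then show ?thesis using 1 by linarith
  qed
  have "(f x)\<^sup>2 = integral\<^sup>L (lebesgue_on {x..x+1}) (\<lambda>y. (f x)\<^sup>2)"
    by (simp add: measure_restrict_space)
  also have "\<dots> \<le> integral\<^sup>L (lebesgue_on {x..x+1}) (\<lambda>y. 2 * (f y)\<^sup>2 + 2 * G)"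
    using fi le by (intro integral_mono) auto
  also have "\<dots> = 2 * integral\<^sup>L (lebesgue_on {x..x+1}) (\<lambda>y. (f y)\<^sup>2) + 2 * G"
    using fi by (simp add: measure_restrict_space)
  also have "integral\<^sup>L (lebesgue_on {x..x+1}) (\<lambda>y. (f y)\<^sup>2) \<le> integral\<^sup>L (lebesgue_on {c..}) (\<lambda>x. (f x)\<^sup>2)"
    using f sub[of "x+1"] by (intro lebesgue_on_integral_mono_set) (auto simp: sq_integrable_def)
  finally show ?thesis unfolding G_def by simp
qed

lemma H1_pair_power4:
  assumes H: "H1_pair {c..} f g"
  shows "integrable (lebesgue_on {c..}) (\<lambda>x. (f x)^4)"
proof -
  define B where "B = 2 * (integral\<^sup>L (lebesgue_on {c..}) (\<lambda>x. (f x)\<^sup>2) + integral\<^sup>L (lebesgue_on {c..}) (\<lambda>x. (g x)\<^sup>2))"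
  have f: "sq_integrable {c..} f" using H by (simp add: H1_pair_def)
  show ?thesis
  proof (rule Bochner_Integration.integrable_bound)
    show "integrable (lebesgue_on {c..}) (\<lambda>x. B * (f x)\<^sup>2)" using f by (simp add: sq_integrable_def)
    show "(\<lambda>x. (f x)^4) \<in> borel_measurable (lebesgue_on {c..})" using f by (auto simp: sq_integrable_def)
    have "norm ((f x)^4) \<le> norm (B * (f x)\<^sup>2)" if "x \<in> {c..}" for x
    proof -
      have "(f x)\<^sup>2 \<le> B" using H1_pair_bound[OF H] that by (simp add: B_def)
      then have "(f x)\<^sup>2 * (f x)\<^sup>2 \<le> B * (f x)\<^sup>2" by (intro mult_right_mono) auto
      moreover have "(f x)^4 = (f x)\<^sup>2 * (f x)\<^sup>2" by (simp flip: power_add)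
      ultimately have "(f x)^4 \<le> B * (f x)\<^sup>2" by (simp only:)
      moreover have "0 \<le> (f x)^4" by simp
      ultimately show ?thesis unfolding real_norm_def by linarith
    qed
    then show "AE x in lebesgue_on {c..}. norm ((f x)^4) \<le> norm (B * (f x)\<^sup>2)"
      by (intro AE_I2) simp
  qed
qed

text \<open>Otherwise the integral of f^2 over an interval of length n would be at least n e^2 for
  every n. Such points are where calibrated paths end and where functions are cut off.\<close>

lemma sq_integrable_small_value:
  assumes f: "sq_integrable {c..} f" and "e > 0"
  obtains x where "R \<le> x" "c \<le> x" "\<bar>f x\<bar> < e"
proof (rule ccontr)
  assume "\<not> thesis"
  then have ge: "e \<le> \<bar>f x\<bar>" if "R \<le> x" "c \<le> x" for x using that \<open>\<And>x. R \<le> x \<Longrightarrow> c \<le> x \<Longrightarrow> \<bar>f x\<bar> < e \<Longrightarrow> thesis\<close> by (meson not_less)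
  define I where "I = integral\<^sup>L (lebesgue_on {c..}) (\<lambda>x. (f x)\<^sup>2)"
  define A where "A = max R c"
  have "real n * e\<^sup>2 \<le> I" for n :: nat
  proof -
    have sub: "{A..A + real n} \<subseteq> {c..}" by (auto simp: A_def)
    have fi: "integrable (lebesgue_on {A..A+real n}) (\<lambda>x. (f x)\<^sup>2)"
      using sq_integrable_subset[OF f sub] by (simp add: sq_integrable_def)
    have "real n * e\<^sup>2 = integral\<^sup>L (lebesgue_on {A..A+real n}) (\<lambda>x. e\<^sup>2)"
      by (simp add: measure_restrict_space)
    also have "\<dots> \<le> integral\<^sup>L (lebesgue_on {A..A+real n}) (\<lambda>x. (f x)\<^sup>2)"
    proof (rule integral_mono[OF _ fi])
      fix x assume "x \<in> space (lebesgue_on {A..A+real n})"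
      then have "e \<le> \<bar>f x\<bar>" using ge by (simp add: A_def)
      then show "e\<^sup>2 \<le> (f x)\<^sup>2" using \<open>e > 0\<close> abs_le_square_iff[of e "f x"] by simp
    qed simp
    also have "\<dots> \<le> I" unfolding I_def
      using f sub by (intro lebesgue_on_integral_mono_set) (auto simp: sq_integrable_def)
    finally show ?thesis .
  qed
  moreover obtain n :: nat where "I / e\<^sup>2 < real n" using reals_Archimedean2 by blast
  ultimately show False using \<open>e > 0\<close> by (simp add: pos_divide_less_eq) (meson not_le)
qed

text \<open>
  The sharp Gagliardo--Nirenberg inequality on a half-line: rescaling \<open>f\<close> such that its maximum is
  that of the soliton, the calibration bounds the action from below by that of the soliton.
\<close>

lemma half_line_inequality:
  assumes H: "H1_pair {R..} f g" and \<mu>: "\<mu> > 0"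
  shows "16/3 * \<mu>^3 * integral\<^sup>L (lebesgue_on {R..}) (\<lambda>x. (f x)^4)
    \<le> (integral\<^sup>L (lebesgue_on {R..}) (\<lambda>x. (g x)\<^sup>2 + \<mu>\<^sup>2 * (f x)\<^sup>2) + \<mu> * (f R)\<^sup>2)\<^sup>2"
proof (cases "\<forall>x\<in>{R..}. f x = 0")
  case True
  then have "integral\<^sup>L (lebesgue_on {R..}) (\<lambda>x. (f x)^4) = integral\<^sup>L (lebesgue_on {R..}) (\<lambda>x. 0)"
    by (intro Bochner_Integration.integral_cong) auto
  then show ?thesis by simp
next
  case False
  have ac: "ac_on {R..} f g" and f: "sq_integrable {R..} f" and g: "sq_integrable {R..} g"
    using H by (auto simp: H1_pair_def)
  have f4: "integrable (lebesgue_on {R..}) (\<lambda>x. (f x)^4)" by (rule H1_pair_power4[OF H])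
  define A where "A = integral\<^sup>L (lebesgue_on {R..}) (\<lambda>x. (g x)\<^sup>2 + \<mu>\<^sup>2 * (f x)\<^sup>2)"
  define b where "b = integral\<^sup>L (lebesgue_on {R..}) (\<lambda>x. (f x)^4)"
  define S where "S = Sup ((\<lambda>x. \<bar>f x\<bar>) ` {R..})"
  have bdd: "bdd_above ((\<lambda>x. \<bar>f x\<bar>) ` {R..})"
  proof (rule bdd_aboveI2)
    fix x assume "x \<in> {R..}"
    then show "\<bar>f x\<bar> \<le> sqrt (2 * (integral\<^sup>L (lebesgue_on {R..}) (\<lambda>x. (f x)\<^sup>2) + integral\<^sup>L (lebesgue_on {R..}) (\<lambda>x. (g x)\<^sup>2)))"
      using H1_pair_bound[OF H, of x] by (intro real_le_rsqrt) simp
  qed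
  have Sub: "\<bar>f x\<bar> \<le> S" if "R \<le> x" for x unfolding S_def by (rule cSup_upper) (use that bdd in auto)
  obtain x1 where "R \<le> x1" "f x1 \<noteq> 0" using False by auto
  then have S0: "S > 0" using Sub[of x1] by linarith
  \<comment> \<open>This factor brings the supremum of |f| to \<open>sqrt 2 * \<mu>\<close>, the
    height of the soliton.\<close>
  define t where "t = sqrt 2 * \<mu> / S"
  have t0: "t > 0" using \<mu> S0 by (simp add: t_def)
  have tb: "\<bar>t * f x\<bar> \<le> sqrt 2 * \<mu>" if "R \<le> x" for x
    using Sub[OF that] \<mu> S0 t0 by (simp add: t_def abs_mult pos_divide_le_eq mult_left_mono)
  define h where "h = (\<lambda>x. (t * g x)\<^sup>2 + \<mu>\<^sup>2 * (t * f x)\<^sup>2 - (t * f x)^4 / 2)"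
  have h0: "h x \<ge> 0" if "x \<in> {R..}" for x
  proof -
    have "\<bar>t * f x\<bar>\<^sup>2 \<le> (sqrt 2 * \<mu>)\<^sup>2" using tb[of x] that by (intro power_mono) auto
    then have "(t * f x)\<^sup>2 \<le> 2 * \<mu>\<^sup>2" by (simp add: power_mult_distrib)
    then have "(t * f x)\<^sup>2 * (t * f x)\<^sup>2 \<le> 2 * \<mu>\<^sup>2 * (t * f x)\<^sup>2" by (intro mult_right_mono) auto
    moreover have "(t * f x)^4 = (t * f x)\<^sup>2 * (t * f x)\<^sup>2" by (simp flip: power_add)
    ultimately have "(t * f x)^4 / 2 \<le> \<mu>\<^sup>2 * (t * f x)\<^sup>2" by linarith
    then show ?thesis using zero_le_power2[of "t * g x"] unfolding h_def by linarith
  qed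
  have hi: "integrable (lebesgue_on {R..}) h"
    unfolding h_def power_mult_distrib using f g f4 by (auto simp: sq_integrable_def)
  have hint: "integral\<^sup>L (lebesgue_on {R..}) h = t\<^sup>2 * A - t^4 / 2 * b"
    unfolding h_def power_mult_distrib A_def b_def using f g f4
    by (simp add: sq_integrable_def algebra_simps)
  define X where "X = t\<^sup>2 * A - t^4 / 2 * b"
  \<comment> \<open>The path runs from R to a point x0 close to the maximum and then down to a point
    y where f is nearly 0. The two calibrations together give twice the maximal value
    \<open>2/3 * \<mu>^3\<close> of \<open>calib\<close>, less its value at R and errors controlled
    by e.\<close>
  have key: "4/3 * \<mu>^3 \<le> 1/2 * X + \<mu>/2 * (t * f R)\<^sup>2"
  proof (rule field_le_epsilon)
    fix e :: real assume e: "e > 0"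
    have "isCont (calib \<mu>) (sqrt 2 * \<mu>)" using calib_continuous[of UNIV \<mu>] by (simp add: continuous_on_eq_continuous_at)
    then obtain d where d: "d > 0" "\<And>u. \<bar>u - sqrt 2 * \<mu>\<bar> < d \<Longrightarrow> \<bar>calib \<mu> u - calib \<mu> (sqrt 2 * \<mu>)\<bar> < e/4"
      unfolding continuous_at_eps_delta dist_real_def using e by (metis zero_less_divide_iff zero_less_numeral)
    have "S - d / t < S" using d t0 by simp
    then obtain x0 where x0: "R \<le> x0" "S - d/t < \<bar>f x0\<bar>"
      unfolding S_def using less_cSup_iff[OF _ bdd] by auto
    have "t * S = sqrt 2 * \<mu>" using S0 by (simp add: t_def)
    moreover have "t * (S - d/t) < t * \<bar>f x0\<bar>" using x0(2) t0 by (rule mult_strict_left_mono)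
    ultimately have "sqrt 2 * \<mu> - d < \<bar>t * f x0\<bar>" using t0 by (simp add: right_diff_distrib abs_mult)
    then have "\<bar>calib \<mu> \<bar>t * f x0\<bar> - calib \<mu> (sqrt 2 * \<mu>)\<bar> < e/4"
      using tb[OF x0(1)] by (intro d(2)) auto
    then have c0: "2/3 * \<mu>^3 - e/4 \<le> calib \<mu> (t * f x0)"
      unfolding calib_abs calib_max[OF less_imp_le[OF \<mu>]] by linarith
    have "sqrt (e / \<mu>) > 0" using e \<mu> by simp
    then have "sqrt (e / \<mu>) / t > 0" using t0 by simp
    then obtain y where y: "x0 \<le> y" "R \<le> y" "\<bar>f y\<bar> < sqrt (e / \<mu>) / t"
      by (rule sq_integrable_small_value[OF f])
    have "\<bar>t * f y\<bar> \<le> sqrt (e / \<mu>)" using y(3) t0 by (simp add: abs_mult pos_less_divide_eq mult.commute)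
    then have "\<bar>t * f y\<bar>\<^sup>2 \<le> (sqrt (e/\<mu>))\<^sup>2" by (intro power_mono) auto
    then have "\<mu>/2 * (t * f y)\<^sup>2 \<le> \<mu>/2 * (e/\<mu>)" using \<mu> e by (intro mult_left_mono) auto
    then have cy: "calib \<mu> (t * f y) \<le> e/2" using calib_le[OF _ tb[OF y(2)]] \<mu> by (simp add: field_simps)
    have cR: "calib \<mu> (t * f R) \<le> \<mu>/2 * (t * f R)\<^sup>2" using calib_le[OF _ tb[of R]] \<mu> by simp
    have acs: "ac_on {u..v} (\<lambda>x. t * f x) (\<lambda>x. t * g x)" "sq_integrable {u..v} (\<lambda>x. t * g x)" if "R \<le> u" for u v
      using ac_on_subset[OF ac_on_lincomb[OF ac ac, of t 0]] sq_integrable_subset[OF sq_integrable_lincomb[OF g g, of t 0]] that by auto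
    have hJ: "integral {u..v} h = integral\<^sup>L (lebesgue_on {u..v}) h" "h integrable_on {u..v}" if "R \<le> u" for u v
      using lebesgue_integral_eq_integral[OF integrable_lebesgue_on_subset[OF hi, of "{u..v}"]]
        integrable_on_lebesgue_on[OF integrable_lebesgue_on_subset[OF hi, of "{u..v}"]] that by auto
    have "calib \<mu> (t * f x0) - calib \<mu> (t * f R) \<le> 1/2 * integral {R..x0} h"
    proof -
      have "\<bar>calib \<mu> (t * f x0) - calib \<mu> (t * f R)\<bar> \<le> 1/2 * integral {R..x0} h"
        by (rule calibration[OF acs(1)[OF order_refl] acs(2)[OF order_refl] x0(1), of \<mu>, folded h_def]) (use tb in auto)
      then show ?thesis by linarith
    qed
    moreover have "calib \<mu> (t * f x0) - calib \<mu> (t * f y) \<le> 1/2 * integral {x0..y} h"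
    proof -
      have "\<bar>calib \<mu> (t * f y) - calib \<mu> (t * f x0)\<bar> \<le> 1/2 * integral {x0..y} h"
        by (rule calibration[OF acs(1)[OF x0(1)] acs(2)[OF x0(1)] y(1), of \<mu>, folded h_def]) (use tb x0(1) in auto)
      then show ?thesis by linarith
    qed
    moreover have "integral {R..x0} h + integral {x0..y} h = integral {R..y} h"
      using x0 y hJ(2)[of R y] by (intro Henstock_Kurzweil_Integration.integral_combine) auto
    moreover have "integral {R..y} h \<le> X"
      unfolding X_def hint[symmetric] hJ(1)[OF order_refl]
      using hi h0 by (intro lebesgue_on_integral_mono_set) auto
    ultimately show "4/3 * \<mu>^3 \<le> 1/2 * X + \<mu>/2 * (t * f R)\<^sup>2 + e"
      using c0 cy cR by linarith
  qed
  define A' where "A' = A + \<mu> * (f R)\<^sup>2"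
  define T where "T = t\<^sup>2"
  have b0: "b \<ge> 0" unfolding b_def by simp
  have "t^4 = T\<^sup>2" by (simp add: T_def flip: power_mult)
  then have k: "4/3 * \<mu>^3 \<le> 1/2 * T * A' - 1/4 * T\<^sup>2 * b"
    using key by (simp add: X_def A'_def T_def power_mult_distrib algebra_simps)
  \<comment> \<open>This square removes the particular scaling T from the lower bound and leaves the
    scale-invariant inequality.\<close>
  have "0 \<le> (A' - T * b)\<^sup>2" by simp
  then have "4 * b * (1/2 * T * A' - 1/4 * T\<^sup>2 * b) \<le> A'\<^sup>2" by (simp add: power2_eq_square algebra_simps)
  moreover have "4 * b * (4/3 * \<mu>^3) \<le> 4 * b * (1/2 * T * A' - 1/4 * T\<^sup>2 * b)" using k b0 by (intro mult_left_mono) auto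
  ultimately show ?thesis unfolding A_def[symmetric] b_def[symmetric] A'_def by (simp add: algebra_simps)
qed

section \<open>The variational problem on the glued half-line\<close>

lemma integrable_lebesgue_on_interval_split:
  fixes h :: "real \<Rightarrow> real"
  assumes "integrable (lebesgue_on {a..}) h" "a \<le> c"
  shows "integrable (lebesgue_on {a..c}) h" "integrable (lebesgue_on {c..}) h"
    "integral\<^sup>L (lebesgue_on {a..}) h = integral\<^sup>L (lebesgue_on {a..c}) h + integral\<^sup>L (lebesgue_on {c..}) h"
proof -
  show 1: "integrable (lebesgue_on {a..c}) h" "integrable (lebesgue_on {c..}) h"
    using assms by (auto intro: integrable_lebesgue_on_subset[OF assms(1)])
  have "{a..c} \<inter> {c..} \<in> null_sets lebesgue"
  proof -
    have "{a..c} \<inter> {c..} = {c}" using assms(2) by auto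
    then show ?thesis by simp
  qed
  then have "integral\<^sup>L (lebesgue_on ({a..c} \<union> {c..})) h = integral\<^sup>L (lebesgue_on {a..c}) h + integral\<^sup>L (lebesgue_on {c..}) h"
    by (intro lebesgue_on_integral_Un 1) auto
  moreover have "{a..c} \<union> {c..} = {a..}" using assms(2) by auto
  ultimately show "integral\<^sup>L (lebesgue_on {a..}) h = integral\<^sup>L (lebesgue_on {a..c}) h + integral\<^sup>L (lebesgue_on {c..}) h" by simp
qed

lemma lebesgue_on_integral_glue:
  fixes h1 h2 :: "real \<Rightarrow> real"
  assumes "integrable (lebesgue_on {a..c}) h1" "integrable (lebesgue_on {c..}) h2" "a \<le> c"
  shows "integrable (lebesgue_on {a..}) (\<lambda>x. if x \<le> c then h1 x else h2 x)"
    "integral\<^sup>L (lebesgue_on {a..}) (\<lambda>x. if x \<le> c then h1 x else h2 x)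
      = integral\<^sup>L (lebesgue_on {a..c}) h1 + integral\<^sup>L (lebesgue_on {c..}) h2"
proof -
  let ?h = "\<lambda>x. if x \<le> c then h1 x else h2 x"
  have lebesgue_singleton: "{c} \<in> sets lebesgue" by simp
  have "{a..c} \<inter> {c<..} = {}" by auto
  then have n: "{a..c} \<inter> {c<..} \<in> null_sets lebesgue" by simp
  have u: "{a..c} \<union> {c<..} = {a..}" using assms(3) by auto
  have i1: "integrable (lebesgue_on {a..c}) ?h"
    using assms(1) by (rule Bochner_Integration.integrable_cong[THEN iffD1, rotated 2]) auto
  have h2: "integrable (lebesgue_on {c<..}) h2"
    using assms(2) by (rule integrable_lebesgue_on_subset) auto
  then have i2: "integrable (lebesgue_on {c<..}) ?h"
    by (rule Bochner_Integration.integrable_cong[THEN iffD1, rotated 2]) auto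
  show "integrable (lebesgue_on {a..}) ?h"
    using lebesgue_on_integral_Un(1)[OF i1 i2 n] u by simp
  have "integral\<^sup>L (lebesgue_on {a..}) ?h = integral\<^sup>L (lebesgue_on {a..c}) ?h + integral\<^sup>L (lebesgue_on {c<..}) ?h"
    using lebesgue_on_integral_Un(2)[OF i1 i2 n] u by simp
  also have "integral\<^sup>L (lebesgue_on {a..c}) ?h = integral\<^sup>L (lebesgue_on {a..c}) h1"
    by (intro Bochner_Integration.integral_cong) auto
  also have "integral\<^sup>L (lebesgue_on {c<..}) ?h = integral\<^sup>L (lebesgue_on {c<..}) h2"
    by (intro Bochner_Integration.integral_cong) auto
  also have "integral\<^sup>L (lebesgue_on {c<..}) h2 = integral\<^sup>L (lebesgue_on {c..}) h2"
  proof -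
    have s: "integrable (lebesgue_on {c}) h2" using assms(2) by (rule integrable_lebesgue_on_subset) auto
    have "{c} \<inter> {c<..} \<in> null_sets lebesgue" by simp
    moreover have "{c} \<union> {c<..} = {c..}" by auto
    moreover have "integral\<^sup>L (lebesgue_on {c}) h2 = 0"
      unfolding lebesgue_on_integral_set[OF lebesgue_singleton] set_lebesgue_integral_def
      by (intro integral_eq_zero_AE AE_I'[of "{c}"]) (auto simp: indicator_def split: if_splits)
    ultimately show ?thesis using lebesgue_on_integral_Un(2)[OF s h2] by simp
  qed
  finally show "integral\<^sup>L (lebesgue_on {a..}) ?h = integral\<^sup>L (lebesgue_on {a..c}) h1 + integral\<^sup>L (lebesgue_on {c..}) h2" .
qed

lemma measurable_lebesgue_on_glue:
  fixes h1 h2 :: "real \<Rightarrow> real"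
  assumes "h1 \<in> borel_measurable (lebesgue_on {a..c})" "h2 \<in> borel_measurable (lebesgue_on {c..})"
  shows "(\<lambda>x. if x \<le> c then h1 x else h2 x) \<in> borel_measurable (lebesgue_on {a..})"
proof -
  have 1: "(\<lambda>x. if x \<in> {a..c} then h1 x else 0) \<in> borel_measurable lebesgue"
    using assms(1) by (subst borel_measurable_if) auto
  have "h2 \<in> borel_measurable (lebesgue_on {c<..})"
    using assms(2) by (rule measurable_restrict_mono) auto
  then have 2: "(\<lambda>x. if x \<in> {c<..} then h2 x else 0) \<in> borel_measurable lebesgue"
    by (subst borel_measurable_if) auto
  have "(\<lambda>x. (if x \<in> {a..c} then h1 x else 0) + (if x \<in> {c<..} then h2 x else 0)) \<in> borel_measurable (lebesgue_on {a..})"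
    by (intro measurable_restrict_space1 borel_measurable_add 1 2)
  then show ?thesis by (rule measurable_cong[THEN iffD1, rotated]) auto
qed

text \<open>Matching values at c suffice for absolute continuity across c; the derivative at the
  single point c does not influence any integral.\<close>

lemma H1_pair_glue:
  assumes H1: "H1_pair {a..c} f1 g1" and H2: "H1_pair {c..} f2 g2" and "a \<le> c" "f1 c = f2 c"
  shows "H1_pair {a..} (\<lambda>x. if x \<le> c then f1 x else f2 x) (\<lambda>x. if x \<le> c then g1 x else g2 x)"
    (is "H1_pair _ ?f ?g")
proof -
  have ac1: "ac_on {a..c} f1 g1" and ac2: "ac_on {c..} f2 g2" using H1 H2 by (auto simp: H1_pair_def)
  have sq: "sq_integrable {a..} (\<lambda>x. if x \<le> c then h1 x else h2 x)"
    if "sq_integrable {a..c} h1" "sq_integrable {c..} h2" for h1 h2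
  proof -
    have "integrable (lebesgue_on {a..}) (\<lambda>x. if x \<le> c then (h1 x)\<^sup>2 else (h2 x)\<^sup>2)"
      using that \<open>a \<le> c\<close> by (intro lebesgue_on_integral_glue) (auto simp: sq_integrable_def)
    moreover have "(\<lambda>x. if x \<le> c then (h1 x)\<^sup>2 else (h2 x)\<^sup>2) = (\<lambda>x. (if x \<le> c then h1 x else h2 x)\<^sup>2)" by auto
    ultimately show ?thesis
      using that measurable_lebesgue_on_glue[of h1 a c h2] by (simp add: sq_integrable_def)
  qed
  have hi1: "(?g has_integral (f1 y - f1 x)) {x..y}" if "a \<le> x" "x \<le> y" "y \<le> c" for x y
  proof (rule has_integral_eq)
    show "(g1 has_integral (f1 y - f1 x)) {x..y}"
      using ac_onD[OF ac1, of x y] that by (auto simp: has_integral_integrable_integral)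
  qed (use that in auto)
  have hi2: "(?g has_integral (f2 y - f2 x)) {x..y}" if "c \<le> x" "x \<le> y" for x y
  proof (rule has_integral_spike_finite)
    show "(g2 has_integral (f2 y - f2 x)) {x..y}"
      using ac_onD[OF ac2, of x y] that by (auto simp: has_integral_integrable_integral)
    show "finite {c}" by simp
  qed (use that in auto)
  have "ac_on {a..} ?f ?g"
    unfolding ac_on_def
  proof (intro ballI impI)
    fix x y assume xy: "x \<in> {a..}" "y \<in> {a..}" "x \<le> y"
    have hi: "(?g has_integral (?f y - ?f x)) {x..y}"
    proof -
      consider "y \<le> c" | "c < x" | "x \<le> c" "c < y" using xy by linarith
      then show ?thesis
      proof cases
        case 1 then show ?thesis using hi1[of x y] xy by simp
      next
        case 2 then show ?thesis using hi2[of x y] xy by simp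
      next
        case 3
        have "(?g has_integral (f1 c - f1 x) + (f2 y - f2 c)) {x..y}"
          by (rule has_integral_combine[OF _ _ hi1 hi2]) (use 3 xy in auto)
        then show ?thesis using 3 \<open>f1 c = f2 c\<close> by simp
      qed
    qed
    have "sq_integrable {a..} ?g" using H1 H2 by (intro sq) (auto simp: H1_pair_def)
    then have "sq_integrable {x..y} ?g" by (rule sq_integrable_subset) (use xy in auto)
    then show "?g absolutely_integrable_on {x..y} \<and> integral {x..y} ?g = ?f y - ?f x"
      using hi sq_integrable_imp_absolutely_integrable integral_unique by blast
  qed
  then show ?thesis using H1 H2 sq by (simp add: H1_pair_def)
qed

text \<open>For a non-negative integrand, integrability on the ray and the value of the integral
  come together from the limit T of the primitive.\<close>

lemma lebesgue_on_FTC_atLeast: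
  fixes f F :: "real \<Rightarrow> real"
  assumes m: "f \<in> borel_measurable borel" and d: "\<And>x. a \<le> x \<Longrightarrow> (F has_real_derivative f x) (at x)"
    and nn: "\<And>x. a \<le> x \<Longrightarrow> 0 \<le> f x" and lim: "(F \<longlongrightarrow> T) at_top"
  shows "has_bochner_integral (lebesgue_on {a..}) f (T - F a)"
proof -
  have "F a \<le> F x" if "a \<le> x" for x
    by (rule DERIV_nonneg_imp_nondecreasing[OF that]) (use d nn in auto)
  then have T: "F a \<le> T"
    by (intro tendsto_lowerbound[OF lim]) (auto simp: eventually_at_top_linorder)
  have i: "(\<integral>\<^sup>+x. ennreal (f x) * indicator {a..} x \<partial>lborel) = ennreal (T - F a)"
    by (rule nn_integral_FTC_atLeast[where F = F, OF m d nn lim])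
  have e: "ennreal (f x) * indicator {a..} x = ennreal (indicator {a..} x * f x)" for x
    by (auto simp: indicator_def)
  have "has_bochner_integral lborel (\<lambda>x. indicator {a..} x * f x) (T - F a)"
  proof (rule has_bochner_integral_nn_integral)
    show "(\<integral>\<^sup>+x. ennreal (indicator {a..} x * f x) \<partial>lborel) = ennreal (T - F a)" using i unfolding e .
    show "AE x in lborel. 0 \<le> indicator {a..} x * f x" using nn by (auto simp: indicator_def)
    show "(\<lambda>x. indicator {a..} x * f x) \<in> borel_measurable lborel" using m by simp
  qed (use T in simp)
  moreover have "(\<lambda>x. indicator {a..} x * f x) \<in> borel_measurable lborel" using m by simp
  ultimately have "has_bochner_integral lebesgue (\<lambda>x. indicator {a..} x * f x) (T - F a)"
    by (simp add: has_bochner_integral_iff integrable_completion integral_completion)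
  then show ?thesis by (simp add: has_bochner_integral_restrict_space)
qed

text \<open>Continuing a function beyond R by this tail gives an admissible competitor at a cost
  proportional to the square of its value c at R.\<close>

lemma exp_tail:
  "H1_pair {R..} (\<lambda>x. c * exp (R - x)) (\<lambda>x. - (c * exp (R - x)))"
  "integral\<^sup>L (lebesgue_on {R..}) (\<lambda>x. (c * exp (R - x))\<^sup>2) = c\<^sup>2 / 2"
proof -
  have e2: "(\<lambda>x. (c * exp (R - x))\<^sup>2) = (\<lambda>x. c\<^sup>2 * exp (2 * (R - x)))"
    by (auto simp: fun_eq_iff power_mult_distrib exp_double[symmetric] mult.commute)
  have b0: "has_bochner_integral (lebesgue_on {R..}) (\<lambda>x. exp (2 * (R - x))) (0 - (- exp (2 * (R - R)) / 2))"
  proof (rule lebesgue_on_FTC_atLeast[where F = "\<lambda>x. - exp (2 * (R - x)) / 2"])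
    show "((\<lambda>x. - exp (2 * (R - x)) / 2) \<longlongrightarrow> 0) at_top" by real_asymp
    show "((\<lambda>x. - exp (2 * (R - x)) / 2) has_real_derivative exp (2 * (R - x))) (at x)" for x
      by (auto intro!: derivative_eq_intros)
  qed auto
  then have b': "has_bochner_integral (lebesgue_on {R..}) (\<lambda>x. exp (2 * (R - x))) (1/2)" by simp
  have i2: "integrable (lebesgue_on {R..}) (\<lambda>x. (c * exp (R - x))\<^sup>2)"
    unfolding e2 using b' by (simp add: has_bochner_integral_iff)
  show "integral\<^sup>L (lebesgue_on {R..}) (\<lambda>x. (c * exp (R - x))\<^sup>2) = c\<^sup>2 / 2"
    unfolding e2 using b' by (simp add: has_bochner_integral_iff)
  have m: "(\<lambda>x. c * exp (R - x)) \<in> borel_measurable (lebesgue_on {R..})" for c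
    by (intro continuous_imp_measurable_on_sets_lebesgue continuous_intros) auto
  have s: "sq_integrable {R..} (\<lambda>x. c * exp (R - x))" using m i2 by (simp add: sq_integrable_def)
  have "ac_on {R..} (\<lambda>x. c * exp (R - x)) (\<lambda>x. - (c * exp (R - x)))"
    unfolding ac_on_def
  proof (intro ballI impI conjI)
    fix x y :: real assume xy: "x \<le> y"
    show "(\<lambda>x. - (c * exp (R - x))) absolutely_integrable_on {x..y}"
      by (intro absolutely_integrable_continuous_real continuous_intros)
    show "integral {x..y} (\<lambda>x. - (c * exp (R - x))) = c * exp (R - y) - c * exp (R - x)"
      by (intro integral_unique fundamental_theorem_of_calculus xy)
        (auto intro!: derivative_eq_intros simp flip: has_real_derivative_iff_has_vector_derivative)
  qed
  then show "H1_pair {R..} (\<lambda>x. c * exp (R - x)) (\<lambda>x. - (c * exp (R - x)))"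
    using s m[of "-c"] i2 by (simp add: H1_pair_def sq_integrable_def)
qed

text \<open>
  A function on the tadpole is encoded by one function on \<open>[-L, \<infinity>)\<close> taking equal values at \<open>-L\<close> and
  \<open>L\<close>: the half-line is attached at \<open>L\<close>.
\<close>

definition admissible :: "real \<Rightarrow> (real \<Rightarrow> real) \<Rightarrow> (real \<Rightarrow> real) \<Rightarrow> bool" where
  "admissible L f g \<longleftrightarrow> H1_pair {-L..} f g \<and> f (-L) = f L"

definition quad :: "real \<Rightarrow> real \<Rightarrow> real \<Rightarrow> (real \<Rightarrow> real) \<Rightarrow> (real \<Rightarrow> real) \<Rightarrow> real" where
  "quad \<omega> \<gamma> L f g = integral\<^sup>L (lebesgue_on {-L..}) (\<lambda>x. (g x)\<^sup>2 + \<omega> * (f x)\<^sup>2) + \<gamma> * (f L)\<^sup>2"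

definition quart :: "real \<Rightarrow> (real \<Rightarrow> real) \<Rightarrow> real" where
  "quart L f = integral\<^sup>L (lebesgue_on {-L..}) (\<lambda>x. (f x)^4)"

text \<open>The quotient is unchanged by scaling, so a competitor may be normalised to
  \<open>quart = 1\<close> for compactness or to \<open>quad = quart\<close>, which is the Nehari
  constraint.\<close>

definition best_const :: "real \<Rightarrow> real \<Rightarrow> real \<Rightarrow> real" where
  "best_const \<omega> \<gamma> L = Inf {(quad \<omega> \<gamma> L f g)\<^sup>2 / quart L f | f g. admissible L f g \<and> quart L f > 0}"

lemma quad_nonneg: "0 \<le> \<omega> \<Longrightarrow> 0 \<le> \<gamma> \<Longrightarrow> 0 \<le> quad \<omega> \<gamma> L f g"
  by (simp add: quad_def)

lemma quart_nonneg: "0 \<le> quart L f"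
  by (simp add: quart_def)

lemma quad_scale: "quad \<omega> \<gamma> L (\<lambda>x. s * f x) (\<lambda>x. s * g x) = s\<^sup>2 * quad \<omega> \<gamma> L f g"
proof -
  have "(\<lambda>x. (s * g x)\<^sup>2 + \<omega> * (s * f x)\<^sup>2) = (\<lambda>x. s\<^sup>2 * ((g x)\<^sup>2 + \<omega> * (f x)\<^sup>2))"
    by (simp add: power_mult_distrib algebra_simps)
  then have "integral\<^sup>L (lebesgue_on {-L..}) (\<lambda>x. (s * g x)\<^sup>2 + \<omega> * (s * f x)\<^sup>2)
      = s\<^sup>2 * integral\<^sup>L (lebesgue_on {-L..}) (\<lambda>x. (g x)\<^sup>2 + \<omega> * (f x)\<^sup>2)"
    by (simp only: integral_mult_right_zero)
  moreover have "\<gamma> * (s * f L)\<^sup>2 = s\<^sup>2 * (\<gamma> * (f L)\<^sup>2)" by (simp add: power_mult_distrib)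
  ultimately show ?thesis unfolding quad_def by (simp only: distrib_left)
qed

lemma quart_scale: "quart L (\<lambda>x. s * f x) = s^4 * quart L f"
  unfolding quart_def by (simp add: power_mult_distrib)

lemma admissible_lincomb:
  "admissible L f g \<Longrightarrow> admissible L f' g' \<Longrightarrow> admissible L (\<lambda>x. s * f x + t * f' x) (\<lambda>x. s * g x + t * g' x)"
  unfolding admissible_def using H1_pair_lincomb by auto

lemma admissible_scale: "admissible L f g \<Longrightarrow> admissible L (\<lambda>x. s * f x) (\<lambda>x. s * g x)"
  unfolding admissible_def using H1_pair_scale by auto

lemma admissible_integrable:
  assumes "admissible L f g"
  shows "integrable (lebesgue_on {-L..}) (\<lambda>x. (g x)\<^sup>2)" "integrable (lebesgue_on {-L..}) (\<lambda>x. (f x)\<^sup>2)"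
    "integrable (lebesgue_on {-L..}) (\<lambda>x. (f x)^4)"
  using assms H1_pair_power4 unfolding admissible_def H1_pair_def sq_integrable_def by blast+

text \<open>This identity plays the part of uniform convexity: if a midpoint nearly attains the
  minimum, the half-difference is small.\<close>

lemma quad_parallelogram:
  assumes "admissible L f g" "admissible L f' g'"
  shows "quad \<omega> \<gamma> L (\<lambda>x. 1/2 * f x + 1/2 * f' x) (\<lambda>x. 1/2 * g x + 1/2 * g' x)
    + quad \<omega> \<gamma> L (\<lambda>x. 1/2 * f x + (-1/2) * f' x) (\<lambda>x. 1/2 * g x + (-1/2) * g' x)
    = 1/2 * quad \<omega> \<gamma> L f g + 1/2 * quad \<omega> \<gamma> L f' g'"
proof -
  let ?M = "lebesgue_on {-L..}"
  note i = admissible_integrable(1,2)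
  have 1: "integrable ?M (\<lambda>x. (1/2 * g x + 1/2 * g' x)\<^sup>2 + \<omega> * (1/2 * f x + 1/2 * f' x)\<^sup>2)"
    "integrable ?M (\<lambda>x. (1/2 * g x + (-1/2) * g' x)\<^sup>2 + \<omega> * (1/2 * f x + (-1/2) * f' x)\<^sup>2)"
    by (intro Bochner_Integration.integrable_add integrable_mult_right i[OF admissible_lincomb[OF assms]])+
  have "integral\<^sup>L ?M (\<lambda>x. (1/2 * g x + 1/2 * g' x)\<^sup>2 + \<omega> * (1/2 * f x + 1/2 * f' x)\<^sup>2)
    + integral\<^sup>L ?M (\<lambda>x. (1/2 * g x + (-1/2) * g' x)\<^sup>2 + \<omega> * (1/2 * f x + (-1/2) * f' x)\<^sup>2)
    = integral\<^sup>L ?M (\<lambda>x. 1/2 * ((g x)\<^sup>2 + \<omega> * (f x)\<^sup>2) + 1/2 * ((g' x)\<^sup>2 + \<omega> * (f' x)\<^sup>2))"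
    unfolding Bochner_Integration.integral_add[OF 1, symmetric]
    by (intro Bochner_Integration.integral_cong refl) (simp add: power2_eq_square field_simps)
  also have "\<dots> = 1/2 * integral\<^sup>L ?M (\<lambda>x. (g x)\<^sup>2 + \<omega> * (f x)\<^sup>2) + 1/2 * integral\<^sup>L ?M (\<lambda>x. (g' x)\<^sup>2 + \<omega> * (f' x)\<^sup>2)"
    using i[OF assms(1)] i[OF assms(2)] by simp
  finally have e: "integral\<^sup>L ?M (\<lambda>x. (1/2 * g x + 1/2 * g' x)\<^sup>2 + \<omega> * (1/2 * f x + 1/2 * f' x)\<^sup>2)
    + integral\<^sup>L ?M (\<lambda>x. (1/2 * g x + (-1/2) * g' x)\<^sup>2 + \<omega> * (1/2 * f x + (-1/2) * f' x)\<^sup>2)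
    = 1/2 * integral\<^sup>L ?M (\<lambda>x. (g x)\<^sup>2 + \<omega> * (f x)\<^sup>2) + 1/2 * integral\<^sup>L ?M (\<lambda>x. (g' x)\<^sup>2 + \<omega> * (f' x)\<^sup>2)" .
  have "\<gamma> * (1/2 * f L + 1/2 * f' L)\<^sup>2 + \<gamma> * (1/2 * f L + (-1/2) * f' L)\<^sup>2 = 1/2 * (\<gamma> * (f L)\<^sup>2) + 1/2 * (\<gamma> * (f' L)\<^sup>2)"
    by (simp add: power2_eq_square field_simps)
  with e show ?thesis unfolding quad_def by argo
qed

lemma best_const_le:
  assumes "admissible L f g"
  shows "best_const \<omega> \<gamma> L * quart L f \<le> (quad \<omega> \<gamma> L f g)\<^sup>2"
proof (cases "quart L f > 0")
  case True
  have "best_const \<omega> \<gamma> L \<le> (quad \<omega> \<gamma> L f g)\<^sup>2 / quart L f"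
    unfolding best_const_def
    by (rule cInf_lower) (use assms True in \<open>auto intro!: bdd_belowI[of _ 0]\<close>)
  then show ?thesis using True by (simp add: pos_le_divide_eq)
next
  case False
  then have "quart L f = 0" using quart_nonneg[of L f] by linarith
  then show ?thesis by simp
qed

lemma best_const_nonneg:
  assumes "admissible L f g" "quart L f > 0"
  shows "0 \<le> best_const \<omega> \<gamma> L"
  unfolding best_const_def by (rule cInf_greatest) (use assms in auto)

lemma best_const_approx:
  assumes "admissible L f0 g0" "quart L f0 > 0" "0 \<le> \<omega>" "0 \<le> \<gamma>" "e > 0"
  obtains f g where "admissible L f g" "quart L f = 1" "quad \<omega> \<gamma> L f g < sqrt (best_const \<omega> \<gamma> L) + e"
proof -
  let ?\<Lambda> = "best_const \<omega> \<gamma> L"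
  have \<Lambda>: "0 \<le> ?\<Lambda>" by (rule best_const_nonneg[OF assms(1,2)])
  have "?\<Lambda> < (sqrt ?\<Lambda> + e)\<^sup>2" using \<Lambda> assms(5) by (simp add: power2_sum add_pos_nonneg)
  moreover define S where "S = {(quad \<omega> \<gamma> L f g)\<^sup>2 / quart L f | f g. admissible L f g \<and> quart L f > 0}"
  ultimately have "Inf S < (sqrt ?\<Lambda> + e)\<^sup>2" by (simp only: best_const_def S_def)
  moreover have "S \<noteq> {}" using assms(1,2) unfolding S_def by blast
  ultimately obtain z where "z \<in> S" "z < (sqrt ?\<Lambda> + e)\<^sup>2" using cInf_lessD by blast
  then obtain f g where fg: "admissible L f g" "quart L f > 0" "(quad \<omega> \<gamma> L f g)\<^sup>2 / quart L f < (sqrt ?\<Lambda> + e)\<^sup>2"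
    unfolding S_def by blast
  \<comment> \<open>The factor is the inverse fourth root of the quartic mass and normalises that
    mass to 1.\<close>
  define c where "c = 1 / sqrt (sqrt (quart L f))"
  have c2: "c\<^sup>2 = 1 / sqrt (quart L f)" using fg(2) by (simp add: c_def power_divide)
  have "c^4 = (c\<^sup>2)\<^sup>2" by simp
  also have "\<dots> = 1 / quart L f" unfolding c2 using fg(2) by (simp add: power_divide)
  finally have c4: "c^4 = 1 / quart L f" .
  have "(c\<^sup>2 * quad \<omega> \<gamma> L f g)\<^sup>2 < (sqrt ?\<Lambda> + e)\<^sup>2"
    using fg(3) by (simp add: power_mult_distrib c2 power_divide fg(2) less_imp_le)
  then have "c\<^sup>2 * quad \<omega> \<gamma> L f g < sqrt ?\<Lambda> + e"
    by (rule power_less_imp_less_base) (use \<Lambda> assms(5) in simp)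
  then have 1: "quad \<omega> \<gamma> L (\<lambda>x. c * f x) (\<lambda>x. c * g x) < sqrt ?\<Lambda> + e" unfolding quad_scale .
  have 2: "quart L (\<lambda>x. c * f x) = 1" unfolding quart_scale c4 using fg(2) by simp
  show ?thesis by (rule that[OF admissible_scale[OF fg(1)] 2 1])
qed


text \<open>The inequality for \<Lambda> is applied to f cut off at R and continued by an
  exponential tail; the tail costs the term with \<open>(f R)\<^sup>2\<close> and can only add
  quartic mass.\<close>

lemma half_line_core:
  assumes adm: "admissible L f g" and R: "L \<le> R" "0 < L" and "0 \<le> \<omega>" "0 \<le> \<gamma>" "0 \<le> \<Lambda>"
    and \<Lambda>: "\<And>f g. admissible L f g \<Longrightarrow> \<Lambda> * quart L f \<le> (quad \<omega> \<gamma> L f g)\<^sup>2"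
  shows "sqrt (\<Lambda> * integral\<^sup>L (lebesgue_on {-L..R}) (\<lambda>x. (f x)^4))
    \<le> integral\<^sup>L (lebesgue_on {-L..R}) (\<lambda>x. (g x)\<^sup>2 + \<omega> * (f x)\<^sup>2) + \<gamma> * (f L)\<^sup>2 + (1 + \<omega>) / 2 * (f R)\<^sup>2"
proof -
  define w where "w = (\<lambda>x. if x \<le> R then f x else f R * exp (R - x))"
  define v where "v = (\<lambda>x. if x \<le> R then g x else - (f R * exp (R - x)))"
  have LR: "- L \<le> R" using R by simp
  have H: "H1_pair {-L..} f g" and b: "f (-L) = f L" using adm by (auto simp: admissible_def)
  have H1: "H1_pair {-L..R} f g" by (rule H1_pair_subset[OF H]) auto
  have "H1_pair {-L..} w v"
    unfolding w_def v_def by (rule H1_pair_glue[OF H1 exp_tail(1) LR]) simp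
  moreover have "w (-L) = w L" using b R LR by (simp add: w_def)
  ultimately have aw: "admissible L w v" by (simp add: admissible_def)
  note i = admissible_integrable[OF adm]
  note iw = admissible_integrable[OF aw]
  have i1: "integrable (lebesgue_on {-L..R}) (\<lambda>x. (g x)\<^sup>2 + \<omega> * (f x)\<^sup>2)"
    using i by (intro integrable_lebesgue_on_interval_split(1)[OF _ LR]) auto
  have e2i: "integrable (lebesgue_on {R..}) (\<lambda>x. (f R * exp (R - x))\<^sup>2)"
    using exp_tail(1)[of R "f R"] by (simp add: H1_pair_def sq_integrable_def)
  have "quad \<omega> \<gamma> L w v = integral\<^sup>L (lebesgue_on {-L..}) (\<lambda>x. if x \<le> R then (g x)\<^sup>2 + \<omega> * (f x)\<^sup>2 else (1 + \<omega>) * (f R * exp (R - x))\<^sup>2) + \<gamma> * (f L)\<^sup>2"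
    unfolding quad_def using R
    by (intro arg_cong2[where f = "(+)"] Bochner_Integration.integral_cong refl) (auto simp: w_def v_def algebra_simps)
  also have "\<dots> = integral\<^sup>L (lebesgue_on {-L..R}) (\<lambda>x. (g x)\<^sup>2 + \<omega> * (f x)\<^sup>2) + integral\<^sup>L (lebesgue_on {R..}) (\<lambda>x. (1 + \<omega>) * (f R * exp (R - x))\<^sup>2) + \<gamma> * (f L)\<^sup>2"
    using e2i by (subst lebesgue_on_integral_glue(2)[OF i1 _ LR]) auto
  also have "integral\<^sup>L (lebesgue_on {R..}) (\<lambda>x. (1 + \<omega>) * (f R * exp (R - x))\<^sup>2) = (1 + \<omega>) / 2 * (f R)\<^sup>2"
    by (simp only: integral_mult_right_zero exp_tail(2))
  finally have q: "quad \<omega> \<gamma> L w v = integral\<^sup>L (lebesgue_on {-L..R}) (\<lambda>x. (g x)\<^sup>2 + \<omega> * (f x)\<^sup>2) + \<gamma> * (f L)\<^sup>2 + (1 + \<omega>) / 2 * (f R)\<^sup>2"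
    by simp
  have "integral\<^sup>L (lebesgue_on {-L..R}) (\<lambda>x. (f x)^4) = integral\<^sup>L (lebesgue_on {-L..R}) (\<lambda>x. (w x)^4)"
    by (intro Bochner_Integration.integral_cong) (auto simp: w_def)
  also have "\<dots> \<le> quart L w"
    unfolding quart_def by (rule lebesgue_on_integral_mono_set[OF iw(3)]) auto
  finally have "\<Lambda> * integral\<^sup>L (lebesgue_on {-L..R}) (\<lambda>x. (f x)^4) \<le> \<Lambda> * quart L w"
    using \<open>0 \<le> \<Lambda>\<close> by (rule mult_left_mono)
  also have "\<dots> \<le> (quad \<omega> \<gamma> L w v)\<^sup>2" by (rule \<Lambda>[OF aw])
  finally have "sqrt (\<Lambda> * integral\<^sup>L (lebesgue_on {-L..R}) (\<lambda>x. (f x)^4)) \<le> sqrt ((quad \<omega> \<gamma> L w v)\<^sup>2)"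
    by (rule real_sqrt_le_mono)
  also have "\<dots> = quad \<omega> \<gamma> L w v" using quad_nonneg[OF assms(4,5)] by simp
  finally show ?thesis unfolding q .
qed

text \<open>Splitting at \<open>R\<close>: since \<open>\<Lambda>\<close> is smaller than the constant of the line, mass beyond \<open>R\<close> is expensive.\<close>

lemma tail_mass_bound:
  assumes adm: "admissible L f g" and R: "L \<le> R" "0 < L" and \<omega>: "\<omega> = \<mu>\<^sup>2" "\<mu> > 0" and "0 \<le> \<gamma>" "0 \<le> \<Lambda>"
    and \<Lambda>: "\<And>f g. admissible L f g \<Longrightarrow> \<Lambda> * quart L f \<le> (quad \<omega> \<gamma> L f g)\<^sup>2"
    and q: "quart L f = 1"
  shows "(sqrt (16/3 * \<mu>^3) - sqrt \<Lambda>) * sqrt (integral\<^sup>L (lebesgue_on {R..}) (\<lambda>x. (f x)^4))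
    \<le> quad \<omega> \<gamma> L f g - sqrt \<Lambda> + ((1 + \<omega>) / 2 + \<mu>) * (f R)\<^sup>2"
proof -
  have LR: "- L \<le> R" using R by simp
  have H: "H1_pair {-L..} f g" using adm by (auto simp: admissible_def)
  have H2: "H1_pair {R..} f g" by (rule H1_pair_subset[OF H]) (use LR in auto)
  note i = admissible_integrable[OF adm]
  define a where "a = integral\<^sup>L (lebesgue_on {-L..R}) (\<lambda>x. (f x)^4)"
  define b where "b = integral\<^sup>L (lebesgue_on {R..}) (\<lambda>x. (f x)^4)"
  define qa where "qa = integral\<^sup>L (lebesgue_on {-L..R}) (\<lambda>x. (g x)\<^sup>2 + \<omega> * (f x)\<^sup>2)"
  define qb where "qb = integral\<^sup>L (lebesgue_on {R..}) (\<lambda>x. (g x)\<^sup>2 + \<omega> * (f x)\<^sup>2)"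
  have ab: "a + b = 1" using integrable_lebesgue_on_interval_split(3)[OF i(3) LR] q
    unfolding a_def b_def quart_def by simp
  have ab0: "a \<ge> 0" "b \<ge> 0" by (auto simp: a_def b_def)
  have "integrable (lebesgue_on {-L..}) (\<lambda>x. (g x)\<^sup>2 + \<omega> * (f x)\<^sup>2)" using i by simp
  from integrable_lebesgue_on_interval_split(3)[OF this LR]
  have qq: "quad \<omega> \<gamma> L f g = qa + qb + \<gamma> * (f L)\<^sup>2" unfolding quad_def qa_def qb_def by simp
  have 1: "sqrt (\<Lambda> * a) \<le> qa + \<gamma> * (f L)\<^sup>2 + (1 + \<omega>) / 2 * (f R)\<^sup>2"
    unfolding a_def qa_def using \<omega> assms(6,7) by (intro half_line_core[OF adm R _ _ _ \<Lambda>]) auto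
  have "16/3 * \<mu>^3 * b \<le> (qb + \<mu> * (f R)\<^sup>2)\<^sup>2"
    unfolding b_def qb_def \<omega>(1) by (rule half_line_inequality[OF H2 \<omega>(2)])
  then have "sqrt (16/3 * \<mu>^3 * b) \<le> sqrt ((qb + \<mu> * (f R)\<^sup>2)\<^sup>2)" by (rule real_sqrt_le_mono)
  also have "\<dots> = qb + \<mu> * (f R)\<^sup>2" using \<omega> by (simp add: qb_def)
  finally have 2: "sqrt (16/3 * \<mu>^3) * sqrt b \<le> qb + \<mu> * (f R)\<^sup>2"
    unfolding real_sqrt_mult[of "16/3 * \<mu>^3" b] .
  \<comment> \<open>On [0, 1] a square root dominates its argument, so sqrt a + sqrt b is at least a
    + b = 1: distributing the mass over two pieces never lowers the sum of their costs.\<close>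
  have "a \<le> 1" "b \<le> 1" using ab ab0 by auto
  then have "a \<le> sqrt a" "b \<le> sqrt b"
    using ab0 by (auto intro!: real_le_rsqrt simp: power2_eq_square mult_left_le)
  then have "1 \<le> sqrt a + sqrt b" using ab by linarith
  then have "sqrt \<Lambda> * 1 \<le> sqrt \<Lambda> * (sqrt a + sqrt b)" using assms(7) by (intro mult_left_mono) auto
  then have 3: "sqrt \<Lambda> \<le> sqrt (\<Lambda> * a) + sqrt \<Lambda> * sqrt b" by (simp add: real_sqrt_mult distrib_left)
  have "(sqrt (16/3 * \<mu>^3) - sqrt \<Lambda>) * sqrt b = sqrt (16/3 * \<mu>^3) * sqrt b - sqrt \<Lambda> * sqrt b" by (rule left_diff_distrib)
  moreover have "((1 + \<omega>) / 2 + \<mu>) * (f R)\<^sup>2 = (1 + \<omega>) / 2 * (f R)\<^sup>2 + \<mu> * (f R)\<^sup>2" by (rule distrib_right)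
  ultimately show ?thesis using 1 2 3 qq unfolding b_def[symmetric] by linarith
qed


text \<open>The pointwise part of the Arzela-Ascoli theorem: a diagonal subsequence converges at the
  rational points, and the common Hoelder bound extends this to all points.\<close>

lemma pointwise_convergent_subsequence:
  fixes f :: "nat \<Rightarrow> real \<Rightarrow> real"
  assumes bd: "\<And>n x. a \<le> x \<Longrightarrow> \<bar>f n x\<bar> \<le> C"
    and hoe: "\<And>n x y. a \<le> x \<Longrightarrow> x \<le> y \<Longrightarrow> (f n y - f n x)\<^sup>2 \<le> (y - x) * K" and K: "0 \<le> K"
  obtains k F where "strict_mono (k :: nat \<Rightarrow> nat)" "\<And>x. a \<le> x \<Longrightarrow> (\<lambda>n. f (k n) x) \<longlonglongrightarrow> F x"
proof -
  have "countable {x \<in> \<rat>. a \<le> x}" using countable_rat by (rule countable_subset[rotated]) auto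
  then obtain k where k: "strict_mono (k :: nat \<Rightarrow> nat)" and kc: "\<And>x. x \<in> {x \<in> \<rat>. a \<le> x} \<Longrightarrow> \<exists>l. (\<lambda>n. f (k n) x) \<longlonglongrightarrow> l"
    by (rule function_convergent_subsequence[where f = f and M = C]) (use bd in auto)
  have "convergent (\<lambda>n. f (k n) x)" if x: "a \<le> x" for x
  proof (rule Cauchy_convergent, rule metric_CauchyI)
    fix e :: real assume e: "e > 0"
    \<comment> \<open>Points closer than d have values within e/4, and K + 1 avoids division by
      zero; with e/4 for the rational point the total stays below e.\<close>
    define d where "d = (e/4)\<^sup>2 / (K + 1)"
    have "d > 0" using e K by (simp add: d_def)
    then obtain s where s: "s \<in> \<rat>" "x < s" "s < x + d" using Rats_dense_in_real[of x "x + d"] by auto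
    have "convergent (\<lambda>n. f (k n) s)" using kc[of s] s x by (auto simp: convergent_def)
    then have "Cauchy (\<lambda>n. f (k n) s)" by (rule convergent_Cauchy)
    then obtain N where N: "\<And>m n. m \<ge> N \<Longrightarrow> n \<ge> N \<Longrightarrow> dist (f (k m) s) (f (k n) s) < e/4"
      using e unfolding Cauchy_def by (metis zero_less_divide_iff zero_less_numeral)
    have near: "\<bar>f n s - f n x\<bar> \<le> e/4" for n
    proof -
      have "(f n s - f n x)\<^sup>2 \<le> (s - x) * K" using hoe[OF x] s(2) by simp
      also have "\<dots> \<le> d * (K + 1)" using s K by (intro mult_mono) auto
      also have "\<dots> = (e/4)\<^sup>2" using K by (simp add: d_def)
      finally show ?thesis using e by (simp add: abs_le_square_iff[symmetric])
    qed
    have "dist (f (k m) x) (f (k n) x) < e" if "m \<ge> N" "n \<ge> N" for m n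
      using N[OF that] near[of "k m"] near[of "k n"] e unfolding dist_real_def by linarith
    then show "\<exists>M. \<forall>m\<ge>M. \<forall>n\<ge>M. dist (f (k m) x) (f (k n) x) < e" by blast
  qed
  then have "(\<lambda>n. f (k n) x) \<longlonglongrightarrow> lim (\<lambda>n. f (k n) x)" if "a \<le> x" for x
    using that by (simp add: convergent_LIMSEQ_iff)
  then show ?thesis by (rule that[OF k])
qed

lemma lebesgue_on_bounded_convergence:
  fixes h :: "nat \<Rightarrow> real \<Rightarrow> real"
  assumes m: "\<And>n. h n \<in> borel_measurable (lebesgue_on {a..b})"
    and lim: "\<And>x. x \<in> {a..b} \<Longrightarrow> (\<lambda>n. h n x) \<longlonglongrightarrow> H x" and bd: "\<And>n x. x \<in> {a..b} \<Longrightarrow> \<bar>h n x\<bar> \<le> C"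
  shows "(\<lambda>n. integral\<^sup>L (lebesgue_on {a..b}) (h n)) \<longlonglongrightarrow> integral\<^sup>L (lebesgue_on {a..b}) H"
proof (rule integral_dominated_convergence[where w = "\<lambda>_. C"])
  show "H \<in> borel_measurable (lebesgue_on {a..b})"
    by (rule borel_measurable_LIMSEQ_metric[of h, OF m]) (use lim in auto)
  show "AE x in lebesgue_on {a..b}. (\<lambda>n. h n x) \<longlonglongrightarrow> H x" using lim by (intro AE_I2) auto
  show "AE x in lebesgue_on {a..b}. norm (h n x) \<le> C" for n using bd by (intro AE_I2) auto
qed (use m in auto)

lemma power4_lipschitz:
  fixes a b C :: real
  assumes "\<bar>a\<bar> \<le> C" "\<bar>b\<bar> \<le> C"
  shows "\<bar>a^4 - b^4\<bar> \<le> 4 * C^3 * \<bar>a - b\<bar>"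
proof -
  have C: "0 \<le> C" using assms by linarith
  have "a^4 - b^4 = (a - b) * ((a + b) * (a\<^sup>2 + b\<^sup>2))" by (simp add: power4_eq_xxxx power2_eq_square algebra_simps)
  then have "\<bar>a^4 - b^4\<bar> = \<bar>a - b\<bar> * (\<bar>a + b\<bar> * (a\<^sup>2 + b\<^sup>2))" by (simp add: abs_mult)
  also have "\<dots> \<le> \<bar>a - b\<bar> * ((2 * C) * (2 * C\<^sup>2))"
  proof -
    have "a\<^sup>2 \<le> C\<^sup>2" "b\<^sup>2 \<le> C\<^sup>2" using assms abs_le_square_iff[of a C] abs_le_square_iff[of b C] C by auto
    then show ?thesis using assms C by (intro mult_left_mono mult_mono) auto
  qed
  also have "\<dots> = 4 * C^3 * \<bar>a - b\<bar>" by (simp add: power2_eq_square power3_eq_cube)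
  finally show ?thesis .
qed

section \<open>Compactness of minimising sequences\<close>

text \<open>A normalised minimising sequence F, with derivatives G, that already converges pointwise
  to f. The strict gap \<open>\<Lambda>R\<close> is what prevents mass from escaping.\<close>

locale minimizing_sequence =
  fixes \<omega> \<gamma> L \<mu> \<Lambda> C :: real and F G :: "nat \<Rightarrow> real \<Rightarrow> real" and f :: "real \<Rightarrow> real"
  assumes \<omega>: "\<omega> = \<mu>\<^sup>2" and \<mu>: "\<mu> > 0" and \<gamma>: "0 \<le> \<gamma>" and L: "0 < L" and \<Lambda>0: "0 \<le> \<Lambda>"
    and \<Lambda>: "\<And>f g. admissible L f g \<Longrightarrow> \<Lambda> * quart L f \<le> (quad \<omega> \<gamma> L f g)\<^sup>2"
    and \<Lambda>R: "\<Lambda> < 16/3 * \<mu>^3"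
    and adm: "\<And>n. admissible L (F n) (G n)" and q1: "\<And>n. quart L (F n) = 1"
    and qlim: "\<And>n. quad \<omega> \<gamma> L (F n) (G n) \<le> sqrt \<Lambda> + 1 / (real n + 1)"
    and bd: "\<And>n x. - L \<le> x \<Longrightarrow> \<bar>F n x\<bar> \<le> C"
    and lim: "\<And>x. - L \<le> x \<Longrightarrow> (\<lambda>n. F n x) \<longlonglongrightarrow> f x"
begin

lemma \<omega>0: "0 < \<omega>" using \<omega> \<mu> by simp

lemma quad_ge: "admissible L u v \<Longrightarrow> sqrt \<Lambda> * sqrt (quart L u) \<le> quad \<omega> \<gamma> L u v"
proof -
  assume "admissible L u v"
  then have "sqrt (\<Lambda> * quart L u) \<le> sqrt ((quad \<omega> \<gamma> L u v)\<^sup>2)" by (intro real_sqrt_le_mono \<Lambda>)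
  then show ?thesis using quad_nonneg[of \<omega> \<gamma> L u v] \<omega>0 \<gamma> by (simp add: real_sqrt_mult)
qed

lemma meas: "F n \<in> borel_measurable (lebesgue_on {-L..})" "G n \<in> borel_measurable (lebesgue_on {-L..})"
  using adm[of n] by (auto simp: admissible_def H1_pair_def sq_integrable_def)

lemma meas_ab: "-L \<le> a \<Longrightarrow> F n \<in> borel_measurable (lebesgue_on {a..b})"
  using meas(1) by (rule measurable_restrict_mono) auto

lemma fmeas: "f \<in> borel_measurable (lebesgue_on {-L..})"
  by (rule borel_measurable_LIMSEQ_metric[of F, OF meas(1)]) (use lim in auto)

lemma quad_bound: "quad \<omega> \<gamma> L (F n) (G n) \<le> sqrt \<Lambda> + 1"
proof -
  have "1 / (real n + 1) \<le> 1" by simp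
  then show ?thesis using qlim[of n] by linarith
qed

lemma sq_bounds:
  "integral\<^sup>L (lebesgue_on {-L..}) (\<lambda>x. (G n x)\<^sup>2) \<le> sqrt \<Lambda> + 1"
  "\<omega> * integral\<^sup>L (lebesgue_on {-L..}) (\<lambda>x. (F n x)\<^sup>2) \<le> sqrt \<Lambda> + 1"
proof -
  note i = admissible_integrable[OF adm[of n]]
  have "quad \<omega> \<gamma> L (F n) (G n) = integral\<^sup>L (lebesgue_on {-L..}) (\<lambda>x. (G n x)\<^sup>2) + \<omega> * integral\<^sup>L (lebesgue_on {-L..}) (\<lambda>x. (F n x)\<^sup>2) + \<gamma> * (F n L)\<^sup>2"
    unfolding quad_def using i by simp
  moreover have "0 \<le> \<gamma> * (F n L)\<^sup>2" "0 \<le> integral\<^sup>L (lebesgue_on {-L..}) (\<lambda>x. (G n x)\<^sup>2)"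
    "0 \<le> \<omega> * integral\<^sup>L (lebesgue_on {-L..}) (\<lambda>x. (F n x)\<^sup>2)" using \<gamma> \<omega>0 by auto
  ultimately show "integral\<^sup>L (lebesgue_on {-L..}) (\<lambda>x. (G n x)\<^sup>2) \<le> sqrt \<Lambda> + 1"
    "\<omega> * integral\<^sup>L (lebesgue_on {-L..}) (\<lambda>x. (F n x)\<^sup>2) \<le> sqrt \<Lambda> + 1"
    using quad_bound[of n] by linarith+
qed

lemma f_sq_integrable: "sq_integrable {-L..} f"
proof -
  have "integrable (lebesgue_on {-L..}) (\<lambda>x. (f x)\<^sup>2)"
  proof (rule Fatou_bound[where h = "\<lambda>n x. (F n x)\<^sup>2" and C = "(sqrt \<Lambda> + 1) / \<omega>"])
    show "(\<lambda>x. (f x)\<^sup>2) \<in> borel_measurable (lebesgue_on {-L..})" using fmeas by simp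
    show "AE x in lebesgue_on {-L..}. (\<lambda>n. (F n x)\<^sup>2) \<longlonglongrightarrow> (f x)\<^sup>2"
      by (intro AE_I2 tendsto_power lim) auto
    show "integral\<^sup>L (lebesgue_on {-L..}) (\<lambda>x. (F n x)\<^sup>2) \<le> (sqrt \<Lambda> + 1) / \<omega>" for n
      using sq_bounds(2)[of n] \<omega>0 by (simp add: pos_le_divide_eq mult.commute)
    show "integrable (lebesgue_on {-L..}) (\<lambda>x. (F n x)\<^sup>2)" for n by (rule admissible_integrable(2)[OF adm])
  qed auto
  then show ?thesis using fmeas by (simp add: sq_integrable_def)
qed

lemma inverse_small: "e > 0 \<Longrightarrow> \<exists>N::nat. \<forall>n\<ge>N. 1 / (real n + 1) < e"
proof -
  assume e: "e > 0"
  obtain N :: nat where N: "1 / e < real N" using reals_Archimedean2 by blast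
  have "1 / (real n + 1) < e" if "n \<ge> N" for n
  proof -
    have "1 / e < real n + 1" using N that by linarith
    then show ?thesis using e by (simp add: field_simps)
  qed
  then show ?thesis by blast
qed

text \<open>The pointwise limit f is square integrable, so it is small at some R, and the F n are
  eventually small there too. By the gap, the mass beyond R is then controlled by this value and by
  the excess over the minimum.\<close>

lemma tail_small:
  assumes e: "e > 0"
  obtains R N where "L \<le> R" "\<And>n. n \<ge> (N::nat) \<Longrightarrow> integral\<^sup>L (lebesgue_on {R..}) (\<lambda>x. (F n x)^4) \<le> e"
proof -
  define c where "c = sqrt (16/3 * \<mu>^3) - sqrt \<Lambda>"
  define D where "D = (1 + \<omega>) / 2 + \<mu>"
  have c: "c > 0" using \<Lambda>R by (simp add: c_def)
  have D: "D > 0" using \<omega>0 \<mu> unfolding D_def by (intro add_pos_pos divide_pos_pos) auto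
  \<comment> \<open>Half of the budget is for the excess over the minimum, half for the term at
    R.\<close>
  define \<eta> where "\<eta> = c * sqrt e / 2"
  have \<eta>: "\<eta> > 0" using c e by (simp add: \<eta>_def)
  have "sqrt (\<eta> / D) > 0" using \<eta> D by simp
  then obtain R where R: "L \<le> R" "- L \<le> R" "\<bar>f R\<bar> < sqrt (\<eta> / D)"
    by (rule sq_integrable_small_value[OF f_sq_integrable])
  have "(\<lambda>n. \<bar>F n R\<bar>) \<longlonglongrightarrow> \<bar>f R\<bar>" by (intro tendsto_rabs lim R)
  then have "\<forall>\<^sub>F n in sequentially. \<bar>F n R\<bar> < sqrt (\<eta> / D)" using R(3) by (rule order_tendstoD)
  then obtain N1 where N1: "\<And>n. n \<ge> N1 \<Longrightarrow> \<bar>F n R\<bar> < sqrt (\<eta> / D)" unfolding eventually_sequentially by blast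
  obtain N2 where N2: "\<And>n::nat. n \<ge> N2 \<Longrightarrow> 1 / (real n + 1) < \<eta>" using inverse_small[OF \<eta>] by blast
  have "integral\<^sup>L (lebesgue_on {R..}) (\<lambda>x. (F n x)^4) \<le> e" if n: "n \<ge> max N1 N2" for n
  proof -
    define b where "b = integral\<^sup>L (lebesgue_on {R..}) (\<lambda>x. (F n x)^4)"
    have "c * sqrt b \<le> quad \<omega> \<gamma> L (F n) (G n) - sqrt \<Lambda> + D * (F n R)\<^sup>2"
      unfolding c_def b_def D_def by (rule tail_mass_bound[OF adm R(1) L \<omega> \<mu> \<gamma> \<Lambda>0 \<Lambda> q1])
    moreover have "quad \<omega> \<gamma> L (F n) (G n) - sqrt \<Lambda> \<le> \<eta>" using qlim[of n] N2[of n] n by force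
    moreover have "D * (F n R)\<^sup>2 \<le> \<eta>"
    proof -
      have "\<bar>F n R\<bar>\<^sup>2 \<le> (sqrt (\<eta> / D))\<^sup>2" using N1[of n] n by (intro power_mono) auto
      then have "(F n R)\<^sup>2 \<le> \<eta> / D" using \<eta> D by simp
      then show ?thesis using D by (simp add: pos_le_divide_eq mult.commute)
    qed
    ultimately have "c * sqrt b \<le> c * sqrt e" by (simp add: \<eta>_def)
    then have "sqrt b \<le> sqrt e" using c by simp
    then show ?thesis by (simp add: b_def)
  qed
  then show ?thesis by (rule that[OF R(1)])
qed

lemma quart_split: "L \<le> R \<Longrightarrow> integral\<^sup>L (lebesgue_on {-L..R}) (\<lambda>x. (F n x)^4) = 1 - integral\<^sup>L (lebesgue_on {R..}) (\<lambda>x. (F n x)^4)"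
  using integrable_lebesgue_on_interval_split(3)[OF admissible_integrable(3)[OF adm[of n]], of R] q1[of n] L
  unfolding quart_def by simp

text \<open>On a bounded interval late members are close to f and hence to each other in
  \<open>L\<^sup>1\<close>, and the fourth power is Lipschitz on bounded values; beyond R there is
  hardly any mass to lose.\<close>

lemma midpoint_quart:
  assumes e: "e > 0"
  obtains N where "\<And>n m. n \<ge> (N::nat) \<Longrightarrow> m \<ge> N \<Longrightarrow> 1 - e \<le> quart L (\<lambda>x. 1/2 * F n x + 1/2 * F m x)"
proof -
  have C0: "0 \<le> C" using bd[of L 0] L by force
  have e2: "e/2 > 0" using e by simp
  obtain R N1 where R: "L \<le> R" "\<And>n. n \<ge> (N1::nat) \<Longrightarrow> integral\<^sup>L (lebesgue_on {R..}) (\<lambda>x. (F n x)^4) \<le> e/2"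
    using tail_small[OF e2] by blast
  define d where "d = (\<lambda>n. integral\<^sup>L (lebesgue_on {-L..R}) (\<lambda>x. \<bar>F n x - f x\<bar>))"
  have fm: "f \<in> borel_measurable (lebesgue_on {-L..R})" using fmeas by (rule measurable_restrict_mono) auto
  have fb: "\<bar>f x\<bar> \<le> C" if "- L \<le> x" for x
    by (rule LIMSEQ_le_const2[OF tendsto_rabs[OF lim[OF that]]]) (use bd that in auto)
  have "d \<longlonglongrightarrow> integral\<^sup>L (lebesgue_on {-L..R}) (\<lambda>x. 0)"
    unfolding d_def
  proof (rule lebesgue_on_bounded_convergence[where C = "2 * C"])
    show "(\<lambda>x. \<bar>F n x - f x\<bar>) \<in> borel_measurable (lebesgue_on {-L..R})" for n
      using meas_ab[of "-L" n R] fm by simp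
    show "(\<lambda>n. \<bar>F n x - f x\<bar>) \<longlonglongrightarrow> 0" if "x \<in> {-L..R}" for x
    proof (rule tendsto_rabs_zero)
      show "(\<lambda>n. F n x - f x) \<longlonglongrightarrow> 0" using lim[of x] that by (simp add: LIM_zero)
    qed
    show "\<bar>\<bar>F n x - f x\<bar>\<bar> \<le> 2 * C" if "x \<in> {-L..R}" for n x
      using bd[of x n] fb[of x] that by auto
  qed
  then have d0: "d \<longlonglongrightarrow> 0" by simp
  define B where "B = 4 * C^3 + 1"
  have B: "B > 0" using C0 by (simp add: B_def add_nonneg_pos)
  have "e / (2 * B) > 0" using e B by simp
  from order_tendstoD(2)[OF d0 this]
  obtain N2 where N2: "\<And>n. n \<ge> N2 \<Longrightarrow> d n < e / (2 * B)" unfolding eventually_sequentially by blast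
  have "1 - e \<le> quart L (\<lambda>x. 1/2 * F n x + 1/2 * F m x)" if nm: "n \<ge> max N1 N2" "m \<ge> max N1 N2" for n m
  proof -
    let ?w = "\<lambda>x. 1/2 * F n x + 1/2 * F m x"
    let ?M = "lebesgue_on {-L..R}"
    have LR: "- L \<le> R" using R(1) L by simp
    note iw = admissible_integrable(3)[OF admissible_lincomb[OF adm[of n] adm[of m], of "1/2" "1/2"]]
    have iwR: "integrable ?M (\<lambda>x. (?w x)^4)" by (rule integrable_lebesgue_on_interval_split(1)[OF iw LR])
    have inR: "integrable ?M (\<lambda>x. (F n x)^4)" by (rule integrable_lebesgue_on_interval_split(1)[OF admissible_integrable(3)[OF adm] LR])
    have di: "integrable ?M (\<lambda>x. \<bar>F k x - f x\<bar>)" for k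
    proof (rule Bochner_Integration.integrable_bound[where f = "\<lambda>_. 2 * C"])
      show "(\<lambda>x. \<bar>F k x - f x\<bar>) \<in> borel_measurable ?M" using meas_ab[of "-L" k R] fm by simp
      show "AE x in ?M. norm \<bar>F k x - f x\<bar> \<le> norm (2 * C)"
      proof (intro AE_I2)
        fix x assume "x \<in> space ?M"
        then have "\<bar>F k x\<bar> \<le> C" "\<bar>f x\<bar> \<le> C" using bd[of x k] fb[of x] by auto
        then show "norm \<bar>F k x - f x\<bar> \<le> norm (2 * C)" by simp
      qed
    qed simp
    have le: "(F n x)^4 - B/2 * (\<bar>F n x - f x\<bar> + \<bar>F m x - f x\<bar>) \<le> (?w x)^4" if x: "x \<in> {-L..R}" for x
    proof -
      have b: "\<bar>F n x\<bar> \<le> C" "\<bar>F m x\<bar> \<le> C" using bd x by auto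
      then have "\<bar>?w x\<bar> \<le> C" by auto
      from power4_lipschitz[OF b(1) this]
      have "\<bar>(F n x)^4 - (?w x)^4\<bar> \<le> 4 * C^3 * \<bar>F n x - ?w x\<bar>" .
      also have "\<dots> \<le> B * \<bar>F n x - ?w x\<bar>" by (intro mult_right_mono) (auto simp: B_def)
      also have "\<dots> \<le> B * (1/2 * (\<bar>F n x - f x\<bar> + \<bar>F m x - f x\<bar>))"
      proof (rule mult_left_mono)
        have "F n x - ?w x = 1/2 * ((F n x - f x) - (F m x - f x))" by (simp add: field_simps)
        then have "\<bar>F n x - ?w x\<bar> = 1/2 * \<bar>(F n x - f x) - (F m x - f x)\<bar>" by (simp only: abs_mult)
        also have "\<dots> \<le> 1/2 * (\<bar>F n x - f x\<bar> + \<bar>F m x - f x\<bar>)"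
          using abs_triangle_ineq4[of "F n x - f x" "F m x - f x"] by (intro mult_left_mono) auto
        finally show "\<bar>F n x - ?w x\<bar> \<le> 1/2 * (\<bar>F n x - f x\<bar> + \<bar>F m x - f x\<bar>)" .
      qed (use B in simp)
      also have "\<dots> = B/2 * (\<bar>F n x - f x\<bar> + \<bar>F m x - f x\<bar>)" by simp
      finally show ?thesis by linarith
    qed
    have "1 - e/2 \<le> integral\<^sup>L ?M (\<lambda>x. (F n x)^4)" using R(2)[of n] nm quart_split[OF R(1), of n] by simp
    moreover have "B/2 * (d n + d m) \<le> e/2"
    proof -
      have "d n + d m \<le> e / B" using N2[of n] N2[of m] nm by (simp add: field_simps)
      then have "B/2 * (d n + d m) \<le> B/2 * (e / B)" using B by (intro mult_left_mono) auto
      then show ?thesis using B by simp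
    qed
    moreover have "integral\<^sup>L ?M (\<lambda>x. (F n x)^4 - B/2 * (\<bar>F n x - f x\<bar> + \<bar>F m x - f x\<bar>)) = integral\<^sup>L ?M (\<lambda>x. (F n x)^4) - B/2 * (d n + d m)"
      unfolding d_def using inR di by simp
    moreover have "integral\<^sup>L ?M (\<lambda>x. (F n x)^4 - B/2 * (\<bar>F n x - f x\<bar> + \<bar>F m x - f x\<bar>)) \<le> integral\<^sup>L ?M (\<lambda>x. (?w x)^4)"
      using inR di iwR le by (intro integral_mono) auto
    moreover have "integral\<^sup>L ?M (\<lambda>x. (?w x)^4) \<le> quart L ?w"
      unfolding quart_def by (rule lebesgue_on_integral_mono_set[OF iw]) auto
    ultimately show ?thesis by linarith
  qed
  then show ?thesis by (rule that)
qed

text \<open>Midpoints of late members have almost unit quartic mass, so their quadratic part is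
  almost minimal; by the parallelogram law nothing is left for the half-difference.\<close>

lemma derivative_Cauchy:
  assumes e: "e > 0"
  shows "\<exists>N. \<forall>n\<ge>N. \<forall>m\<ge>N. integral\<^sup>L (lebesgue_on {-L..}) (\<lambda>x. (G n x - G m x)\<^sup>2) < e"
proof -
  define \<delta> where "\<delta> = min 1 (e / (8 * (sqrt \<Lambda> + 1)))"
  have s0: "0 \<le> sqrt \<Lambda>" using \<Lambda>0 by simp
  have \<delta>: "0 < \<delta>" "\<delta> \<le> 1" "sqrt \<Lambda> * \<delta> \<le> e/8"
  proof -
    show "0 < \<delta>" "\<delta> \<le> 1" using e s0 by (auto simp: \<delta>_def add_nonneg_pos)
    have "(sqrt \<Lambda> + 1) * \<delta> \<le> (sqrt \<Lambda> + 1) * (e / (8 * (sqrt \<Lambda> + 1)))"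
      using s0 by (intro mult_left_mono) (auto simp: \<delta>_def)
    also have "\<dots> = e/8" using s0 by (simp add: field_simps add_nonneg_eq_0_iff)
    finally show "sqrt \<Lambda> * \<delta> \<le> e/8" using \<open>0 < \<delta>\<close> by (simp add: distrib_right)
  qed
  obtain N1 where N1: "\<And>n m. n \<ge> (N1::nat) \<Longrightarrow> m \<ge> N1 \<Longrightarrow> 1 - \<delta> \<le> quart L (\<lambda>x. 1/2 * F n x + 1/2 * F m x)"
    using midpoint_quart[OF \<delta>(1)] by blast
  obtain N2 where N2: "\<And>n::nat. n \<ge> N2 \<Longrightarrow> 1 / (real n + 1) < e/8" using inverse_small[of "e/8"] e by auto
  have "integral\<^sup>L (lebesgue_on {-L..}) (\<lambda>x. (G n x - G m x)\<^sup>2) < e" if nm: "n \<ge> max N1 N2" "m \<ge> max N1 N2" for n m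
  proof -
    let ?w = "\<lambda>x. 1/2 * F n x + 1/2 * F m x" and ?v = "\<lambda>x. 1/2 * G n x + 1/2 * G m x"
    let ?w' = "\<lambda>x. 1/2 * F n x + (-1/2) * F m x" and ?v' = "\<lambda>x. 1/2 * G n x + (-1/2) * G m x"
    have par: "quad \<omega> \<gamma> L ?w ?v + quad \<omega> \<gamma> L ?w' ?v' = 1/2 * quad \<omega> \<gamma> L (F n) (G n) + 1/2 * quad \<omega> \<gamma> L (F m) (G m)"
      by (rule quad_parallelogram[OF adm adm])
    have "1 - \<delta> \<le> sqrt (quart L ?w)"
    proof (cases "quart L ?w \<le> 1")
      case True
      have "quart L ?w \<le> sqrt (quart L ?w)"
        using True quart_nonneg[of L ?w] by (intro real_le_rsqrt) (simp add: power2_eq_square mult_left_le)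
      then show ?thesis using N1[of n m] nm by simp
    next
      case False
      then have "1 \<le> sqrt (quart L ?w)" by simp
      then show ?thesis using \<delta>(1) by linarith
    qed
    then have "sqrt \<Lambda> * (1 - \<delta>) \<le> sqrt \<Lambda> * sqrt (quart L ?w)" using s0 by (rule mult_left_mono)
    also have "\<dots> \<le> quad \<omega> \<gamma> L ?w ?v" by (rule quad_ge[OF admissible_lincomb[OF adm adm]])
    finally have 1: "sqrt \<Lambda> - e/8 \<le> quad \<omega> \<gamma> L ?w ?v" using \<delta>(3) by (simp add: right_diff_distrib)
    have 2: "quad \<omega> \<gamma> L (F n) (G n) < sqrt \<Lambda> + e/8" "quad \<omega> \<gamma> L (F m) (G m) < sqrt \<Lambda> + e/8"
      using qlim[of n] qlim[of m] N2[of n] N2[of m] nm by force+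
    \<comment> \<open>A derivative of the half-difference is half of G n - G m, so e/4 here becomes
      e for the full difference.\<close>
    have 3: "quad \<omega> \<gamma> L ?w' ?v' < e/4" using par 1 2 by linarith
    have a': "admissible L ?w' ?v'" by (rule admissible_lincomb[OF adm adm])
    note i' = admissible_integrable[OF a']
    have "integral\<^sup>L (lebesgue_on {-L..}) (\<lambda>x. (?v' x)\<^sup>2) \<le> integral\<^sup>L (lebesgue_on {-L..}) (\<lambda>x. (?v' x)\<^sup>2 + \<omega> * (?w' x)\<^sup>2)"
      using i' \<omega>0 by (intro integral_mono Bochner_Integration.integrable_add integrable_mult_right) auto
    also have "\<dots> \<le> quad \<omega> \<gamma> L ?w' ?v'" unfolding quad_def using \<gamma> by simp
    finally have "integral\<^sup>L (lebesgue_on {-L..}) (\<lambda>x. (?v' x)\<^sup>2) < e/4" using 3 by linarith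
    moreover have "(\<lambda>x. (?v' x)\<^sup>2) = (\<lambda>x. 1/4 * (G n x - G m x)\<^sup>2)" by (auto simp: fun_eq_iff power2_eq_square field_simps)
    ultimately have "1/4 * integral\<^sup>L (lebesgue_on {-L..}) (\<lambda>x. (G n x - G m x)\<^sup>2) < e/4" by (simp only: integral_mult_right_zero)
    then show ?thesis by simp
  qed
  then show ?thesis by blast
qed

lemma diff_sq_integrable: "integrable (lebesgue_on {-L..}) (\<lambda>x. (G n x - G m x)\<^sup>2)"
  using admissible_integrable(1)[OF admissible_lincomb[OF adm[of n] adm[of m], of 1 "-1"]] by simp

text \<open>Riesz-Fischer yields an almost everywhere limit g of the derivatives. Convergence in
  \<open>L\<^sup>2\<close> makes their integrals converge, and these are the increments of the F n,
  which tend to those of f.\<close>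

lemma limit_derivative:
  obtains r g where "strict_mono (r :: nat \<Rightarrow> nat)" "sq_integrable {-L..} g"
    "AE x in lebesgue_on {-L..}. (\<lambda>n. G (r n) x) \<longlonglongrightarrow> g x" "ac_on {-L..} f g"
proof -
  let ?M = "lebesgue_on {-L..}"
  obtain r g where r: "strict_mono (r :: nat \<Rightarrow> nat)" and gm: "g \<in> borel_measurable ?M"
    and ae: "AE x in ?M. (\<lambda>n. G (r n) x) \<longlonglongrightarrow> g x"
    by (rule L2_Cauchy_AE_subsequence[of G ?M, OF meas(2) diff_sq_integrable derivative_Cauchy])
  have rn: "r n \<ge> n" for n by (rule seq_suble[OF r])
  have limr: "(\<lambda>n. F (r n) x) \<longlonglongrightarrow> f x" if "-L \<le> x" for x
    using LIMSEQ_subseq_LIMSEQ[OF lim[OF that] r] by (simp add: o_def)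
  have "integrable ?M (\<lambda>x. (g x)\<^sup>2)"
  proof (rule Fatou_bound[where h = "\<lambda>n x. (G (r n) x)\<^sup>2" and C = "sqrt \<Lambda> + 1"])
    show "AE x in ?M. (\<lambda>n. (G (r n) x)\<^sup>2) \<longlonglongrightarrow> (g x)\<^sup>2"
      using ae by eventually_elim (rule tendsto_power)
  qed (use gm admissible_integrable(1)[OF adm] sq_bounds(1) in auto)
  then have gsq: "sq_integrable {-L..} g" using gm by (simp add: sq_integrable_def)
  have Gsq: "sq_integrable {-L..} (G n)" for n using adm by (simp add: admissible_def H1_pair_def)
  have dif: "sq_integrable {-L..} (\<lambda>x. G n x - g x)" for n
    using sq_integrable_lincomb[OF Gsq gsq, of 1 n "-1"] by simp
  \<comment> \<open>Fatou's lemma in the second index of the Cauchy condition upgrades almost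
    everywhere convergence to convergence in \<open>L\<^sup>2\<close>.\<close>
  have conv: "\<exists>N. \<forall>n\<ge>N. integral\<^sup>L ?M (\<lambda>x. (G (r n) x - g x)\<^sup>2) \<le> e" if e: "e > 0" for e
  proof -
    obtain N where N: "\<And>n m. n \<ge> N \<Longrightarrow> m \<ge> N \<Longrightarrow> integral\<^sup>L ?M (\<lambda>x. (G n x - G m x)\<^sup>2) < e"
      using derivative_Cauchy[OF e] by blast
    have "integral\<^sup>L ?M (\<lambda>x. (G (r n) x - g x)\<^sup>2) \<le> e" if n: "n \<ge> N" for n
    proof (rule Fatou_bound[where h = "\<lambda>k x. (G (r n) x - G (r (k + N)) x)\<^sup>2"])
      show "AE x in ?M. (\<lambda>k. (G (r n) x - G (r (k + N)) x)\<^sup>2) \<longlonglongrightarrow> (G (r n) x - g x)\<^sup>2"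
        using ae
      proof eventually_elim
        case (elim x)
        have "(\<lambda>k. G (r (k + N)) x) \<longlonglongrightarrow> g x" using elim by (rule LIMSEQ_ignore_initial_segment)
        then show ?case by (intro tendsto_power tendsto_diff tendsto_const)
      qed
      show "(\<lambda>x. (G (r n) x - g x)\<^sup>2) \<in> borel_measurable ?M" using gm meas(2) by simp
      show "integrable ?M (\<lambda>x. (G (r n) x - G (r (k + N)) x)\<^sup>2)" for k by (rule diff_sq_integrable)
      show "integral\<^sup>L ?M (\<lambda>x. (G (r n) x - G (r (k + N)) x)\<^sup>2) \<le> e" for k
      proof (rule less_imp_le, rule N)
        show "N \<le> r n" using rn[of n] n by linarith
        show "N \<le> r (k + N)" using rn[of "k + N"] by linarith
      qed
    qed auto
    then show ?thesis by blast
  qed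
  have acG: "ac_on {-L..} (F n) (G n)" for n using adm by (simp add: admissible_def H1_pair_def)
  have ac: "ac_on {-L..} f g"
    unfolding ac_on_def
  proof (intro ballI impI conjI)
    fix x y assume xy: "x \<in> {-L..}" "y \<in> {-L..}" "x \<le> y"
    have sub: "{x..y} \<subseteq> {-L..}" using xy by auto
    have gxy: "sq_integrable {x..y} g" by (rule sq_integrable_subset[OF gsq sub]) auto
    then show "g absolutely_integrable_on {x..y}" by (rule sq_integrable_imp_absolutely_integrable)
    then have gi: "g integrable_on {x..y}" by (rule set_lebesgue_integral_eq_integral(1))
    have "(\<lambda>n. integral {x..y} (G (r n))) \<longlonglongrightarrow> integral {x..y} g"
    proof (rule LIMSEQ_I)
      fix e :: real assume e: "e > 0"
      define D where "D = y - x + 1"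
      have D: "D > 0" using xy by (simp add: D_def)
      have "e\<^sup>2 / D / 2 > 0" using e D by simp
      from conv[OF this] obtain N where N: "\<And>n. n \<ge> N \<Longrightarrow> integral\<^sup>L ?M (\<lambda>x. (G (r n) x - g x)\<^sup>2) \<le> e\<^sup>2 / D / 2"
        by blast
      have "norm (integral {x..y} (G (r n)) - integral {x..y} g) < e" if "n \<ge> N" for n
      proof -
        have dxy: "sq_integrable {x..y} (\<lambda>x. G (r n) x - g x)" by (rule sq_integrable_subset[OF dif sub]) auto
        have Gi: "G (r n) integrable_on {x..y}" using ac_onD(3)[OF acG xy] .
        have "integral {x..y} (G (r n)) - integral {x..y} g = integral {x..y} (\<lambda>x. G (r n) x - g x)"
          by (rule Henstock_Kurzweil_Integration.integral_diff[OF Gi gi, symmetric])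
        then have "(integral {x..y} (G (r n)) - integral {x..y} g)\<^sup>2 \<le> (y - x) * integral\<^sup>L (lebesgue_on {x..y}) (\<lambda>x. (G (r n) x - g x)\<^sup>2)"
          using sq_integrable_integral_bound[OF dxy xy(3)] by simp
        also have "\<dots> \<le> (y - x) * integral\<^sup>L ?M (\<lambda>x. (G (r n) x - g x)\<^sup>2)"
          using xy dif[of "r n"] sub by (intro mult_left_mono lebesgue_on_integral_mono_set) (auto simp: sq_integrable_def)
        also have "\<dots> \<le> D * (e\<^sup>2 / D / 2)"
          using N[OF that] xy D by (intro mult_mono) (auto simp: D_def)
        also have "\<dots> = e\<^sup>2 / 2" using D by simp
        also have "\<dots> < e\<^sup>2" using e by simp
        finally have "sqrt ((integral {x..y} (G (r n)) - integral {x..y} g)\<^sup>2) < sqrt (e\<^sup>2)"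
          by (rule real_sqrt_less_mono)
        then show ?thesis unfolding real_sqrt_abs real_norm_def using e by linarith
      qed
      then show "\<exists>no. \<forall>n\<ge>no. norm (integral {x..y} (G (r n)) - integral {x..y} g) < e" by blast
    qed
    moreover have "integral {x..y} (G (r n)) = F (r n) y - F (r n) x" for n
      using ac_onD(2)[OF acG xy] .
    ultimately have "(\<lambda>n. F (r n) y - F (r n) x) \<longlonglongrightarrow> integral {x..y} g" by simp
    moreover have "(\<lambda>n. F (r n) y - F (r n) x) \<longlonglongrightarrow> f y - f x" using xy by (intro tendsto_diff limr) auto
    ultimately show "integral {x..y} g = f y - f x" by (rule LIMSEQ_unique)
  qed
  show ?thesis by (rule that[OF r gsq ae ac])
qed

text \<open>Lower semicontinuity by Fatou's lemma. The vertex term converges by itself; it is moved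
  to the right-hand side with an error e/2, which is why the sequence is started late.\<close>

lemma quad_le:
  assumes r: "strict_mono (r :: nat \<Rightarrow> nat)" and gm: "g \<in> borel_measurable (lebesgue_on {-L..})"
    and ae: "AE x in lebesgue_on {-L..}. (\<lambda>n. G (r n) x) \<longlonglongrightarrow> g x"
  shows "quad \<omega> \<gamma> L f g \<le> sqrt \<Lambda>"
proof (rule field_le_epsilon)
  let ?M = "lebesgue_on {-L..}"
  have rn: "r n \<ge> n" for n by (rule seq_suble[OF r])
  have limr: "(\<lambda>n. F (r n) x) \<longlonglongrightarrow> f x" if "-L \<le> x" for x
    using LIMSEQ_subseq_LIMSEQ[OF lim[OF that] r] by (simp add: o_def)
  fix e :: real assume e: "e > 0"
  have "(\<lambda>n. \<gamma> * (F (r n) L)\<^sup>2) \<longlonglongrightarrow> \<gamma> * (f L)\<^sup>2" using L by (intro tendsto_intros limr) auto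
  moreover have "\<gamma> * (f L)\<^sup>2 - e/2 < \<gamma> * (f L)\<^sup>2" using e by simp
  ultimately have "\<forall>\<^sub>F n in sequentially. \<gamma> * (f L)\<^sup>2 - e/2 < \<gamma> * (F (r n) L)\<^sup>2" by (rule order_tendstoD)
  then obtain N1 where N1: "\<And>n. n \<ge> N1 \<Longrightarrow> \<gamma> * (f L)\<^sup>2 - e/2 < \<gamma> * (F (r n) L)\<^sup>2" unfolding eventually_sequentially by blast
  obtain N2 where N2: "\<And>n::nat. n \<ge> N2 \<Longrightarrow> 1 / (real n + 1) < e/2" using inverse_small[of "e/2"] e by auto
  define N where "N = max N1 N2"
  have "integral\<^sup>L ?M (\<lambda>x. (g x)\<^sup>2 + \<omega> * (f x)\<^sup>2) \<le> sqrt \<Lambda> + e - \<gamma> * (f L)\<^sup>2"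
  proof (rule Fatou_bound[where h = "\<lambda>n x. (G (r (n + N)) x)\<^sup>2 + \<omega> * (F (r (n + N)) x)\<^sup>2"])
    show "integrable ?M (\<lambda>x. (G (r (n + N)) x)\<^sup>2 + \<omega> * (F (r (n + N)) x)\<^sup>2)" for n
      using admissible_integrable[OF adm] by simp
    show "(\<lambda>x. (g x)\<^sup>2 + \<omega> * (f x)\<^sup>2) \<in> borel_measurable ?M" using gm fmeas by simp
    have "AE x in ?M. x \<in> {-L..}" by (intro AE_I2) simp
    with ae show "AE x in ?M. (\<lambda>n. (G (r (n + N)) x)\<^sup>2 + \<omega> * (F (r (n + N)) x)\<^sup>2) \<longlonglongrightarrow> (g x)\<^sup>2 + \<omega> * (f x)\<^sup>2"
    proof eventually_elim
      case (elim x)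
      have "(\<lambda>k. G (r (k + N)) x) \<longlonglongrightarrow> g x" using elim(1) by (rule LIMSEQ_ignore_initial_segment)
      moreover have "(\<lambda>k. F (r (k + N)) x) \<longlonglongrightarrow> f x" using limr[of x] elim(2) by (intro LIMSEQ_ignore_initial_segment) simp
      ultimately show ?case by (intro tendsto_intros)
    qed
    show "integral\<^sup>L ?M (\<lambda>x. (G (r (n + N)) x)\<^sup>2 + \<omega> * (F (r (n + N)) x)\<^sup>2) \<le> sqrt \<Lambda> + e - \<gamma> * (f L)\<^sup>2" for n
    proof -
      have "N1 \<le> n + N" "N2 \<le> r (n + N)" using rn[of "n + N"] by (auto simp: N_def)
      then show ?thesis
        using qlim[of "r (n + N)"] N1[of "n + N"] N2[of "r (n + N)"] unfolding quad_def by linarith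
    qed
  qed (use \<omega>0 in auto)
  then show "quad \<omega> \<gamma> L f g \<le> sqrt \<Lambda> + e" unfolding quad_def by linarith
qed

text \<open>Quartic integrals over bounded intervals converge by bounded convergence, and the tails
  carry mass at most e.\<close>

lemma quart_ge:
  assumes af: "admissible L f g"
  shows "1 \<le> quart L f"
proof (rule field_le_epsilon)
  fix e :: real assume e: "e > 0"
  obtain R N where R: "L \<le> R" "\<And>n. n \<ge> (N::nat) \<Longrightarrow> integral\<^sup>L (lebesgue_on {R..}) (\<lambda>x. (F n x)^4) \<le> e"
    by (rule tail_small[OF e]) (rule that; blast)
  have "(\<lambda>n. integral\<^sup>L (lebesgue_on {-L..R}) (\<lambda>x. (F n x)^4)) \<longlonglongrightarrow> integral\<^sup>L (lebesgue_on {-L..R}) (\<lambda>x. (f x)^4)"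
  proof (rule lebesgue_on_bounded_convergence[where C = "C^4"])
    show "(\<lambda>x. (F n x)^4) \<in> borel_measurable (lebesgue_on {-L..R})" for n using meas_ab[of "-L" n R] by simp
    show "(\<lambda>n. (F n x)^4) \<longlonglongrightarrow> (f x)^4" if "x \<in> {-L..R}" for x using that by (intro tendsto_power lim) auto
    show "\<bar>(F n x)^4\<bar> \<le> C^4" if "x \<in> {-L..R}" for n x
      using power_mono[OF bd[of x n], of 4] that by (simp add: power_abs)
  qed
  then have "1 - e \<le> integral\<^sup>L (lebesgue_on {-L..R}) (\<lambda>x. (f x)^4)"
  proof (rule LIMSEQ_le_const)
    show "\<exists>N. \<forall>n\<ge>N. 1 - e \<le> integral\<^sup>L (lebesgue_on {-L..R}) (\<lambda>x. (F n x)^4)"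
    proof (intro exI[of _ N] allI impI)
      fix n assume "n \<ge> N"
      then show "1 - e \<le> integral\<^sup>L (lebesgue_on {-L..R}) (\<lambda>x. (F n x)^4)"
        using R(2)[of n] quart_split[OF R(1), of n] by linarith
    qed
  qed
  also have "\<dots> \<le> quart L f"
    unfolding quart_def by (rule lebesgue_on_integral_mono_set[OF admissible_integrable(3)[OF af]]) auto
  finally show "1 \<le> quart L f + e" by simp
qed

lemma minimizer: "\<exists>g. admissible L f g \<and> 1 \<le> quart L f \<and> (quad \<omega> \<gamma> L f g)\<^sup>2 = \<Lambda> * quart L f"
proof -
  obtain r g where r: "strict_mono (r :: nat \<Rightarrow> nat)" and gsq: "sq_integrable {-L..} g"
    and ae: "AE x in lebesgue_on {-L..}. (\<lambda>n. G (r n) x) \<longlonglongrightarrow> g x" and ac: "ac_on {-L..} f g"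
    by (rule limit_derivative)
  have l1: "(\<lambda>n. F n (-L)) \<longlonglongrightarrow> f (-L)" and l2: "(\<lambda>n. F n L) \<longlonglongrightarrow> f L" using L by (auto intro: lim)
  have ends: "F n (-L) = F n L" for n using adm by (simp add: admissible_def)
  have "f (-L) = f L" by (rule LIMSEQ_unique[OF l1[unfolded ends] l2])
  then have af: "admissible L f g"
    using ac gsq f_sq_integrable by (simp add: admissible_def H1_pair_def)
  have "(quad \<omega> \<gamma> L f g)\<^sup>2 \<le> (sqrt \<Lambda>)\<^sup>2" using quad_le[OF r _ ae] gsq quad_nonneg[of \<omega> \<gamma> L f g] \<omega>0 \<gamma> by (intro power_mono) (auto simp: sq_integrable_def)
  also have "\<dots> = \<Lambda> * 1" using \<Lambda>0 by simp
  also have "\<dots> \<le> \<Lambda> * quart L f" using quart_ge[OF af] \<Lambda>0 by (rule mult_left_mono)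
  finally show ?thesis using af quart_ge[OF af] \<Lambda>[OF af] by (intro exI[of _ g]) simp
qed

end

text \<open>The test pair supplies the strict gap. Bounded quadratic parts give uniform bounds and a
  common Hoelder modulus, hence a pointwise convergent subsequence of a normalised minimising
  sequence.\<close>

theorem minimizer_exists:
  assumes \<omega>: "\<omega> = \<mu>\<^sup>2" and \<mu>: "\<mu> > 0" and \<gamma>: "0 \<le> \<gamma>" and L: "0 < L"
    and test: "admissible L f0 g0" "(quad \<omega> \<gamma> L f0 g0)\<^sup>2 < 16/3 * \<mu>^3 * quart L f0"
  obtains f g where "admissible L f g" "0 < quart L f" "(quad \<omega> \<gamma> L f g)\<^sup>2 = best_const \<omega> \<gamma> L * quart L f"
    "best_const \<omega> \<gamma> L < 16/3 * \<mu>^3"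
proof -
  let ?\<Lambda> = "best_const \<omega> \<gamma> L" and ?M = "lebesgue_on {-L..}"
  have \<omega>0: "\<omega> > 0" using \<omega> \<mu> by simp
  have "0 < 16/3 * \<mu>^3 * quart L f0" using test(2) by (rule order_le_less_trans[OF zero_le_power2])
  then have q0: "quart L f0 > 0" using \<mu> by (simp add: zero_less_mult_iff)
  have \<Lambda>0: "0 \<le> ?\<Lambda>" by (rule best_const_nonneg[OF test(1) q0])
  have "?\<Lambda> * quart L f0 < 16/3 * \<mu>^3 * quart L f0" using best_const_le[OF test(1), of \<omega> \<gamma>] test(2) by linarith
  then have \<Lambda>R: "?\<Lambda> < 16/3 * \<mu>^3" using q0 by simp
  have "\<exists>f g. admissible L f g \<and> quart L f = 1 \<and> quad \<omega> \<gamma> L f g < sqrt ?\<Lambda> + 1 / (real n + 1)" for n :: nat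
    by (rule best_const_approx[OF test(1) q0 less_imp_le[OF \<omega>0] \<gamma>, of "1 / (real n + 1)"]) auto
  then obtain F0 G0 where FG: "\<And>n. admissible L (F0 n) (G0 n)" "\<And>n. quart L (F0 n) = 1"
    "\<And>n::nat. quad \<omega> \<gamma> L (F0 n) (G0 n) < sqrt ?\<Lambda> + 1 / (real n + 1)" by metis
  define K where "K = sqrt ?\<Lambda> + 1"
  have K0: "K \<ge> 0" using \<Lambda>0 by (simp add: K_def)
  have qK: "quad \<omega> \<gamma> L (F0 n) (G0 n) \<le> K" for n
  proof -
    have "1 / (real n + 1) \<le> 1" by simp
    then show ?thesis using FG(3)[of n] unfolding K_def by linarith
  qed
  have b: "integral\<^sup>L ?M (\<lambda>x. (G0 n x)\<^sup>2) \<le> K" "integral\<^sup>L ?M (\<lambda>x. (F0 n x)\<^sup>2) \<le> K / \<omega>" for n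
  proof -
    note i = admissible_integrable[OF FG(1)[of n]]
    have "quad \<omega> \<gamma> L (F0 n) (G0 n) = integral\<^sup>L ?M (\<lambda>x. (G0 n x)\<^sup>2) + \<omega> * integral\<^sup>L ?M (\<lambda>x. (F0 n x)\<^sup>2) + \<gamma> * (F0 n L)\<^sup>2"
      unfolding quad_def using i by simp
    moreover have "0 \<le> \<gamma> * (F0 n L)\<^sup>2" "0 \<le> integral\<^sup>L ?M (\<lambda>x. (G0 n x)\<^sup>2)"
      "0 \<le> \<omega> * integral\<^sup>L ?M (\<lambda>x. (F0 n x)\<^sup>2)" using \<gamma> \<omega>0 by auto
    ultimately have "integral\<^sup>L ?M (\<lambda>x. (G0 n x)\<^sup>2) \<le> K" "\<omega> * integral\<^sup>L ?M (\<lambda>x. (F0 n x)\<^sup>2) \<le> K"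
      using qK[of n] by linarith+
    then show "integral\<^sup>L ?M (\<lambda>x. (G0 n x)\<^sup>2) \<le> K" "integral\<^sup>L ?M (\<lambda>x. (F0 n x)\<^sup>2) \<le> K / \<omega>"
      using \<omega>0 by (auto simp: pos_le_divide_eq mult.commute)
  qed
  define C where "C = sqrt (2 * (K / \<omega> + K))"
  have Hp: "H1_pair {-L..} (F0 n) (G0 n)" for n using FG(1) by (simp add: admissible_def)
  have bd: "\<bar>F0 n x\<bar> \<le> C" if "- L \<le> x" for n x
    unfolding C_def using H1_pair_bound[OF Hp that, of n] b[of n] by (intro real_le_rsqrt) simp
  have hoe: "(F0 n y - F0 n x)\<^sup>2 \<le> (y - x) * K" if xy: "- L \<le> x" "x \<le> y" for n x y
  proof -
    have ac: "ac_on {-L..} (F0 n) (G0 n)" and g: "sq_integrable {-L..} (G0 n)" using Hp by (auto simp: H1_pair_def)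
    have sub: "{x..y} \<subseteq> {-L..}" using xy by auto
    have "(F0 n y - F0 n x)\<^sup>2 \<le> (y - x) * integral\<^sup>L (lebesgue_on {x..y}) (\<lambda>x. (G0 n x)\<^sup>2)"
      by (rule ac_on_Hoelder[OF ac g _ sub xy(2)]) simp
    also have "integral\<^sup>L (lebesgue_on {x..y}) (\<lambda>x. (G0 n x)\<^sup>2) \<le> integral\<^sup>L ?M (\<lambda>x. (G0 n x)\<^sup>2)"
      using g sub by (intro lebesgue_on_integral_mono_set) (auto simp: sq_integrable_def)
    also have "\<dots> \<le> K" by (rule b)
    finally show ?thesis using xy by (simp add: mult_left_mono)
  qed
  obtain k f where k: "strict_mono (k :: nat \<Rightarrow> nat)" "\<And>x. - L \<le> x \<Longrightarrow> (\<lambda>n. F0 (k n) x) \<longlonglongrightarrow> f x"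
  proof (rule pointwise_convergent_subsequence[of "-L" F0 C K, OF bd hoe K0])
    fix k f assume "strict_mono (k :: nat \<Rightarrow> nat)" "\<And>x. - L \<le> x \<Longrightarrow> (\<lambda>n. F0 (k n) x) \<longlonglongrightarrow> f x"
    then show thesis by (rule that)
  qed assumption+
  have kn: "1 / (real (k n) + 1) \<le> 1 / (real n + 1)" for n
    using seq_suble[OF k(1), of n] by (intro divide_left_mono) auto
  interpret minimizing_sequence \<omega> \<gamma> L \<mu> ?\<Lambda> C "\<lambda>n. F0 (k n)" "\<lambda>n. G0 (k n)" f
  proof
    show "quad \<omega> \<gamma> L (F0 (k n)) (G0 (k n)) \<le> sqrt ?\<Lambda> + 1 / (real n + 1)" for n
      using FG(3)[of "k n"] kn[of n] by linarith
  qed (use assms \<Lambda>0 \<Lambda>R best_const_le FG bd k in auto)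
  obtain g where g: "admissible L f g" "1 \<le> quart L f" "(quad \<omega> \<gamma> L f g)\<^sup>2 = ?\<Lambda> * quart L f" using minimizer by blast
  show ?thesis by (rule that[OF g(1) _ g(3) \<Lambda>R]) (use g(2) in linarith)
qed

section \<open>The Euler--Lagrange equation\<close>

text \<open>Near 0 a linear term would dominate: for N = |a| + |M| + 1 the argument -a / (2 N) lies
  in [-1, 1] and makes the upper estimate equal to -a^2 / (4 N).\<close>

lemma linear_term_zero:
  fixes a M :: real
  assumes "\<And>t. \<bar>t\<bar> \<le> 1 \<Longrightarrow> 0 \<le> a * t + M * t\<^sup>2"
  shows "a = 0"
proof (rule ccontr)
  assume a: "a \<noteq> 0"
  define N where "N = \<bar>a\<bar> + \<bar>M\<bar> + 1"
  have N: "N > 0" "\<bar>a\<bar> \<le> N" by (auto simp: N_def)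
  define t where "t = - a / (2 * N)"
  have "\<bar>t\<bar> = \<bar>a\<bar> / (2 * N)" using N by (simp add: t_def abs_divide)
  then have "\<bar>t\<bar> \<le> 1" using N by (simp add: pos_divide_le_eq)
  then have "0 \<le> a * t + M * t\<^sup>2" by (rule assms)
  also have "\<dots> \<le> a * t + N * t\<^sup>2" by (intro add_left_mono mult_right_mono) (auto simp: N_def)
  also have "\<dots> = - a\<^sup>2 / (4 * N)" using N by (simp add: t_def power2_eq_square field_simps)
  also have "\<dots> < 0" using a N by simp
  finally show False by simp
qed

text \<open>The fourth power lies above its tangents. This gives a lower bound for the quartic mass
  of a variation without differentiating under the integral.\<close>

lemma power4_convex: "(a::real)^4 + 4 * (a^3 * b) \<le> (a + b)^4"
proof -
  have "(a + b)^4 - a^4 - 4 * (a^3 * b) = b\<^sup>2 * (2 * a\<^sup>2 + (2 * a + b)\<^sup>2)"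
    by (simp add: power4_eq_xxxx power3_eq_cube power2_eq_square algebra_simps)
  moreover have "0 \<le> b\<^sup>2 * (2 * a\<^sup>2 + (2 * a + b)\<^sup>2)" by simp
  ultimately show ?thesis by linarith
qed

text \<open>Minimisers of the quotient in the scaling of the Nehari set, where the quadratic and the
  quartic part both equal \<Lambda>; it is in this scaling that the Euler-Lagrange equation has
  coefficient 1 at the cubic term.\<close>

definition ground :: "real \<Rightarrow> real \<Rightarrow> real \<Rightarrow> (real \<Rightarrow> real) \<Rightarrow> (real \<Rightarrow> real) \<Rightarrow> bool" where
  "ground \<omega> \<gamma> L w g \<longleftrightarrow> admissible L w g \<and> 0 < best_const \<omega> \<gamma> L \<and>
     quad \<omega> \<gamma> L w g = best_const \<omega> \<gamma> L \<and> quart L w = best_const \<omega> \<gamma> L"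

text \<open>Along w + t \<phi> the quadratic part is an exact polynomial in t and the quartic part
  lies above its tangent. Minimality then leaves a non-negative expression with linear coefficient
  \<open>4 * \<Lambda> * (b - d)\<close>.\<close>

lemma weak_Euler_Lagrange:
  assumes w: "ground \<omega> \<gamma> L w g" and \<phi>: "admissible L \<phi> \<psi>" and "0 \<le> \<omega>" "0 \<le> \<gamma>"
  shows "integrable (lebesgue_on {-L..}) (\<lambda>x. g x * \<psi> x + (\<omega> * w x - (w x)^3) * \<phi> x)"
    "integral\<^sup>L (lebesgue_on {-L..}) (\<lambda>x. g x * \<psi> x + (\<omega> * w x - (w x)^3) * \<phi> x) + \<gamma> * w L * \<phi> L = 0"
proof -
  let ?M = "lebesgue_on {-L..}"
  define \<Lambda> where "\<Lambda> = best_const \<omega> \<gamma> L"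
  have aw: "admissible L w g" and \<Lambda>: "\<Lambda> > 0" "quad \<omega> \<gamma> L w g = \<Lambda>" "quart L w = \<Lambda>"
    using w by (auto simp: ground_def \<Lambda>_def)
  have sq: "sq_integrable {-L..} w" "sq_integrable {-L..} g" "sq_integrable {-L..} \<phi>" "sq_integrable {-L..} \<psi>"
    and Hw: "H1_pair {-L..} w g"
    using aw \<phi> by (auto simp: admissible_def H1_pair_def)
  note p = sq_integrable_mult
  have i1: "integrable ?M (\<lambda>x. g x * \<psi> x)" "integrable ?M (\<lambda>x. w x * \<phi> x)" by (intro p sq)+
  have i3: "integrable ?M (\<lambda>x. (w x)^3 * \<phi> x)"
  proof -
    define C where "C = 2 * (integral\<^sup>L ?M (\<lambda>x. (w x)\<^sup>2) + integral\<^sup>L ?M (\<lambda>x. (g x)\<^sup>2))"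
    show ?thesis
    proof (rule Bochner_Integration.integrable_bound)
      show "integrable ?M (\<lambda>x. C * (w x * \<phi> x))" using i1(2) by simp
      show "(\<lambda>x. (w x)^3 * \<phi> x) \<in> borel_measurable ?M" using sq by (auto simp: sq_integrable_def)
      show "AE x in ?M. norm ((w x)^3 * \<phi> x) \<le> norm (C * (w x * \<phi> x))"
      proof (rule AE_I2)
        fix x assume "x \<in> space ?M"
        then have b: "(w x)\<^sup>2 \<le> C" using H1_pair_bound[OF Hw, of x] by (simp add: C_def)
        have "norm ((w x)^3 * \<phi> x) = (w x)\<^sup>2 * \<bar>w x * \<phi> x\<bar>"
          by (simp add: abs_mult power3_eq_cube power2_eq_square)
        also have "\<dots> \<le> C * \<bar>w x * \<phi> x\<bar>" using b by (intro mult_right_mono) auto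
        also have "\<dots> \<le> norm (C * (w x * \<phi> x))" by (simp add: abs_mult mult_right_mono)
        finally show "norm ((w x)^3 * \<phi> x) \<le> norm (C * (w x * \<phi> x))" .
      qed
    qed
  qed
  have eq: "(\<lambda>x. g x * \<psi> x + (\<omega> * w x - (w x)^3) * \<phi> x) = (\<lambda>x. g x * \<psi> x + \<omega> * (w x * \<phi> x) - (w x)^3 * \<phi> x)"
    by (simp add: algebra_simps)
  show "integrable ?M (\<lambda>x. g x * \<psi> x + (\<omega> * w x - (w x)^3) * \<phi> x)"
    unfolding eq using i1 i3 by simp
  define b where "b = integral\<^sup>L ?M (\<lambda>x. g x * \<psi> x) + \<omega> * integral\<^sup>L ?M (\<lambda>x. w x * \<phi> x) + \<gamma> * w L * \<phi> L"
  define c where "c = quad \<omega> \<gamma> L \<phi> \<psi>"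
  define d where "d = integral\<^sup>L ?M (\<lambda>x. (w x)^3 * \<phi> x)"
  note iw = admissible_integrable[OF aw] and ip = admissible_integrable[OF \<phi>]
  have quad_exp: "quad \<omega> \<gamma> L (\<lambda>x. 1 * w x + t * \<phi> x) (\<lambda>x. 1 * g x + t * \<psi> x) = \<Lambda> + 2 * t * b + t\<^sup>2 * c" for t
  proof -
    have "(\<lambda>x. (1 * g x + t * \<psi> x)\<^sup>2 + \<omega> * (1 * w x + t * \<phi> x)\<^sup>2)
      = (\<lambda>x. ((g x)\<^sup>2 + \<omega> * (w x)\<^sup>2) + 2 * t * (g x * \<psi> x + \<omega> * (w x * \<phi> x)) + t\<^sup>2 * ((\<psi> x)\<^sup>2 + \<omega> * (\<phi> x)\<^sup>2))"
      by (simp add: power2_eq_square algebra_simps)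
    then have "integral\<^sup>L ?M (\<lambda>x. (1 * g x + t * \<psi> x)\<^sup>2 + \<omega> * (1 * w x + t * \<phi> x)\<^sup>2)
      = integral\<^sup>L ?M (\<lambda>x. (g x)\<^sup>2 + \<omega> * (w x)\<^sup>2) + 2 * t * (integral\<^sup>L ?M (\<lambda>x. g x * \<psi> x) + \<omega> * integral\<^sup>L ?M (\<lambda>x. w x * \<phi> x))
        + t\<^sup>2 * integral\<^sup>L ?M (\<lambda>x. (\<psi> x)\<^sup>2 + \<omega> * (\<phi> x)\<^sup>2)"
      using iw ip i1 by simp
    moreover have "\<gamma> * (1 * w L + t * \<phi> L)\<^sup>2 = \<gamma> * (w L)\<^sup>2 + 2 * t * (\<gamma> * w L * \<phi> L) + t\<^sup>2 * (\<gamma> * (\<phi> L)\<^sup>2)"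
      by (simp add: power2_eq_square algebra_simps)
    ultimately show ?thesis using \<Lambda>(2) unfolding quad_def b_def c_def by (simp add: algebra_simps)
  qed
  \<comment> \<open>For |t| \<le> 1 the cubic and quartic terms of the squared polynomial are
    absorbed into the coefficient of t^2.\<close>
  have key: "0 \<le> 4 * \<Lambda> * (b - d) * t + (4 * b\<^sup>2 + 2 * \<Lambda> * \<bar>c\<bar> + 4 * \<bar>b * c\<bar> + c\<^sup>2) * t\<^sup>2" if t: "\<bar>t\<bar> \<le> 1" for t
  proof -
    let ?w = "\<lambda>x. 1 * w x + t * \<phi> x"
    have at: "admissible L ?w (\<lambda>x. 1 * g x + t * \<psi> x)" by (rule admissible_lincomb[OF aw \<phi>])
    have "\<Lambda> + 4 * t * d = integral\<^sup>L ?M (\<lambda>x. (w x)^4 + 4 * t * ((w x)^3 * \<phi> x))"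
      using iw(3) i3 \<Lambda>(3) by (simp add: d_def quart_def)
    also have "\<dots> \<le> quart L ?w"
      unfolding quart_def
    proof (rule integral_mono)
      show "integrable ?M (\<lambda>x. (w x)^4 + 4 * t * ((w x)^3 * \<phi> x))" using iw(3) i3 by simp
      show "integrable ?M (\<lambda>x. (?w x)^4)" by (rule admissible_integrable(3)[OF at])
      show "(w x)^4 + 4 * t * ((w x)^3 * \<phi> x) \<le> (?w x)^4" for x
        using power4_convex[of "w x" "t * \<phi> x"] by (simp add: mult_ac)
    qed
    finally have "\<Lambda> * (\<Lambda> + 4 * t * d) \<le> \<Lambda> * quart L ?w" using \<Lambda>(1) by simp
    also have "\<dots> \<le> (\<Lambda> + 2 * t * b + t\<^sup>2 * c)\<^sup>2" using best_const_le[OF at, of \<omega> \<gamma>] unfolding quad_exp \<Lambda>_def .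
    also have "\<dots> = \<Lambda>\<^sup>2 + 4 * \<Lambda> * b * t + (4 * b\<^sup>2 + 2 * \<Lambda> * c) * t\<^sup>2 + (4 * (b * c) * t) * t\<^sup>2 + (c\<^sup>2 * t\<^sup>2) * t\<^sup>2"
      by (simp add: power2_eq_square algebra_simps)
    also have "\<dots> \<le> \<Lambda>\<^sup>2 + 4 * \<Lambda> * b * t + (4 * b\<^sup>2 + 2 * \<Lambda> * \<bar>c\<bar>) * t\<^sup>2 + (4 * \<bar>b * c\<bar>) * t\<^sup>2 + c\<^sup>2 * t\<^sup>2"
    proof -
      have "2 * \<Lambda> * c \<le> 2 * \<Lambda> * \<bar>c\<bar>" using \<Lambda>(1) by simp
      moreover have "4 * (b * c) * t \<le> 4 * \<bar>b * c\<bar>"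
      proof -
        have "(b * c) * t \<le> \<bar>b * c\<bar> * \<bar>t\<bar>" by (metis abs_ge_self abs_mult)
        also have "\<dots> \<le> \<bar>b * c\<bar> * 1" using t by (intro mult_left_mono) auto
        finally show ?thesis by simp
      qed
      moreover have "t\<^sup>2 \<le> 1" using t by (simp add: abs_square_le_1)
      then have "c\<^sup>2 * t\<^sup>2 \<le> c\<^sup>2" by (simp add: mult_left_le)
      ultimately have k: "4 * b\<^sup>2 + 2 * \<Lambda> * c \<le> 4 * b\<^sup>2 + 2 * \<Lambda> * \<bar>c\<bar>" "4 * (b * c) * t \<le> 4 * \<bar>b * c\<bar>" "c\<^sup>2 * t\<^sup>2 \<le> c\<^sup>2"
        by linarith+
      from k[THEN mult_right_mono[OF _ zero_le_power2[of t]]]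
      show ?thesis by linarith
    qed
    finally show ?thesis by (simp add: power2_eq_square algebra_simps)
  qed
  have "4 * \<Lambda> * (b - d) = 0"
    by (rule linear_term_zero[where M = "4 * b\<^sup>2 + 2 * \<Lambda> * \<bar>c\<bar> + 4 * \<bar>b * c\<bar> + c\<^sup>2"]) (use key in blast)
  then have "b = d" using \<Lambda>(1) by simp
  then show "integral\<^sup>L ?M (\<lambda>x. g x * \<psi> x + (\<omega> * w x - (w x)^3) * \<phi> x) + \<gamma> * w L * \<phi> L = 0"
    unfolding eq using i1 i3 by (simp add: b_def d_def)
qed

text \<open>Pairing with the derivative of a ramp produces a mean value over [a, b], so testing the
  equation with ramps yields difference quotients.\<close>

definition ramp :: "real \<Rightarrow> real \<Rightarrow> real \<Rightarrow> real" where
  "ramp a b x = (if x \<le> a then 0 else if x \<le> b then (x - a) / (b - a) else 1)"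

definition ramp' :: "real \<Rightarrow> real \<Rightarrow> real \<Rightarrow> real" where
  "ramp' a b x = (if x \<in> {a..b} then 1 / (b - a) else 0)"

lemma ramp'_has_integral:
  assumes "(h has_integral I) {a..b}" "x \<le> a" "b \<le> y"
  shows "((\<lambda>t. h t * ramp' a b t) has_integral I / (b - a)) {x..y}"
proof -
  have "((\<lambda>t. h t * (1 / (b - a))) has_integral I * (1 / (b - a))) {a..b}"
    by (rule has_integral_mult_left[OF assms(1)])
  then have "((\<lambda>t. if t \<in> {a..b} then h t * (1 / (b - a)) else 0) has_integral I * (1 / (b - a))) {x..y}"
    using assms(2,3) by (subst has_integral_restrict) auto
  moreover have "(\<lambda>t. if t \<in> {a..b} then h t * (1 / (b - a)) else 0) = (\<lambda>t. h t * ramp' a b t)"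
    by (auto simp: ramp'_def)
  ultimately show ?thesis by simp
qed

lemma ramp_ac_on:
  assumes "a < b"
  shows "ac_on X (ramp a b) (ramp' a b)"
  unfolding ac_on_def
proof (intro ballI impI)
  fix x y :: real assume xy: "x \<le> y"
  have "(ramp' a b has_integral (ramp a b y - ramp a b x)) {x..y}"
  proof (rule fundamental_theorem_of_calculus_interior_strong[of "{a,b}"])
    have "ramp a b = (\<lambda>t. max 0 (min 1 ((t - a) / (b - a))))"
      using assms by (auto simp: ramp_def fun_eq_iff max_def min_def field_simps)
    then show "continuous_on {x..y} (ramp a b)" using assms by (simp add: continuous_intros)
    fix t assume t: "t \<in> {x<..<y} - {a, b}"
    consider "t < a" | "a < t" "t < b" | "b < t" using t by fastforce
    then have "(ramp a b has_real_derivative ramp' a b t) (at t)"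
    proof cases
      case 1
      have "((\<lambda>_. 0) has_real_derivative ramp' a b t) (at t)" using 1 by (simp add: ramp'_def)
      then show ?thesis
        by (rule has_field_derivative_transform_within_open[of _ _ _ "{..<a}"]) (use 1 in \<open>auto simp: ramp_def\<close>)
    next
      case 2
      have "((\<lambda>t. (t - a) / (b - a)) has_real_derivative ramp' a b t) (at t)"
        using 2 by (auto simp: ramp'_def intro!: derivative_eq_intros)
      then show ?thesis
        by (rule has_field_derivative_transform_within_open[of _ _ _ "{a<..<b}"]) (use 2 in \<open>auto simp: ramp_def\<close>)
    next
      case 3
      have "((\<lambda>_. 1) has_real_derivative ramp' a b t) (at t)" using 3 by (simp add: ramp'_def)
      then show ?thesis
        by (rule has_field_derivative_transform_within_open[of _ _ _ "{b<..}"]) (use 3 assms in \<open>auto simp: ramp_def\<close>)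
    qed
    then show "(ramp a b has_vector_derivative ramp' a b t) (at t)"
      by (simp add: has_real_derivative_iff_has_vector_derivative)
  qed (use xy in auto)
  moreover from this have "ramp' a b absolutely_integrable_on {x..y}"
    using assms by (intro nonnegative_absolutely_integrable_1) (auto simp: ramp'_def)
  ultimately show "ramp' a b absolutely_integrable_on {x..y} \<and> integral {x..y} (ramp' a b) = ramp a b y - ramp a b x"
    by (simp add: integral_unique)
qed

lemma sq_integrable_bounded_support:
  assumes m: "h \<in> borel_measurable (lebesgue_on {c..})" and z: "\<And>x. x > Y \<Longrightarrow> h x = 0" and b: "\<And>x. \<bar>h x\<bar> \<le> B"
  shows "sq_integrable {c..} h"
proof -
  have "integrable (lebesgue_on {c..}) (\<lambda>x. B\<^sup>2 * indicator {c..Y} x)"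
    by (intro integrable_mult_right integrable_real_indicator) (auto simp: emeasure_restrict_space sets_restrict_space_iff emeasure_lborel_Icc_eq)
  then have "integrable (lebesgue_on {c..}) (\<lambda>x. (h x)\<^sup>2)"
  proof (rule Bochner_Integration.integrable_bound)
    show "(\<lambda>x. (h x)\<^sup>2) \<in> borel_measurable (lebesgue_on {c..})" using m by simp
    show "AE x in lebesgue_on {c..}. norm ((h x)\<^sup>2) \<le> norm (B\<^sup>2 * indicator {c..Y} x)"
    proof (rule AE_I2)
      fix x assume x: "x \<in> space (lebesgue_on {c..})"
      show "norm ((h x)\<^sup>2) \<le> norm (B\<^sup>2 * indicator {c..Y} x)"
      proof (cases "x \<le> Y")
        case True
        have "\<bar>h x\<bar>\<^sup>2 \<le> B\<^sup>2" by (intro power_mono b) simp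
        then show ?thesis using True x by (simp add: indicator_def)
      qed (use z[of x] in simp)
    qed
  qed
  then show ?thesis using m by (simp add: sq_integrable_def)
qed

lemma ramp_measurable: "ramp a b \<in> borel_measurable (lebesgue_on X)" "ramp' a b \<in> borel_measurable (lebesgue_on X)"
proof -
  have "ramp a b \<in> borel_measurable borel" "ramp' a b \<in> borel_measurable borel"
    unfolding ramp_def[abs_def] ramp'_def[abs_def] by measurable
  then show "ramp a b \<in> borel_measurable (lebesgue_on X)" "ramp' a b \<in> borel_measurable (lebesgue_on X)"
    by (auto intro!: measurable_restrict_space1 measurable_completion)
qed

lemma ramp_bounds: "a < b \<Longrightarrow> \<bar>ramp a b x\<bar> \<le> 1" "a < b \<Longrightarrow> \<bar>ramp' a b x\<bar> \<le> 1 / (b - a)"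
  by (auto simp: ramp_def ramp'_def field_simps)

text \<open>All test functions that are needed have the form \<open>c\<^sub>0 + s ramp a b + t ramp c d\<close>.\<close>

lemma ramp_test:
  assumes w: "ground \<omega> \<gamma> L w g" and \<omega>\<gamma>: "0 \<le> \<omega>" "0 \<le> \<gamma>" and L: "0 < L"
    and abcd: "-L \<le> a" "a < b" "-L \<le> c" "c < d" and st: "c0 + s + t = 0"
    and vtx: "c0 = c0 + s * ramp a b L + t * ramp c d L"
    and V: "\<And>x. -L \<le> x \<Longrightarrow> (V has_real_derivative \<omega> * w x - (w x)^3) (at x within {-L..})" "V (-L) = 0"
    and F: "\<And>x. -L \<le> x \<Longrightarrow> (F has_real_derivative V x) (at x within {-L..})"
  shows "s * (((w b - F b) - (w a - F a)) / (b - a)) + t * (((w d - F d) - (w c - F c)) / (d - c)) + \<gamma> * w L * c0 = 0"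
proof -
  \<comment> \<open>Both ramps have reached 1 before Y, so by \<open>st\<close> the test function
    vanishes from there on.\<close>
  define Y where "Y = max b d + 1"
  have Y: "b < Y" "d < Y" "-L < Y" using abcd by (auto simp: Y_def)
  define \<phi> where "\<phi> = (\<lambda>x. c0 + s * ramp a b x + t * ramp c d x)"
  define \<psi> where "\<psi> = (\<lambda>x. s * ramp' a b x + t * ramp' c d x)"
  have z\<phi>: "\<phi> x = 0" if "x \<ge> max b d" for x
  proof -
    have "ramp a b x = 1" "ramp c d x = 1" using that abcd by (auto simp: ramp_def field_simps)
    then show ?thesis using st by (simp add: \<phi>_def)
  qed
  have z\<psi>: "\<psi> x = 0" if "x > max b d" for x using that by (auto simp: \<psi>_def ramp'_def)
  have ac: "ac_on X \<phi> \<psi>" for X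
  proof -
    have "ac_on X (\<lambda>x. s * ramp a b x + t * ramp c d x) \<psi>"
      unfolding \<psi>_def by (intro ac_on_lincomb ramp_ac_on abcd)
    then show ?thesis unfolding ac_on_def \<phi>_def by simp
  qed
  have "sq_integrable {-L..} \<phi>"
  proof (rule sq_integrable_bounded_support)
    show "\<phi> \<in> borel_measurable (lebesgue_on {-L..})" unfolding \<phi>_def using ramp_measurable by simp
    show "\<phi> x = 0" if "x > Y" for x using z\<phi>[of x] that Y by simp
    show "\<bar>\<phi> x\<bar> \<le> \<bar>c0\<bar> + \<bar>s\<bar> + \<bar>t\<bar>" for x
    proof -
      have "\<bar>s * ramp a b x\<bar> \<le> \<bar>s\<bar>" "\<bar>t * ramp c d x\<bar> \<le> \<bar>t\<bar>"
        using ramp_bounds(1)[OF abcd(2), of x] ramp_bounds(1)[OF abcd(4), of x] by (simp_all add: abs_mult mult_left_le)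
      then show ?thesis unfolding \<phi>_def by linarith
    qed
  qed
  moreover have "sq_integrable {-L..} \<psi>"
  proof (rule sq_integrable_bounded_support)
    show "\<psi> \<in> borel_measurable (lebesgue_on {-L..})" unfolding \<psi>_def using ramp_measurable by simp
    show "\<psi> x = 0" if "x > Y" for x using z\<psi>[of x] that Y by simp
    show "\<bar>\<psi> x\<bar> \<le> \<bar>s\<bar> * (1 / (b - a)) + \<bar>t\<bar> * (1 / (d - c))" for x
    proof -
      have "\<bar>s * ramp' a b x\<bar> \<le> \<bar>s\<bar> * (1 / (b - a))" "\<bar>t * ramp' c d x\<bar> \<le> \<bar>t\<bar> * (1 / (d - c))"
        unfolding abs_mult by (intro mult_left_mono ramp_bounds abcd abs_ge_zero)+
      then show ?thesis unfolding \<psi>_def by linarith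
    qed
  qed
  moreover have "\<phi> (-L) = c0" using abcd by (simp add: \<phi>_def ramp_def)
  moreover have \<phi>L: "\<phi> L = c0" using vtx by (simp add: \<phi>_def)
  ultimately have adm: "admissible L \<phi> \<psi>" using ac by (simp add: admissible_def H1_pair_def)
  let ?k = "\<lambda>x. g x * \<psi> x + (\<omega> * w x - (w x)^3) * \<phi> x"
  note EL = weak_Euler_Lagrange[OF w adm \<omega>\<gamma>]
  have LY: "-L \<le> Y" using Y by simp
  note sp = integrable_lebesgue_on_interval_split[OF EL(1) LY]
  have "integral\<^sup>L (lebesgue_on {Y..}) ?k = integral\<^sup>L (lebesgue_on {Y..}) (\<lambda>x. 0)"
  proof (rule Bochner_Integration.integral_cong)
    fix x assume "x \<in> space (lebesgue_on {Y..})"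
    then show "?k x = 0" using z\<phi>[of x] z\<psi>[of x] Y by simp
  qed simp
  then have "integral\<^sup>L (lebesgue_on {-L..Y}) ?k + \<gamma> * w L * c0 = 0"
    using EL(2) sp(3) \<phi>L by simp
  moreover have "(?k has_integral integral\<^sup>L (lebesgue_on {-L..Y}) ?k) {-L..Y}"
    by (rule has_integral_integral_lebesgue_on[OF sp(1)]) simp
  moreover from calculation(1) have "integral\<^sup>L (lebesgue_on {-L..Y}) ?k = - (\<gamma> * w L * c0)" by linarith
  ultimately have k: "(?k has_integral (- (\<gamma> * w L * c0))) {-L..Y}" by (simp only:)
  have wac: "ac_on {-L..} w g" using w by (simp add: ground_def admissible_def H1_pair_def)
  have wc: "continuous_on {-L..} w" by (rule ac_on_continuous[OF wac]) (simp add: is_interval_ci)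
  \<comment> \<open>Integration by parts moves the nonlinear term onto \<psi> through its primitive
    V. What remains is the mean value of g - V over the two ramps, that is, difference quotients of
    w - F.\<close>
  have hphi: "((\<lambda>x. (\<omega> * w x - (w x)^3) * \<phi> x + V x * \<psi> x) has_integral (V Y * \<phi> Y - V (-L) * \<phi> (-L))) {-L..Y}"
  proof (rule ac_on_mult_C1[OF ac LY])
    show "(V has_real_derivative \<omega> * w x - (w x)^3) (at x within {-L..Y})" if "x \<in> {-L..Y}" for x
      using V(1)[of x] that by (intro DERIV_subset[OF V(1)]) auto
    show "continuous_on {-L..Y} (\<lambda>x. \<omega> * w x - (w x)^3)"
      by (intro continuous_intros continuous_on_subset[OF wc]) auto
  qed
  have inc: "(g has_integral w y - w x) {x..y}" "(V has_integral F y - F x) {x..y}" if "-L \<le> x" "x \<le> y" for x y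
  proof -
    show "(g has_integral w y - w x) {x..y}"
      using ac_onD[OF wac, of x y] that by (simp add: has_integral_integrable_integral)
    show "(V has_integral F y - F x) {x..y}"
    proof (rule fundamental_theorem_of_calculus[OF that(2)])
      fix u assume "u \<in> {x..y}"
      then show "(F has_vector_derivative V u) (at u within {x..y})"
        using that F[of u] unfolding has_real_derivative_iff_has_vector_derivative[symmetric]
        by (intro DERIV_subset[OF F]) auto
    qed
  qed
  have psi: "((\<lambda>x. h x * \<psi> x) has_integral (s * (I1 / (b - a)) + t * (I2 / (d - c)))) {-L..Y}"
    if "(h has_integral I1) {a..b}" "(h has_integral I2) {c..d}" for h I1 I2
  proof -
    have "((\<lambda>x. s * (h x * ramp' a b x) + t * (h x * ramp' c d x)) has_integral (s * (I1 / (b - a)) + t * (I2 / (d - c)))) {-L..Y}"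
      using that abcd Y by (intro has_integral_add has_integral_mult_right ramp'_has_integral) auto
    moreover have "(\<lambda>x. s * (h x * ramp' a b x) + t * (h x * ramp' c d x)) = (\<lambda>x. h x * \<psi> x)"
      by (simp add: \<psi>_def algebra_simps)
    ultimately show ?thesis by simp
  qed
  have "((\<lambda>x. g x * \<psi> x) has_integral (s * ((w b - w a) / (b - a)) + t * ((w d - w c) / (d - c)))) {-L..Y}"
    "((\<lambda>x. V x * \<psi> x) has_integral (s * ((F b - F a) / (b - a)) + t * ((F d - F c) / (d - c)))) {-L..Y}"
    using abcd by (intro psi inc; simp)+
  from has_integral_diff[OF has_integral_add[OF this(1) hphi] this(2)]
  have "((\<lambda>x. g x * \<psi> x + ((\<omega> * w x - (w x)^3) * \<phi> x + V x * \<psi> x) - V x * \<psi> x) has_integral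
     (s * ((w b - w a) / (b - a)) + t * ((w d - w c) / (d - c))) + (V Y * \<phi> Y - V (-L) * \<phi> (-L)) -
     (s * ((F b - F a) / (b - a)) + t * ((F d - F c) / (d - c)))) {-L..Y}" .
  then have "(?k has_integral
     (s * ((w b - w a) / (b - a)) + t * ((w d - w c) / (d - c))) + (V Y * \<phi> Y - V (-L) * \<phi> (-L)) -
     (s * ((F b - F a) / (b - a)) + t * ((F d - F c) / (d - c)))) {-L..Y}" by simp
  from has_integral_unique[OF k this]
  have "- (\<gamma> * w L * c0) = (s * ((w b - w a) / (b - a)) + t * ((w d - w c) / (d - c))) -
     (s * ((F b - F a) / (b - a)) + t * ((F d - F c) / (d - c)))"
    using z\<phi>[of Y] V(2) by (simp add: Y_def)
  moreover have "s * (((w b - F b) - (w a - F a)) / (b - a)) = s * ((w b - w a) / (b - a)) - s * ((F b - F a) / (b - a))"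
    "t * (((w d - F d) - (w c - F c)) / (d - c)) = t * ((w d - w c) / (d - c)) - t * ((F d - F c) / (d - c))"
  proof -
    have e: "(w y - F y) - (w x - F x) = (w y - w x) - (F y - F x)" for x y by simp
    show "s * (((w b - F b) - (w a - F a)) / (b - a)) = s * ((w b - w a) / (b - a)) - s * ((F b - F a) / (b - a))"
      "t * (((w d - F d) - (w c - F c)) / (d - c)) = t * ((w d - w c) / (d - c)) - t * ((F d - F c) / (d - c))"
      unfolding e by (simp_all only: diff_divide_distrib right_diff_distrib)
  qed
  ultimately show ?thesis by linarith
qed

text \<open>The du Bois-Reymond argument: w minus a second primitive F of the nonlinearity has equal
  difference quotients from the left end of each edge, hence is affine on each edge. The slopes on
  the two edges are tied by a test function that does not vanish at the vertex.\<close>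

theorem Euler_Lagrange:
  assumes w: "ground \<omega> \<gamma> L w g" and \<omega>\<gamma>: "0 \<le> \<omega>" "0 \<le> \<gamma>" and L: "0 < L"
  obtains vc vh where
    "\<And>x. x \<in> {-L..L} \<Longrightarrow> (w has_real_derivative vc x) (at x within {-L..L})"
    "\<And>x. x \<in> {-L..L} \<Longrightarrow> (vc has_real_derivative \<omega> * w x - (w x)^3) (at x within {-L..L})"
    "\<And>x. x \<in> {L..} \<Longrightarrow> (w has_real_derivative vh x) (at x within {L..})"
    "\<And>x. x \<in> {L..} \<Longrightarrow> (vh has_real_derivative \<omega> * w x - (w x)^3) (at x within {L..})"
    "vh L + vc (-L) - vc L = \<gamma> * w L"
proof -
  have wac: "ac_on {-L..} w g" using w by (simp add: ground_def admissible_def H1_pair_def)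
  have wc: "continuous_on {-L..} w" by (rule ac_on_continuous[OF wac]) (simp add: is_interval_ci)
  have prim: "((\<lambda>x. integral {-L..x} h) has_real_derivative h x) (at x within {-L..})"
    if h: "continuous_on {-L..} h" and x: "-L \<le> x" for h :: "real \<Rightarrow> real" and x
  proof -
    have "((\<lambda>x. integral {-L..x} h) has_real_derivative h x) (at x within {-L..x+1})"
      by (rule integral_has_real_derivative) (use x continuous_on_subset[OF h] in auto)
    moreover have "at x within {-L..x+1} = at x within {-L..}"
      by (rule at_within_nhd[of _ "{..<x+1}"]) auto
    ultimately show ?thesis by simp
  qed
  define V where "V = (\<lambda>x. integral {-L..x} (\<lambda>x. \<omega> * w x - (w x)^3))"
  define F where "F = (\<lambda>x. integral {-L..x} V)"
  have V: "(V has_real_derivative \<omega> * w x - (w x)^3) (at x within {-L..})" if "-L \<le> x" for x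
    unfolding V_def by (rule prim[OF _ that]) (intro continuous_intros wc)
  have Vc: "continuous_on {-L..} V" using V by (intro DERIV_continuous_on) auto
  have F: "(F has_real_derivative V x) (at x within {-L..})" if "-L \<le> x" for x
    unfolding F_def by (rule prim[OF Vc that])
  have V0: "V (-L) = 0" by (simp add: V_def)
  note test = ramp_test[OF w \<omega>\<gamma> L _ _ _ _ _ _ V V0 F]
  define z where "z = (\<lambda>x. w x - F x)"
  define kc where "kc = (z L - z (-L)) / (L - (-L))"
  define kh where "kh = (z (L + 1) - z L) / ((L + 1) - L)"
  have zc: "z x = z (-L) + kc * (x - (-L))" if x: "x \<in> {-L..L}" for x
  proof (cases "x = -L")
    case False
    then have "-L < x" using x by simp
    \<comment> \<open>The ramps rise on [-L, x] and on [-L, L]; their difference vanishes at both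
      ends of the loop.\<close>
    have "1 * ((z x - z (-L)) / (x - (-L))) + (-1) * kc + \<gamma> * w L * 0 = 0"
      unfolding z_def kc_def by (rule test) (use L x \<open>-L < x\<close> in \<open>auto simp: ramp_def\<close>)
    then have "(z x - z (-L)) / (x - (-L)) = kc" by simp
    then show ?thesis using \<open>-L < x\<close> by (simp add: field_simps)
  qed simp
  have zh: "z x = z L + kh * (x - L)" if x: "x \<in> {L..}" for x
  proof (cases "x = L")
    case False
    then have "L < x" using x by simp
    have "1 * ((z x - z L) / (x - L)) + (-1) * kh + \<gamma> * w L * 0 = 0"
      unfolding z_def kh_def by (rule test) (use L x \<open>L < x\<close> in \<open>auto simp: ramp_def\<close>)
    then have "(z x - z L) / (x - L) = kh" by simp
    then show ?thesis using \<open>L < x\<close> by (simp add: field_simps)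
  qed simp
  have kh: "kh = \<gamma> * w L"
  proof -
    \<comment> \<open>The test function equals 1 on the whole loop and falls linearly to 0 on
      [L, L + 1].\<close>
    have "(-1) * kh + 0 * kh + \<gamma> * w L * 1 = 0"
      unfolding z_def kh_def by (rule test) (use L in \<open>auto simp: ramp_def\<close>)
    then show ?thesis by simp
  qed
  show ?thesis
  proof (rule that[of "\<lambda>x. V x + kc" "\<lambda>x. V x + kh"])
    fix x assume x: "x \<in> {-L..L}"
    have dF: "(F has_real_derivative V x) (at x within {-L..L})"
      and dV: "(V has_real_derivative \<omega> * w x - (w x)^3) (at x within {-L..L})"
      by (rule DERIV_subset[OF F] DERIV_subset[OF V]; use x in auto)+
    have "((\<lambda>x. F x + (z (-L) + kc * (x - (-L)))) has_real_derivative V x + kc) (at x within {-L..L})"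
      using dF by (auto intro!: derivative_eq_intros)
    then show "(w has_real_derivative V x + kc) (at x within {-L..L})"
    proof (rule has_field_derivative_transform_within[of _ _ _ _ 1])
      fix y assume "y \<in> {-L..L}"
      then show "F y + (z (-L) + kc * (y - (-L))) = w y" using zc[of y] by (simp add: z_def)
    qed (use x in auto)
    show "((\<lambda>x. V x + kc) has_real_derivative \<omega> * w x - (w x)^3) (at x within {-L..L})"
      using dV by (auto intro!: derivative_eq_intros)
  next
    fix x assume x: "x \<in> {L..}"
    have dF: "(F has_real_derivative V x) (at x within {L..})"
      and dV: "(V has_real_derivative \<omega> * w x - (w x)^3) (at x within {L..})"
      by (rule DERIV_subset[OF F] DERIV_subset[OF V]; use x L in auto)+
    have "((\<lambda>x. F x + (z L + kh * (x - L))) has_real_derivative V x + kh) (at x within {L..})"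
      using dF by (auto intro!: derivative_eq_intros)
    then show "(w has_real_derivative V x + kh) (at x within {L..})"
    proof (rule has_field_derivative_transform_within[of _ _ _ _ 1])
      fix y assume "y \<in> {L..}"
      then show "F y + (z L + kh * (y - L)) = w y" using zh[of y] by (simp add: z_def)
    qed (use x in auto)
    show "((\<lambda>x. V x + kh) has_real_derivative \<omega> * w x - (w x)^3) (at x within {L..})"
      using dV by (auto intro!: derivative_eq_intros)
  next
    show "V L + kh + (V (-L) + kc) - (V L + kc) = \<gamma> * w L" using kh V0 by simp
  qed
qed

section \<open>Non-negative minimisers\<close>

lemma H1_pair_change_derivative:
  assumes X: "is_interval X" "closed X" and H: "H1_pair X f g" and ac: "ac_on X f g'"
    and m: "g' \<in> borel_measurable (lebesgue_on X)"
  shows "H1_pair X f g'" "integral\<^sup>L (lebesgue_on X) (\<lambda>x. (g' x)\<^sup>2) = integral\<^sup>L (lebesgue_on X) (\<lambda>x. (g x)\<^sup>2)"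
proof -
  have Xl: "X \<in> sets lebesgue" using X(2) by auto
  have ac0: "ac_on X f g" and f: "sq_integrable X f" and g: "sq_integrable X g" using H by (auto simp: H1_pair_def)
  have "{x \<in> X. g x \<noteq> g' x} \<in> null_sets lebesgue"
    using ac_on_derivative_unique[OF X ac0 ac] by (simp add: negligible_iff_null_sets)
  then have "AE x in lebesgue. \<not> (x \<in> {x \<in> X. g x \<noteq> g' x})" by (rule AE_not_in)
  then have "AE x in lebesgue. x \<in> X \<longrightarrow> (g x)\<^sup>2 = (g' x)\<^sup>2" by eventually_elim auto
  then have ae: "AE x in lebesgue_on X. (g x)\<^sup>2 = (g' x)\<^sup>2" using Xl by (simp add: AE_restrict_space_iff)
  have m2: "(\<lambda>x. (g' x)\<^sup>2) \<in> borel_measurable (lebesgue_on X)" "(\<lambda>x. (g x)\<^sup>2) \<in> borel_measurable (lebesgue_on X)"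
    using m g by (auto simp: sq_integrable_def)
  have "integrable (lebesgue_on X) (\<lambda>x. (g' x)\<^sup>2)"
    using integrable_cong_AE_imp[OF _ m2(1) ae] g by (auto simp: sq_integrable_def)
  then show "H1_pair X f g'" using ac f m by (simp add: H1_pair_def sq_integrable_def)
  show "integral\<^sup>L (lebesgue_on X) (\<lambda>x. (g' x)\<^sup>2) = integral\<^sup>L (lebesgue_on X) (\<lambda>x. (g x)\<^sup>2)"
    by (rule integral_cong_AE[OF m2]) (use ae in \<open>eventually_elim, simp\<close>)
qed

lemma C1_ac_on:
  assumes X: "is_interval X" and d: "\<And>x. x \<in> X \<Longrightarrow> (f has_real_derivative v x) (at x within X)" and c: "continuous_on X v"
  shows "ac_on X f v"
  unfolding ac_on_def
proof (intro ballI impI conjI)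
  fix x y assume xy: "x \<in> X" "y \<in> X" "x \<le> y"
  have sub: "{x..y} \<subseteq> X" using X xy unfolding is_interval_1 by (meson atLeastAtMost_iff subsetI)
  show "v absolutely_integrable_on {x..y}"
    by (intro absolutely_integrable_continuous_real continuous_on_subset[OF c sub])
  show "integral {x..y} v = f y - f x"
  proof (intro integral_unique fundamental_theorem_of_calculus xy)
    fix t assume "t \<in> {x..y}"
    then show "(f has_vector_derivative v t) (at t within {x..y})"
      unfolding has_real_derivative_iff_has_vector_derivative[symmetric]
      by (intro DERIV_subset[OF d sub]) (use sub in auto)
  qed
qed

text \<open>The modulus is approximated by \<open>sqrt (f\<^sup>2 + \<epsilon>\<^sup>2)\<close>.\<close>

lemma abs_ac_on:
  assumes X: "is_interval X" and d: "\<And>x. x \<in> X \<Longrightarrow> (f has_real_derivative v x) (at x within X)" and c: "continuous_on X v"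
  shows "ac_on X (\<lambda>x. \<bar>f x\<bar>) (\<lambda>x. sgn (f x) * v x)"
  unfolding ac_on_def
proof (intro ballI impI)
  fix x y assume xy: "x \<in> X" "y \<in> X" "x \<le> y"
  have sub: "{x..y} \<subseteq> X" using X xy unfolding is_interval_1 by (meson atLeastAtMost_iff subsetI)
  have vc: "continuous_on {x..y} v" using c sub by (rule continuous_on_subset)
  have df: "(f has_real_derivative v t) (at t within {x..y})" if "t \<in> {x..y}" for t
    by (rule DERIV_subset[OF d sub]) (use that sub in auto)
  have fc: "continuous_on {x..y} f" using df by (rule DERIV_continuous_on)
  define e where "e = (\<lambda>n::nat. inverse (real (Suc n)))"
  have e0: "e n > 0" for n by (simp add: e_def)
  have elim: "e \<longlonglongrightarrow> 0" unfolding e_def by (rule LIMSEQ_inverse_real_of_nat)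
  define h where "h = (\<lambda>n t. f t * v t / sqrt ((f t)\<^sup>2 + (e n)\<^sup>2))"
  have pos: "(f t)\<^sup>2 + (e n)\<^sup>2 > 0" for t n using e0[of n] by (simp add: add_nonneg_pos)
  have hc: "continuous_on {x..y} (h n)" for n
    unfolding h_def using e0[of n] by (intro continuous_intros fc vc) auto
  have hint: "(h n has_integral (sqrt ((f y)\<^sup>2 + (e n)\<^sup>2) - sqrt ((f x)\<^sup>2 + (e n)\<^sup>2))) {x..y}" for n
  proof (rule fundamental_theorem_of_calculus[OF xy(3)])
    fix t assume t: "t \<in> {x..y}"
    have D: "((\<lambda>t. sqrt ((f t)\<^sup>2 + (e n)\<^sup>2)) has_real_derivative inverse (sqrt ((f t)\<^sup>2 + (e n)\<^sup>2)) / 2 * (2 * f t * v t)) (at t within {x..y})"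
    proof (rule DERIV_chain2[where g = "\<lambda>t. (f t)\<^sup>2 + (e n)\<^sup>2", OF DERIV_real_sqrt[OF pos[of t n]]])
      have "((\<lambda>t. f t * f t + (e n)\<^sup>2) has_real_derivative (v t * f t + v t * f t) + 0) (at t within {x..y})"
        by (intro DERIV_add DERIV_mult DERIV_const df t)
      then show "((\<lambda>t. (f t)\<^sup>2 + (e n)\<^sup>2) has_real_derivative 2 * f t * v t) (at t within {x..y})"
        by (simp add: power2_eq_square mult_ac)
    qed
    have "inverse s / 2 * (2 * p * q) = p * q / s" for s p q :: real
      by (cases "s = 0") (auto simp: field_simps)
    from D[unfolded this] show "((\<lambda>t. sqrt ((f t)\<^sup>2 + (e n)\<^sup>2)) has_vector_derivative h n t) (at t within {x..y})"
      unfolding h_def has_real_derivative_iff_has_vector_derivative .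
  qed
  have inth: "integral\<^sup>L (lebesgue_on {x..y}) (h n) = sqrt ((f y)\<^sup>2 + (e n)\<^sup>2) - sqrt ((f x)\<^sup>2 + (e n)\<^sup>2)" for n
    using lebesgue_integral_eq_integral[OF continuous_imp_integrable_real[OF hc[of n]]] integral_unique[OF hint[of n]] by simp
  obtain B where B: "\<And>t. t \<in> {x..y} \<Longrightarrow> \<bar>v t\<bar> \<le> B"
  proof -
    have "bounded (v ` {x..y})" using compact_continuous_image[OF vc compact_Icc] by (rule compact_imp_bounded)
    then obtain B where "\<forall>z\<in>v ` {x..y}. norm z \<le> B" unfolding bounded_iff by blast
    then show ?thesis by (intro that[of B]) auto
  qed
  \<comment> \<open>Since sgn 0 = 0, the limit is right also where f vanishes.\<close>
  have hlim: "(\<lambda>n. h n t) \<longlonglongrightarrow> sgn (f t) * v t" for t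
  proof (cases "f t = 0")
    case True then show ?thesis by (simp add: h_def)
  next
    case False
    have "(\<lambda>n. f t * v t / sqrt ((f t)\<^sup>2 + (e n)\<^sup>2)) \<longlonglongrightarrow> f t * v t / sqrt ((f t)\<^sup>2 + 0\<^sup>2)"
      using False by (intro tendsto_intros elim) simp
    moreover have "f t * v t / sqrt ((f t)\<^sup>2 + 0\<^sup>2) = sgn (f t) * v t" using False by (simp add: sgn_if)
    ultimately show ?thesis by (simp add: h_def)
  qed
  have hb: "\<bar>h n t\<bar> \<le> B" if t: "t \<in> {x..y}" for n t
  proof -
    have "\<bar>f t\<bar> \<le> sqrt ((f t)\<^sup>2 + (e n)\<^sup>2)" by (rule real_le_rsqrt) simp
    then have "\<bar>f t\<bar> / sqrt ((f t)\<^sup>2 + (e n)\<^sup>2) \<le> 1" using pos[of t n] by simp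
    then have "\<bar>f t\<bar> / sqrt ((f t)\<^sup>2 + (e n)\<^sup>2) * \<bar>v t\<bar> \<le> 1 * B" using B[OF t] by (intro mult_mono) auto
    then show ?thesis by (simp add: h_def abs_mult)
  qed
  have hm: "h n \<in> borel_measurable (lebesgue_on {x..y})" for n
    using hc by (intro continuous_imp_measurable_on_sets_lebesgue) auto
  have l1: "(\<lambda>n. integral\<^sup>L (lebesgue_on {x..y}) (h n)) \<longlonglongrightarrow> integral\<^sup>L (lebesgue_on {x..y}) (\<lambda>t. sgn (f t) * v t)"
    by (rule lebesgue_on_bounded_convergence[OF hm hlim hb])
  have "(\<lambda>n. sqrt ((f y)\<^sup>2 + (e n)\<^sup>2) - sqrt ((f x)\<^sup>2 + (e n)\<^sup>2)) \<longlonglongrightarrow> sqrt ((f y)\<^sup>2 + 0\<^sup>2) - sqrt ((f x)\<^sup>2 + 0\<^sup>2)"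
    by (intro tendsto_intros elim)
  then have l2: "(\<lambda>n. sqrt ((f y)\<^sup>2 + (e n)\<^sup>2) - sqrt ((f x)\<^sup>2 + (e n)\<^sup>2)) \<longlonglongrightarrow> \<bar>f y\<bar> - \<bar>f x\<bar>" by simp
  have "integral\<^sup>L (lebesgue_on {x..y}) (\<lambda>t. sgn (f t) * v t) = \<bar>f y\<bar> - \<bar>f x\<bar>"
    by (rule LIMSEQ_unique[OF l1[unfolded inth] l2])
  moreover have "integrable (lebesgue_on {x..y}) (\<lambda>t. sgn (f t) * v t)"
  proof (rule Bochner_Integration.integrable_bound[where f = "\<lambda>_. B"])
    show "(\<lambda>t. sgn (f t) * v t) \<in> borel_measurable (lebesgue_on {x..y})"
      by (rule borel_measurable_LIMSEQ_metric[of h, OF hm]) (rule hlim)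
    show "AE t in lebesgue_on {x..y}. norm (sgn (f t) * v t) \<le> norm B"
    proof (rule AE_I2)
      fix t assume "t \<in> space (lebesgue_on {x..y})"
      then have b: "\<bar>v t\<bar> \<le> B" using B by simp
      then have "0 \<le> B" by (rule order_trans[OF abs_ge_zero])
      then show "norm (sgn (f t) * v t) \<le> norm B" using b by (simp add: abs_mult abs_sgn_eq)
    qed
  qed simp
  ultimately show "(\<lambda>t. sgn (f t) * v t) absolutely_integrable_on {x..y} \<and> integral {x..y} (\<lambda>t. sgn (f t) * v t) = \<bar>f y\<bar> - \<bar>f x\<bar>"
    using lebesgue_integral_eq_integral[of "{x..y}" "\<lambda>t. sgn (f t) * v t"] by (simp add: set_integrable_def integrable_restrict_space)
qed

text \<open>Derivatives are taken within each edge and are one-sided at the vertex. The last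
  equation is Kirchhoff's condition: the outgoing derivatives are vh L, vc (-L) and - vc L.\<close>

definition classical :: "real \<Rightarrow> real \<Rightarrow> real \<Rightarrow> (real \<Rightarrow> real) \<Rightarrow> (real \<Rightarrow> real) \<Rightarrow> (real \<Rightarrow> real) \<Rightarrow> bool" where
  "classical \<omega> \<gamma> L w vc vh \<longleftrightarrow>
    (\<forall>x\<in>{-L..L}. (w has_real_derivative vc x) (at x within {-L..L})) \<and>
    (\<forall>x\<in>{-L..L}. (vc has_real_derivative \<omega> * w x - (w x)^3) (at x within {-L..L})) \<and>
    (\<forall>x\<in>{L..}. (w has_real_derivative vh x) (at x within {L..})) \<and>
    (\<forall>x\<in>{L..}. (vh has_real_derivative \<omega> * w x - (w x)^3) (at x within {L..})) \<and>
    vh L + vc (-L) - vc L = \<gamma> * w L"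

text \<open>The derivative of w is unique up to null sets, so the continuous derivatives on the two
  edges may replace g without changing the quadratic part.\<close>

lemma ground_classical:
  assumes w: "ground \<omega> \<gamma> L w g" and \<omega>\<gamma>: "0 \<le> \<omega>" "0 \<le> \<gamma>" and L: "0 < L"
  obtains vc vh where "classical \<omega> \<gamma> L w vc vh" "H1_pair {-L..L} w vc" "H1_pair {L..} w vh"
    "ground \<omega> \<gamma> L w (\<lambda>x. if x \<le> L then vc x else vh x)"
proof -
  obtain vc vh where EL:
    "\<And>x. x \<in> {-L..L} \<Longrightarrow> (w has_real_derivative vc x) (at x within {-L..L})"
    "\<And>x. x \<in> {-L..L} \<Longrightarrow> (vc has_real_derivative \<omega> * w x - (w x)^3) (at x within {-L..L})"
    "\<And>x. x \<in> {L..} \<Longrightarrow> (w has_real_derivative vh x) (at x within {L..})"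
    "\<And>x. x \<in> {L..} \<Longrightarrow> (vh has_real_derivative \<omega> * w x - (w x)^3) (at x within {L..})"
    "vh L + vc (-L) - vc L = \<gamma> * w L"
    using Euler_Lagrange[OF assms, of thesis] by blast
  have cl: "classical \<omega> \<gamma> L w vc vh" using EL by (simp add: classical_def)
  have H: "H1_pair {-L..} w g" and adm: "admissible L w g" using w by (auto simp: ground_def admissible_def)
  have c: "continuous_on {-L..L} vc" "continuous_on {L..} vh"
    using DERIV_continuous_on[OF EL(2)] DERIV_continuous_on[OF EL(4)] by blast+
  have m: "vc \<in> borel_measurable (lebesgue_on {-L..L})" "vh \<in> borel_measurable (lebesgue_on {L..})"
    using c by (auto intro: continuous_imp_measurable_on_sets_lebesgue)
  have "H1_pair {-L..L} w g" by (rule H1_pair_subset[OF H]) auto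
  note 1 = H1_pair_change_derivative[OF is_interval_cc closed_atLeastAtMost this C1_ac_on[OF is_interval_cc EL(1) c(1)] m(1)]
  have "H1_pair {L..} w g" by (rule H1_pair_subset[OF H]) (use L in auto)
  note 2 = H1_pair_change_derivative[OF is_interval_ci closed_atLeast this C1_ac_on[OF is_interval_ci EL(3) c(2)] m(2)]
  define v where "v = (\<lambda>x. if x \<le> L then vc x else vh x)"
  have LL: "-L \<le> L" using L by simp
  have "H1_pair {-L..} (\<lambda>x. if x \<le> L then w x else w x) v"
    unfolding v_def by (rule H1_pair_glue[OF 1(1) 2(1) LL refl])
  then have Hv: "H1_pair {-L..} w v" by simp
  then have av: "admissible L w v" using adm by (simp add: admissible_def)
  have mv: "v \<in> borel_measurable (lebesgue_on {-L..})" and acv: "ac_on {-L..} w v" using Hv by (auto simp: H1_pair_def sq_integrable_def)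
  have "integral\<^sup>L (lebesgue_on {-L..}) (\<lambda>x. (v x)\<^sup>2) = integral\<^sup>L (lebesgue_on {-L..}) (\<lambda>x. (g x)\<^sup>2)"
    by (rule H1_pair_change_derivative(2)[OF is_interval_ci closed_atLeast H acv mv])
  then have "quad \<omega> \<gamma> L w v = quad \<omega> \<gamma> L w g"
    unfolding quad_def using admissible_integrable[OF adm] admissible_integrable[OF av] by simp
  then have "ground \<omega> \<gamma> L w v" using w av by (simp add: ground_def)
  then have "ground \<omega> \<gamma> L w (\<lambda>x. if x \<le> L then vc x else vh x)" by (simp only: v_def)
  then show ?thesis by (intro that[of vc vh] cl 1(1) 2(1))
qed

text \<open>An upper bound on the quadratic part suffices, because the lower bound is the defining
  inequality of \<Lambda>.\<close>

lemma groundI: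
  assumes "admissible L w g" "0 < best_const \<omega> \<gamma> L" "quart L w = best_const \<omega> \<gamma> L" "quad \<omega> \<gamma> L w g \<le> best_const \<omega> \<gamma> L"
    "0 \<le> \<omega>" "0 \<le> \<gamma>"
  shows "ground \<omega> \<gamma> L w g"
proof -
  let ?\<Lambda> = "best_const \<omega> \<gamma> L"
  have "?\<Lambda>\<^sup>2 \<le> (quad \<omega> \<gamma> L w g)\<^sup>2" using best_const_le[OF assms(1), of \<omega> \<gamma>] assms(3) by (simp add: power2_eq_square)
  then have "?\<Lambda> \<le> quad \<omega> \<gamma> L w g" using quad_nonneg[OF assms(5,6)] by (rule power2_le_imp_le)
  then show ?thesis using assms by (simp add: ground_def)
qed

text \<open>Passing to the modulus does not increase the quadratic part and preserves the quartic
  one. The derivative of |w| is computed from that of a continuously differentiable w, so the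
  Euler-Lagrange equation comes before.\<close>

lemma ground_abs:
  assumes w: "ground \<omega> \<gamma> L w g" and \<omega>\<gamma>: "0 \<le> \<omega>" "0 \<le> \<gamma>" and L: "0 < L"
  obtains g' where "ground \<omega> \<gamma> L (\<lambda>x. \<bar>w x\<bar>) g'"
proof -
  obtain vc vh where cl: "classical \<omega> \<gamma> L w vc vh" and H: "H1_pair {-L..L} w vc" "H1_pair {L..} w vh"
    and gv: "ground \<omega> \<gamma> L w (\<lambda>x. if x \<le> L then vc x else vh x)"
    by (rule ground_classical[OF assms])
  define v where "v = (\<lambda>x. if x \<le> L then vc x else vh x)"
  have c: "continuous_on {-L..L} vc" "continuous_on {L..} vh" 
  proof -
    have "(vc has_real_derivative \<omega> * w x - (w x)^3) (at x within {-L..L})" if "x \<in> {-L..L}" for x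
      using cl that by (simp add: classical_def)
    then show "continuous_on {-L..L} vc" by (rule DERIV_continuous_on)
    have "(vh has_real_derivative \<omega> * w x - (w x)^3) (at x within {L..})" if "x \<in> {L..}" for x
      using cl that by (simp add: classical_def)
    then show "continuous_on {L..} vh" by (rule DERIV_continuous_on)
  qed
  have ac: "ac_on {-L..L} (\<lambda>x. \<bar>w x\<bar>) (\<lambda>x. sgn (w x) * vc x)" "ac_on {L..} (\<lambda>x. \<bar>w x\<bar>) (\<lambda>x. sgn (w x) * vh x)"
    using cl c unfolding classical_def by (auto intro!: abs_ac_on simp: is_interval_cc is_interval_ci)
  have sq: "sq_integrable X (\<lambda>x. \<bar>w x\<bar>)" "sq_integrable X (\<lambda>x. sgn (w x) * u x)" if H: "H1_pair X w u" for X u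
  proof -
    show "sq_integrable X (\<lambda>x. \<bar>w x\<bar>)" using H by (auto simp: H1_pair_def sq_integrable_def)
    have m: "(\<lambda>x. sgn (w x) * u x) \<in> borel_measurable (lebesgue_on X)" using H by (auto simp: H1_pair_def sq_integrable_def)
    moreover have "integrable (lebesgue_on X) (\<lambda>x. (sgn (w x) * u x)\<^sup>2)"
    proof (rule Bochner_Integration.integrable_bound[where f = "\<lambda>x. (u x)\<^sup>2"])
      show "integrable (lebesgue_on X) (\<lambda>x. (u x)\<^sup>2)" using H by (simp add: H1_pair_def sq_integrable_def)
      show "(\<lambda>x. (sgn (w x) * u x)\<^sup>2) \<in> borel_measurable (lebesgue_on X)" by (intro borel_measurable_power m)
    qed (auto simp: power_mult_distrib sgn_if)
    ultimately show "sq_integrable X (\<lambda>x. sgn (w x) * u x)" by (simp add: sq_integrable_def)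
  qed
  have Ha: "H1_pair {-L..L} (\<lambda>x. \<bar>w x\<bar>) (\<lambda>x. sgn (w x) * vc x)" "H1_pair {L..} (\<lambda>x. \<bar>w x\<bar>) (\<lambda>x. sgn (w x) * vh x)"
    using ac sq[OF H(1)] sq[OF H(2)] by (auto simp: H1_pair_def)
  have LL: "-L \<le> L" using L by simp
  have "H1_pair {-L..} (\<lambda>x. if x \<le> L then \<bar>w x\<bar> else \<bar>w x\<bar>) (\<lambda>x. if x \<le> L then sgn (w x) * vc x else sgn (w x) * vh x)"
    by (rule H1_pair_glue[OF Ha LL refl])
  moreover have "(\<lambda>x. if x \<le> L then sgn (w x) * vc x else sgn (w x) * vh x) = (\<lambda>x. sgn (w x) * v x)" by (auto simp: v_def)
  ultimately have "H1_pair {-L..} (\<lambda>x. \<bar>w x\<bar>) (\<lambda>x. sgn (w x) * v x)" by simp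
  moreover have av: "admissible L w v" using gv by (simp add: ground_def v_def)
  ultimately have adm: "admissible L (\<lambda>x. \<bar>w x\<bar>) (\<lambda>x. sgn (w x) * v x)" by (simp add: admissible_def)
  have q: "quart L (\<lambda>x. \<bar>w x\<bar>) = best_const \<omega> \<gamma> L" using gv by (simp add: ground_def quart_def)
  note i = admissible_integrable[OF av] and i' = admissible_integrable[OF adm]
  have "quad \<omega> \<gamma> L (\<lambda>x. \<bar>w x\<bar>) (\<lambda>x. sgn (w x) * v x) \<le> quad \<omega> \<gamma> L w v"
    unfolding quad_def
  proof (intro add_mono integral_mono)
    show "integrable (lebesgue_on {-L..}) (\<lambda>x. (sgn (w x) * v x)\<^sup>2 + \<omega> * \<bar>w x\<bar>\<^sup>2)" using i' by simp
    show "integrable (lebesgue_on {-L..}) (\<lambda>x. (v x)\<^sup>2 + \<omega> * (w x)\<^sup>2)" using i by simp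
  qed (auto simp: power_mult_distrib sgn_if)
  then show ?thesis using gv by (intro that[OF groundI[OF adm _ q _ \<omega>\<gamma>]]) (auto simp: ground_def v_def)
qed

lemma ground_exists:
  assumes \<omega>: "\<omega> = \<mu>\<^sup>2" and \<mu>: "\<mu> > 0" and \<gamma>: "0 \<le> \<gamma>" and L: "0 < L"
    and test: "admissible L f0 g0" "(quad \<omega> \<gamma> L f0 g0)\<^sup>2 < 16/3 * \<mu>^3 * quart L f0"
  obtains w g where "ground \<omega> \<gamma> L w g" "\<And>x. 0 \<le> w x" "best_const \<omega> \<gamma> L < 16/3 * \<mu>^3"
proof -
  let ?\<Lambda> = "best_const \<omega> \<gamma> L"
  obtain f g where fg: "admissible L f g" "0 < quart L f" "(quad \<omega> \<gamma> L f g)\<^sup>2 = ?\<Lambda> * quart L f" and \<Lambda>R: "?\<Lambda> < 16/3 * \<mu>^3"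
    by (rule minimizer_exists[OF assms])
  note i = admissible_integrable[OF fg(1)]
  have \<omega>0: "0 < \<omega>" using \<omega> \<mu> by simp
  have H: "H1_pair {-L..} f g" using fg(1) by (simp add: admissible_def)
  define C where "C = 2 * (integral\<^sup>L (lebesgue_on {-L..}) (\<lambda>x. (f x)\<^sup>2) + integral\<^sup>L (lebesgue_on {-L..}) (\<lambda>x. (g x)\<^sup>2))"
  have "quart L f \<le> integral\<^sup>L (lebesgue_on {-L..}) (\<lambda>x. C * (f x)\<^sup>2)"
    unfolding quart_def
  proof (rule integral_mono)
    fix x assume "x \<in> space (lebesgue_on {-L..})"
    then have "(f x)\<^sup>2 \<le> C" using H1_pair_bound[OF H, of x] by (simp add: C_def)
    then have "(f x)\<^sup>2 * (f x)\<^sup>2 \<le> C * (f x)\<^sup>2" by (rule mult_right_mono) simp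
    moreover have "(f x)^4 = (f x)\<^sup>2 * (f x)\<^sup>2" by (simp flip: power_add)
    ultimately show "(f x)^4 \<le> C * (f x)\<^sup>2" by (simp only:)
  qed (use i in auto)
  then have "integral\<^sup>L (lebesgue_on {-L..}) (\<lambda>x. (f x)\<^sup>2) \<noteq> 0" using fg(2) by auto
  moreover have "0 \<le> integral\<^sup>L (lebesgue_on {-L..}) (\<lambda>x. (f x)\<^sup>2)" by simp
  ultimately have "0 < \<omega> * integral\<^sup>L (lebesgue_on {-L..}) (\<lambda>x. (f x)\<^sup>2)" using \<omega>0 by (simp add: less_le)
  moreover have "quad \<omega> \<gamma> L f g = integral\<^sup>L (lebesgue_on {-L..}) (\<lambda>x. (g x)\<^sup>2) + \<omega> * integral\<^sup>L (lebesgue_on {-L..}) (\<lambda>x. (f x)\<^sup>2) + \<gamma> * (f L)\<^sup>2"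
    unfolding quad_def using i by simp
  moreover have "0 \<le> \<gamma> * (f L)\<^sup>2" "0 \<le> integral\<^sup>L (lebesgue_on {-L..}) (\<lambda>x. (g x)\<^sup>2)" using \<gamma> by auto
  ultimately have q0: "0 < quad \<omega> \<gamma> L f g" by linarith
  then have "0 < ?\<Lambda> * quart L f" using fg(3) by (metis zero_less_power)
  then have \<Lambda>0: "0 < ?\<Lambda>" using fg(2) by (simp add: zero_less_mult_iff)
  \<comment> \<open>Scaling by c makes both parts equal to Q^2 / B = \<Lambda>.\<close>
  define c where "c = sqrt (quad \<omega> \<gamma> L f g / quart L f)"
  have c2: "c\<^sup>2 = quad \<omega> \<gamma> L f g / quart L f" using q0 fg(2) by (simp add: c_def)
  have "c\<^sup>2 * quad \<omega> \<gamma> L f g = ?\<Lambda>" using fg(2,3) unfolding c2 by (simp add: power2_eq_square)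
  then have q1: "quad \<omega> \<gamma> L (\<lambda>x. c * f x) (\<lambda>x. c * g x) = ?\<Lambda>" by (simp only: quad_scale)
  have "c^4 * quart L f = (c\<^sup>2)\<^sup>2 * quart L f" by simp
  also have "\<dots> = ?\<Lambda>" unfolding c2 power_divide fg(3) using fg(2) by (simp add: power2_eq_square)
  finally have q2: "quart L (\<lambda>x. c * f x) = ?\<Lambda>" by (simp only: quart_scale)
  have "ground \<omega> \<gamma> L (\<lambda>x. c * f x) (\<lambda>x. c * g x)"
    using admissible_scale[OF fg(1)] \<Lambda>0 q1 q2 by (simp add: ground_def)
  then obtain g' where "ground \<omega> \<gamma> L (\<lambda>x. \<bar>c * f x\<bar>) g'"
    by (rule ground_abs[OF _ less_imp_le[OF \<omega>0] \<gamma> L])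
  then show ?thesis by (rule that[OF _ _ \<Lambda>R]) simp
qed

section \<open>Translation to the tadpole graph\<close>

lemma lebesgue_on_shift:
  fixes h :: "real \<Rightarrow> real"
  shows "integrable (lebesgue_on {0..}) (\<lambda>x. h (x + c)) \<longleftrightarrow> integrable (lebesgue_on {c..}) h"
    "integral\<^sup>L (lebesgue_on {0..}) (\<lambda>x. h (x + c)) = integral\<^sup>L (lebesgue_on {c..}) h"
proof -
  have e: "indicator {0..} x *\<^sub>R h (x + c) = (\<lambda>x. indicator {c..} x *\<^sub>R h x) (c + 1 * x)" for x
    by (auto simp: indicator_def add.commute)
  show "integrable (lebesgue_on {0..}) (\<lambda>x. h (x + c)) \<longleftrightarrow> integrable (lebesgue_on {c..}) h"
    using lebesgue_integrable_real_affine_iff[of 1 "\<lambda>x. indicator {c..} x *\<^sub>R h x" c]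
    by (simp add: integrable_restrict_space e del: scaleR_conv_of_real real_scaleR_def)
  show "integral\<^sup>L (lebesgue_on {0..}) (\<lambda>x. h (x + c)) = integral\<^sup>L (lebesgue_on {c..}) h"
    using lebesgue_integral_real_affine[of 1 "\<lambda>x. indicator {c..} x *\<^sub>R h x" c]
    by (simp add: integral_restrict_space e del: scaleR_conv_of_real real_scaleR_def)
qed

lemma measurable_lebesgue_on_shift:
  fixes h :: "real \<Rightarrow> real"
  assumes "h \<in> borel_measurable (lebesgue_on {c..})"
  shows "(\<lambda>x. h (x + (c - d))) \<in> borel_measurable (lebesgue_on {d..})"
proof -
  have "(\<lambda>x. if x \<in> {c..} then h x else 0) \<in> borel_measurable lebesgue"
    using assms by (subst borel_measurable_if) auto
  from borel_measurable_affine[OF this, of 1 "c - d"]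
  have "(\<lambda>x. if c \<le> (c - d) + x then h ((c - d) + x) else 0) \<in> borel_measurable lebesgue" by (simp cong: if_cong)
  then have "(\<lambda>x. if c \<le> (c - d) + x then h ((c - d) + x) else 0) \<in> borel_measurable (lebesgue_on {d..})"
    by (rule measurable_restrict_space1)
  then show ?thesis by (rule measurable_cong[THEN iffD1, rotated]) (auto simp: add.commute)
qed

lemma sq_integrable_shift:
  assumes "sq_integrable {c..} f"
  shows "sq_integrable {d..} (\<lambda>x. f (x + (c - d)))"
proof -
  have "integrable (lebesgue_on {0..}) (\<lambda>x. (f (x + c))\<^sup>2)"
    using assms lebesgue_on_shift(1)[of "\<lambda>x. (f x)\<^sup>2" c] by (simp add: sq_integrable_def)
  then have "integrable (lebesgue_on {0..}) (\<lambda>x. (\<lambda>x. (f (x + (c - d)))\<^sup>2) (x + d))" by simp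
  then have "integrable (lebesgue_on {d..}) (\<lambda>x. (f (x + (c - d)))\<^sup>2)"
    by (rule lebesgue_on_shift(1)[of "\<lambda>x. (f (x + (c - d)))\<^sup>2" d, THEN iffD1])
  then show ?thesis using assms measurable_lebesgue_on_shift[of f c d] by (simp add: sq_integrable_def)
qed

lemma H1_pair_shift:
  assumes "H1_pair {c..} f g"
  shows "H1_pair {d..} (\<lambda>x. f (x + (c - d))) (\<lambda>x. g (x + (c - d)))"
proof -
  have ac: "ac_on {c..} f g" and sq: "sq_integrable {c..} g" using assms by (auto simp: H1_pair_def)
  have "ac_on {d..} (\<lambda>x. f (x + (c - d))) (\<lambda>x. g (x + (c - d)))"
    unfolding ac_on_def
  proof (intro ballI impI conjI)
    fix x y assume xy: "x \<in> {d..}" "y \<in> {d..}" "x \<le> y"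
    have "sq_integrable {x..y} (\<lambda>x. g (x + (c - d)))"
      by (rule sq_integrable_subset[OF sq_integrable_shift[OF sq, of d]]) (use xy in auto)
    then show "(\<lambda>x. g (x + (c - d))) absolutely_integrable_on {x..y}" by (rule sq_integrable_imp_absolutely_integrable)
    have "(g has_integral (f (y + (c - d)) - f (x + (c - d)))) (cbox (x + (c - d)) (y + (c - d)))"
      using ac_onD[OF ac, of "x + (c - d)" "y + (c - d)"] xy by (simp add: has_integral_integrable_integral)
    from has_integral_affinity[OF this, of 1 "c - d"]
    have "((\<lambda>x. g (x + (c - d))) has_integral (f (y + (c - d)) - f (x + (c - d)))) {x..y}" using xy by simp
    then show "integral {x..y} (\<lambda>x. g (x + (c - d))) = f (y + (c - d)) - f (x + (c - d))" by (rule integral_unique)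
  qed
  then show ?thesis using assms sq_integrable_shift[of c _ d] by (simp add: H1_pair_def)
qed

text \<open>Norms on the graph are integrals over open edges, whereas the glued half-line is closed;
  the difference is a finite set.\<close>

lemma lebesgue_on_open_closed:
  fixes h :: "real \<Rightarrow> real"
  assumes Y: "Y \<in> sets lebesgue" "finite N" "X = Y \<union> N"
  shows "h \<in> borel_measurable (lebesgue_on Y) \<longleftrightarrow> h \<in> borel_measurable (lebesgue_on X)"
    "integrable (lebesgue_on Y) h \<longleftrightarrow> integrable (lebesgue_on X) h"
    "integrable (lebesgue_on X) h \<Longrightarrow> integral\<^sup>L (lebesgue_on Y) h = integral\<^sup>L (lebesgue_on X) h"
proof -
  have "negligible N" using Y(2) by (rule negligible_finite)
  then have N: "N \<in> sets lebesgue" "N \<in> null_sets lebesgue" by (auto simp: negligible_iff_null_sets)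
  have sing: "{n} \<in> sets lebesgue" for n :: real by (simp add: negligible_imp_sets)
  have X: "X \<in> sets lebesgue" using Y N by auto
  define N' where "N' = N - Y"
  have N': "N' \<in> sets lebesgue" "finite N'" "X = Y \<union> N'" "Y \<inter> N' = {}" using Y N by (auto simp: N'_def)
  have m: "h \<in> borel_measurable (lebesgue_on X)" if "h \<in> borel_measurable (lebesgue_on Y)"
  proof -
    have 1: "(\<lambda>x. if x \<in> Y then h x else 0) \<in> borel_measurable lebesgue" using that Y(1) by (subst borel_measurable_if) auto
    have 2: "(\<lambda>x. \<Sum>n\<in>N'. h n * indicator {n} x) \<in> borel_measurable lebesgue" by (intro borel_measurable_sum borel_measurable_times borel_measurable_indicator sing) auto
    have "(\<lambda>x. (if x \<in> Y then h x else 0) + (\<Sum>n\<in>N'. h n * indicator {n} x)) \<in> borel_measurable (lebesgue_on X)"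
      by (intro measurable_restrict_space1 borel_measurable_add 1 2)
    then show ?thesis
    proof (rule measurable_cong[THEN iffD1, rotated])
      fix x assume "x \<in> space (lebesgue_on X)"
      then have x: "x \<in> Y \<union> N'" using N' by simp
      have "(\<Sum>n\<in>N'. h n * indicator {n} x) = (\<Sum>n\<in>N'. if n = x then h n else 0)"
        by (intro sum.cong) (auto simp: indicator_def)
      also have "\<dots> = (if x \<in> N' then h x else 0)" using N'(2) by simp
      finally show "(if x \<in> Y then h x else 0) + (\<Sum>n\<in>N'. h n * indicator {n} x) = h x" using x N'(4) by auto
    qed
  qed
  then show "h \<in> borel_measurable (lebesgue_on Y) \<longleftrightarrow> h \<in> borel_measurable (lebesgue_on X)"
    using measurable_restrict_mono[of h lebesgue X borel Y] Y(3) by blast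
  have ind: "AE x in lebesgue. indicator Y x *\<^sub>R h x = indicator X x *\<^sub>R h x"
    by (rule AE_I'[OF N(2)]) (use Y(3) in \<open>auto simp: indicator_def\<close>)
  show i: "integrable (lebesgue_on Y) h \<longleftrightarrow> integrable (lebesgue_on X) h"
  proof
    assume "integrable (lebesgue_on X) h"
    then show "integrable (lebesgue_on Y) h" by (rule integrable_lebesgue_on_subset) (use X Y in auto)
  next
    assume i: "integrable (lebesgue_on Y) h"
    have "integrable (lebesgue_on N') h"
    proof -
      have "integrable lebesgue (\<lambda>x. indicator N' x *\<^sub>R h x)"
      proof (rule integrable_cong_AE_imp[of lebesgue "\<lambda>_. 0"])
        have "h \<in> borel_measurable (lebesgue_on X)" using m i by blast
        then have "h \<in> borel_measurable (lebesgue_on N')" by (rule measurable_restrict_mono) (use N' in auto)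
        then show "(\<lambda>x. indicator N' x *\<^sub>R h x) \<in> borel_measurable lebesgue"
          using N'(1) by (simp add: borel_measurable_restrict_space_iff)
        have "N' \<in> null_sets lebesgue" using N(2) unfolding N'_def by (rule null_sets_subset) (use N' in \<open>auto simp: N'_def\<close>)
        then show "AE x in lebesgue. 0 = indicator N' x *\<^sub>R h x"
          by (rule AE_I') (auto simp: indicator_def)
      qed simp
      then show ?thesis using N'(1) by (simp add: integrable_restrict_space)
    qed
    from lebesgue_on_integral_Un(1)[OF i this] show "integrable (lebesgue_on X) h" using N' Y(1) by simp
  qed
  assume "integrable (lebesgue_on X) h"
  then have "(\<lambda>x. indicator X x *\<^sub>R h x) \<in> borel_measurable lebesgue" "(\<lambda>x. indicator Y x *\<^sub>R h x) \<in> borel_measurable lebesgue"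
    using i X Y(1) by (auto simp: integrable_restrict_space dest: borel_measurable_integrable)
  then show "integral\<^sup>L (lebesgue_on Y) h = integral\<^sup>L (lebesgue_on X) h"
    using X Y(1) ind by (simp only: integral_restrict_space sets.Int_space_eq2) (rule integral_cong_AE, auto)
qed

lemma sq_integrable_open_closed:
  assumes "Y \<in> sets lebesgue" "finite N" "X = Y \<union> N"
  shows "sq_integrable Y f \<longleftrightarrow> sq_integrable X f"
  unfolding sq_integrable_def using lebesgue_on_open_closed(1,2)[OF assms] by blast

lemma edge_closures:
  fixes L :: real
  assumes "0 < L"
  shows "closure {-L<..<L} = {-L..L}" "closure {0<..} = {0::real..}"
    "{-L..L} = {-L<..<L} \<union> {-L, L}" "{0..} = {0<..} \<union> {0::real}"
proof -
  show "closure {-L<..<L} = {-L..L}" using assms by (intro closure_greaterThanLessThan) simp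
  show "closure {0<..} = {0::real..}" by (rule closure_greaterThan)
qed (use assms in auto)

text \<open>At L the value of the loop is taken; on \<open>H1D\<close> it coincides with that of the
  half-line.\<close>

definition glue :: "real \<Rightarrow> (real \<Rightarrow> 'a) \<times> (real \<Rightarrow> 'a) \<Rightarrow> real \<Rightarrow> 'a" where
  "glue L v x = (if x \<le> L then fst v x else snd v (x - L))"

lemma tadpole_norm_pow_glue:
  assumes L: "0 < L" and i: "integrable (lebesgue_on {-L..L}) (\<lambda>x. cmod (fst v x) ^ p)"
    "integrable (lebesgue_on {0..}) (\<lambda>x. cmod (snd v x) ^ p)"
  shows "tadpole_norm_pow p L v = integral\<^sup>L (lebesgue_on {-L..}) (\<lambda>x. cmod (glue L v x) ^ p)"
proof -
  have i2: "integrable (lebesgue_on {L..}) (\<lambda>x. cmod (snd v (x - L)) ^ p)"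
    using lebesgue_on_shift(1)[of "\<lambda>x. cmod (snd v (x - L)) ^ p" L] i(2) by simp
  have "tadpole_norm_pow p L v = integral\<^sup>L (lebesgue_on {-L<..<L}) (\<lambda>x. cmod (fst v x) ^ p) + integral\<^sup>L (lebesgue_on {0<..}) (\<lambda>x. cmod (snd v x) ^ p)"
    unfolding tadpole_norm_pow_def by (simp add: Lp_norm_pow_lebesgue_on)
  also have "integral\<^sup>L (lebesgue_on {-L<..<L}) (\<lambda>x. cmod (fst v x) ^ p) = integral\<^sup>L (lebesgue_on {-L..L}) (\<lambda>x. cmod (fst v x) ^ p)"
    by (rule lebesgue_on_open_closed(3)[OF _ _ edge_closures(3)[OF L] i(1)]) auto
  also have "integral\<^sup>L (lebesgue_on {0<..}) (\<lambda>x. cmod (snd v x) ^ p) = integral\<^sup>L (lebesgue_on {0..}) (\<lambda>x. cmod (snd v x) ^ p)"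
    by (rule lebesgue_on_open_closed(3)[OF _ _ edge_closures(4)[OF L] i(2)]) auto
  also have "\<dots> = integral\<^sup>L (lebesgue_on {L..}) (\<lambda>x. cmod (snd v (x - L)) ^ p)"
    using lebesgue_on_shift(2)[of "\<lambda>x. cmod (snd v (x - L)) ^ p" L] by simp
  also have "integral\<^sup>L (lebesgue_on {-L..L}) (\<lambda>x. cmod (fst v x) ^ p) + integral\<^sup>L (lebesgue_on {L..}) (\<lambda>x. cmod (snd v (x - L)) ^ p)
    = integral\<^sup>L (lebesgue_on {-L..}) (\<lambda>x. if x \<le> L then cmod (fst v x) ^ p else cmod (snd v (x - L)) ^ p)"
    by (rule lebesgue_on_integral_glue(2)[symmetric, OF i(1) i2]) (use L in simp)
  also have "(\<lambda>x. if x \<le> L then cmod (fst v x) ^ p else cmod (snd v (x - L)) ^ p) = (\<lambda>x. cmod (glue L v x) ^ p)"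
    by (auto simp: glue_def)
  finally show ?thesis .
qed

lemma glue_admissible:
  fixes F G :: "(real \<Rightarrow> complex) \<times> (real \<Rightarrow> complex)" and P :: "complex \<Rightarrow> real"
  assumes L: "0 < L" and c: "H1_pair {-L..L} (\<lambda>x. P (fst F x)) (\<lambda>x. P (fst G x))"
    and h: "H1_pair {0..} (\<lambda>x. P (snd F x)) (\<lambda>x. P (snd G x))" and v: "fst F (-L) = fst F L" "fst F L = snd F 0"
  shows "admissible L (\<lambda>x. P (glue L F x)) (\<lambda>x. P (glue L G x))"
proof -
  have "H1_pair {L..} (\<lambda>x. P (snd F (x + (0 - L)))) (\<lambda>x. P (snd G (x + (0 - L))))" by (rule H1_pair_shift[OF h])
  then have h': "H1_pair {L..} (\<lambda>x. P (snd F (x - L))) (\<lambda>x. P (snd G (x - L)))" by simp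
  have "H1_pair {-L..} (\<lambda>x. if x \<le> L then P (fst F x) else P (snd F (x - L))) (\<lambda>x. if x \<le> L then P (fst G x) else P (snd G (x - L)))"
    by (rule H1_pair_glue[OF c h']) (use L v in auto)
  moreover have "(\<lambda>x. if x \<le> L then P (fst F x) else P (snd F (x - L))) = (\<lambda>x. P (glue L F x))"
    "(\<lambda>x. if x \<le> L then P (fst G x) else P (snd G (x - L))) = (\<lambda>x. P (glue L G x))" by (auto simp: glue_def)
  ultimately show ?thesis using v L by (simp add: admissible_def glue_def)
qed

lemma H1_on_H1_pair:
  assumes J: "open J" "is_interval J" "J \<noteq> {}" and X: "closure J = X" "X = J \<union> N" "finite N" and F: "H1_on J F"
  shows "H1_pair X (\<lambda>x. Re (F x)) (\<lambda>x. Re (weak_deriv J F x))" "H1_pair X (\<lambda>x. Im (F x)) (\<lambda>x. Im (weak_deriv J F x))"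
proof -
  have Jl: "J \<in> sets lebesgue" using J(1) by auto
  have "L2_on J F" "L2_on J (weak_deriv J F)" using F weak_deriv_props(1)[OF F] by (auto simp: H1_on_def)
  then show "H1_pair X (\<lambda>x. Re (F x)) (\<lambda>x. Re (weak_deriv J F x))" "H1_pair X (\<lambda>x. Im (F x)) (\<lambda>x. Im (weak_deriv J F x))"
    using H1_on_weak_deriv_ac_on[OF J F] sq_integrable_open_closed[OF Jl X(3,2)]
    unfolding H1_pair_def L2_on_iff_Re_Im[OF Jl] X(1) by auto
qed

section \<open>The functionals on complex-valued functions\<close>

definition tadpole_quad :: "real \<Rightarrow> real \<Rightarrow> real \<Rightarrow> tadpole_fun \<Rightarrow> real" where
  "tadpole_quad \<omega> \<gamma> L v = tadpole_norm_pow 2 L (tadpole_deriv L v) + \<gamma> * (cmod (vertex_value v))\<^sup>2 + \<omega> * tadpole_norm_pow 2 L v"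

lemma action_quad: "action \<omega> \<gamma> L v = tadpole_quad \<omega> \<gamma> L v / 2 - tadpole_norm_pow 4 L v / 4"
  by (simp add: action_def tadpole_quad_def)

lemma nehari_quad: "nehari_functional \<omega> \<gamma> L v = tadpole_quad \<omega> \<gamma> L v - tadpole_norm_pow 4 L v"
  by (simp add: nehari_functional_def tadpole_quad_def)

text \<open>Real and imaginary part are admissible separately. The quadratic part is the sum of
  theirs, while the quartic part couples them.\<close>

lemma H1D_glue:
  assumes L: "0 < L" and v: "v \<in> H1D L"
  defines "w \<equiv> glue L v" and "g \<equiv> glue L (tadpole_deriv L v)"
  shows "admissible L (\<lambda>x. Re (w x)) (\<lambda>x. Re (g x))" "admissible L (\<lambda>x. Im (w x)) (\<lambda>x. Im (g x))"
    "tadpole_quad \<omega> \<gamma> L v = quad \<omega> \<gamma> L (\<lambda>x. Re (w x)) (\<lambda>x. Re (g x)) + quad \<omega> \<gamma> L (\<lambda>x. Im (w x)) (\<lambda>x. Im (g x))"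
    "tadpole_norm_pow 4 L v = integral\<^sup>L (lebesgue_on {-L..}) (\<lambda>x. ((Re (w x))\<^sup>2 + (Im (w x))\<^sup>2)\<^sup>2)"
proof -
  let ?M = "lebesgue_on {-L..}" and ?D = "tadpole_deriv L v"
  have H: "H1_on {-L<..<L} (fst v)" "H1_on {0<..} (snd v)" and e: "fst v (-L) = fst v L" "fst v L = snd v 0"
    using v by (auto simp: H1D_def)
  have ne: "{-L<..<L} \<noteq> {}" using L by simp
  have ne0: "{0::real<..} \<noteq> {}" by simp
  note c = H1_on_H1_pair[OF open_greaterThanLessThan is_interval_oo ne edge_closures(1)[OF L] edge_closures(3)[OF L] _ H(1)]
  note h = H1_on_H1_pair[OF open_greaterThan is_interval_oi ne0 edge_closures(2)[OF L] edge_closures(4)[OF L] _ H(2)]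
  have pc: "H1_pair {-L..L} (\<lambda>x. Re (fst v x)) (\<lambda>x. Re (fst ?D x))" "H1_pair {-L..L} (\<lambda>x. Im (fst v x)) (\<lambda>x. Im (fst ?D x))"
    using c by (simp_all add: tadpole_deriv_def)
  have ph: "H1_pair {0..} (\<lambda>x. Re (snd v x)) (\<lambda>x. Re (snd ?D x))" "H1_pair {0..} (\<lambda>x. Im (snd v x)) (\<lambda>x. Im (snd ?D x))"
    using h by (simp_all add: tadpole_deriv_def)
  show a: "admissible L (\<lambda>x. Re (w x)) (\<lambda>x. Re (g x))" "admissible L (\<lambda>x. Im (w x)) (\<lambda>x. Im (g x))"
    unfolding w_def g_def by (rule glue_admissible[OF L pc(1) ph(1) e] glue_admissible[OF L pc(2) ph(2) e])+
  note i1 = admissible_integrable[OF a(1)] and i2 = admissible_integrable[OF a(2)]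
  have sqc: "integrable (lebesgue_on X) (\<lambda>x. (cmod (f x))\<^sup>2)"
    if "sq_integrable X (\<lambda>x. Re (f x))" "sq_integrable X (\<lambda>x. Im (f x))" for X f
    using that by (simp add: sq_integrable_def cmod_power2)
  have n2: "tadpole_norm_pow 2 L v = integral\<^sup>L ?M (\<lambda>x. (cmod (w x))\<^sup>2)"
    unfolding w_def by (rule tadpole_norm_pow_glue[OF L]; rule sqc) (use pc ph in \<open>auto simp: H1_pair_def\<close>)
  have d2: "tadpole_norm_pow 2 L ?D = integral\<^sup>L ?M (\<lambda>x. (cmod (g x))\<^sup>2)"
    unfolding g_def by (rule tadpole_norm_pow_glue[OF L]; rule sqc) (use pc ph in \<open>auto simp: H1_pair_def\<close>)
  have c4: "cmod z ^ 4 = ((Re z)\<^sup>2 + (Im z)\<^sup>2)\<^sup>2" for z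
    by (simp add: cmod_power2[symmetric] flip: power_mult)
  have i4: "integrable ?M (\<lambda>x. cmod (w x) ^ 4)"
  proof (rule Bochner_Integration.integrable_bound)
    show "integrable ?M (\<lambda>x. 2 * (Re (w x))^4 + 2 * (Im (w x))^4)" using i1 i2 by simp
    have "(\<lambda>x. Re (w x)) \<in> borel_measurable ?M" "(\<lambda>x. Im (w x)) \<in> borel_measurable ?M"
      using a by (auto simp: admissible_def H1_pair_def sq_integrable_def)
    then show "(\<lambda>x. cmod (w x) ^ 4) \<in> borel_measurable ?M" unfolding c4 by simp
    have "(a\<^sup>2 + b\<^sup>2)\<^sup>2 \<le> 2 * a^4 + 2 * b^4" for a b :: real
    proof -
      have "0 \<le> (a\<^sup>2 - b\<^sup>2)\<^sup>2" by simp
      then show ?thesis by (simp add: power2_eq_square power4_eq_xxxx algebra_simps)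
    qed
    then show "AE x in ?M. norm (cmod (w x) ^ 4) \<le> norm (2 * (Re (w x))^4 + 2 * (Im (w x))^4)"
      unfolding c4 by (intro AE_I2) simp
  qed
  have eqs: "integrable (lebesgue_on {-L..L}) (\<lambda>x. cmod (fst v x) ^ 4)" "integrable (lebesgue_on {0..}) (\<lambda>x. cmod (snd v x) ^ 4)"
  proof -
    have LL: "-L \<le> L" using L by simp
    have "integrable (lebesgue_on {-L..L}) (\<lambda>x. cmod (w x) ^ 4)" by (rule integrable_lebesgue_on_interval_split(1)[OF i4 LL])
    then show "integrable (lebesgue_on {-L..L}) (\<lambda>x. cmod (fst v x) ^ 4)"
      by (rule Bochner_Integration.integrable_cong[THEN iffD1, rotated 2]) (auto simp: w_def glue_def)
    have "integrable (lebesgue_on {L..}) (\<lambda>x. cmod (w x) ^ 4)" by (rule integrable_lebesgue_on_interval_split(2)[OF i4 LL])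
    then have "integrable (lebesgue_on {0..}) (\<lambda>x. cmod (w (x + L)) ^ 4)" unfolding lebesgue_on_shift(1)[of "\<lambda>x. cmod (w x) ^ 4"] .
    then show "integrable (lebesgue_on {0..}) (\<lambda>x. cmod (snd v x) ^ 4)"
      by (rule Bochner_Integration.integrable_cong[THEN iffD1, rotated 2]) (auto simp: w_def glue_def e)
  qed
  show "tadpole_norm_pow 4 L v = integral\<^sup>L ?M (\<lambda>x. ((Re (w x))\<^sup>2 + (Im (w x))\<^sup>2)\<^sup>2)"
    unfolding tadpole_norm_pow_glue[OF L eqs] w_def c4 ..
  have "cmod (vertex_value v) = cmod (w L)" using e by (simp add: vertex_value_def w_def glue_def)
  then show "tadpole_quad \<omega> \<gamma> L v = quad \<omega> \<gamma> L (\<lambda>x. Re (w x)) (\<lambda>x. Re (g x)) + quad \<omega> \<gamma> L (\<lambda>x. Im (w x)) (\<lambda>x. Im (g x))"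
    unfolding tadpole_quad_def n2 d2 quad_def using i1 i2 by (simp add: cmod_power2 algebra_simps)
qed

text \<open>Complex values do not lower the constant: Cauchy-Schwarz for the mixed term bounds the
  quartic part by \<open>(sqrt A + sqrt B)\<^sup>2\<close>, and the real inequality, in its
  square-root form, adds up over the two parts.\<close>

lemma tadpole_best_const:
  assumes L: "0 < L" and v: "v \<in> H1D L" and "0 \<le> \<omega>" "0 \<le> \<gamma>" and \<Lambda>: "0 \<le> best_const \<omega> \<gamma> L"
  shows "best_const \<omega> \<gamma> L * tadpole_norm_pow 4 L v \<le> (tadpole_quad \<omega> \<gamma> L v)\<^sup>2"
proof -
  define a b ga gb where "a = (\<lambda>x. Re (glue L v x))" and "b = (\<lambda>x. Im (glue L v x))"
    and "ga = (\<lambda>x. Re (glue L (tadpole_deriv L v) x))" and "gb = (\<lambda>x. Im (glue L (tadpole_deriv L v) x))"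
  note H = H1D_glue(1,2)[OF L v, folded a_def b_def ga_def gb_def] H1D_glue(3)[OF L v, of \<omega> \<gamma>, folded a_def b_def ga_def gb_def]
  have H4: "tadpole_norm_pow 4 L v = integral\<^sup>L (lebesgue_on {-L..}) (\<lambda>x. ((a x)\<^sup>2 + (b x)\<^sup>2)\<^sup>2)"
    using H1D_glue(4)[OF L v] by (simp add: a_def b_def)
  let ?M = "lebesgue_on {-L..}" and ?\<Lambda> = "best_const \<omega> \<gamma> L"
  note i1 = admissible_integrable[OF H(1)] and i2 = admissible_integrable[OF H(2)]
  have sq: "sq_integrable {-L..} (\<lambda>x. (a x)\<^sup>2)" "sq_integrable {-L..} (\<lambda>x. (b x)\<^sup>2)"
    using i1(3) i2(3) H(1,2) by (auto simp: sq_integrable_def admissible_def H1_pair_def simp flip: power_mult)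
  define A B where "A = quart L a" and "B = quart L b"
  have AB: "A \<ge> 0" "B \<ge> 0" unfolding A_def B_def by (rule quart_nonneg)+
  define C where "C = integral\<^sup>L ?M (\<lambda>x. (a x)\<^sup>2 * (b x)\<^sup>2)"
  have "C\<^sup>2 \<le> A * B" using sq_integrable_Cauchy_Schwarz[OF sq] by (simp add: C_def A_def B_def quart_def flip: power_mult)
  then have "sqrt (C\<^sup>2) \<le> sqrt (A * B)" by (rule real_sqrt_le_mono)
  then have C: "C \<le> sqrt A * sqrt B" by (simp add: real_sqrt_mult)
  have "tadpole_norm_pow 4 L v = integral\<^sup>L ?M (\<lambda>x. (a x)^4 + 2 * ((a x)\<^sup>2 * (b x)\<^sup>2) + (b x)^4)"
    unfolding H4 by (intro Bochner_Integration.integral_cong) (auto simp: power2_eq_square power4_eq_xxxx algebra_simps)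
  also have "\<dots> = A + 2 * C + B" using i1(3) i2(3) sq_integrable_mult[OF sq] by (simp add: A_def B_def C_def quart_def)
  also have "\<dots> \<le> A + 2 * (sqrt A * sqrt B) + B" using C by simp
  also have "\<dots> = (sqrt A + sqrt B)\<^sup>2" using AB by (simp add: power2_sum)
  finally have n: "tadpole_norm_pow 4 L v \<le> (sqrt A + sqrt B)\<^sup>2" .
  have le: "sqrt ?\<Lambda> * sqrt (quart L f) \<le> quad \<omega> \<gamma> L f g" if "admissible L f g" for f g
  proof -
    have "sqrt (?\<Lambda> * quart L f) \<le> sqrt ((quad \<omega> \<gamma> L f g)\<^sup>2)" by (intro real_sqrt_le_mono best_const_le that)
    then show ?thesis using quad_nonneg[OF assms(3,4), of L f g] by (simp add: real_sqrt_mult)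
  qed
  have "sqrt ?\<Lambda> * (sqrt A + sqrt B) \<le> tadpole_quad \<omega> \<gamma> L v"
    using le[OF H(1)] le[OF H(2)] unfolding H(3) A_def B_def by (simp add: distrib_left)
  then have "(sqrt ?\<Lambda> * (sqrt A + sqrt B))\<^sup>2 \<le> (tadpole_quad \<omega> \<gamma> L v)\<^sup>2" using AB \<Lambda> by (intro power_mono) auto
  then have "?\<Lambda> * (sqrt A + sqrt B)\<^sup>2 \<le> (tadpole_quad \<omega> \<gamma> L v)\<^sup>2" using \<Lambda> by (simp add: power_mult_distrib)
  moreover have "?\<Lambda> * tadpole_norm_pow 4 L v \<le> ?\<Lambda> * (sqrt A + sqrt B)\<^sup>2" using n \<Lambda> by (rule mult_left_mono)
  ultimately show ?thesis by linarith
qed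

definition tadpole_of :: "real \<Rightarrow> (real \<Rightarrow> real) \<Rightarrow> tadpole_fun" where
  "tadpole_of L w = (\<lambda>x. complex_of_real (w x), \<lambda>x. complex_of_real (w (x + L)))"

lemma tadpole_of_props:
  assumes L: "0 < L" and w: "admissible L w g"
  shows "tadpole_of L w \<in> H1D L" "tadpole_quad \<omega> \<gamma> L (tadpole_of L w) = quad \<omega> \<gamma> L w g"
    "tadpole_norm_pow 4 L (tadpole_of L w) = quart L w"
proof -
  let ?M = "lebesgue_on {-L..}"
  have H: "H1_pair {-L..} w g" and e: "w (-L) = w L" using w by (auto simp: admissible_def)
  note i = admissible_integrable[OF w]
  have ne: "{-L<..<L} \<noteq> {}" using L by simp
  have ne0: "{0::real<..} \<noteq> {}" by simp
  have LL: "-L \<le> L" using L by simp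
  have Hc: "H1_pair {-L..L} w g" by (rule H1_pair_subset[OF H]) auto
  have HL: "H1_pair {L..} w g" by (rule H1_pair_subset[OF H]) (use L in auto)
  have Hh: "H1_pair {0..} (\<lambda>x. w (x + L)) (\<lambda>x. g (x + L))" using H1_pair_shift[OF HL, of 0] by simp
  have sc: "sq_integrable {-L<..<L} w" "sq_integrable {-L<..<L} g"
    using Hc sq_integrable_open_closed[OF _ _ edge_closures(3)[OF L]] by (auto simp: H1_pair_def)
  have sh: "sq_integrable {0<..} (\<lambda>x. w (x + L))" "sq_integrable {0<..} (\<lambda>x. g (x + L))"
    using Hh sq_integrable_open_closed[OF _ _ edge_closures(4)[OF L]] by (auto simp: H1_pair_def)
  have acc: "ac_on (closure {-L<..<L}) w g" and ach: "ac_on (closure {0<..}) (\<lambda>x. w (x + L)) (\<lambda>x. g (x + L))"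
    using Hc Hh by (simp_all add: edge_closures[OF L] H1_pair_def)
  note c = open_greaterThanLessThan is_interval_oo ne acc sc
  note h = open_greaterThan is_interval_oi ne0 ach sh
  show u: "tadpole_of L w \<in> H1D L"
    using H1_on_of_real[OF c] H1_on_of_real[OF h] e L by (simp add: H1D_def tadpole_of_def)
  have int: "integral\<^sup>L (lebesgue_on {-L<..<L}) f + integral\<^sup>L (lebesgue_on {0<..}) (\<lambda>x. f (x + L)) = integral\<^sup>L ?M f"
    if f: "integrable ?M f" for f :: "real \<Rightarrow> real"
  proof -
    note s = integrable_lebesgue_on_interval_split[OF f LL]
    have "integrable (lebesgue_on {0..}) (\<lambda>x. f (x + L))" unfolding lebesgue_on_shift(1) by (rule s(2))
    then have "integral\<^sup>L (lebesgue_on {0<..}) (\<lambda>x. f (x + L)) = integral\<^sup>L (lebesgue_on {L..}) f"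
      using lebesgue_on_open_closed(3)[OF _ _ edge_closures(4)[OF L], of "\<lambda>x. f (x + L)"] lebesgue_on_shift(2)[of f L] by simp
    moreover have "integral\<^sup>L (lebesgue_on {-L<..<L}) f = integral\<^sup>L (lebesgue_on {-L..L}) f"
      by (rule lebesgue_on_open_closed(3)[OF _ _ edge_closures(3)[OF L] s(1)]) auto
    ultimately show ?thesis using s(3) by simp
  qed
  show "tadpole_norm_pow 4 L (tadpole_of L w) = quart L w"
    using int[OF i(3)] by (simp add: tadpole_norm_pow_def Lp_norm_pow_lebesgue_on tadpole_of_def quart_def)
  have "tadpole_norm_pow 2 L (tadpole_of L w) = integral\<^sup>L ?M (\<lambda>x. (w x)\<^sup>2)"
    using int[OF i(2)] by (simp add: tadpole_norm_pow_def Lp_norm_pow_lebesgue_on tadpole_of_def)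
  moreover have "tadpole_norm_pow 2 L (tadpole_deriv L (tadpole_of L w)) = integral\<^sup>L ?M (\<lambda>x. (g x)\<^sup>2)"
    using int[OF i(1)] Lp_norm_pow_weak_deriv_of_real[OF c] Lp_norm_pow_weak_deriv_of_real[OF h]
    by (simp add: tadpole_norm_pow_def tadpole_of_def tadpole_deriv_def)
  ultimately show "tadpole_quad \<omega> \<gamma> L (tadpole_of L w) = quad \<omega> \<gamma> L w g"
    unfolding tadpole_quad_def quad_def using i L by (simp add: vertex_value_def tadpole_of_def)
qed

text \<open>The representatives are continuous, so a vanishing \<open>L\<^sup>4\<close>-norm forces
  every value to be zero. This permits division by the quartic part on the Nehari set.\<close>

lemma tadpole_nonzero_quart:
  assumes L: "0 < L" and v: "v \<in> H1D L" and z: "tadpole_norm_pow 4 L v = 0"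
  shows "\<not> tadpole_nonzero L v"
proof -
  let ?M = "lebesgue_on {-L..}"
  note H = H1D_glue[OF L v]
  have z0: "f x = 0" if adm: "admissible L f g" and q: "quart L f = 0" and x: "-L \<le> x" for f g x
  proof (rule ccontr)
    assume nz: "f x \<noteq> 0"
    have fc: "continuous_on {-L..} f"
      using adm by (intro ac_on_continuous[of _ _ g]) (auto simp: admissible_def H1_pair_def is_interval_ci)
    have "continuous_on {x..x+1} (\<lambda>t. (f t)^4)" using x by (intro continuous_on_power continuous_on_subset[OF fc]) auto
    moreover have "integral\<^sup>L (lebesgue_on {x..x+1}) (\<lambda>t. (f t)^4) \<le> quart L f"
      unfolding quart_def using x by (intro lebesgue_on_integral_mono_set[OF admissible_integrable(3)[OF adm]]) auto
    moreover have "0 \<le> integral\<^sup>L (lebesgue_on {x..x+1}) (\<lambda>t. (f t)^4)" by simp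
    ultimately have c: "continuous_on {x..x+1} (\<lambda>t. (f t)^4)" and "integral\<^sup>L (lebesgue_on {x..x+1}) (\<lambda>t. (f t)^4) = 0"
      using q by linarith+
    then have "integral {x..x+1} (\<lambda>t. (f t)^4) = 0"
      using lebesgue_integral_eq_integral[OF continuous_imp_integrable_real[OF c]] by simp
    then have "\<forall>t\<in>{x..x+1}. (f t)^4 = 0" using integral_eq_0_iff[OF c] by simp
    then show False using nz by simp
  qed
  define a b where "a = (\<lambda>x. Re (glue L v x))" and "b = (\<lambda>x. Im (glue L v x))"
  note adm = H(1,2)[folded a_def b_def] 
  have n4: "tadpole_norm_pow 4 L v = integral\<^sup>L (lebesgue_on {-L..}) (\<lambda>x. ((a x)\<^sup>2 + (b x)\<^sup>2)\<^sup>2)"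
    using H(4) by (simp add: a_def b_def)
  have le: "quart L f \<le> tadpole_norm_pow 4 L v" if "f = a \<or> f = b" for f
  proof -
    have i: "integrable ?M (\<lambda>x. ((a x)\<^sup>2 + (b x)\<^sup>2)\<^sup>2)"
    proof (rule Bochner_Integration.integrable_bound)
      show "integrable ?M (\<lambda>x. 2 * (a x)^4 + 2 * (b x)^4)"
        using admissible_integrable(3)[OF adm(1)] admissible_integrable(3)[OF adm(2)] by simp
      show "(\<lambda>x. ((a x)\<^sup>2 + (b x)\<^sup>2)\<^sup>2) \<in> borel_measurable ?M"
        using adm by (auto simp: admissible_def H1_pair_def sq_integrable_def)
      have "(c\<^sup>2 + d\<^sup>2)\<^sup>2 \<le> 2 * c^4 + 2 * d^4" for c d :: real
      proof -
        have "0 \<le> (c\<^sup>2 - d\<^sup>2)\<^sup>2" by simp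
        then show ?thesis by (simp add: power2_eq_square power4_eq_xxxx algebra_simps)
      qed
      then show "AE x in ?M. norm (((a x)\<^sup>2 + (b x)\<^sup>2)\<^sup>2) \<le> norm (2 * (a x)^4 + 2 * (b x)^4)" by (intro AE_I2) simp
    qed
    have "(f x)^4 \<le> ((a x)\<^sup>2 + (b x)\<^sup>2)\<^sup>2" for x
    proof -
      have "(f x)\<^sup>2 \<le> (a x)\<^sup>2 + (b x)\<^sup>2" using that by auto
      then have "((f x)\<^sup>2)\<^sup>2 \<le> ((a x)\<^sup>2 + (b x)\<^sup>2)\<^sup>2" by (rule power_mono) simp
      then show ?thesis by simp
    qed
    moreover have "integrable ?M (\<lambda>x. (f x)^4)"
      using that admissible_integrable(3)[OF adm(1)] admissible_integrable(3)[OF adm(2)] by (elim disjE) simp_all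
    ultimately show ?thesis unfolding n4 quart_def by (intro integral_mono i)
  qed
  have "quart L a = 0" "quart L b = 0" using le[of a] le[of b] quart_nonneg[of L a] quart_nonneg[of L b] z by auto
  then have g0: "glue L v x = 0" if "-L \<le> x" for x
    using z0[OF adm(1) _ that] z0[OF adm(2) _ that] by (simp add: a_def b_def complex_eq_iff)
  show ?thesis
  proof
    assume "tadpole_nonzero L v"
    then consider x where "x \<in> {-L..L}" "fst v x \<noteq> 0" | x where "x \<in> {0..}" "snd v x \<noteq> 0"
      unfolding tadpole_nonzero_def by blast
    then show False
    proof cases
      case 1 then show ?thesis using g0[of x] by (simp add: glue_def)
    next
      case 2
      then have "glue L v (x + L) = snd v x" using v by (auto simp: glue_def H1D_def)
      then show ?thesis using g0[of "x + L"] 2 L by simp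
    qed
  qed
qed

text \<open>On the Nehari set Q = B, so \<open>\<Lambda> * B \<le> B\<^sup>2\<close> and the action
  B / 4 is at least \<Lambda> / 4; w attains this value.\<close>

theorem ground_state_from_ground:
  assumes L: "0 < L" and \<omega>\<gamma>: "0 \<le> \<omega>" "0 \<le> \<gamma>" and w: "ground \<omega> \<gamma> L w g" "\<And>x. 0 \<le> w x"
  shows "action_ground_state \<omega> \<gamma> L (tadpole_of L w)" "tadpole_nonneg L (tadpole_of L w)"
    "action_inf \<omega> \<gamma> L = best_const \<omega> \<gamma> L / 4"
proof -
  let ?\<Lambda> = "best_const \<omega> \<gamma> L" and ?u = "tadpole_of L w"
  have adm: "admissible L w g" and \<Lambda>: "0 < ?\<Lambda>" "quad \<omega> \<gamma> L w g = ?\<Lambda>" "quart L w = ?\<Lambda>" using w(1) by (auto simp: ground_def)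
  note u = tadpole_of_props[OF L adm]
  have "tadpole_nonzero L ?u"
  proof (rule ccontr)
    assume n: "\<not> tadpole_nonzero L ?u"
    have "w x = 0" if "x \<in> {-L..}" for x
    proof (cases "x \<le> L")
      case True
      then show ?thesis using n that by (auto simp: tadpole_nonzero_def tadpole_of_def)
    next
      case False
      then have "x - L \<in> {0..}" by simp
      then have "snd ?u (x - L) = 0" using n unfolding tadpole_nonzero_def by blast
      then show ?thesis by (simp add: tadpole_of_def)
    qed
    then have "quart L w = integral\<^sup>L (lebesgue_on {-L..}) (\<lambda>x. 0)"
      unfolding quart_def by (intro Bochner_Integration.integral_cong) auto
    then show False using \<Lambda> by simp
  qed
  then have uN: "?u \<in> nehari_set \<omega> \<gamma> L"
    using u(1) u(2)[of \<omega> \<gamma>] u(3) \<Lambda> by (simp add: nehari_set_def nehari_quad)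
  have au: "action \<omega> \<gamma> L ?u = ?\<Lambda> / 4" using u(2)[of \<omega> \<gamma>] u(3) \<Lambda> by (simp add: action_quad)
  have lb: "?\<Lambda> / 4 \<le> action \<omega> \<gamma> L v" if v: "v \<in> nehari_set \<omega> \<gamma> L" for v
  proof -
    have vH: "v \<in> H1D L" and eq: "tadpole_quad \<omega> \<gamma> L v = tadpole_norm_pow 4 L v" and nz: "tadpole_nonzero L v"
      using v by (auto simp: nehari_set_def nehari_quad)
    define B where "B = tadpole_norm_pow 4 L v"
    have ineq: "?\<Lambda> * B \<le> B\<^sup>2"
      using tadpole_best_const[OF L vH \<omega>\<gamma>] \<Lambda>(1) unfolding eq B_def by simp
    have "?\<Lambda> \<le> B"
    proof -
      have "0 \<le> B" unfolding B_def H1D_glue(4)[OF L vH] by simp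
      moreover have "B \<noteq> 0"
      proof
        assume "B = 0"
        then show False using nz tadpole_nonzero_quart[OF L vH] by (simp add: B_def)
      qed
      ultimately show ?thesis using ineq by (simp add: power2_eq_square)
    qed
    then show ?thesis unfolding action_quad eq B_def by simp
  qed
  have inf: "action_inf \<omega> \<gamma> L = ?\<Lambda> / 4"
    unfolding action_inf_def
  proof (rule cInf_eq_minimum)
    show "?\<Lambda> / 4 \<in> action \<omega> \<gamma> L ` nehari_set \<omega> \<gamma> L" unfolding au[symmetric] by (rule imageI[OF uN])
    show "?\<Lambda> / 4 \<le> y" if "y \<in> action \<omega> \<gamma> L ` nehari_set \<omega> \<gamma> L" for y using that lb by auto
  qed
  then show "action_inf \<omega> \<gamma> L = ?\<Lambda> / 4" .
  show "action_ground_state \<omega> \<gamma> L ?u" using uN au inf by (simp add: action_ground_state_def)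
  show "tadpole_nonneg L ?u" using w(2) by (simp add: tadpole_nonneg_def tadpole_of_def)
qed

text \<open>The imaginary part of a non-negative function is zero and its quadratic part is
  non-negative, so the real part has full quartic mass and a quadratic part of at most
  \<Lambda>.\<close>

theorem ground_from_ground_state:
  assumes L: "0 < L" and \<omega>\<gamma>: "0 \<le> \<omega>" "0 \<le> \<gamma>" and inf: "action_inf \<omega> \<gamma> L = best_const \<omega> \<gamma> L / 4"
    and \<Lambda>: "0 < best_const \<omega> \<gamma> L" and u: "action_ground_state \<omega> \<gamma> L u" "tadpole_nonneg L u"
  obtains g where "ground \<omega> \<gamma> L (\<lambda>x. Re (glue L u x)) g" "\<And>x. -L \<le> x \<Longrightarrow> 0 \<le> Re (glue L u x)"
proof -
  let ?\<Lambda> = "best_const \<omega> \<gamma> L" and ?M = "lebesgue_on {-L..}"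
  have uH: "u \<in> H1D L" and eq: "tadpole_quad \<omega> \<gamma> L u = tadpole_norm_pow 4 L u" and a: "action \<omega> \<gamma> L u = ?\<Lambda> / 4"
    using u(1) inf by (auto simp: action_ground_state_def nehari_set_def nehari_quad)
  have B: "tadpole_norm_pow 4 L u = ?\<Lambda>" using a by (simp add: action_quad eq)
  note H = H1D_glue(1,2)[OF L uH] H1D_glue(3)[OF L uH, of \<omega> \<gamma>] H1D_glue(4)[OF L uH]
  have nn: "glue L u x \<in> \<real>\<^sub>\<ge>\<^sub>0" if "-L \<le> x" for x
    using u(2) that by (auto simp: tadpole_nonneg_def glue_def)
  have Im0: "Im (glue L u x) = 0" and Re0: "0 \<le> Re (glue L u x)" if "-L \<le> x" for x
    using nn[OF that] by (auto simp: complex_nonneg_Reals_iff)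
  have "tadpole_norm_pow 4 L u = quart L (\<lambda>x. Re (glue L u x))"
    unfolding H(4) quart_def by (intro Bochner_Integration.integral_cong) (auto simp: Im0 simp flip: power_mult)
  then have q: "quart L (\<lambda>x. Re (glue L u x)) = ?\<Lambda>" using B by simp
  have "quad \<omega> \<gamma> L (\<lambda>x. Re (glue L u x)) (\<lambda>x. Re (glue L (tadpole_deriv L u) x)) \<le> ?\<Lambda>"
    using H(3) eq B quad_nonneg[OF \<omega>\<gamma>, of L "\<lambda>x. Im (glue L u x)" "\<lambda>x. Im (glue L (tadpole_deriv L u) x)"] by linarith
  then have "ground \<omega> \<gamma> L (\<lambda>x. Re (glue L u x)) (\<lambda>x. Re (glue L (tadpole_deriv L u) x))"
    by (intro groundI H(1) \<Lambda> q \<omega>\<gamma>)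
  then show ?thesis using Re0 by (rule that)
qed

section \<open>The stationary equation\<close>

text \<open>The second-order equation as a first-order system in the phase plane, with one-sided
  derivatives at end points of X, so that it restricts to the edges of the graph.\<close>

definition soliton_ode :: "real \<Rightarrow> real set \<Rightarrow> (real \<Rightarrow> real) \<Rightarrow> (real \<Rightarrow> real) \<Rightarrow> bool" where
  "soliton_ode \<omega> X u v \<longleftrightarrow>
    (\<forall>x\<in>X. (u has_real_derivative v x) (at x within X) \<and> (v has_real_derivative \<omega> * u x - (u x)^3) (at x within X))"

lemma soliton_odeD:
  assumes "soliton_ode \<omega> X u v" "x \<in> X"
  shows "(u has_real_derivative v x) (at x within X)" "(v has_real_derivative \<omega> * u x - (u x)^3) (at x within X)"
  using assms by (auto simp: soliton_ode_def)

lemma soliton_ode_continuous_on: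
  assumes "soliton_ode \<omega> X u v"
  shows "continuous_on X u" "continuous_on X v"
  by (rule DERIV_continuous_on, erule soliton_odeD[OF assms])+

lemma soliton_ode_subset:
  assumes "soliton_ode \<omega> X u v" "Y \<subseteq> X"
  shows "soliton_ode \<omega> Y u v"
  unfolding soliton_ode_def
proof
  fix x assume "x \<in> Y"
  then have "x \<in> X" using assms(2) by blast
  note d = soliton_odeD[OF assms(1) this]
  show "(u has_real_derivative v x) (at x within Y) \<and> (v has_real_derivative \<omega> * u x - (u x)^3) (at x within Y)"
    using DERIV_subset[OF d(1) assms(2)] DERIV_subset[OF d(2) assms(2)] by blast
qed

lemma soliton_ode_reflect:
  assumes o: "soliton_ode \<omega> (uminus ` X) u v"
  shows "soliton_ode \<omega> X (\<lambda>x. u (-x)) (\<lambda>x. - v (-x))"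
  unfolding soliton_ode_def
proof
  fix x assume "x \<in> X"
  then have "-x \<in> uminus ` X" by simp
  note d = soliton_odeD[OF o this]
  have m: "(uminus has_real_derivative -1) (at x within X)" by (auto intro!: derivative_eq_intros)
  have "(u \<circ> uminus has_real_derivative v (-x) * -1) (at x within X)" by (rule DERIV_image_chain[OF d(1) m])
  moreover have "(v \<circ> uminus has_real_derivative (\<omega> * u (-x) - (u (-x))^3) * -1) (at x within X)" by (rule DERIV_image_chain[OF d(2) m])
  then have "((\<lambda>x. - (v \<circ> uminus) x) has_real_derivative - ((\<omega> * u (-x) - (u (-x))^3) * -1)) (at x within X)" by (rule DERIV_minus)
  ultimately show "((\<lambda>x. u (-x)) has_real_derivative - v (-x)) (at x within X) \<and>
      ((\<lambda>x. - v (-x)) has_real_derivative \<omega> * u (-x) - (u (-x))^3) (at x within X)"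
    by (simp add: o_def)
qed

lemma soliton_ode_shift:
  assumes o: "soliton_ode \<omega> ((\<lambda>x. x + c) ` X) u v"
  shows "soliton_ode \<omega> X (\<lambda>x. u (x + c)) (\<lambda>x. v (x + c))"
  unfolding soliton_ode_def
proof
  fix x assume "x \<in> X"
  then have "x + c \<in> (\<lambda>x. x + c) ` X" by simp
  note d = soliton_odeD[OF o this]
  have m: "((\<lambda>x. x + c) has_real_derivative 1) (at x within X)" by (auto intro!: derivative_eq_intros)
  show "((\<lambda>x. u (x + c)) has_real_derivative v (x + c)) (at x within X) \<and>
      ((\<lambda>x. v (x + c)) has_real_derivative \<omega> * u (x + c) - (u (x + c))^3) (at x within X)"
    using DERIV_image_chain[OF d(1) m] DERIV_image_chain[OF d(2) m] by (simp add: o_def)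
qed

text \<open>The first integral of the system. It vanishes on the homoclinic orbit of the soliton and
  is negative on the orbits inside, which dn parametrises.\<close>

lemma soliton_ode_energy:
  assumes o: "soliton_ode \<omega> X u v" and X: "is_interval X" "x \<in> X" "y \<in> X"
  shows "(v x)\<^sup>2 - \<omega> * (u x)\<^sup>2 + (u x)^4 / 2 = (v y)\<^sup>2 - \<omega> * (u y)\<^sup>2 + (u y)^4 / 2"
proof -
  have "((\<lambda>x. (v x)\<^sup>2 - \<omega> * (u x)\<^sup>2 + (u x)^4 / 2) has_real_derivative 0) (at x within X)" if "x \<in> X" for x
  proof -
    note d = soliton_odeD[OF o that]
    have "((\<lambda>x. (v x)\<^sup>2 - \<omega> * (u x)\<^sup>2 + (u x)^4 * (1/2)) has_real_derivative
        of_nat 2 * ((\<omega> * u x - (u x)^3) * v x ^ (2 - Suc 0)) - \<omega> * (of_nat 2 * (v x * u x ^ (2 - Suc 0)))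
        + of_nat 4 * (v x * u x ^ (4 - Suc 0)) * (1/2)) (at x within X)"
      by (intro DERIV_add DERIV_diff DERIV_power DERIV_cmult DERIV_cmult_right d)
    then have "((\<lambda>x. (v x)\<^sup>2 - \<omega> * (u x)\<^sup>2 + (u x)^4 * (1/2)) has_real_derivative 0) (at x within X)"
      by (rule DERIV_cong) (simp add: algebra_simps)
    then show ?thesis by simp
  qed
  then obtain c where "\<forall>x\<in>X. (v x)\<^sup>2 - \<omega> * (u x)\<^sup>2 + (u x)^4 / 2 = c"
    using has_field_derivative_zero_constant[OF is_interval_convex[OF X(1)]] by blast
  then show ?thesis using X by simp
qed

text \<open>Gronwall's inequality for the squared distance of two solutions in the phase plane.\<close>

lemma soliton_ode_unique_right:
  assumes o1: "soliton_ode \<omega> {a..b} u1 v1" and o2: "soliton_ode \<omega> {a..b} u2 v2"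
    and ab: "a \<le> b" and init: "u1 a = u2 a" "v1 a = v2 a"
  shows "u1 b = u2 b" "v1 b = v2 b"
proof -
  note c1 = soliton_ode_continuous_on[OF o1] and c2 = soliton_ode_continuous_on[OF o2]
  have bd: "\<exists>M. \<forall>t\<in>{a..b}. \<bar>u t\<bar> \<le> M" if "continuous_on {a..b} u" for u :: "real \<Rightarrow> real"
  proof -
    have "bounded (u ` {a..b})" using compact_continuous_image[OF that compact_Icc] by (rule compact_imp_bounded)
    then show ?thesis unfolding bounded_iff by auto
  qed
  obtain M1 M2 where M: "\<forall>t\<in>{a..b}. \<bar>u1 t\<bar> \<le> M1" "\<forall>t\<in>{a..b}. \<bar>u2 t\<bar> \<le> M2"
    using bd[OF c1(1)] bd[OF c2(1)] by blast
  define M where "M = max M1 M2"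
  have Mb: "\<bar>u1 t\<bar> \<le> M" "\<bar>u2 t\<bar> \<le> M" if "t \<in> {a..b}" for t using M that by (auto simp: M_def le_max_iff_disj)
  define C where "C = 1 + \<bar>\<omega>\<bar> + 3 * (M * M)"
  \<comment> \<open>The quotient of u1^3 - u2^3 by u1 - u2; it is what the cubic terms contribute to
    the derivative of the squared distance.\<close>
  define r where "r = (\<lambda>t. u1 t * u1 t + u1 t * u2 t + u2 t * u2 t)"
  define d where "d = (\<lambda>t. (u1 t - u2 t)\<^sup>2 + (v1 t - v2 t)\<^sup>2)"
  define d' where "d' = (\<lambda>t. 2 * ((u1 t - u2 t) * (v1 t - v2 t)) * (1 + \<omega> - r t))"
  have dd: "(d has_real_derivative d' t) (at t within {a..b})" if t: "t \<in> {a..b}" for t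
  proof -
    note e1 = soliton_odeD[OF o1 t] and e2 = soliton_odeD[OF o2 t]
    show ?thesis unfolding d_def
      by (rule DERIV_cong[OF DERIV_add[OF DERIV_power[OF DERIV_diff[OF e1(1) e2(1)], of 2] DERIV_power[OF DERIV_diff[OF e1(2) e2(2)], of 2]]])
        (simp add: d'_def r_def algebra_simps power2_eq_square power3_eq_cube)
  qed
  have d'le: "d' t \<le> C * d t" if t: "t \<in> {a..b}" for t
  proof -
    have pr: "\<bar>p * q\<bar> \<le> M * M" if "\<bar>p\<bar> \<le> M" "\<bar>q\<bar> \<le> M" for p q
      unfolding abs_mult using that by (intro mult_mono) auto
    have "\<bar>r t\<bar> \<le> 3 * (M * M)" unfolding r_def
      using pr[OF Mb(1)[OF t] Mb(1)[OF t]] pr[OF Mb(1)[OF t] Mb(2)[OF t]] pr[OF Mb(2)[OF t] Mb(2)[OF t]] by linarith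
    then have 1: "\<bar>1 + \<omega> - r t\<bar> \<le> C" unfolding C_def by linarith
    have 2: "\<bar>2 * ((u1 t - u2 t) * (v1 t - v2 t))\<bar> \<le> d t"
    proof -
      have "0 \<le> ((u1 t - u2 t) - (v1 t - v2 t))\<^sup>2" "0 \<le> ((u1 t - u2 t) + (v1 t - v2 t))\<^sup>2" by auto
      then have "2 * ((u1 t - u2 t) * (v1 t - v2 t)) \<le> d t" "- (2 * ((u1 t - u2 t) * (v1 t - v2 t))) \<le> d t"
        unfolding d_def power2_diff[of "u1 t - u2 t"] power2_sum[of "u1 t - u2 t"] by linarith+
      then show ?thesis by linarith
    qed
    have "\<bar>d' t\<bar> \<le> d t * C" unfolding d'_def abs_mult[of "2 * _"] by (rule mult_mono[OF 2 1]) (simp_all add: d_def)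
    then show ?thesis by (simp add: mult.commute abs_le_iff)
  qed
  have "exp (- C * a) * d a \<ge> exp (- C * b) * d b"
  proof (rule DERIV_nonpos_imp_decreasing_open[OF ab])
    fix t assume t: "a < t" "t < b"
    have e: "((\<lambda>t. exp (- C * t)) has_real_derivative exp (- C * t) * (- C)) (at t)"
      by (auto intro!: derivative_eq_intros)
    have dt: "(d has_real_derivative d' t) (at t)" using dd[of t] t by (simp add: at_within_Icc_at)
    have "exp (- C * t) * (- C) * d t + d' t * exp (- C * t) = exp (- C * t) * (d' t - C * d t)" by (simp add: algebra_simps)
    moreover have "exp (- C * t) * (d' t - C * d t) \<le> 0" using d'le[of t] t by (intro mult_nonneg_nonpos) auto
    ultimately show "\<exists>y. ((\<lambda>t. exp (- C * t) * d t) has_real_derivative y) (at t) \<and> y \<le> 0"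
      using DERIV_mult[OF e dt] by metis
  next
    have "continuous_on {a..b} d" unfolding d_def by (intro continuous_intros c1 c2)
    then show "continuous_on {a..b} (\<lambda>t. exp (- C * t) * d t)" by (intro continuous_intros)
  qed
  moreover have "d a = 0" by (simp add: d_def init)
  ultimately have "exp (- C * b) * d b \<le> 0" by simp
  then have "d b \<le> 0" by (simp add: mult_le_0_iff)
  then show "u1 b = u2 b" "v1 b = v2 b" unfolding d_def by (simp_all add: sum_power2_le_zero_iff)
qed

text \<open>To the left of x0 both solutions are reflected, which preserves the system.\<close>

lemma soliton_ode_unique:
  assumes X: "is_interval X" "x0 \<in> X" "x \<in> X" and o1: "soliton_ode \<omega> X u1 v1" and o2: "soliton_ode \<omega> X u2 v2"
    and init: "u1 x0 = u2 x0" "v1 x0 = v2 x0"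
  shows "u1 x = u2 x" "v1 x = v2 x"
proof -
  have sub: "{p..q} \<subseteq> X" if "p \<in> X" "q \<in> X" for p q
    using X(1) that unfolding is_interval_1 by (meson atLeastAtMost_iff subsetI)
  have "u1 x = u2 x \<and> v1 x = v2 x"
  proof (cases "x0 \<le> x")
    case True
    show ?thesis
      using soliton_ode_unique_right[OF soliton_ode_subset[OF o1 sub[OF X(2,3)]] soliton_ode_subset[OF o2 sub[OF X(2,3)]] True init]
      by blast
  next
    case False
    have im: "uminus ` {-x0..-x} = {x..x0}" by auto
    note r = soliton_ode_reflect[of \<omega> "{-x0..-x}", unfolded im]
    have "u1 (- (-x)) = u2 (- (-x))" "- v1 (- (-x)) = - v2 (- (-x))"
      by (rule soliton_ode_unique_right[OF r[OF soliton_ode_subset[OF o1 sub[OF X(3,2)]]] r[OF soliton_ode_subset[OF o2 sub[OF X(3,2)]]]];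
          use False init in simp)+
    then show ?thesis by simp
  qed
  then show "u1 x = u2 x" "v1 x = v2 x" by auto
qed

section \<open>The soliton\<close>

definition sech_slope :: "real \<Rightarrow> real \<Rightarrow> real \<Rightarrow> real" where
  "sech_slope \<omega> b x = - sqrt \<omega> * tanh (sqrt \<omega> * x + b) * sech_profile \<omega> b x"

lemma sech_sq:
  assumes "0 \<le> \<omega>"
  shows "(sech_profile \<omega> b x)\<^sup>2 = 2 * \<omega> * (1 - (tanh (sqrt \<omega> * x + b))\<^sup>2)"
proof -
  have c: "(1 / cosh y)\<^sup>2 = 1 - (tanh y)\<^sup>2" for y :: real
  proof -
    have "1 - (tanh y)\<^sup>2 = ((cosh y)\<^sup>2 - (sinh y)\<^sup>2) / (cosh y)\<^sup>2"
      by (simp add: tanh_def power_divide diff_divide_distrib)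
    also have "(cosh y)\<^sup>2 - (sinh y)\<^sup>2 = 1" using cosh_square_eq[of y] by simp
    finally show ?thesis by (simp add: power_divide)
  qed
  have "(sech_profile \<omega> b x)\<^sup>2 = (sqrt (2 * \<omega>))\<^sup>2 * (1 / cosh (sqrt \<omega> * x + b))\<^sup>2"
    by (simp only: sech_profile_def power_mult_distrib)
  then show ?thesis unfolding c using assms by simp
qed

lemma sech_deriv:
  assumes "0 < \<omega>"
  shows "(sech_profile \<omega> b has_real_derivative sech_slope \<omega> b x) (at x within X)"
    "(sech_slope \<omega> b has_real_derivative \<omega> * sech_profile \<omega> b x - (sech_profile \<omega> b x)^3) (at x within X)"
proof -
  let ?t = "\<lambda>x. tanh (sqrt \<omega> * x + b)"
  have 1: "((\<lambda>x. sqrt (2*\<omega>) * (1 / cosh (sqrt \<omega> * x + b))) has_real_derivative sech_slope \<omega> b x) (at x within X)" for x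
    by (rule derivative_eq_intros refl | simp add: sech_slope_def sech_profile_def tanh_def power2_eq_square)+
  then show d: "(sech_profile \<omega> b has_real_derivative sech_slope \<omega> b x) (at x within X)"
    unfolding sech_profile_def[abs_def] .
  have 2: "(?t has_real_derivative (1 - (?t x)\<^sup>2) * sqrt \<omega>) (at x within X)"
    by (auto intro!: derivative_eq_intros)
  define t p where "t = ?t x" and "p = sech_profile \<omega> b x"
  have p2: "p * p = 2 * \<omega> * (1 - t * t)" using sech_sq[of \<omega> b x] assms by (simp add: p_def t_def power2_eq_square)
  have s: "sqrt \<omega> * sqrt \<omega> = \<omega>" using assms by simp
  have "((\<lambda>x. - sqrt \<omega> * (?t x * sech_profile \<omega> b x)) has_real_derivative
      - sqrt \<omega> * ((1 - (?t x)\<^sup>2) * sqrt \<omega> * sech_profile \<omega> b x + sech_slope \<omega> b x * ?t x)) (at x within X)"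
    by (intro DERIV_cmult DERIV_mult 2 d)
  moreover have "- sqrt \<omega> * ((1 - (?t x)\<^sup>2) * sqrt \<omega> * sech_profile \<omega> b x + sech_slope \<omega> b x * ?t x) = \<omega> * p - p ^ 3"
  proof -
    have "- sqrt \<omega> * ((1 - t\<^sup>2) * sqrt \<omega> * p + (- sqrt \<omega> * t * p) * t) = (sqrt \<omega> * sqrt \<omega>) * (t * t * p + t * t * p - p)"
      by (simp add: algebra_simps power2_eq_square)
    also have "\<dots> = \<omega> * p - (p * p) * p" unfolding s p2 by (simp add: algebra_simps)
    finally show ?thesis by (simp add: t_def p_def sech_slope_def power3_eq_cube)
  qed
  ultimately have "((\<lambda>x. - sqrt \<omega> * (?t x * sech_profile \<omega> b x)) has_real_derivative \<omega> * p - p ^ 3) (at x within X)" by simp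
  moreover have "(\<lambda>x. - sqrt \<omega> * (?t x * sech_profile \<omega> b x)) = sech_slope \<omega> b" by (auto simp: sech_slope_def)
  ultimately show "(sech_slope \<omega> b has_real_derivative \<omega> * sech_profile \<omega> b x - (sech_profile \<omega> b x)^3) (at x within X)"
    by (simp add: p_def)
qed

lemma soliton_ode_sech: "0 < \<omega> \<Longrightarrow> soliton_ode \<omega> X (sech_profile \<omega> b) (sech_slope \<omega> b)"
  unfolding soliton_ode_def using sech_deriv by blast

section \<open>Test functions\<close>

text \<open>All three integrands are polynomials in the hyperbolic tangent times its derivative,
  hence so are their primitives; t is the value of the tangent at the left end.\<close>

lemma sech_integrals:
  assumes \<mu>: "0 < \<mu>" and t: "t = tanh (\<mu> * a + b)"
  shows "has_bochner_integral (lebesgue_on {a..}) (\<lambda>x. (sech_profile (\<mu>\<^sup>2) b x)\<^sup>2) (2 * \<mu> - 2 * \<mu> * t)"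
    "has_bochner_integral (lebesgue_on {a..}) (\<lambda>x. (sech_slope (\<mu>\<^sup>2) b x)\<^sup>2) (2/3 * \<mu>^3 - 2/3 * \<mu>^3 * t^3)"
    "has_bochner_integral (lebesgue_on {a..}) (\<lambda>x. (sech_profile (\<mu>\<^sup>2) b x)^4) (8/3 * \<mu>^3 - 4 * \<mu>^3 * (t - t^3/3))"
proof -
  let ?t = "\<lambda>x. tanh (\<mu> * x + b)" and ?p = "sech_profile (\<mu>\<^sup>2) b" and ?q = "sech_slope (\<mu>\<^sup>2) b"
  have sq: "sqrt (\<mu>\<^sup>2) = \<mu>" using \<mu> by simp
  have p2: "(?p x)\<^sup>2 = 2 * \<mu>\<^sup>2 * (1 - (?t x)\<^sup>2)" for x using sech_sq[of "\<mu>\<^sup>2" b x] unfolding sq by simp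
  have q2: "(?q x)\<^sup>2 = \<mu>\<^sup>2 * (?t x)\<^sup>2 * (?p x)\<^sup>2" for x unfolding sech_slope_def sq by (simp add: power_mult_distrib)
  have p4: "(?p x)^4 = ((?p x)\<^sup>2)\<^sup>2" for x by simp
  have dt: "(?t has_real_derivative (1 - (?t x)\<^sup>2) * \<mu>) (at x)" for x by (auto intro!: derivative_eq_intros)
  have cp: "continuous_on UNIV ?p" "continuous_on UNIV ?q"
    using soliton_ode_continuous_on[OF soliton_ode_sech[of "\<mu>\<^sup>2" UNIV b]] \<mu> by auto
  have m: "(\<lambda>x. (?p x)\<^sup>2) \<in> borel_measurable borel" "(\<lambda>x. (?q x)\<^sup>2) \<in> borel_measurable borel" "(\<lambda>x. (?p x)^4) \<in> borel_measurable borel"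
    by (intro borel_measurable_continuous_onI continuous_on_power cp)+
  have "LIM x at_top. b + \<mu> * x :> at_top"
    using \<mu> by (intro filterlim_tendsto_add_at_top[OF tendsto_const] filterlim_tendsto_pos_mult_at_top[OF tendsto_const] filterlim_ident) auto
  then have "LIM x at_top. \<mu> * x + b :> at_top" by (simp only: add.commute[of b])
  then have lt: "(?t \<longlongrightarrow> 1) at_top" by (rule filterlim_compose[OF tanh_real_at_top])
  have "has_bochner_integral (lebesgue_on {a..}) (\<lambda>x. (?p x)\<^sup>2) (2 * \<mu> * 1 - 2 * \<mu> * ?t a)"
  proof (rule lebesgue_on_FTC_atLeast[OF m(1)])
    show "((\<lambda>x. 2 * \<mu> * ?t x) has_real_derivative (?p x)\<^sup>2) (at x)" for x
      by (rule DERIV_cong[OF DERIV_cmult[OF dt]]) (unfold p2, simp add: power2_eq_square algebra_simps)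
    show "((\<lambda>x. 2 * \<mu> * ?t x) \<longlongrightarrow> 2 * \<mu> * 1) at_top" by (intro tendsto_intros lt)
  qed simp
  then show "has_bochner_integral (lebesgue_on {a..}) (\<lambda>x. (?p x)\<^sup>2) (2 * \<mu> - 2 * \<mu> * t)" by (simp add: t)
  have "has_bochner_integral (lebesgue_on {a..}) (\<lambda>x. (?q x)\<^sup>2) (2/3 * \<mu>^3 * 1^3 - 2/3 * \<mu>^3 * (?t a)^3)"
  proof (rule lebesgue_on_FTC_atLeast[OF m(2)])
    show "((\<lambda>x. 2/3 * \<mu>^3 * (?t x)^3) has_real_derivative (?q x)\<^sup>2) (at x)" for x
      by (rule DERIV_cong[OF DERIV_cmult[OF DERIV_power[OF dt]]]) (unfold q2 p2, simp add: power2_eq_square power3_eq_cube algebra_simps)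
    show "((\<lambda>x. 2/3 * \<mu>^3 * (?t x)^3) \<longlongrightarrow> 2/3 * \<mu>^3 * 1^3) at_top" by (intro tendsto_intros lt)
  qed simp
  then show "has_bochner_integral (lebesgue_on {a..}) (\<lambda>x. (?q x)\<^sup>2) (2/3 * \<mu>^3 - 2/3 * \<mu>^3 * t^3)" by (simp add: t)
  have "has_bochner_integral (lebesgue_on {a..}) (\<lambda>x. (?p x)^4) (4 * \<mu>^3 * (1 - 1^3 * (1/3)) - 4 * \<mu>^3 * (?t a - (?t a)^3 * (1/3)))"
  proof (rule lebesgue_on_FTC_atLeast[OF m(3)])
    show "((\<lambda>x. 4 * \<mu>^3 * (?t x - (?t x)^3 * (1/3))) has_real_derivative (?p x)^4) (at x)" for x
      by (rule DERIV_cong[OF DERIV_cmult[OF DERIV_diff[OF dt DERIV_cmult_right[OF DERIV_power[OF dt]]]]])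
        (unfold p4 p2, simp add: power2_eq_square power3_eq_cube algebra_simps)
    show "((\<lambda>x. 4 * \<mu>^3 * (?t x - (?t x)^3 * (1/3))) \<longlongrightarrow> 4 * \<mu>^3 * (1 - 1^3 * (1/3))) at_top" by (intro tendsto_intros lt)
  qed simp
  then show "has_bochner_integral (lebesgue_on {a..}) (\<lambda>x. (?p x)^4) (8/3 * \<mu>^3 - 4 * \<mu>^3 * (t - t^3/3))" by (simp add: t)
qed

lemma H1_pair_sech:
  assumes \<mu>: "0 < \<mu>"
  shows "H1_pair {a..} (sech_profile (\<mu>\<^sup>2) b) (sech_slope (\<mu>\<^sup>2) b)"
proof -
  have o: "soliton_ode (\<mu>\<^sup>2) X (sech_profile (\<mu>\<^sup>2) b) (sech_slope (\<mu>\<^sup>2) b)" for X using \<mu> by (intro soliton_ode_sech) simp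
  have "ac_on {a..} (sech_profile (\<mu>\<^sup>2) b) (sech_slope (\<mu>\<^sup>2) b)"
    by (rule C1_ac_on[OF is_interval_ci soliton_odeD(1)[OF o] soliton_ode_continuous_on(2)[OF o]])
  moreover have "sech_profile (\<mu>\<^sup>2) b \<in> borel_measurable (lebesgue_on {a..})" "sech_slope (\<mu>\<^sup>2) b \<in> borel_measurable (lebesgue_on {a..})"
    by (intro continuous_imp_measurable_on_sets_lebesgue soliton_ode_continuous_on[OF o]; simp)+
  ultimately show ?thesis
    using sech_integrals(1,2)[OF \<mu> refl, of a b] by (simp add: H1_pair_def sq_integrable_def has_bochner_integral_iff)
qed

text \<open>By symmetry the soliton centred on the loop is admissible. With \<open>\<mu> * t\<close>
  in place of \<gamma> its quadratic part would equal its quartic part, and the latter misses the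
  mass left of -L; the smaller \<gamma> gives the strict inequality.\<close>

lemma soliton_test_function:
  assumes \<mu>: "0 < \<mu>" and \<gamma>: "\<gamma> < \<mu> * tanh (\<mu> * L)" and L: "0 < L"
  defines "f \<equiv> sech_profile (\<mu>\<^sup>2) 0" and "g \<equiv> sech_slope (\<mu>\<^sup>2) 0"
  assumes \<gamma>0: "0 \<le> \<gamma>"
  shows "admissible L f g" "(quad (\<mu>\<^sup>2) \<gamma> L f g)\<^sup>2 < 16/3 * \<mu>^3 * quart L f"
proof -
  show "admissible L f g" unfolding admissible_def f_def g_def
    using H1_pair_sech[OF \<mu>] by (simp add: sech_profile_def)
  define t where "t = tanh (\<mu> * L)"
  have t: "0 < t" "t < 1" using \<mu> L by (simp_all add: t_def tanh_real_lt_1)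
  have mt: "- t = tanh (\<mu> * (-L) + 0)" by (simp add: t_def)
  note i = sech_integrals[OF \<mu> mt, folded f_def g_def]
  have i12: "integrable (lebesgue_on {-L..}) (\<lambda>x. (f x)\<^sup>2)" "integrable (lebesgue_on {-L..}) (\<lambda>x. (g x)\<^sup>2)"
    using i by (simp_all add: has_bochner_integral_iff)
  have fL: "(f L)\<^sup>2 = 2 * \<mu>\<^sup>2 * (1 - t\<^sup>2)" using sech_sq[of "\<mu>\<^sup>2" 0 L] \<mu> by (simp add: f_def t_def)
  have Q: "quad (\<mu>\<^sup>2) \<gamma> L f g = (2/3 * \<mu>^3 - 2/3 * \<mu>^3 * (-t)^3) + \<mu>\<^sup>2 * (2 * \<mu> - 2 * \<mu> * (-t)) + \<gamma> * (2 * \<mu>\<^sup>2 * (1 - t\<^sup>2))"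
    unfolding quad_def fL using i i12 by (simp add: has_bochner_integral_iff)
  define B where "B = quart L f"
  have B: "B = 8/3 * \<mu>^3 - 4 * \<mu>^3 * ((-t) - (-t)^3/3)" using i(3) by (simp add: B_def quart_def has_bochner_integral_iff)
  have "t\<^sup>2 < 1" using t by (simp add: power_less_one_iff)
  then have "0 < 2 * \<mu>\<^sup>2 * (1 - t\<^sup>2)" using \<mu> by simp
  then have "\<gamma> * (2 * \<mu>\<^sup>2 * (1 - t\<^sup>2)) < \<mu> * t * (2 * \<mu>\<^sup>2 * (1 - t\<^sup>2))"
    using \<gamma> unfolding t_def[symmetric] by (rule mult_strict_right_mono[rotated])
  moreover have "(2/3 * \<mu>^3 - 2/3 * \<mu>^3 * (-t)^3) + \<mu>\<^sup>2 * (2 * \<mu> - 2 * \<mu> * (-t)) + \<mu> * t * (2 * \<mu>\<^sup>2 * (1 - t\<^sup>2)) = B"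
    unfolding B by (simp add: power2_eq_square power3_eq_cube algebra_simps)
  ultimately have QB: "quad (\<mu>\<^sup>2) \<gamma> L f g < B" unfolding Q by linarith
  have "B = 16/3 * \<mu>^3 - 4/3 * \<mu>^3 * ((1 - t)\<^sup>2 * (2 + t))"
    unfolding B by (simp add: power2_eq_square power3_eq_cube field_simps)
  moreover have "0 < 4/3 * \<mu>^3 * ((1 - t)\<^sup>2 * (2 + t))" using t \<mu> by (intro mult_pos_pos) auto
  ultimately have B2: "B < 16/3 * \<mu>^3" by linarith
  have q0: "0 \<le> quad (\<mu>\<^sup>2) \<gamma> L f g" by (rule quad_nonneg) (use \<gamma>0 in auto)
  have "(quad (\<mu>\<^sup>2) \<gamma> L f g)\<^sup>2 < B\<^sup>2" using QB q0 by (intro power_strict_mono) auto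
  also have "\<dots> \<le> 16/3 * \<mu>^3 * B" using B2 QB q0 unfolding power2_eq_square by (intro mult_right_mono) auto
  finally show "(quad (\<mu>\<^sup>2) \<gamma> L f g)\<^sup>2 < 16/3 * \<mu>^3 * quart L f" by (simp add: B_def)
qed

text \<open>As the loop shrinks only half a soliton and the vertex term remain: Q tends to
  \<open>8/3 * \<mu>^3 + 2 * \<gamma> * \<mu>\<^sup>2\<close> and B to \<open>8/3 * \<mu>^3\<close>,
  half the quartic mass of the line.\<close>

lemma plateau_test_function:
  assumes \<mu>: "0 < \<mu>" and \<gamma>: "0 \<le> \<gamma>" "\<gamma> + 2 * L * \<mu>\<^sup>2 \<le> 55/100 * \<mu>" and L: "0 < L"
  obtains f g where "admissible L f g" "(quad (\<mu>\<^sup>2) \<gamma> L f g)\<^sup>2 < 16/3 * \<mu>^3 * quart L f"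
proof -
  \<comment> \<open>The peak of the soliton sits at L, where it meets the plateau of height
    c.\<close>
  define b where "b = - \<mu> * L"
  let ?p = "sech_profile (\<mu>\<^sup>2) b" and ?q = "sech_slope (\<mu>\<^sup>2) b"
  define c where "c = sqrt (2 * \<mu>\<^sup>2)"
  have c2: "c\<^sup>2 = 2 * \<mu>\<^sup>2" using \<mu> by (simp add: c_def)
  have c4: "c^4 = 4 * \<mu>^4" using arg_cong[OF c2, of "\<lambda>x. x\<^sup>2"] by (simp add: power_mult_distrib flip: power_mult)
  have pL: "?p L = c" using \<mu> by (simp add: sech_profile_def b_def c_def)
  define f where "f = (\<lambda>x. if x \<le> L then c else ?p x)"
  define g where "g = (\<lambda>x. if x \<le> L then 0 else ?q x)"
  have "H1_pair {-L..L} (\<lambda>_. c) (\<lambda>_. 0)"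
  proof -
    have "ac_on {-L..L} (\<lambda>_. c) (\<lambda>_. 0)" by (rule C1_ac_on[OF is_interval_cc]) auto
    then show ?thesis by (simp add: H1_pair_def sq_integrable_def)
  qed
  then have "H1_pair {-L..} f g"
    unfolding f_def g_def by (rule H1_pair_glue[OF _ H1_pair_sech[OF \<mu>]]) (use L pL in auto)
  then have adm: "admissible L f g" using L by (simp add: admissible_def f_def)
  have z: "0 = tanh (\<mu> * L + b)" by (simp add: b_def)
  note i = sech_integrals[OF \<mu> z]
  have con: "has_bochner_integral (lebesgue_on {-L..L}) (\<lambda>_. r) (2 * L * r)" for r :: real
    using L by (simp add: has_bochner_integral_iff measure_restrict_space)
  have i12: "has_bochner_integral (lebesgue_on {L..}) (\<lambda>x. (?q x)\<^sup>2 + \<mu>\<^sup>2 * (?p x)\<^sup>2) (2/3 * \<mu>^3 - 2/3 * \<mu>^3 * 0^3 + \<mu>\<^sup>2 * (2 * \<mu> - 2 * \<mu> * 0))"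
    by (intro has_bochner_integral_add has_bochner_integral_mult_right i)
  have LL: "-L \<le> L" using L by simp
  have "integral\<^sup>L (lebesgue_on {-L..}) (\<lambda>x. if x \<le> L then \<mu>\<^sup>2 * c\<^sup>2 else (?q x)\<^sup>2 + \<mu>\<^sup>2 * (?p x)\<^sup>2) = 2 * L * (\<mu>\<^sup>2 * c\<^sup>2) + 8/3 * \<mu>^3"
    unfolding lebesgue_on_integral_glue(2)[OF integrable.intros[OF con] integrable.intros[OF i12] LL]
      has_bochner_integral_integral_eq[OF con] has_bochner_integral_integral_eq[OF i12]
    by (simp add: power2_eq_square power3_eq_cube)
  moreover have "(\<lambda>x. if x \<le> L then \<mu>\<^sup>2 * c\<^sup>2 else (?q x)\<^sup>2 + \<mu>\<^sup>2 * (?p x)\<^sup>2) = (\<lambda>x. (g x)\<^sup>2 + \<mu>\<^sup>2 * (f x)\<^sup>2)"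
    by (auto simp: f_def g_def)
  ultimately have Q: "quad (\<mu>\<^sup>2) \<gamma> L f g = 2 * L * (\<mu>\<^sup>2 * c\<^sup>2) + 8/3 * \<mu>^3 + \<gamma> * c\<^sup>2"
    by (simp add: quad_def f_def)
  also have "\<dots> = 8/3 * \<mu>^3 + 2 * \<mu>\<^sup>2 * (\<gamma> + 2 * L * \<mu>\<^sup>2)" unfolding c2 by (simp add: algebra_simps)
  also have "\<dots> \<le> 8/3 * \<mu>^3 + 2 * \<mu>\<^sup>2 * (55/100 * \<mu>)" using \<gamma>(2) by (intro add_left_mono mult_left_mono) auto
  also have "\<dots> = 113/30 * \<mu>^3" by (simp add: power2_eq_square power3_eq_cube)
  finally have Q1: "quad (\<mu>\<^sup>2) \<gamma> L f g \<le> 113/30 * \<mu>^3" .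
  have "integral\<^sup>L (lebesgue_on {-L..}) (\<lambda>x. if x \<le> L then c^4 else (?p x)^4) = 2 * L * c^4 + 8/3 * \<mu>^3"
    unfolding lebesgue_on_integral_glue(2)[OF integrable.intros[OF con] integrable.intros[OF i(3)] LL]
      has_bochner_integral_integral_eq[OF con] has_bochner_integral_integral_eq[OF i(3)] by simp
  moreover have "(\<lambda>x. if x \<le> L then c^4 else (?p x)^4) = (\<lambda>x. (f x)^4)" by (auto simp: f_def)
  ultimately have B: "8/3 * \<mu>^3 \<le> quart L f" using L by (simp add: quart_def c4)
  have m3: "0 < \<mu>^3" using \<mu> by simp
  have "(quad (\<mu>\<^sup>2) \<gamma> L f g)\<^sup>2 \<le> (113/30 * \<mu>^3)\<^sup>2" using Q1 quad_nonneg[of "\<mu>\<^sup>2" \<gamma> L f g] \<gamma>(1) by (intro power_mono) auto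
  \<comment> \<open>The square of 113/30 = 8/3 + 2 * 55/100 is just below 128/9, which explains the
    bound 55/100.\<close>
  also have "\<dots> < 16/3 * \<mu>^3 * (8/3 * \<mu>^3)" using mult_pos_pos[OF m3 m3] by (simp add: power2_eq_square)
  also have "\<dots> \<le> 16/3 * \<mu>^3 * quart L f" using B m3 by (intro mult_left_mono) auto
  finally show ?thesis by (rule that[OF adm])
qed

section \<open>Jacobi elliptic functions\<close>

lemma ellF_integrand:
  fixes k \<theta> :: real
  assumes "0 \<le> k" "k < 1"
  shows "0 < 1 - k\<^sup>2 * (sin \<theta>)\<^sup>2" "1 - k\<^sup>2 * (sin \<theta>)\<^sup>2 \<le> 1"
proof -
  have "k\<^sup>2 < 1" using assms by (simp add: power_less_one_iff)
  moreover have "k\<^sup>2 * (sin \<theta>)\<^sup>2 \<le> k\<^sup>2 * 1" by (intro mult_left_mono) (auto simp: sin_squared_eq)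
  ultimately show "0 < 1 - k\<^sup>2 * (sin \<theta>)\<^sup>2" by simp
qed simp

lemma ellF_deriv:
  assumes k: "0 \<le> k" "k < 1"
  shows "(ellF k has_real_derivative 1 / sqrt (1 - k\<^sup>2 * (sin x)\<^sup>2)) (at x)"
proof -
  let ?f = "\<lambda>\<theta>. 1 / sqrt (1 - k\<^sup>2 * (sin \<theta>)\<^sup>2)"
  define R where "R = \<bar>x\<bar> + 1"
  have "sqrt (1 - k\<^sup>2 * (sin \<theta>)\<^sup>2) \<noteq> 0" for \<theta> using ellF_integrand(1)[OF k, of \<theta>] by simp
  then have c: "continuous_on {-R..R} ?f" by (intro continuous_intros) auto
  have "((\<lambda>u. LBINT y=ereal 0..ereal u. ?f y) has_vector_derivative ?f x) (at x within {-R..R})"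
    by (rule interval_integral_FTC2[OF _ _ c]) (auto simp: R_def)
  moreover have "(\<lambda>u. LBINT y=ereal 0..ereal u. ?f y) = ellF k" by (auto simp: ellF_def zero_ereal_def)
  moreover have "at x within {-R..R} = at x" by (rule at_within_Icc_at) (auto simp: R_def)
  ultimately show ?thesis by (simp add: has_real_derivative_iff_has_vector_derivative)
qed

text \<open>The integrand is at least 1. Expansion gives injectivity and surjectivity of
  \<open>ellF k\<close>, and its inverse does not increase distances.\<close>

lemma ellF_expanding:
  assumes k: "0 \<le> k" "k < 1" and "x \<le> y"
  shows "y - x \<le> ellF k y - ellF k x"
proof -
  have "ellF k x - x \<le> ellF k y - y"
  proof (rule DERIV_nonneg_imp_nondecreasing[OF assms(3)])
    fix t
    have "1 \<le> 1 / sqrt (1 - k\<^sup>2 * (sin t)\<^sup>2)" using ellF_integrand[OF k, of t] by simp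
    then show "\<exists>z. ((\<lambda>t. ellF k t - t) has_real_derivative z) (at t) \<and> 0 \<le> z"
      by (intro exI[of _ "1 / sqrt (1 - k\<^sup>2 * (sin t)\<^sup>2) - 1"] conjI DERIV_diff ellF_deriv[OF k] DERIV_ident) simp
  qed
  then show ?thesis by simp
qed

lemma ellF_0: "ellF k 0 = 0"
  by (simp add: ellF_def zero_ereal_def[symmetric])

lemma ellK_nonneg:
  assumes k: "0 \<le> k" "k < 1"
  shows "0 \<le> ellK k"
  using ellF_expanding[OF k, of 0 "pi/2"] pi_ge_zero unfolding ellK_def ellF_0 by linarith

lemma ellF_jacobi_am:
  assumes k: "0 \<le> k" "k < 1"
  shows "ellF k (jacobi_am k z) = z"
proof -
  have cont: "isCont (ellF k) x" for x using ellF_deriv[OF k] by (rule DERIV_isCont)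
  have "\<exists>x. ellF k x = z"
  proof -
    have "ellF k (-\<bar>z\<bar>) \<le> z" "z \<le> ellF k \<bar>z\<bar>"
      using ellF_expanding[OF k, of "-\<bar>z\<bar>" 0] ellF_expanding[OF k, of 0 "\<bar>z\<bar>"] by (auto simp: ellF_0)
    then show ?thesis using IVT[of "ellF k" "-\<bar>z\<bar>" z "\<bar>z\<bar>"] cont by auto
  qed
  moreover have "x = y" if "ellF k x = z" "ellF k y = z" for x y
    using ellF_expanding[OF k, of x y] ellF_expanding[OF k, of y x] that by linarith
  ultimately have "\<exists>!x. ellF k x = z" by blast
  then show ?thesis unfolding jacobi_am_def by (rule theI')
qed

text \<open>The inverse function rule, with continuity supplied by the Lipschitz bound; the
  reciprocal of the integrand at the amplitude is dn.\<close>

lemma jacobi_am_deriv: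
  assumes k: "0 \<le> k" "k < 1"
  shows "(jacobi_am k has_real_derivative jacobi_dn k z) (at z)"
proof -
  note am = ellF_jacobi_am[OF k]
  have lip: "\<bar>jacobi_am k x - jacobi_am k y\<bar> \<le> \<bar>x - y\<bar>" for x y
    using ellF_expanding[OF k, of "jacobi_am k x" "jacobi_am k y"] ellF_expanding[OF k, of "jacobi_am k y" "jacobi_am k x"]
    unfolding am by linarith
  have "isCont (jacobi_am k) z"
    unfolding continuous_at_eps_delta
  proof (intro allI impI)
    fix e :: real assume "0 < e"
    then show "\<exists>d>0. \<forall>x'. dist x' z < d \<longrightarrow> dist (jacobi_am k x') (jacobi_am k z) < e"
      using lip by (intro exI[of _ e]) (auto simp: dist_real_def intro: le_less_trans)
  qed
  moreover have "1 / sqrt (1 - k\<^sup>2 * (sin (jacobi_am k z))\<^sup>2) \<noteq> 0" using ellF_integrand(1)[OF k, of "jacobi_am k z"] by simp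
  ultimately have "(jacobi_am k has_real_derivative inverse (1 / sqrt (1 - k\<^sup>2 * (sin (jacobi_am k z))\<^sup>2))) (at z)"
    by (intro DERIV_inverse_function[where a = "z - 1" and b = "z + 1", OF ellF_deriv[OF k]]) (auto simp: am)
  then show ?thesis by (simp add: jacobi_dn_def)
qed

lemma jacobi_dn_deriv:
  assumes k: "0 \<le> k" "k < 1"
  defines "s \<equiv> \<lambda>z. - k\<^sup>2 * (sin (jacobi_am k z) * cos (jacobi_am k z))"
  shows "(jacobi_dn k has_real_derivative s z) (at z)"
    "(s has_real_derivative (2 - k\<^sup>2) * jacobi_dn k z - 2 * (jacobi_dn k z)^3) (at z)"
proof -
  note am = jacobi_am_deriv[OF k, of z]
  have pos: "0 < 1 - k\<^sup>2 * (sin (jacobi_am k z))\<^sup>2" by (rule ellF_integrand(1)[OF k])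
  have dn2: "(jacobi_dn k z)\<^sup>2 = 1 - k\<^sup>2 * (sin (jacobi_am k z))\<^sup>2" using pos by (simp add: jacobi_dn_def)
  have dn0: "0 < jacobi_dn k z" using pos by (simp add: jacobi_dn_def)
  have ds: "((\<lambda>z. sin (jacobi_am k z)) has_real_derivative cos (jacobi_am k z) * jacobi_dn k z) (at z)"
    "((\<lambda>z. cos (jacobi_am k z)) has_real_derivative - sin (jacobi_am k z) * jacobi_dn k z) (at z)"
    by (rule DERIV_chain2[OF DERIV_sin am] DERIV_chain2[OF DERIV_cos am])+
  have i: "((\<lambda>z. 1 - k\<^sup>2 * (sin (jacobi_am k z))\<^sup>2) has_real_derivative 0 - k\<^sup>2 * (of_nat 2 * (cos (jacobi_am k z) * jacobi_dn k z * sin (jacobi_am k z) ^ (2 - Suc 0)))) (at z)"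
    by (intro DERIV_diff DERIV_const DERIV_cmult DERIV_power ds)
  have "((\<lambda>z. sqrt (1 - k\<^sup>2 * (sin (jacobi_am k z))\<^sup>2)) has_real_derivative
      inverse (jacobi_dn k z) / 2 * (0 - k\<^sup>2 * (of_nat 2 * (cos (jacobi_am k z) * jacobi_dn k z * sin (jacobi_am k z) ^ (2 - Suc 0))))) (at z)"
    unfolding jacobi_dn_def[of k z] by (rule DERIV_chain2[where f = sqrt, OF DERIV_real_sqrt[OF pos] i[unfolded jacobi_dn_def[of k z]]])
  moreover have "inverse (jacobi_dn k z) / 2 * (0 - k\<^sup>2 * (of_nat 2 * (cos (jacobi_am k z) * jacobi_dn k z * sin (jacobi_am k z) ^ (2 - Suc 0)))) = s z"
    using dn0 by (simp add: s_def field_simps)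
  ultimately show "(jacobi_dn k has_real_derivative s z) (at z)" by (simp add: jacobi_dn_def[abs_def])
  have "(s has_real_derivative - k\<^sup>2 * (cos (jacobi_am k z) * jacobi_dn k z * cos (jacobi_am k z) + (- sin (jacobi_am k z) * jacobi_dn k z) * sin (jacobi_am k z))) (at z)"
    unfolding s_def by (intro DERIV_cmult DERIV_mult ds)
  moreover have "- k\<^sup>2 * (cos a * d * cos a + (- sin a * d) * sin a) = (2 - k\<^sup>2) * d - 2 * d^3" if "d\<^sup>2 = 1 - k\<^sup>2 * (sin a)\<^sup>2" for a d
  proof -
    have c: "cos a * cos a = 1 - sin a * sin a" using sin_cos_squared_add[of a] by (simp add: power2_eq_square)
    have "- k\<^sup>2 * (cos a * d * cos a + (- sin a * d) * sin a) = - k\<^sup>2 * d * (cos a * cos a - sin a * sin a)" by (simp add: algebra_simps)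
    also have "\<dots> = (2 - k\<^sup>2) * d - 2 * (1 - k\<^sup>2 * (sin a)\<^sup>2) * d" unfolding c by (simp add: algebra_simps power2_eq_square)
    also have "\<dots> = (2 - k\<^sup>2) * d - 2 * d^3" unfolding that[symmetric] by (simp add: power2_eq_square power3_eq_cube)
    finally show ?thesis .
  qed
  ultimately show "(s has_real_derivative (2 - k\<^sup>2) * jacobi_dn k z - 2 * (jacobi_dn k z)^3) (at z)" using dn2 by simp
qed

text \<open>The solution with a critical point of height u 0 at the centre is compared with the dn
  profile of the same height; both solve one initial value problem.\<close>

lemma soliton_ode_dnoidal:
  assumes o: "soliton_ode \<omega> {-L..L} u v" and L: "0 < L" and \<omega>: "0 < \<omega>" and c: "\<omega> < (u 0)\<^sup>2" "(u 0)\<^sup>2 < 2 * \<omega>" "0 < u 0"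
    and v0: "v 0 = 0"
  shows "\<exists>k. dnoidal_type \<omega> {-L..L} u k 0"
proof -
  define c where "c = u 0"
  \<comment> \<open>The modulus is read off from the height:
    \<open>c\<^sup>2 = 2 * \<omega> / (2 - k\<^sup>2)\<close>. The bounds on c^2 place k between 0
    and 1.\<close>
  define k where "k = sqrt (2 - 2 * \<omega> / c\<^sup>2)"
  have c2: "\<omega> < c\<^sup>2" "c\<^sup>2 < 2 * \<omega>" "0 < c" using assms by (auto simp: c_def)
  have k2: "k\<^sup>2 = 2 - 2 * \<omega> / c\<^sup>2" using c2 by (simp add: k_def field_simps)
  have "2 - 2 * \<omega> / c\<^sup>2 < 1" using c2 \<omega> by (simp add: field_simps)
  then have k: "0 \<le> k" "k < 1" using c2 \<omega> by (auto simp: k_def field_simps)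
  define \<beta> where "\<beta> = c / sqrt 2"
  have \<beta>2: "\<beta>\<^sup>2 = c\<^sup>2 / 2" by (simp add: \<beta>_def power_divide)
  have s: "2 - k\<^sup>2 = 2 * \<omega> / c\<^sup>2" using k2 by simp
  have p: "dn_profile \<omega> k 0 x = c * jacobi_dn k (\<beta> * x)" for x
  proof -
    have 1: "2 * \<omega> / (2 * \<omega> / c\<^sup>2) = c\<^sup>2" and 2: "\<omega> / (2 * \<omega> / c\<^sup>2) = c\<^sup>2 / 2" using \<omega> c2 by simp_all
    have "sqrt (c\<^sup>2) = c" "sqrt (c\<^sup>2 / 2) = \<beta>" using c2 by (simp_all add: \<beta>_def real_sqrt_divide)
    then show ?thesis unfolding dn_profile_def s 1 2 by simp
  qed
  let ?s = "\<lambda>z. - k\<^sup>2 * (sin (jacobi_am k z) * cos (jacobi_am k z))"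
  have "soliton_ode \<omega> {-L..L} (dn_profile \<omega> k 0) (\<lambda>x. c * (?s (\<beta> * x) * \<beta>))"
    unfolding soliton_ode_def p[abs_def]
  proof (intro ballI conjI)
    fix x
    have b: "((\<lambda>x. \<beta> * x) has_real_derivative \<beta>) (at x within {-L..L})" by (auto intro!: derivative_eq_intros)
    show "((\<lambda>x. c * jacobi_dn k (\<beta> * x)) has_real_derivative c * (?s (\<beta> * x) * \<beta>)) (at x within {-L..L})"
      by (intro DERIV_cmult DERIV_chain2[OF jacobi_dn_deriv(1)[OF k] b])
    have "((\<lambda>x. c * (?s (\<beta> * x) * \<beta>)) has_real_derivative c * (((2 - k\<^sup>2) * jacobi_dn k (\<beta> * x) - 2 * (jacobi_dn k (\<beta> * x))^3) * \<beta> * \<beta>)) (at x within {-L..L})"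
      by (intro DERIV_cmult DERIV_cmult_right DERIV_chain2[OF jacobi_dn_deriv(2)[OF k] b])
    moreover have "c * (((2 - k\<^sup>2) * d - 2 * d^3) * \<beta> * \<beta>) = \<omega> * (c * d) - (c * d)^3" for d
    proof -
      have "c * (((2 - k\<^sup>2) * d - 2 * d^3) * \<beta> * \<beta>) = c * ((2 - k\<^sup>2) * d - 2 * d^3) * \<beta>\<^sup>2" by (simp add: power2_eq_square)
      also have "\<dots> = c * d * (c\<^sup>2 / 2 * (2 * \<omega> / c\<^sup>2)) - (c * d)^3" unfolding \<beta>2 s by (simp add: algebra_simps power2_eq_square power3_eq_cube)
      also have "c\<^sup>2 / 2 * (2 * \<omega> / c\<^sup>2) = \<omega>" using c2 by simp
      finally show ?thesis by simp
    qed
    ultimately show "((\<lambda>x. c * (?s (\<beta> * x) * \<beta>)) has_real_derivative \<omega> * (c * jacobi_dn k (\<beta> * x)) - (c * jacobi_dn k (\<beta> * x))^3) (at x within {-L..L})"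
      by simp
  qed
  note dn = this
  have am0: "jacobi_am k 0 = 0"
    using ellF_expanding[OF k, of 0 "jacobi_am k 0"] ellF_expanding[OF k, of "jacobi_am k 0" 0] ellF_jacobi_am[OF k, of 0]
    unfolding ellF_0 by linarith
  have eq: "u x = dn_profile \<omega> k 0 x" if "x \<in> {-L..L}" for x
    by (rule soliton_ode_unique(1)[OF is_interval_cc _ that o dn, of 0]) (use L v0 in \<open>simp_all add: p am0 jacobi_dn_def c_def\<close>)
  have "0 \<le> dn_length \<omega> k" using ellK_nonneg[OF k] \<omega> c2 s by (simp add: dn_length_def)
  then show ?thesis using k eq by (intro exI[of _ k]) (simp add: dnoidal_type_def)
qed

section \<open>The profile on the loop\<close>

lemma left_end_min:
  assumes "a < b" and d: "(f has_real_derivative q) (at a within {a..b})" and m: "\<And>y. y \<in> {a..b} \<Longrightarrow> f a \<le> f y"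
  shows "0 \<le> q"
proof (rule ccontr)
  assume "\<not> 0 \<le> q"
  then have "q < 0" by simp
  then obtain e where e: "e > 0" "\<And>h. 0 < h \<Longrightarrow> a + h \<in> {a..b} \<Longrightarrow> h < e \<Longrightarrow> f (a + h) < f a"
    using has_real_derivative_neg_dec_right[OF d] by blast
  define h where "h = min (e/2) (b - a)"
  have h: "0 < h" "a + h \<in> {a..b}" "h < e" using assms(1) e(1) by (auto simp: h_def)
  show False using e(2)[OF h] m[OF h(2)] by simp
qed

lemma right_end_min:
  assumes "a < b" and d: "(f has_real_derivative q) (at b within {a..b})" and m: "\<And>y. y \<in> {a..b} \<Longrightarrow> f b \<le> f y"
  shows "q \<le> 0"
proof (rule ccontr)
  assume "\<not> q \<le> 0"
  then have "0 < q" by simp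
  then obtain e where e: "e > 0" "\<And>h. 0 < h \<Longrightarrow> b - h \<in> {a..b} \<Longrightarrow> h < e \<Longrightarrow> f (b - h) < f b"
    using has_real_derivative_pos_inc_left[OF d] by blast
  define h where "h = min (e/2) (b - a)"
  have h: "0 < h" "b - h \<in> {a..b}" "h < e" using assms(1) e(1) by (auto simp: h_def)
  show False using e(2)[OF h] m[OF h(2)] by simp
qed

lemma interior_min:
  assumes x: "a < x" "x < b" and d: "(f has_real_derivative q) (at x within {a..b})" and m: "\<And>y. y \<in> {a..b} \<Longrightarrow> f x \<le> f y"
  shows "q = 0"
proof (rule DERIV_local_min)
  show "(f has_real_derivative q) (at x)" using d x by (simp add: at_within_Icc_at)
  show "0 < min (x - a) (b - x)" using x by simp
  show "\<forall>y. \<bar>x - y\<bar> < min (x - a) (b - x) \<longrightarrow> f x \<le> f y" by (intro allI impI m) auto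
qed

lemma interior_max:
  fixes f :: "real \<Rightarrow> real"
  assumes x: "a < x" "x < b" and d: "(f has_real_derivative q) (at x within {a..b})" and m: "\<And>y. y \<in> {a..b} \<Longrightarrow> f y \<le> f x"
  shows "q = 0"
  using interior_min[OF x DERIV_minus[OF d]] m by simp

text \<open>As long as \<open>u\<^sup>2 \<le> \<omega> / 2\<close>, the equation gives u'' at least
  \<omega>/2 times u, hence at least \<omega>/2 times u a; two integrations produce quadratic
  growth.\<close>

lemma soliton_ode_growth:
  assumes o: "soliton_ode \<omega> {a..b} u v" and ab: "a \<le> b" and va: "v a = 0" and m: "0 \<le> u a"
    and u: "\<And>x. x \<in> {a..b} \<Longrightarrow> u a \<le> u x" "\<And>x. x \<in> {a..b} \<Longrightarrow> (u x)\<^sup>2 \<le> \<omega> / 2"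
  shows "u a * (1 + \<omega> / 4 * (b - a)\<^sup>2) \<le> u b"
proof -
  have d: "(u has_real_derivative v x) (at x)" "(v has_real_derivative \<omega> * u x - (u x)^3) (at x)" if "a < x" "x < b" for x
    using soliton_odeD[OF o, of x] that by (simp_all add: at_within_Icc_at)
  have v: "\<omega> / 2 * u a * (x - a) \<le> v x" if x: "x \<in> {a..b}" for x
  proof -
    have "v a - \<omega> / 2 * u a * (a - a) \<le> v x - \<omega> / 2 * u a * (x - a)"
    proof (rule DERIV_nonneg_imp_increasing_open[where f = "\<lambda>x. v x - \<omega> / 2 * u a * (x - a)"])
      fix y assume y: "a < y" "y < x"
      have D: "((\<lambda>x. v x - \<omega> / 2 * u a * (x - a)) has_real_derivative (\<omega> * u y - (u y)^3) - \<omega> / 2 * u a * (1 - 0)) (at y)"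
        by (intro DERIV_diff DERIV_cmult DERIV_ident DERIV_const d) (use x y in auto)
      have u2: "(u y)\<^sup>2 \<le> \<omega> / 2" and u0: "u a \<le> u y" using u[of y] x y by auto
      then have "\<omega> / 2 \<le> \<omega> - (u y)\<^sup>2" by simp
      moreover have "0 \<le> \<omega> / 2" using u2 by (rule order_trans[rotated]) simp
      ultimately have "(\<omega> / 2) * u a \<le> (\<omega> - (u y)\<^sup>2) * u y" using u0 m by (intro mult_mono) auto
      also have "\<dots> = \<omega> * u y - (u y)^3" by (simp add: algebra_simps power2_eq_square power3_eq_cube)
      finally show "\<exists>z. ((\<lambda>x. v x - \<omega> / 2 * u a * (x - a)) has_real_derivative z) (at y) \<and> 0 \<le> z" using D by (intro exI conjI) auto
    next
      show "continuous_on {a..x} (\<lambda>x. v x - \<omega> / 2 * u a * (x - a))"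
        by (intro continuous_intros continuous_on_subset[OF soliton_ode_continuous_on(2)[OF o]]) (use x in auto)
    qed (use x in auto)
    then show ?thesis using va by simp
  qed
  have "u a - \<omega> / 4 * u a * (a - a)\<^sup>2 \<le> u b - \<omega> / 4 * u a * (b - a)\<^sup>2"
  proof (rule DERIV_nonneg_imp_increasing_open[OF ab, where f = "\<lambda>x. u x - \<omega> / 4 * u a * (x - a)\<^sup>2"])
    fix y assume y: "a < y" "y < b"
    have "((\<lambda>x. u x - \<omega> / 4 * u a * (x - a)\<^sup>2) has_real_derivative v y - \<omega> / 4 * u a * (of_nat 2 * ((1 - 0) * (y - a) ^ (2 - Suc 0)))) (at y)"
      by (intro DERIV_diff DERIV_cmult DERIV_power DERIV_ident DERIV_const d y)
    moreover have "0 \<le> v y - \<omega> / 4 * u a * (of_nat 2 * ((1 - 0) * (y - a) ^ (2 - Suc 0)))"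
      using v[of y] y by (simp add: algebra_simps)
    ultimately show "\<exists>z. ((\<lambda>x. u x - \<omega> / 4 * u a * (x - a)\<^sup>2) has_real_derivative z) (at y) \<and> 0 \<le> z"
      by blast
  next
    show "continuous_on {a..b} (\<lambda>x. u x - \<omega> / 4 * u a * (x - a)\<^sup>2)"
      by (intro continuous_intros soliton_ode_continuous_on(1)[OF o])
  qed
  then show ?thesis by (simp add: algebra_simps)
qed

text \<open>In the application \<open>T\<close> is the hyperbolic tangent of the translation parameter on the half-line;
  \<open>jump\<close> is Kirchhoff's condition and \<open>loop4\<close> is what the half-line leaves of \<open>16/3 \<mu>\<^sup>3\<close>.\<close>

locale loop_profile =
  fixes \<mu> \<gamma> L T :: real and w v :: "real \<Rightarrow> real"
  assumes \<mu>: "0 < \<mu>" and \<gamma>: "0 < \<gamma>" and L: "0 < L"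
    and ode: "soliton_ode (\<mu>\<^sup>2) {-L..L} w v" and closed: "w (-L) = w L" and p0: "0 < w L"
    and nonneg: "\<And>x. x \<in> {-L..L} \<Longrightarrow> 0 \<le> w x"
    and T: "\<bar>T\<bar> < 1" and p2: "(w L)\<^sup>2 = 2 * \<mu>\<^sup>2 * (1 - T\<^sup>2)" and jump: "v (-L) - v L = (\<gamma> + \<mu> * T) * w L"
    and loop4: "integral {-L..L} (\<lambda>x. (w x)^4) < \<mu>^3 * (8/3 + 4 * T - 4/3 * T^3)"
    and hoelder: "\<And>x. x \<in> {-L..L} \<Longrightarrow> (w x - w L)\<^sup>2 \<le> 2 * L * (16/3 * \<mu>^3)"
begin

section \<open>Consequences of energy conservation on the loop\<close>

lemma ends: "-L \<in> {-L..L}" "L \<in> {-L..L}" "0 \<in> {-L..L}" "-L < L"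
  using L by auto

text \<open>The relation \<open>p2\<close> says that the height at the vertex is that of a
  zero-energy solution with slope of modulus \<open>\<mu> * |T| * w L\<close>; only the slope on the
  loop differs.\<close>

lemma energy:
  assumes "x \<in> {-L..L}"
  shows "(v x)\<^sup>2 - \<mu>\<^sup>2 * (w x)\<^sup>2 + (w x)^4 / 2 = (v (-L))\<^sup>2 - (\<mu> * T * w L)\<^sup>2"
proof -
  have "(w L)^4 = (w L)\<^sup>2 * (w L)\<^sup>2" by (simp flip: power_add)
  also have "\<dots> = (w L)\<^sup>2 * (2 * \<mu>\<^sup>2 * (1 - T\<^sup>2))" by (simp only: p2[symmetric])
  finally have "- \<mu>\<^sup>2 * (w L)\<^sup>2 + (w L)^4 / 2 = - (\<mu> * T * w L)\<^sup>2" by (simp add: algebra_simps power_mult_distrib)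
  then show ?thesis using soliton_ode_energy[OF ode is_interval_cc assms ends(1)] unfolding closed by linarith
qed

lemma slopes: "v (-L) = v L \<or> v (-L) = - v L"
proof -
  have "(v (-L))\<^sup>2 = (v L)\<^sup>2" using soliton_ode_energy[OF ode is_interval_cc ends(1,2)] unfolding closed by simp
  then show ?thesis by (simp add: power2_eq_iff)
qed

lemma reflection:
  assumes "v (-L) = - v L" and x: "x \<in> {-L..L}"
  shows "w (-x) = w x" "- v (-x) = v x"
proof -
  have im: "uminus ` {-L..L} = {-L..L}" by auto
  have r: "soliton_ode (\<mu>\<^sup>2) {-L..L} (\<lambda>x. w (-x)) (\<lambda>x. - v (-x))" by (rule soliton_ode_reflect) (simp only: im ode)
  show "w (-x) = w x" "- v (-x) = v x"
    by (rule soliton_ode_unique[OF is_interval_cc ends(2) x r ode]; use assms closed in simp)+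
qed

definition even_dnoidal_profile :: bool where
  "even_dnoidal_profile \<longleftrightarrow> (\<forall>x\<in>{-L..L}. w (-x) = w x) \<and> v 0 = 0 \<and> v (-L) = (\<gamma> + \<mu> * T) * w L / 2 \<and>
     \<mu>\<^sup>2 < (w 0)\<^sup>2 \<and> (w 0)\<^sup>2 < 2 * \<mu>\<^sup>2"

text \<open>Opposite end slopes make the loop part even, and equal ones make the jump zero. Hence an
  uneven loop, case (B), can occur only for \<open>\<mu> * T = - \<gamma>\<close>.\<close>

lemma even_slopes:
  assumes "\<gamma> + \<mu> * T \<noteq> 0"
  shows "v (-L) = - v L" "v (-L) = (\<gamma> + \<mu> * T) * w L / 2" "v 0 = 0"
proof -
  have "v (-L) \<noteq> v L" using jump assms p0 by auto
  then show e: "v (-L) = - v L" using slopes by blast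
  then show "v (-L) = (\<gamma> + \<mu> * T) * w L / 2" using jump by simp
  show "v 0 = 0" using reflection(2)[OF e ends(3)] by simp
qed

text \<open>The hypothesis says that at the vertex the loop is less steep than the half-line, so the
  loop part runs strictly inside the homoclinic orbit.\<close>

lemma negative_energy:
  assumes "\<bar>\<gamma> + \<mu> * T\<bar> < 2 * \<bar>\<mu> * T\<bar>" "\<gamma> + \<mu> * T \<noteq> 0" "x \<in> {-L..L}"
  shows "(v x)\<^sup>2 - \<mu>\<^sup>2 * (w x)\<^sup>2 + (w x)^4 / 2 < 0"
proof -
  have "\<bar>(\<gamma> + \<mu> * T) * w L / 2\<bar> < \<bar>\<mu> * T * w L\<bar>" using assms(1) p0 by (simp add: abs_mult)
  then have "((\<gamma> + \<mu> * T) * w L / 2)\<^sup>2 < (\<mu> * T * w L)\<^sup>2"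
    using power_strict_mono[OF _ abs_ge_zero, of "(\<gamma> + \<mu> * T) * w L / 2" _ 2] unfolding power2_abs by fastforce
  then show ?thesis using energy[OF assms(3)] even_slopes(2)[OF assms(2)] by simp
qed

text \<open>At the centre the slope is zero and the energy negative, which bounds the height from
  above. The hypothesis \<open>\<mu> < w 0\<close> makes the centre a maximum of the dnoidal
  solution.\<close>

lemma even_dnoidal_profileI:
  assumes "\<bar>\<gamma> + \<mu> * T\<bar> < 2 * \<bar>\<mu> * T\<bar>" "\<gamma> + \<mu> * T \<noteq> 0" "\<mu> < w 0"
  shows even_dnoidal_profile
proof -
  note e = even_slopes[OF assms(2)]
  have "- \<mu>\<^sup>2 * (w 0)\<^sup>2 + (w 0)^4 / 2 < 0" using negative_energy[OF assms(1,2) ends(3)] e(3) by simp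
  then have "(w 0)\<^sup>2 * ((w 0)\<^sup>2 - 2 * \<mu>\<^sup>2) < 0" by (simp add: algebra_simps flip: power_add)
  then have "(w 0)\<^sup>2 < 2 * \<mu>\<^sup>2" by (simp add: mult_less_0_iff not_less)
  moreover have "\<mu>\<^sup>2 < (w 0)\<^sup>2" using assms(3) \<mu> by (intro power_strict_mono) auto
  ultimately show ?thesis using e reflection(1)[OF e(1)] by (simp add: even_dnoidal_profile_def)
qed

lemma w_continuous: "continuous_on {-L..L} w" "continuous_on {-L..L} v"
  using soliton_ode_continuous_on[OF ode] by auto

text \<open>The jump is the integral of \<open>w\<^sup>3 - \<mu>\<^sup>2 w\<close> over a short
  loop, so \<open>\<gamma> + \<mu> * T\<close> is small compared with \<gamma>. Then T^2 is well
  below 1/2 and the vertex height well above \<mu>; closeness gives \<open>w > \<mu>\<close> on the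
  loop, and concavity makes the jump positive.\<close>

lemma small_loop:
  assumes \<gamma>\<mu>: "\<gamma> < 53/100 * \<mu>" and L\<mu>: "L * \<mu> < 1/1200" and L\<gamma>: "L * \<mu>\<^sup>2 < \<gamma> / 18"
  shows "even_dnoidal_profile" "- \<gamma> < \<mu> * T" "\<mu> * T < - \<gamma> / 3"
proof -
  have m2: "0 < \<mu>\<^sup>2" using \<mu> by simp
  \<comment> \<open>Since \<open>L * \<mu> < 1/1200\<close>, the Hoelder bound 32/3 * L * \<mu>^3 is
    below \<mu>^2 / 100.\<close>
  have close: "\<bar>w x - w L\<bar> < \<mu> / 10" if x: "x \<in> {-L..L}" for x
  proof -
    have "L * \<mu> * \<mu>\<^sup>2 < 1/1200 * \<mu>\<^sup>2" using L\<mu> m2 by (rule mult_strict_right_mono)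
    then have "2 * L * (16/3 * \<mu>^3) < (\<mu> / 10)\<^sup>2"
      using m2 by (simp add: power2_eq_square power3_eq_cube algebra_simps)
    then have "\<bar>w x - w L\<bar>\<^sup>2 < (\<mu> / 10)\<^sup>2" using hoelder[OF x] by simp
    then show ?thesis by (rule power2_less_imp_less) (use \<mu> in simp)
  qed
  have "(w L)\<^sup>2 < (142/100 * \<mu>)\<^sup>2"
  proof -
    have "0 \<le> 2 * \<mu>\<^sup>2 * T\<^sup>2" by simp
    then have "(w L)\<^sup>2 \<le> 2 * \<mu>\<^sup>2" unfolding p2 by (simp add: algebra_simps)
    then show ?thesis using m2 by (simp add: power2_eq_square)
  qed
  then have p1: "w L < 142/100 * \<mu>" by (rule power2_less_imp_less) (use \<mu> in simp)
  have w2\<mu>: "w x < 2 * \<mu>" if "x \<in> {-L..L}" for x using close[OF that] p1 \<mu> by linarith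
  obtain xm where xm: "xm \<in> {-L..L}" "\<And>y. y \<in> {-L..L} \<Longrightarrow> w y \<le> w xm"
    using continuous_attains_sup[OF compact_Icc _ w_continuous(1)] ends(1) by blast
  \<comment> \<open>The jump must be compared with w L itself, so w is bounded by a multiple of w L.
    If the maximum exceeds \<mu>, closeness does it; otherwise w is convex and attains its maximum
    at the ends.\<close>
  have w2p: "w xm \<le> 2 * w L"
  proof (cases "w xm \<le> \<mu>")
    case False
    then show ?thesis using close[OF xm(1)] by linarith
  next
    case True
    have dv: "(v has_real_derivative \<mu>\<^sup>2 * w x - (w x)^3) (at x)" "(w has_real_derivative v x) (at x)" "0 \<le> \<mu>\<^sup>2 * w x - (w x)^3" if "-L < x" "x < L" for x
    proof -
      have x: "x \<in> {-L..L}" using that by simp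
      show "(v has_real_derivative \<mu>\<^sup>2 * w x - (w x)^3) (at x)" "(w has_real_derivative v x) (at x)"
        using soliton_odeD[OF ode x] that by (simp_all add: at_within_Icc_at)
      have "w x \<le> \<mu>" using xm(2)[OF x] True by simp
      then have "(w x)\<^sup>2 \<le> \<mu>\<^sup>2" using nonneg[OF x] by (intro power_mono)
      then have "0 \<le> w x * (\<mu>\<^sup>2 - (w x)\<^sup>2)" using nonneg[OF x] by (intro mult_nonneg_nonneg) auto
      then show "0 \<le> \<mu>\<^sup>2 * w x - (w x)^3" by (simp add: algebra_simps power2_eq_square power3_eq_cube)
    qed
    have "w xm \<le> w L"
    proof (rule ccontr)
      assume n: "\<not> w xm \<le> w L"
      then have "xm \<noteq> L" "xm \<noteq> -L" using closed by auto
      then have i: "-L < xm" "xm < L" using xm(1) by auto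
      have v0: "v xm = 0" by (rule interior_max[OF i soliton_odeD(1)[OF ode xm(1)]]) (rule xm(2))
      have vn: "0 \<le> v y" if y: "xm \<le> y" "y < L" for y
      proof -
        have "v xm \<le> v y"
        proof (rule DERIV_nonneg_imp_increasing_open[OF y(1)])
          fix x assume "xm < x" "x < y"
          then have "-L < x" "x < L" using i y by auto
          then show "\<exists>z. (v has_real_derivative z) (at x) \<and> 0 \<le> z" using dv(1,3) by blast
        qed (rule continuous_on_subset[OF w_continuous(2)], use i y in auto)
        then show ?thesis using v0 by simp
      qed
      have "w xm \<le> w L"
      proof (rule DERIV_nonneg_imp_increasing_open[where f = w and a = xm and b = L])
        fix x assume x: "xm < x" "x < L"
        then show "\<exists>z. (w has_real_derivative z) (at x) \<and> 0 \<le> z" using dv(2)[of x] vn[of x] i by auto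
      qed (use i in \<open>auto intro: continuous_on_subset[OF w_continuous(1)]\<close>)
      then show False using n by simp
    qed
    then show ?thesis using p0 by linarith
  qed
  have bound: "\<bar>\<mu>\<^sup>2 * w x - (w x)^3\<bar> \<le> 2 * w L * (3 * \<mu>\<^sup>2)" if x: "x \<in> {-L..L}" for x
  proof -
    have "(w x)\<^sup>2 \<le> (2 * \<mu>)\<^sup>2" using w2\<mu>[OF x] nonneg[OF x] by (intro power_mono) auto
    then have "(w x)\<^sup>2 \<le> 4 * \<mu>\<^sup>2" by (simp add: power_mult_distrib)
    then have 1: "\<bar>\<mu>\<^sup>2 - (w x)\<^sup>2\<bar> \<le> 3 * \<mu>\<^sup>2" using zero_le_power2[of "w x"] m2 by linarith
    have 2: "w x \<le> 2 * w L" using xm(2)[OF x] w2p by simp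
    have "\<mu>\<^sup>2 * w x - (w x)^3 = w x * (\<mu>\<^sup>2 - (w x)\<^sup>2)" by (simp add: algebra_simps power2_eq_square power3_eq_cube)
    then have "\<bar>\<mu>\<^sup>2 * w x - (w x)^3\<bar> = w x * \<bar>\<mu>\<^sup>2 - (w x)\<^sup>2\<bar>" using nonneg[OF x] by (simp add: abs_mult)
    also have "\<dots> \<le> 2 * w L * (3 * \<mu>\<^sup>2)" using 1 2 p0 by (intro mult_mono) auto
    finally show ?thesis .
  qed
  \<comment> \<open>Over length 2 L this bound amounts to
    \<open>12 * (L * \<mu>\<^sup>2) * w L\<close>. With
    \<open>L * \<mu>\<^sup>2 < \<gamma> / 18\<close> the factor is below 2/3 of \<gamma>, which is
    the source of the threshold \<gamma>/3.\<close>
  have "norm (v (-L) - v L) \<le> 2 * w L * (3 * \<mu>\<^sup>2) * norm (-L - L)"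
  proof (rule field_differentiable_bound[OF convex_real_interval(5) _ _ ends(1,2)])
    fix x assume x: "x \<in> {-L..L}"
    show "(v has_real_derivative \<mu>\<^sup>2 * w x - (w x)^3) (at x within {-L..L})" by (rule soliton_odeD(2)[OF ode x])
    show "norm (\<mu>\<^sup>2 * w x - (w x)^3) \<le> 2 * w L * (3 * \<mu>\<^sup>2)" using bound[OF x] by simp
  qed
  moreover have "norm (v (-L) - v L) = \<bar>\<gamma> + \<mu> * T\<bar> * w L" using jump p0 by (simp add: abs_mult)
  moreover have "2 * w L * (3 * \<mu>\<^sup>2) * norm (-L - L) = 12 * (L * \<mu>\<^sup>2) * w L" using L by simp
  ultimately have "\<bar>\<gamma> + \<mu> * T\<bar> * w L \<le> 12 * (L * \<mu>\<^sup>2) * w L" by (simp only:)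
  then have g: "\<bar>\<gamma> + \<mu> * T\<bar> \<le> 12 * (L * \<mu>\<^sup>2)" using p0 by (rule mult_right_le_imp_le)
  have g1: "\<mu> * T < - \<gamma> / 3" using g L\<gamma> by linarith
  then show "\<mu> * T < - \<gamma> / 3" .
  have "L * \<mu> * \<mu> < 1/1200 * \<mu>" using L\<mu> \<mu> by (rule mult_strict_right_mono)
  then have "L * \<mu>\<^sup>2 < 1/1200 * \<mu>" by (simp add: power2_eq_square mult.assoc)
  \<comment> \<open>53/100 from \<gamma> plus 12/1200 from the jump.\<close>
  then have "\<mu> * (- (54/100)) < \<mu> * T" using g \<gamma>\<mu> by linarith
  then have T1: "- T < 54/100" using \<mu> by (simp only: mult_less_cancel_left_pos)
  have "\<mu> * T < \<mu> * 0" using g1 \<gamma> by simp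
  then have T0: "T < 0" using \<mu> by (simp only: mult_less_cancel_left_pos)
  have "(- T)\<^sup>2 < (54/100)\<^sup>2" using T1 T0 by (intro power_strict_mono) auto
  \<comment> \<open>Twice 1 - (54/100)^2. It exceeds (119/100)^2 = 14161/10000, so subtracting the
    oscillation \<mu>/10 from w L leaves more than \<mu>.\<close>
  then have "14168/10000 < 2 * (1 - T\<^sup>2)" by (simp add: power2_eq_square)
  then have "\<mu>\<^sup>2 * (14168/10000) < \<mu>\<^sup>2 * (2 * (1 - T\<^sup>2))" using m2 by (rule mult_strict_left_mono)
  moreover have "(119/100 * \<mu>)\<^sup>2 = 14161/10000 * \<mu>\<^sup>2" by (simp add: power2_eq_square)
  moreover have "(w L)\<^sup>2 = \<mu>\<^sup>2 * (2 * (1 - T\<^sup>2))" unfolding p2 by simp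
  ultimately have "(119/100 * \<mu>)\<^sup>2 < (w L)\<^sup>2" using m2 by linarith
  then have "119/100 * \<mu> < w L" by (rule power2_less_imp_less) (use p0 in simp)
  then have w\<mu>: "\<mu> < w x" if "x \<in> {-L..L}" for x using close[OF that] \<mu> by linarith
  \<comment> \<open>Above the height \<mu> the right-hand side of the equation is negative.\<close>
  have "v (-L) > v L"
  proof (rule DERIV_neg_imp_decreasing_open[OF ends(4)])
    fix x assume x: "-L < x" "x < L"
    then have "\<mu>\<^sup>2 < (w x)\<^sup>2" using w\<mu>[of x] \<mu> by (intro power_strict_mono) auto
    then have "w x * (\<mu>\<^sup>2 - (w x)\<^sup>2) < 0" using w\<mu>[of x] x \<mu> by (intro mult_pos_neg) auto
    then have "\<mu>\<^sup>2 * w x - (w x)^3 < 0" by (simp add: algebra_simps power2_eq_square power3_eq_cube)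
    moreover have "(v has_real_derivative \<mu>\<^sup>2 * w x - (w x)^3) (at x)"
      using soliton_odeD(2)[OF ode, of x] x by (simp add: at_within_Icc_at)
    ultimately show "\<exists>y. (v has_real_derivative y) (at x) \<and> y < 0" by blast
  qed (rule w_continuous(2))
  then have "0 < (\<gamma> + \<mu> * T) * w L" using jump by simp
  then have g2: "0 < \<gamma> + \<mu> * T" using p0 by (simp add: zero_less_mult_iff)
  then show "- \<gamma> < \<mu> * T" by simp
  have "\<mu> * T < 0" using g1 \<gamma> by linarith
  then have "\<bar>\<gamma> + \<mu> * T\<bar> < 2 * \<bar>\<mu> * T\<bar>" using g1 g2 by linarith
  then show even_dnoidal_profile using g2 w\<mu>[OF ends(3)] by (intro even_dnoidal_profileI) auto
qed

text \<open>A primitive of \<open>u\<^sup>4\<close> along the homoclinic orbit, as a function of \<open>s = sqrt (\<omega> - u\<^sup>2/2)\<close>.\<close>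

definition A :: "real \<Rightarrow> real" where "A s = 4 * (\<mu>\<^sup>2 * s - s^3 * (1/3))"

text \<open>8/3 \<mu>^3 is the quartic mass of half a soliton, and the gap is the mass of its tail
  below the height belonging to s.\<close>

lemma A_gap: "8/3 * \<mu>^3 - A s = 4/3 * ((\<mu> - s)\<^sup>2 * (2 * \<mu> + s))"
  by (simp add: A_def power2_eq_square power3_eq_cube field_simps)

text \<open>From \<open>(\<mu> - s) * (\<mu> + s) = u\<^sup>2 / 2\<close> the product
  \<open>(\<mu> - s) * \<mu>\<close> lies between u^2/4 and u^2/2, so the mass of a soliton tail is
  comparable with the fourth power of its height.\<close>

lemma A_gap_bounds:
  assumes s: "0 \<le> s" "s\<^sup>2 = \<mu>\<^sup>2 - u\<^sup>2 / 2"
  shows "\<mu> * (8/3 * \<mu>^3 - A s) \<le> u^4" "u^4 / 6 \<le> \<mu> * (8/3 * \<mu>^3 - A s)"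
proof -
  have "s\<^sup>2 \<le> \<mu>\<^sup>2" unfolding s(2) by simp
  then have s\<mu>: "s \<le> \<mu>" by (rule power2_le_imp_le) (use \<mu> in simp)
  have pr: "(\<mu> - s) * (\<mu> + s) = u\<^sup>2 / 2" using s(2) by (simp add: algebra_simps power2_eq_square)
  have u4: "u^4 = (u\<^sup>2)\<^sup>2" by simp
  have "(\<mu> - s) * \<mu> \<le> (\<mu> - s) * (\<mu> + s)" "(\<mu> - s) * (\<mu> + s) \<le> (\<mu> - s) * (2 * \<mu>)"
    using s s\<mu> by (intro mult_left_mono; simp)+
  then have b: "(\<mu> - s) * \<mu> \<le> u\<^sup>2 / 2" "u\<^sup>2 / 4 \<le> (\<mu> - s) * \<mu>" "0 \<le> (\<mu> - s) * \<mu>"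
    using pr s\<mu> \<mu> by auto
  have c: "((\<mu> - s) * \<mu>)\<^sup>2 \<le> (u\<^sup>2 / 2)\<^sup>2" "(u\<^sup>2 / 4)\<^sup>2 \<le> ((\<mu> - s) * \<mu>)\<^sup>2"
    by (rule power_mono[OF b(1) b(3)], rule power_mono[OF b(2)]) simp
  have d: "(\<mu> - s)\<^sup>2 * \<mu> * (2 * \<mu>) \<le> (\<mu> - s)\<^sup>2 * \<mu> * (2 * \<mu> + s)" "(\<mu> - s)\<^sup>2 * \<mu> * (2 * \<mu> + s) \<le> (\<mu> - s)\<^sup>2 * \<mu> * (3 * \<mu>)"
    using s s\<mu> \<mu> by (intro mult_left_mono; simp)+
  have e: "\<mu> * (8/3 * \<mu>^3 - A s) = 4/3 * ((\<mu> - s)\<^sup>2 * \<mu> * (2 * \<mu> + s))" unfolding A_gap by simp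
  have "(\<mu> - s)\<^sup>2 * \<mu> * (2 * \<mu>) = 2 * ((\<mu> - s) * \<mu>)\<^sup>2" "(\<mu> - s)\<^sup>2 * \<mu> * (3 * \<mu>) = 3 * ((\<mu> - s) * \<mu>)\<^sup>2"
    by (simp_all add: power_mult_distrib power2_eq_square)
  then show "\<mu> * (8/3 * \<mu>^3 - A s) \<le> u^4" "u^4 / 6 \<le> \<mu> * (8/3 * \<mu>^3 - A s)"
    using c d unfolding e u4 power_divide by auto
qed

text \<open>By \<open>A_le\<close> below the quartic mass of an arc dominates the variation of \<open>A\<close> along it. If the minimum
  is interior, the arcs between the vertex, the minimum and the maxima exceed the bound \<open>loop4\<close>.\<close>

lemma interior_min_large:
  assumes x0: "x0 \<in> {-L..L}" "\<And>y. y \<in> {-L..L} \<Longrightarrow> w x0 \<le> w y" and lt: "w x0 < w L" and small: "w x0 \<le> \<mu> / 10" and L2: "2 \<le> L * \<mu>"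
  shows False
proof -
  define m where "m = w x0"
  have "x0 \<noteq> L" "x0 \<noteq> -L" using lt closed by auto
  then have x0i: "-L < x0" "x0 < L" using x0(1) by auto
  have v0: "v x0 = 0" by (rule interior_min[OF x0i soliton_odeD(1)[OF ode x0(1)]]) (rule x0(2))
  have m0: "0 < m"
  proof (rule ccontr)
    assume "\<not> 0 < m"
    then have "w x0 = 0" using nonneg[OF x0(1)] by (simp add: m_def)
    moreover have "soliton_ode (\<mu>\<^sup>2) {-L..L} (\<lambda>_. 0) (\<lambda>_. 0)" by (simp add: soliton_ode_def)
    ultimately have "w L = 0" using soliton_ode_unique(1)[OF is_interval_cc x0(1) ends(2) ode, of "\<lambda>_. 0" "\<lambda>_. 0"] v0 by simp
    then show False using p0 by simp
  qed
  have "m\<^sup>2 \<le> (\<mu> / 10)\<^sup>2" using small m0 unfolding m_def by (intro power_mono) auto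
  then have m2: "m\<^sup>2 \<le> \<mu>\<^sup>2 / 100" by (simp add: power_divide)
  have m2p: "0 < m\<^sup>2" and \<mu>2p: "0 < \<mu>\<^sup>2" using m0 \<mu> by auto
  have msq: "m\<^sup>2 \<le> (w x)\<^sup>2" if "x \<in> {-L..L}" for x using x0(2)[OF that] m0 unfolding m_def by (intro power_mono) auto
  have en0: "(v x)\<^sup>2 = \<mu>\<^sup>2 * (w x)\<^sup>2 - (w x)^4 / 2 - \<mu>\<^sup>2 * m\<^sup>2 + m^4 / 2" if x: "x \<in> {-L..L}" for x
    using soliton_ode_energy[OF ode is_interval_cc x x0(1)] v0 by (simp add: m_def)
  \<comment> \<open>In this factorisation the heights range over \<open>m\<^sup>2 \<le> w\<^sup>2
    \<le> 2 * \<mu>\<^sup>2 - m\<^sup>2\<close>, and critical points occur only at these two extreme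
    heights.\<close>
  have en: "(v x)\<^sup>2 = ((w x)\<^sup>2 - m\<^sup>2) * (\<mu>\<^sup>2 - ((w x)\<^sup>2 + m\<^sup>2) / 2)" if x: "x \<in> {-L..L}" for x
    unfolding en0[OF x] by (simp add: field_simps power2_eq_square power4_eq_xxxx)
  have ub: "(w x)\<^sup>2 \<le> 2 * \<mu>\<^sup>2 - m\<^sup>2" if x: "x \<in> {-L..L}" for x
  proof (rule ccontr)
    assume n: "\<not> (w x)\<^sup>2 \<le> 2 * \<mu>\<^sup>2 - m\<^sup>2"
    have "0 < (w x)\<^sup>2 - m\<^sup>2" using n m2 \<mu>2p by linarith
    moreover have "\<mu>\<^sup>2 - ((w x)\<^sup>2 + m\<^sup>2) / 2 < 0" using n by (simp add: field_simps)
    ultimately have "(v x)\<^sup>2 < 0" unfolding en[OF x] by (rule mult_pos_neg)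
    then show False by simp
  qed
  have top: "(w x)\<^sup>2 = 2 * \<mu>\<^sup>2 - m\<^sup>2" if x: "x \<in> {-L..L}" and "v x = 0" "m < w x" for x
  proof -
    have "m\<^sup>2 < (w x)\<^sup>2" using that m0 by (intro power_strict_mono) auto
    moreover have "((w x)\<^sup>2 - m\<^sup>2) * (\<mu>\<^sup>2 - ((w x)\<^sup>2 + m\<^sup>2) / 2) = 0" using en[OF x] that(2) by simp
    ultimately have "\<mu>\<^sup>2 - ((w x)\<^sup>2 + m\<^sup>2) / 2 = 0" by (simp only: mult_eq_0_iff) auto
    then show ?thesis by (simp add: field_simps)
  qed
  define s where "s = (\<lambda>x. sqrt (\<mu>\<^sup>2 - (w x)\<^sup>2 / 2))"
  have s2: "(s x)\<^sup>2 = \<mu>\<^sup>2 - (w x)\<^sup>2 / 2" and s0: "0 < s x" if "x \<in> {-L..L}" for x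
  proof -
    have "0 < \<mu>\<^sup>2 - (w x)\<^sup>2 / 2" using ub[OF that] m2p by linarith
    then show "(s x)\<^sup>2 = \<mu>\<^sup>2 - (w x)\<^sup>2 / 2" "0 < s x" by (simp_all add: s_def)
  qed
  have A_deriv: "((\<lambda>x. A (s x)) has_real_derivative - ((w x)^3 * v x / s x)) (at x)" if "-L < x" "x < L" for x
  proof -
    have x: "x \<in> {-L..L}" using that by simp
    have dw: "(w has_real_derivative v x) (at x)" using soliton_odeD(1)[OF ode x] that by (simp add: at_within_Icc_at)
    define D where "D = - (w x * v x) / (2 * s x)"
    have i: "((\<lambda>x. \<mu>\<^sup>2 - (w x)\<^sup>2 * (1/2)) has_real_derivative 0 - (of_nat 2 * (v x * w x ^ (2 - Suc 0))) * (1/2)) (at x)"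
      by (intro DERIV_diff DERIV_const DERIV_cmult_right DERIV_power dw)
    have "0 < \<mu>\<^sup>2 - (w x)\<^sup>2 * (1/2)" using ub[OF x] m2p by linarith
    note dsq = DERIV_chain2[where f = sqrt, OF DERIV_real_sqrt[OF this] i]
    have "s = (\<lambda>x. sqrt (\<mu>\<^sup>2 - (w x)\<^sup>2 * (1/2)))" by (simp add: s_def)
    from dsq[folded this fun_cong[OF this]]
    have "(s has_real_derivative inverse (s x) / 2 * (0 - (of_nat 2 * (v x * w x ^ (2 - Suc 0))) * (1/2))) (at x)" .
    then have ds: "(s has_real_derivative D) (at x)"
      by (rule DERIV_cong) (use s0[OF x] in \<open>simp add: D_def field_simps\<close>)
    have "((\<lambda>x. 4 * (\<mu>\<^sup>2 * s x - (s x)^3 * (1/3))) has_real_derivative 4 * (\<mu>\<^sup>2 * D - (of_nat 3 * (D * s x ^ (3 - Suc 0))) * (1/3))) (at x)"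
      by (intro DERIV_diff DERIV_cmult DERIV_cmult_right DERIV_power ds)
    moreover have "4 * (\<mu>\<^sup>2 * D - (of_nat 3 * (D * s x ^ (3 - Suc 0))) * (1/3)) = - ((w x)^3 * v x / s x)"
    proof -
      have "4 * (\<mu>\<^sup>2 * D - (of_nat 3 * (D * s x ^ (3 - Suc 0))) * (1/3)) = 4 * D * (\<mu>\<^sup>2 - (s x)\<^sup>2)" by (simp add: algebra_simps)
      also have "\<dots> = 2 * D * (w x)\<^sup>2" unfolding s2[OF x] by simp
      also have "\<dots> = - ((w x)^3 * v x / s x)" using s0[OF x] by (simp add: D_def field_simps power2_eq_square power3_eq_cube)
      finally show ?thesis .
    qed
    ultimately show ?thesis by (simp add: A_def[abs_def])
  qed
  \<comment> \<open>As m is small, the orbit is no faster than the homoclinic one at the same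
    height, so A changes along the orbit at a rate of at most w^4.\<close>
  have A_bound: "\<bar>- ((w x)^3 * v x / s x)\<bar> \<le> (w x)^4" if x: "x \<in> {-L..L}" for x
  proof -
    have "m\<^sup>2 \<le> \<mu>\<^sup>2" using m2 \<mu>2p by linarith
    then have "m\<^sup>2 * m\<^sup>2 \<le> \<mu>\<^sup>2 * m\<^sup>2" by (rule mult_right_mono) simp
    moreover have "m^4 = m\<^sup>2 * m\<^sup>2" by (simp flip: power_add)
    moreover have "0 \<le> \<mu>\<^sup>2 * m\<^sup>2" by simp
    ultimately have "(v x)\<^sup>2 \<le> \<mu>\<^sup>2 * (w x)\<^sup>2 - (w x)^4 / 2" using en0[OF x] by linarith
    also have "\<dots> = (w x * s x)\<^sup>2" unfolding power_mult_distrib s2[OF x] by (simp add: algebra_simps flip: power_add)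
    finally have "\<bar>v x\<bar> \<le> w x * s x" using nonneg[OF x] s0[OF x] by (intro power2_le_imp_le[of "\<bar>v x\<bar>"]) auto
    then have "\<bar>v x\<bar> / s x \<le> w x" using s0[OF x] by (simp add: pos_divide_le_eq)
    then have "(w x)^3 * (\<bar>v x\<bar> / s x) \<le> (w x)^3 * w x" using nonneg[OF x] by (intro mult_left_mono) auto
    moreover have "(w x)^3 * w x = (w x)^4" by (simp flip: power_Suc2)
    ultimately show ?thesis using nonneg[OF x] s0[OF x] by (simp add: abs_mult)
  qed
  have w4c: "continuous_on {x..y} (\<lambda>t. (w t)^4)" if "x \<in> {-L..L}" "y \<in> {-L..L}" for x y
    by (intro continuous_on_power continuous_on_subset[OF w_continuous(1)]) (use that in auto)
  define I where "I = (\<lambda>x y. integral {x..y} (\<lambda>t. (w t)^4))"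
  have A_le: "\<sigma> * (A (s x) - A (s y)) \<le> I x y" if x: "x \<in> {-L..L}" and y: "y \<in> {-L..L}" and xy: "x \<le> y" and \<sigma>: "\<bar>\<sigma>\<bar> = 1" for x y \<sigma> :: real
  proof -
    have "I x x + \<sigma> * A (s x) \<le> I x y + \<sigma> * A (s y)"
    proof (rule DERIV_nonneg_imp_increasing_open[OF xy, where f = "\<lambda>t. I x t + \<sigma> * A (s t)"])
      fix t assume t: "x < t" "t < y"
      have tL: "-L < t" "t < L" "t \<in> {-L..L}" using t x y by auto
      have "((\<lambda>t. I x t) has_real_derivative (w t)^4) (at t within {x..y})"
        unfolding I_def by (rule integral_has_real_derivative[OF w4c[OF x y]]) (use t in auto)
      then have "((\<lambda>t. I x t) has_real_derivative (w t)^4) (at t)" using t by (simp add: at_within_Icc_at)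
      then have D: "((\<lambda>t. I x t + \<sigma> * A (s t)) has_real_derivative (w t)^4 + \<sigma> * - ((w t)^3 * v t / s t)) (at t)"
        by (intro DERIV_add DERIV_cmult A_deriv tL)
      have "\<bar>\<sigma> * - ((w t)^3 * v t / s t)\<bar> \<le> (w t)^4" using A_bound[OF tL(3)] \<sigma> by (simp add: abs_mult)
      then have "0 \<le> (w t)^4 + \<sigma> * - ((w t)^3 * v t / s t)" by linarith
      then show "\<exists>z. ((\<lambda>t. I x t + \<sigma> * A (s t)) has_real_derivative z) (at t) \<and> 0 \<le> z" using D by (intro exI[of _ "(w t)^4 + \<sigma> * - ((w t)^3 * v t / s t)"] conjI)
    next
      have "continuous_on {x..y} (\<lambda>t. I x t)"
        unfolding I_def by (rule indefinite_integral_continuous_1[OF integrable_continuous_real[OF w4c[OF x y]]])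
      moreover have "continuous_on {x..y} s" unfolding s_def
        by (intro continuous_intros continuous_on_subset[OF w_continuous(1)]) (use x y in auto)
      ultimately show "continuous_on {x..y} (\<lambda>t. I x t + \<sigma> * A (s t))" unfolding A_def by (intro continuous_intros)
    qed
    moreover have "I x x = 0" by (simp add: I_def)
    ultimately show ?thesis by (simp add: algebra_simps)
  qed
  have Adown: "A (s x) - A (s y) \<le> I x y" and Aup: "A (s y) - A (s x) \<le> I x y" if "x \<in> {-L..L}" "y \<in> {-L..L}" "x \<le> y" for x y
    using A_le[OF that, of 1] A_le[OF that, of "-1"] by auto
  have comb: "I x z + I z y = I x y" if "x \<in> {-L..L}" "y \<in> {-L..L}" "x \<le> z" "z \<le> y" for x y z
    unfolding I_def by (rule Henstock_Kurzweil_Integration.integral_combine[OF that(3,4) integrable_continuous_real[OF w4c[OF that(1,2)]]])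
  have sL: "s L = \<bar>\<mu> * T\<bar>" "s (-L) = s L"
  proof -
    have "\<mu>\<^sup>2 - (w L)\<^sup>2 / 2 = (\<mu> * T)\<^sup>2" unfolding p2 by (simp add: field_simps power_mult_distrib)
    then show "s L = \<bar>\<mu> * T\<bar>" by (simp add: s_def)
    show "s (-L) = s L" by (simp add: s_def closed)
  qed
  define Ap Am where "Ap = A (s L)" and "Am = A (s x0)"
  have \<mu>3: "0 < \<mu>^3" using \<mu> by simp
  have Ap0: "0 \<le> Ap"
  proof -
    have t: "\<bar>T\<bar>^3 \<le> \<bar>T\<bar>^1" using T by (intro power_decreasing) auto
    have "Ap = 4 * \<mu>^3 * (\<bar>T\<bar> - \<bar>T\<bar>^3 * (1/3))"
      using \<mu> by (simp add: Ap_def sL A_def abs_mult power_mult_distrib power2_eq_square power3_eq_cube algebra_simps)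
    also have "0 \<le> \<dots>" using t \<mu>3 by (intro mult_nonneg_nonneg) auto
    finally show ?thesis .
  qed
  \<comment> \<open>The bound \<open>loop4\<close> rewritten: its terms in T are A at the vertex,
    with the sign of T.\<close>
  have total: "I (-L) L < 8/3 * \<mu>^3 + (if 0 < T then Ap else - Ap)"
  proof -
    have "(if 0 < T then Ap else - Ap) = \<mu>^3 * (4 * T - 4/3 * T^3)"
      using \<mu> by (simp add: Ap_def sL A_def abs_mult power_mult_distrib power2_eq_square power3_eq_cube algebra_simps)
    then show ?thesis using loop4 by (simp add: I_def algebra_simps)
  qed
  have m4: "m^4 \<le> \<mu>^4 / 10000" using power_mono[OF m2, of 2] by (simp add: power_divide)
  have gapm: "\<mu> * (8/3 * \<mu>^3 - Am) \<le> m^4"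
    unfolding Am_def by (rule A_gap_bounds(1)) (use s0[OF x0(1)] s2[OF x0(1)] in \<open>auto simp: m_def\<close>)
  have Am: "8/3 * \<mu>^3 - \<mu>^3 / 10000 \<le> Am"
  proof -
    have "\<mu> * (8/3 * \<mu>^3 - Am) \<le> \<mu> * (\<mu>^3 / 10000)" using gapm m4 by (simp add: power_numeral_reduce algebra_simps)
    then show ?thesis using \<mu> by simp
  qed
  have AC: "A (s x) \<le> 4/10 * \<mu>^3" if x: "x \<in> {-L..L}" and t: "(w x)\<^sup>2 = 2 * \<mu>\<^sup>2 - m\<^sup>2" for x
  proof -
    have "(s x)\<^sup>2 \<le> m\<^sup>2" using s2[OF x] t m2p by linarith
    then have "s x \<le> m" by (rule power2_le_imp_le) (use m0 in simp)
    then have "s x \<le> \<mu> / 10" using small by (simp add: m_def)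
    then have "\<mu>\<^sup>2 * s x \<le> \<mu>\<^sup>2 * (\<mu> / 10)" using \<mu>2p by (intro mult_left_mono) auto
    then have 1: "\<mu>\<^sup>2 * s x \<le> \<mu>^3 / 10" by (simp add: power2_eq_square power3_eq_cube)
    have "0 \<le> (s x)^3" using s0[OF x] by simp
    then have "A (s x) \<le> 4 * (\<mu>\<^sup>2 * s x)" by (simp add: A_def)
    then show ?thesis using 1 by simp
  qed
  show False
  proof (cases "0 < T")
    \<comment> \<open>The jump is positive, so w increases at -L and decreases at L. Hence there is
      an interior maximum on each side of x0, both at the upper extreme height.\<close>
    case True
    then have g: "0 < \<gamma> + \<mu> * T" using \<gamma> \<mu> by (simp add: add_pos_pos)
    then have ne: "\<gamma> + \<mu> * T \<noteq> 0" by simp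
    have gp: "0 < (\<gamma> + \<mu> * T) * w L" using g p0 by (rule mult_pos_pos)
    have vl: "0 < v (-L)" using even_slopes(2)[OF ne] gp by simp
    have vr: "v L < 0" using even_slopes(1)[OF ne] vl by simp
    obtain x1 where x1: "x1 \<in> {-L..x0}" "\<And>y. y \<in> {-L..x0} \<Longrightarrow> w y \<le> w x1"
    proof -
      have "continuous_on {-L..x0} w" by (rule continuous_on_subset[OF w_continuous(1)]) (use x0 in auto)
      then show ?thesis using continuous_attains_sup[OF compact_Icc, of "-L" x0 w] x0i that by auto
    qed
    have wx1: "w L \<le> w x1" using x1(2)[of "-L"] x0i closed by simp
    then have mx1: "m < w x1" using lt by (simp add: m_def)
    have x1n: "x1 \<noteq> -L"
    proof
      assume e: "x1 = -L"
      have "(w has_real_derivative v (-L)) (at (-L) within {-L..x0})"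
        by (rule DERIV_subset[OF soliton_odeD(1)[OF ode ends(1)]]) (use x0 in auto)
      then have "((\<lambda>x. - w x) has_real_derivative - v (-L)) (at (-L) within {-L..x0})" by (rule DERIV_minus)
      then have "0 \<le> - v (-L)" by (rule left_end_min[OF x0i(1)]) (use x1 e in auto)
      then show False using vl by simp
    qed
    have x1L: "-L < x1" "x1 < x0" "x1 \<in> {-L..L}" using x1(1) x1n mx1 x0i by (auto simp: m_def less_le)
    have "v x1 = 0"
      by (rule interior_max[OF x1L(1,2) DERIV_subset[OF soliton_odeD(1)[OF ode x1L(3)]]]) (use x0 x1(2) in auto)
    note A1 = AC[OF x1L(3) top[OF x1L(3) this mx1]]
    obtain x2 where x2: "x2 \<in> {x0..L}" "\<And>y. y \<in> {x0..L} \<Longrightarrow> w y \<le> w x2"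
    proof -
      have "continuous_on {x0..L} w" by (rule continuous_on_subset[OF w_continuous(1)]) (use x0 in auto)
      then show ?thesis using continuous_attains_sup[OF compact_Icc, of x0 L w] x0i that by auto
    qed
    have "w L \<le> w x2" using x2(2)[of L] x0i by simp
    then have mx2: "m < w x2" using lt by (simp add: m_def)
    have x2n: "x2 \<noteq> L"
    proof
      assume e: "x2 = L"
      have "(w has_real_derivative v L) (at L within {x0..L})"
        by (rule DERIV_subset[OF soliton_odeD(1)[OF ode ends(2)]]) (use x0 in auto)
      then have "((\<lambda>x. - w x) has_real_derivative - v L) (at L within {x0..L})" by (rule DERIV_minus)
      then have "- v L \<le> 0" by (rule right_end_min[OF x0i(2)]) (use x2 e in auto)
      then show False using vr by simp
    qed
    have x2L: "x0 < x2" "x2 < L" "x2 \<in> {-L..L}" using x2(1) x2n mx2 x0i by (auto simp: m_def less_le)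
    have "v x2 = 0"
      by (rule interior_max[OF x2L(1,2) DERIV_subset[OF soliton_odeD(1)[OF ode x2L(3)]]]) (use x0 x2(2) in auto)
    note A2 = AC[OF x2L(3) top[OF x2L(3) this mx2]]
    \<comment> \<open>Four arcs, from the vertex over a top, the minimum and another top back to the
      vertex. Their mass is at least 2 Am + 2 Ap less four values of A at the tops, each at most
      4/10 \<mu>^3, while fewer than 8/3 \<mu>^3 + Ap are available.\<close>
    have "I (-L) x1 + I x1 x0 + (I x0 x2 + I x2 L) = I (-L) L"
      using comb[of "-L" x0 x1] comb[of x0 L x2] comb[of "-L" L x0] x0 x1L x2L x0i ends by simp
    moreover have "Ap - A (s x1) \<le> I (-L) x1" using Adown[of "-L" x1] x1L ends by (simp add: Ap_def sL)
    moreover have "Am - A (s x1) \<le> I x1 x0" using Aup[of x1 x0] x1L x0 by (simp add: Am_def)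
    moreover have "Am - A (s x2) \<le> I x0 x2" using Adown[of x0 x2] x2L x0 by (simp add: Am_def)
    moreover have "Ap - A (s x2) \<le> I x2 L" using Aup[of x2 L] x2L ends by (simp add: Ap_def)
    ultimately show False using total True A1 A2 Am Ap0 \<mu>3 by simp
  next
    case False
    show False
    proof (cases "\<exists>x1\<in>{-L..L}. (w x1)\<^sup>2 = 2 * \<mu>\<^sup>2 - m\<^sup>2")
      case True
      then obtain x1 where x1: "x1 \<in> {-L..L}" "(w x1)\<^sup>2 = 2 * \<mu>\<^sup>2 - m\<^sup>2" by blast
      note A1 = AC[OF x1]
      \<comment> \<open>The contributions of the vertex cancel along the arcs. With Am close to 8/3
        \<mu>^3 and A at the top at most 4/10 \<mu>^3, the mass is far too large.\<close>
      have "2 * Am - 2 * A (s x1) \<le> I (-L) L"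
      proof (cases "x0 \<le> x1")
        case True
        have "I (-L) x0 + (I x0 x1 + I x1 L) = I (-L) L"
          using comb[of x0 L x1] comb[of "-L" L x0] x0 x1 True ends by simp
        moreover have "Am - Ap \<le> I (-L) x0" using Aup[of "-L" x0] x0 ends by (simp add: Ap_def Am_def sL)
        moreover have "Am - A (s x1) \<le> I x0 x1" using Adown[of x0 x1] x0 x1 True by (simp add: Am_def)
        moreover have "Ap - A (s x1) \<le> I x1 L" using Aup[of x1 L] x1 ends by (simp add: Ap_def)
        ultimately show ?thesis by linarith
      next
        case False
        have "I (-L) x1 + (I x1 x0 + I x0 L) = I (-L) L"
          using comb[of x1 L x0] comb[of "-L" L x1] x0 x1 False ends by simp
        moreover have "Ap - A (s x1) \<le> I (-L) x1" using Adown[of "-L" x1] x1 ends by (simp add: Ap_def sL)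
        moreover have "Am - A (s x1) \<le> I x1 x0" using Aup[of x1 x0] x0 x1 False by (simp add: Am_def)
        moreover have "Am - Ap \<le> I x0 L" using Adown[of x0 L] x0 ends by (simp add: Ap_def Am_def)
        ultimately show ?thesis by linarith
      qed
      then show False using total False A1 Am Ap0 \<mu>3 by simp
    next
      \<comment> \<open>Without a top, w has no interior maximum above w L and only descends to x0
        and returns. The mass is just 2 (Am - Ap), so the vertex must be shown to be well above the
        minimum.\<close>
      case notop: False
      have wp: "w y \<le> w L" if y: "y \<in> {-L..L}" for y
      proof (rule ccontr)
        assume n: "\<not> w y \<le> w L"
        obtain xm where xm: "xm \<in> {-L..L}" "\<And>y. y \<in> {-L..L} \<Longrightarrow> w y \<le> w xm"
          using continuous_attains_sup[OF compact_Icc _ w_continuous(1)] ends(1) by blast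
        have pm: "w L < w xm" using xm(2)[OF y] n by simp
        then have "xm \<noteq> L" "xm \<noteq> -L" using closed by auto
        then have i: "-L < xm" "xm < L" using xm(1) by auto
        have "v xm = 0" by (rule interior_max[OF i soliton_odeD(1)[OF ode xm(1)]]) (rule xm(2))
        then have "(w xm)\<^sup>2 = 2 * \<mu>\<^sup>2 - m\<^sup>2" by (rule top[OF xm(1)]) (use pm lt in \<open>simp add: m_def\<close>)
        then show False using notop xm(1) by blast
      qed
      \<comment> \<open>One end of the loop is at distance at least L from x0, and
        \<open>2 \<le> L * \<mu>\<close> makes the quadratic growth up to there at least a factor 2.
        A vertex height too large for the growth lemma exceeds 2 m directly.\<close>
      have p2m: "2 * m \<le> w L"
      proof (cases "(w L)\<^sup>2 \<le> \<mu>\<^sup>2 / 2")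
        case False
        have "(2 * m)\<^sup>2 = 4 * m\<^sup>2" by (simp add: power_mult_distrib)
        then have "(2 * m)\<^sup>2 \<le> (w L)\<^sup>2" using False m2 \<mu>2p by linarith
        then show ?thesis by (rule power2_le_imp_le) (use p0 in simp)
      next
        case True
        have wsq: "(w x)\<^sup>2 \<le> \<mu>\<^sup>2 / 2" if "x \<in> {-L..L}" for x
          using power_mono[OF wp[OF that] nonneg[OF that], of 2] True by simp
        have grow: "2 * m \<le> w L" if "L \<le> h" "m * (1 + \<mu>\<^sup>2 / 4 * h\<^sup>2) \<le> w L" for h
        proof -
          have "L * \<mu> \<le> h * \<mu>" using that(1) \<mu> by (intro mult_right_mono) auto
          then have "2 \<le> h * \<mu>" using L2 by linarith
          then have "2\<^sup>2 \<le> (h * \<mu>)\<^sup>2" by (rule power_mono) simp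
          then have "2 \<le> 1 + \<mu>\<^sup>2 / 4 * h\<^sup>2" by (simp add: power_mult_distrib mult.commute)
          then have "m * 2 \<le> m * (1 + \<mu>\<^sup>2 / 4 * h\<^sup>2)" using m0 by (intro mult_left_mono) auto
          then show ?thesis using that(2) by simp
        qed
        show ?thesis
        proof (cases "x0 \<le> 0")
          case True
          have "soliton_ode (\<mu>\<^sup>2) {x0..L} w v" by (rule soliton_ode_subset[OF ode]) (use x0 in auto)
          then have "w x0 * (1 + \<mu>\<^sup>2 / 4 * (L - x0)\<^sup>2) \<le> w L"
            by (rule soliton_ode_growth) (use x0 v0 nonneg wsq in auto)
          then show ?thesis using grow[of "L - x0"] True by (simp add: m_def)
        next
          case False
          have im: "uminus ` {-x0..L} = {-L..x0}" by auto
          have "soliton_ode (\<mu>\<^sup>2) {-L..x0} w v" by (rule soliton_ode_subset[OF ode]) (use x0 in auto)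
          then have "soliton_ode (\<mu>\<^sup>2) {-x0..L} (\<lambda>x. w (-x)) (\<lambda>x. - v (-x))" by (intro soliton_ode_reflect) (simp only: im)
          then have "w (- (-x0)) * (1 + \<mu>\<^sup>2 / 4 * (L - (-x0))\<^sup>2) \<le> w (-L)"
            by (rule soliton_ode_growth) (use x0 v0 nonneg wsq in auto)
          then show ?thesis using grow[of "L + x0"] False closed by (simp add: m_def)
        qed
      qed
      have "(2 * m)^4 \<le> (w L)^4" using p2m m0 by (intro power_mono) auto
      then have "16 * m^4 \<le> (w L)^4" by (simp add: power_mult_distrib)
      moreover have "(w L)^4 / 6 \<le> \<mu> * (8/3 * \<mu>^3 - Ap)"
        unfolding Ap_def by (rule A_gap_bounds(2)) (use s0[OF ends(2)] s2[OF ends(2)] in auto)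
      moreover have "0 < m^4" using m0 by simp
      \<comment> \<open>Doubling the height multiplies the fourth power by 16, which outweighs the
        factors 2 and 6 in the tail bounds. Consequently 2 (Am - Ap) is at least 8/3 \<mu>^3 - Ap,
        contrary to \<open>total\<close>.\<close>
      ultimately have "\<mu> * (2 * (8/3 * \<mu>^3 - Am)) \<le> \<mu> * (8/3 * \<mu>^3 - Ap)" using gapm by linarith
      then have "2 * (8/3 * \<mu>^3 - Am) \<le> 8/3 * \<mu>^3 - Ap" using \<mu> by simp
      moreover have "I (-L) x0 + I x0 L = I (-L) L" using comb[of "-L" L x0] x0 ends by simp
      moreover have "Am - Ap \<le> I (-L) x0" using Aup[of "-L" x0] x0 ends by (simp add: Ap_def Am_def sL)
      moreover have "Am - Ap \<le> I x0 L" using Adown[of x0 L] x0 ends by (simp add: Ap_def Am_def)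
      ultimately show False using total False by simp
    qed
  qed
qed

text \<open>A long loop must come close to zero, and by \<open>interior_min_large\<close> it does so
  at the vertex. There the inward slopes are non-negative, which fixes the sign of the jump, and the
  small height forces |T| close to 1.\<close>

lemma large_loop:
  assumes \<gamma>\<mu>: "\<gamma> < \<mu>" and \<delta>: "0 < \<delta>" "\<delta> \<le> 1/10" "\<delta>\<^sup>2 * \<mu>\<^sup>2 < 2 * (\<mu>\<^sup>2 - \<gamma>\<^sup>2)" and L\<delta>: "16/3 \<le> 2 * (L * \<mu>) * \<delta>^4" and L2: "2 \<le> L * \<mu>"
  shows "even_dnoidal_profile" "\<gamma> < \<mu> * T"
proof -
  have \<mu>3: "0 < \<mu>^3" and \<mu>2: "0 < \<mu>\<^sup>2" using \<mu> by auto
  obtain x0 where x0: "x0 \<in> {-L..L}" "\<And>y. y \<in> {-L..L} \<Longrightarrow> w x0 \<le> w y"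
    using continuous_attains_inf[OF compact_Icc _ w_continuous(1)] ends(1) by blast
  \<comment> \<open>Otherwise the quartic mass of the loop would be at least
    \<open>2 * L * (\<delta> * \<mu>)^4\<close>, more than the mass 16/3 \<mu>^3 of a whole
    soliton.\<close>
  have m: "w x0 < \<delta> * \<mu>"
  proof (rule ccontr)
    assume n: "\<not> w x0 < \<delta> * \<mu>"
    have "integral {-L..L} (\<lambda>_. (\<delta> * \<mu>)^4) \<le> integral {-L..L} (\<lambda>x. (w x)^4)"
    proof (rule Henstock_Kurzweil_Integration.integral_le)
      show "(\<lambda>x. (w x)^4) integrable_on {-L..L}" by (intro integrable_continuous_real continuous_on_power w_continuous(1))
      fix x assume "x \<in> {-L..L}"
      then have "\<delta> * \<mu> \<le> w x" using x0(2)[of x] n by simp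
      then show "(\<delta> * \<mu>)^4 \<le> (w x)^4" using \<delta>(1) \<mu> by (intro power_mono) auto
    qed (rule integrable_continuous_real continuous_on_const)+
    then have "2 * L * (\<delta> * \<mu>)^4 \<le> integral {-L..L} (\<lambda>x. (w x)^4)" using L by simp
    also have "\<dots> < \<mu>^3 * (8/3 + 4 * T - 4/3 * T^3)" by (rule loop4)
    also have "\<dots> = \<mu>^3 * (16/3 - 4/3 * ((1 - T)\<^sup>2 * (2 + T)))" by (simp add: power2_eq_square power3_eq_cube field_simps)
    also have "\<dots> \<le> \<mu>^3 * (16/3)"
    proof -
      have "0 \<le> (1 - T)\<^sup>2 * (2 + T)" using T by (intro mult_nonneg_nonneg) auto
      then have "16/3 - 4/3 * ((1 - T)\<^sup>2 * (2 + T)) \<le> 16/3" by linarith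
      then show ?thesis by (rule mult_left_mono) (use \<mu>3 in simp)
    qed
    also have "\<dots> \<le> \<mu>^3 * (2 * (L * \<mu>) * \<delta>^4)" using L\<delta> \<mu>3 by (intro mult_left_mono) auto
    also have "\<dots> = 2 * L * (\<delta> * \<mu>)^4" by (simp add: power_mult_distrib power_numeral_reduce)
    finally show False by simp
  qed
  have "\<delta> * \<mu> \<le> 1/10 * \<mu>" using \<delta>(2) \<mu> by (intro mult_right_mono) auto
  then have "w x0 \<le> \<mu> / 10" using m by simp
  then have "\<not> w x0 < w L" using interior_min_large[OF x0 _ _ L2] by blast
  then have pmin: "w L \<le> w y" if "y \<in> {-L..L}" for y using x0(2)[OF that] by simp
  have "0 \<le> v (-L)" by (rule left_end_min[OF ends(4) soliton_odeD(1)[OF ode ends(1)]]) (simp add: closed pmin)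
  moreover have "v L \<le> 0" by (rule right_end_min[OF ends(4) soliton_odeD(1)[OF ode ends(2)]]) (rule pmin)
  ultimately have "0 \<le> (\<gamma> + \<mu> * T) * w L" using jump by simp
  then have g0: "0 \<le> \<gamma> + \<mu> * T" using p0 by (simp add: zero_le_mult_iff)
  have "w L < \<delta> * \<mu>" using pmin[OF x0(1)] m by simp
  then have "(w L)\<^sup>2 < (\<delta> * \<mu>)\<^sup>2" using p0 by (intro power_strict_mono) auto
  then have "2 * \<mu>\<^sup>2 * (1 - T\<^sup>2) < 2 * (\<mu>\<^sup>2 - \<gamma>\<^sup>2)" using \<delta>(3) unfolding p2 power_mult_distrib by simp
  then have "\<gamma>\<^sup>2 < \<bar>\<mu> * T\<bar>\<^sup>2" by (simp add: algebra_simps power_mult_distrib)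
  then have "\<gamma> < \<bar>\<mu> * T\<bar>" by (rule power2_less_imp_less) simp
  \<comment> \<open>The sign of the jump excludes the alternative
    \<open>\<mu> * T < - \<gamma>\<close>.\<close>
  then show g1: "\<gamma> < \<mu> * T" using g0 by linarith
  have ne: "\<gamma> + \<mu> * T \<noteq> 0" using g1 \<gamma> by linarith
  have ab: "\<bar>\<gamma> + \<mu> * T\<bar> < 2 * \<bar>\<mu> * T\<bar>" using g1 \<gamma> by linarith
  \<comment> \<open>At heights between w L and \<mu> the potential energy decreases with height. A
    centre that low would force the slope at the vertex to vanish, although it is a positive
    multiple of w L.\<close>
  have "\<mu> < w 0"
  proof (rule ccontr)
    assume "\<not> \<mu> < w 0"
    then have "(w 0)\<^sup>2 \<le> \<mu>\<^sup>2" using nonneg[OF ends(3)] by (intro power_mono) auto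
    moreover have pc: "(w L)\<^sup>2 \<le> (w 0)\<^sup>2" using pmin[OF ends(3)] p0 by (intro power_mono) auto
    ultimately have "((w 0)\<^sup>2 - (w L)\<^sup>2) * (((w 0)\<^sup>2 + (w L)\<^sup>2) / 2 - \<mu>\<^sup>2) \<le> 0" by (intro mult_nonneg_nonpos) auto
    moreover have "((w 0)\<^sup>2 - (w L)\<^sup>2) * (((w 0)\<^sup>2 + (w L)\<^sup>2) / 2 - \<mu>\<^sup>2)
        = (- \<mu>\<^sup>2 * (w 0)\<^sup>2 + (w 0)^4 / 2) - (- \<mu>\<^sup>2 * (w L)\<^sup>2 + (w L)^4 / 2)"
      by (simp add: field_simps power2_eq_square power4_eq_xxxx)
    moreover have "(v 0)\<^sup>2 - \<mu>\<^sup>2 * (w 0)\<^sup>2 + (w 0)^4 / 2 = (v L)\<^sup>2 - \<mu>\<^sup>2 * (w L)\<^sup>2 + (w L)^4 / 2"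
      using energy[OF ends(3)] energy[OF ends(2)] by simp
    ultimately have "(v L)\<^sup>2 \<le> 0" using even_slopes(3)[OF ne] by simp
    then have "v (-L) = 0" using even_slopes(1)[OF ne] by simp
    then show False using even_slopes(2)[OF ne] g1 \<gamma> p0 by simp
  qed
  then show even_dnoidal_profile by (rule even_dnoidal_profileI[OF ab ne])
qed

end

section \<open>The profile on the half-line and the shape of ground states\<close>

text \<open>Applied to the energy density on the half-line: being constant and integrable, it is
  zero.\<close>

lemma integrable_const_atLeast:
  assumes i: "integrable (lebesgue_on {a::real..}) (\<lambda>_. c::real)"
  shows "c = 0"
proof (rule ccontr)
  assume c: "c \<noteq> 0"
  define I where "I = integral\<^sup>L (lebesgue_on {a..}) (\<lambda>_. \<bar>c\<bar>)"
  have ic: "integrable (lebesgue_on {a..}) (\<lambda>_. \<bar>c\<bar>)" using Bochner_Integration.integrable_norm[OF i] by simp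
  have I0: "0 \<le> I" unfolding I_def by (rule Bochner_Integration.integral_nonneg) simp
  define R where "R = (I + 1) / \<bar>c\<bar>"
  have R: "0 \<le> R" "R * \<bar>c\<bar> = I + 1" using I0 c by (auto simp: R_def)
  have "integral\<^sup>L (lebesgue_on {a..a+R}) (\<lambda>_. \<bar>c\<bar>) \<le> I"
    unfolding I_def by (rule lebesgue_on_integral_mono_set[OF ic]) auto
  moreover have "integral\<^sup>L (lebesgue_on {a..a+R}) (\<lambda>_. \<bar>c\<bar>) = R * \<bar>c\<bar>" using R(1) by (simp add: measure_restrict_space)
  ultimately show False using R(2) by simp
qed

lemma tanh_surj:
  fixes t :: real
  assumes "\<bar>t\<bar> < 1"
  obtains b where "tanh b = t"
proof -
  have t: "0 < 1 + t" "0 < 1 - t" using assms by auto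
  define r where "r = (1 - t) / (1 + t)"
  have r: "0 < r" using t by (simp add: r_def)
  define b where "b = - ln r / 2"
  have "tanh b = (1 - r) / (1 + r)" unfolding tanh_real_altdef using r by (simp add: b_def)
  also have "\<dots> = t" using t by (simp add: r_def field_simps)
  finally show ?thesis by (rule that)
qed

text \<open>On the half-line the energy is zero, so w follows the homoclinic orbit; subtracting the
  explicit quartic mass of this piece of soliton from \<Lambda> leaves the bound
  \<open>loop4\<close> for the loop.\<close>

lemma ground_loop_profile:
  assumes gr: "ground (\<mu>\<^sup>2) \<gamma> L w g" and \<mu>: "0 < \<mu>" and \<gamma>: "0 < \<gamma>" and L: "0 < L"
    and \<Lambda>: "best_const (\<mu>\<^sup>2) \<gamma> L < 16/3 * \<mu>^3" and nn: "\<And>x. -L \<le> x \<Longrightarrow> 0 \<le> w x"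
  obtains v b where "loop_profile \<mu> \<gamma> L (tanh b) w v" "\<And>y. 0 \<le> y \<Longrightarrow> w (y + L) = sech_profile (\<mu>\<^sup>2) b y"
proof -
  have \<mu>2: "0 < \<mu>\<^sup>2" using \<mu> by simp
  obtain vc vh where cl: "classical (\<mu>\<^sup>2) \<gamma> L w vc vh" and Hc: "H1_pair {-L..L} w vc" and Hh: "H1_pair {L..} w vh"
    and gv: "ground (\<mu>\<^sup>2) \<gamma> L w (\<lambda>x. if x \<le> L then vc x else vh x)"
    by (rule ground_classical[OF gr less_imp_le[OF \<mu>2] less_imp_le[OF \<gamma>] L])
  define gg where "gg = (\<lambda>x. if x \<le> L then vc x else vh x)"
  have adm: "admissible L w gg" and \<Lambda>0: "0 < best_const (\<mu>\<^sup>2) \<gamma> L" and Q: "quad (\<mu>\<^sup>2) \<gamma> L w gg = best_const (\<mu>\<^sup>2) \<gamma> L"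
    and B: "quart L w = best_const (\<mu>\<^sup>2) \<gamma> L"
    using gv by (auto simp: ground_def gg_def)
  note i = admissible_integrable[OF adm]
  have LL: "-L \<le> L" using L by simp
  have oc: "soliton_ode (\<mu>\<^sup>2) {-L..L} w vc" and oh: "soliton_ode (\<mu>\<^sup>2) {L..} w vh" and kir: "vh L + vc (-L) - vc L = \<gamma> * w L"
    using cl by (auto simp: classical_def soliton_ode_def)
  have closed: "w (-L) = w L" using adm by (simp add: admissible_def)
  \<comment> \<open>If the non-negative w vanished at the vertex, all outgoing derivatives would be
    non-negative with sum zero, hence zero, and uniqueness would give w = 0.\<close>
  have p0: "0 < w L"
  proof (rule ccontr)
    assume "\<not> 0 < w L"
    then have wL: "w L = 0" using nn[OF LL] by simp
    have dh: "(w has_real_derivative vh L) (at L within {L..L+1})"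
      by (rule DERIV_subset[OF soliton_odeD(1)[OF oh]]) auto
    have "0 \<le> vh L" by (rule left_end_min[OF _ dh]) (use wL nn L in auto)
    moreover have "0 \<le> vc (-L)" by (rule left_end_min[OF _ soliton_odeD(1)[OF oc]]) (use wL closed nn L in auto)
    moreover have "vc L \<le> 0" by (rule right_end_min[OF _ soliton_odeD(1)[OF oc]]) (use wL nn L in auto)
    ultimately have v0: "vh L = 0" "vc L = 0" using kir wL by auto
    have z: "soliton_ode (\<mu>\<^sup>2) X (\<lambda>_. 0) (\<lambda>_. 0)" for X by (simp add: soliton_ode_def)
    have "w x = 0" if "x \<in> {-L..}" for x
    proof (cases "x \<le> L")
      case True
      then show ?thesis using soliton_ode_unique(1)[OF is_interval_cc _ _ oc z, of L x] that L wL v0 by simp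
    next
      case False
      then show ?thesis using soliton_ode_unique(1)[OF is_interval_ci _ _ oh z, of L x] wL v0 by simp
    qed
    then have "quart L w = integral\<^sup>L (lebesgue_on {-L..}) (\<lambda>x. 0)"
      unfolding quart_def by (intro Bochner_Integration.integral_cong) auto
    then show False using B \<Lambda>0 by simp
  qed
  define c where "c = (vh L)\<^sup>2 - \<mu>\<^sup>2 * (w L)\<^sup>2 + (w L)^4 / 2"
  have w4h: "integrable (lebesgue_on {L..}) (\<lambda>x. (w x)^4)" by (rule integrable_lebesgue_on_interval_split(2)[OF i(3) LL])
  have "c = 0"
  proof (rule integrable_const_atLeast)
    have "integrable (lebesgue_on {L..}) (\<lambda>x. (vh x)\<^sup>2 - \<mu>\<^sup>2 * (w x)\<^sup>2 + (w x)^4 / 2)"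
      using Hh w4h by (intro Bochner_Integration.integrable_add Bochner_Integration.integrable_diff integrable_mult_right integrable_divide)
        (auto simp: H1_pair_def sq_integrable_def)
    then show "integrable (lebesgue_on {L..}) (\<lambda>_. c)"
    proof (rule Bochner_Integration.integrable_cong[THEN iffD1, rotated 2])
      fix x assume "x \<in> space (lebesgue_on {L..})"
      then show "(vh x)\<^sup>2 - \<mu>\<^sup>2 * (w x)\<^sup>2 + (w x)^4 / 2 = c"
        unfolding c_def by (intro soliton_ode_energy[OF oh is_interval_ci]) auto
    qed simp
  qed
  then have en: "(vh L)\<^sup>2 = \<mu>\<^sup>2 * (w L)\<^sup>2 - (w L)^4 / 2" by (simp add: c_def)
  \<comment> \<open>On the soliton the logarithmic derivative is -\<mu> times the hyperbolic
    tangent, so this T is the tangent of the translation parameter.\<close>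
  define T where "T = - vh L / (\<mu> * w L)"
  have vhL: "vh L = - \<mu> * T * w L" using \<mu> p0 by (simp add: T_def)
  have wp2: "0 < (w L)\<^sup>2" using p0 by simp
  have p2: "(w L)\<^sup>2 = 2 * \<mu>\<^sup>2 * (1 - T\<^sup>2)"
  proof -
    have "(w L)\<^sup>2 * (\<mu>\<^sup>2 * T\<^sup>2) = (w L)\<^sup>2 * (\<mu>\<^sup>2 - (w L)\<^sup>2 / 2)"
      using en unfolding vhL by (simp add: power_mult_distrib algebra_simps flip: power_add)
    then have "\<mu>\<^sup>2 * T\<^sup>2 = \<mu>\<^sup>2 - (w L)\<^sup>2 / 2" using wp2 by (simp only: mult_cancel_left) simp
    then show ?thesis by (simp add: algebra_simps)
  qed
  have "0 < 2 * \<mu>\<^sup>2 * (1 - T\<^sup>2)" using wp2 by (simp only: p2)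
  then have "T\<^sup>2 < 1" using \<mu> by (simp add: zero_less_mult_iff)
  then have T1: "\<bar>T\<bar> < 1" by (simp add: abs_square_less_1)
  obtain b where b: "tanh b = T" by (rule tanh_surj[OF T1])
  have pb: "w L = sech_profile (\<mu>\<^sup>2) b 0"
  proof (rule power2_eq_imp_eq)
    show "(w L)\<^sup>2 = (sech_profile (\<mu>\<^sup>2) b 0)\<^sup>2" using sech_sq[of "\<mu>\<^sup>2" b 0] by (simp add: p2 b)
  qed (use p0 in \<open>auto simp: sech_profile_def\<close>)
  have vb: "vh L = sech_slope (\<mu>\<^sup>2) b 0" unfolding sech_slope_def pb[symmetric] using \<mu> by (simp add: b vhL)
  have im: "(\<lambda>x. x + L) ` {0..} = {L..}" by (auto intro: image_eqI[of _ _ "x - L" for x])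
  have os: "soliton_ode (\<mu>\<^sup>2) {0..} (\<lambda>x. w (x + L)) (\<lambda>x. vh (x + L))" by (rule soliton_ode_shift) (simp only: im oh)
  have W: "w (y + L) = sech_profile (\<mu>\<^sup>2) b y" if "0 \<le> y" for y
    by (rule soliton_ode_unique(1)[OF is_interval_ci _ _ os soliton_ode_sech[OF \<mu>2], of 0]) (use that pb vb in auto)
  have half: "integral\<^sup>L (lebesgue_on {L..}) (\<lambda>x. (w x)^4) = 8/3 * \<mu>^3 - 4 * \<mu>^3 * (T - T^3/3)"
  proof -
    have "integral\<^sup>L (lebesgue_on {L..}) (\<lambda>x. (w x)^4) = integral\<^sup>L (lebesgue_on {0..}) (\<lambda>x. (w (x + L))^4)"
      by (rule lebesgue_on_shift(2)[of "\<lambda>x. (w x)^4" L, symmetric])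
    also have "\<dots> = integral\<^sup>L (lebesgue_on {0..}) (\<lambda>x. (sech_profile (\<mu>\<^sup>2) b x)^4)"
      by (intro Bochner_Integration.integral_cong) (auto simp: W)
    also have "\<dots> = 8/3 * \<mu>^3 - 4 * \<mu>^3 * (T - T^3/3)"
      by (rule has_bochner_integral_integral_eq[OF sech_integrals(3)[OF \<mu>]]) (simp add: b)
    finally show ?thesis .
  qed
  have "integral\<^sup>L (lebesgue_on {-L..L}) (\<lambda>x. (w x)^4) = best_const (\<mu>\<^sup>2) \<gamma> L - integral\<^sup>L (lebesgue_on {L..}) (\<lambda>x. (w x)^4)"
    using integrable_lebesgue_on_interval_split(3)[OF i(3) LL] B by (simp add: quart_def)
  moreover have "integral\<^sup>L (lebesgue_on {-L..L}) (\<lambda>x. (w x)^4) = integral {-L..L} (\<lambda>x. (w x)^4)"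
    by (intro lebesgue_integral_eq_integral continuous_imp_integrable_real continuous_on_power soliton_ode_continuous_on(1)[OF oc]) auto
  ultimately have loop4: "integral {-L..L} (\<lambda>x. (w x)^4) < \<mu>^3 * (8/3 + 4 * T - 4/3 * T^3)"
    using \<Lambda> unfolding half by (simp add: algebra_simps)
  \<comment> \<open>The Dirichlet integral is at most the quadratic part, which equals \<Lambda>;
    this gives the Hoelder bound on the loop.\<close>
  have dirichlet: "integral\<^sup>L (lebesgue_on {-L..L}) (\<lambda>x. (vc x)\<^sup>2) \<le> 16/3 * \<mu>^3"
  proof -
    have "integral\<^sup>L (lebesgue_on {-L..L}) (\<lambda>x. (vc x)\<^sup>2) = integral\<^sup>L (lebesgue_on {-L..L}) (\<lambda>x. (gg x)\<^sup>2)"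
      by (intro Bochner_Integration.integral_cong) (auto simp: gg_def)
    also have "\<dots> \<le> integral\<^sup>L (lebesgue_on {-L..}) (\<lambda>x. (gg x)\<^sup>2)"
      by (rule lebesgue_on_integral_mono_set[OF i(1)]) auto
    also have "\<dots> \<le> quad (\<mu>\<^sup>2) \<gamma> L w gg"
    proof -
      have "quad (\<mu>\<^sup>2) \<gamma> L w gg = integral\<^sup>L (lebesgue_on {-L..}) (\<lambda>x. (gg x)\<^sup>2) + \<mu>\<^sup>2 * integral\<^sup>L (lebesgue_on {-L..}) (\<lambda>x. (w x)\<^sup>2) + \<gamma> * (w L)\<^sup>2"
        unfolding quad_def using i by simp
      moreover have "0 \<le> \<mu>\<^sup>2 * integral\<^sup>L (lebesgue_on {-L..}) (\<lambda>x. (w x)\<^sup>2)" "0 \<le> \<gamma> * (w L)\<^sup>2" using \<gamma> by auto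
      ultimately show ?thesis by linarith
    qed
    also have "\<dots> \<le> 16/3 * \<mu>^3" using \<Lambda> Q by simp
    finally show ?thesis .
  qed
  have hoelder: "(w x - w L)\<^sup>2 \<le> 2 * L * (16/3 * \<mu>^3)" if x: "x \<in> {-L..L}" for x
  proof -
    have sq: "sq_integrable {x..L} vc"
      by (rule sq_integrable_subset[of "{-L..L}"]) (use Hc x in \<open>auto simp: H1_pair_def\<close>)
    have ac: "ac_on {-L..L} w vc" using Hc by (simp add: H1_pair_def)
    have "integral {x..L} vc = w L - w x" using ac_onD[OF ac, of x L] x L by auto
    then have "(w L - w x)\<^sup>2 \<le> (L - x) * integral\<^sup>L (lebesgue_on {x..L}) (\<lambda>x. (vc x)\<^sup>2)"
      using sq_integrable_integral_bound[OF sq] x by simp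
    also have "\<dots> \<le> 2 * L * (16/3 * \<mu>^3)"
    proof (rule mult_mono)
      have "integral\<^sup>L (lebesgue_on {x..L}) (\<lambda>x. (vc x)\<^sup>2) \<le> integral\<^sup>L (lebesgue_on {-L..L}) (\<lambda>x. (vc x)\<^sup>2)"
        by (rule lebesgue_on_integral_mono_set) (use Hc x in \<open>auto simp: H1_pair_def sq_integrable_def\<close>)
      then show "integral\<^sup>L (lebesgue_on {x..L}) (\<lambda>x. (vc x)\<^sup>2) \<le> 16/3 * \<mu>^3" using dirichlet by linarith
    qed (use x L in auto)
    finally show ?thesis by (simp add: power2_commute)
  qed
  have jump: "vc (-L) - vc L = (\<gamma> + \<mu> * T) * w L" using kir vhL by (simp add: algebra_simps)
  have "loop_profile \<mu> \<gamma> L (tanh b) w vc"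
    unfolding b by (rule loop_profile.intro[OF \<mu> \<gamma> L oc closed p0 _ T1 p2 jump loop4 hoelder]) (auto intro: nn)
  then show ?thesis using W by (rule that)
qed

section \<open>Reading off the shape from the phase plane\<close>

lemma Gamma_iff:
  "(p, q) \<in> Gamma1 \<omega> \<gamma> \<longleftrightarrow> q = q_plus \<omega> \<gamma> p \<and> 0 < p \<and> p \<le> sqrt (2*\<omega>)"
  "(p, q) \<in> Gamma2 \<omega> \<gamma> \<longleftrightarrow> q = q_minus \<omega> \<gamma> p \<and> sqrt (2*(\<omega> - \<gamma>\<^sup>2)) \<le> p \<and> p \<le> sqrt (2*\<omega>)"
  "(p, q) \<in> Gamma3 \<omega> \<gamma> \<longleftrightarrow> q = q_minus \<omega> \<gamma> p \<and> 0 < p \<and> p \<le> sqrt (2*(\<omega> - \<gamma>\<^sup>2))"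
  by (auto simp: Gamma1_def Gamma2_def Gamma3_def)

text \<open>The hypotheses place P on Gamma1 only: \<open>q_plus\<close> and \<open>q_minus\<close>
  differ at this height, and p is below the heights of E0 and of the common point of Gamma2 and
  Gamma3. All other cases are vacuous.\<close>

lemma shape_A_tail:
  assumes "even_on_loop L uc" "(uc has_real_derivative q_plus \<omega> \<gamma> (uc (-L))) (at (-L) within {-L..L})"
    and p: "0 < uc (-L)" "uc (-L) < sqrt (2*(\<omega> - \<gamma>\<^sup>2))" and "tail_type \<omega> uh" "even_dnoidal \<omega> L uc"
  shows "shape_A \<omega> \<gamma> L uc uh"
proof -
  let ?p = "uc (-L)"
  have 1: "sqrt (2*(\<omega> - \<gamma>\<^sup>2)) \<le> sqrt (2*\<omega>)" by simp
  have "0 < sqrt (2*(\<omega> - \<gamma>\<^sup>2))" using p by linarith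
  then have g: "0 < \<omega> - \<gamma>\<^sup>2" by simp
  have "?p\<^sup>2 < (sqrt (2*(\<omega> - \<gamma>\<^sup>2)))\<^sup>2" using p by (intro power_strict_mono) auto
  then have "?p\<^sup>2 < 2 * \<omega> - 2 * \<gamma>\<^sup>2" using g by simp
  then have "?p\<^sup>2 < 2 * \<omega>" using zero_le_power2[of \<gamma>] by linarith
  then have "0 < sqrt (\<omega> - ?p\<^sup>2/2)" by simp
  then have "q_plus \<omega> \<gamma> ?p \<noteq> q_minus \<omega> \<gamma> ?p" using p(1) by (simp add: q_plus_def q_minus_def)
  then show ?thesis unfolding shape_A_def Let_def
    by (intro conjI assms(1) exI[of _ "q_plus \<omega> \<gamma> ?p"] assms(2)) (use p less_imp_le[OF less_le_trans[OF p(2) 1]] assms(5,6) in \<open>auto simp: Gamma_iff E0_def\<close>)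
qed

text \<open>P lies on Gamma2 only, strictly above the common point with Gamma3 and strictly below
  E0, so (A-iii)(c) is the only case with a true premise.\<close>

lemma shape_A_bump:
  assumes "even_on_loop L uc" "(uc has_real_derivative q_minus \<omega> \<gamma> (uc (-L))) (at (-L) within {-L..L})"
    and p: "0 < uc (-L)" "sqrt (2*(\<omega> - \<gamma>\<^sup>2)) < uc (-L)" "uc (-L) < sqrt (2*(\<omega> - \<gamma>\<^sup>2/9))" and \<gamma>: "0 < \<gamma>"
    and "bump_type \<omega> uh" "even_dnoidal \<omega> L uc"
  shows "shape_A \<omega> \<gamma> L uc uh"
proof -
  let ?p = "uc (-L)"
  have g: "0 < \<gamma>\<^sup>2" using \<gamma> by simp
  then have 1: "sqrt (2*(\<omega> - \<gamma>\<^sup>2/9)) < sqrt (2*\<omega>)" by simp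
  have "0 < sqrt (2*(\<omega> - \<gamma>\<^sup>2/9))" using p by linarith
  then have g9: "0 < \<omega> - \<gamma>\<^sup>2/9" by simp
  have "?p\<^sup>2 < (sqrt (2*(\<omega> - \<gamma>\<^sup>2/9)))\<^sup>2" using p by (intro power_strict_mono) auto
  also have "\<dots> = 2 * \<omega> - 2 * \<gamma>\<^sup>2/9" using g9 by simp
  finally have "?p\<^sup>2 < 2 * \<omega>" using g by linarith
  then have "0 < sqrt (\<omega> - ?p\<^sup>2/2)" by simp
  then have "q_plus \<omega> \<gamma> ?p \<noteq> q_minus \<omega> \<gamma> ?p" using p(1) by (simp add: q_plus_def q_minus_def)
  then show ?thesis unfolding shape_A_def Let_def
    by (intro conjI assms(1) exI[of _ "q_minus \<omega> \<gamma> ?p"] assms(2)) (use p less_trans[OF p(3) 1] assms(7,8) in \<open>auto simp: Gamma_iff E0_def\<close>)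
qed

text \<open>From \<open>p2\<close>,
  \<open>sqrt (\<mu>\<^sup>2 - (w L)\<^sup>2/2) = |\<mu> * T|\<close>. Thus the slope at the vertex
  is \<open>q_plus\<close> for positive and \<open>q_minus\<close> for negative T, and comparing
  |\<mu> T| with \<gamma> and \<gamma>/3 is comparing w L with the two critical heights.\<close>

lemma (in loop_profile) shape_A_of_profile:
  assumes e: even_dnoidal_profile and b: "T = tanh b"
    and T: "\<gamma> < \<mu> * T \<or> - \<gamma> < \<mu> * T \<and> \<mu> * T < - \<gamma> / 3"
    and uc: "\<And>x. x \<in> {-L..L} \<Longrightarrow> uc x = w x" and uh: "\<And>y. 0 \<le> y \<Longrightarrow> uh y = sech_profile (\<mu>\<^sup>2) b y"
  shows "shape_A (\<mu>\<^sup>2) \<gamma> L uc uh"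
proof -
  have ev: "even_on_loop L uc"
    unfolding even_on_loop_def
  proof
    fix x assume x: "x \<in> {-L..L}"
    then have "-x \<in> {-L..L}" by simp
    then show "uc (-x) = uc x" using e x uc by (simp add: even_dnoidal_profile_def)
  qed
  have up: "uc (-L) = w L" using uc[OF ends(1)] closed by simp
  have "(w has_real_derivative v (-L)) (at (-L) within {-L..L})" by (rule soliton_odeD(1)[OF ode ends(1)])
  then have dq: "(uc has_real_derivative v (-L)) (at (-L) within {-L..L})"
    by (rule has_field_derivative_transform_within[OF _ zero_less_one ends(1)]) (use uc in auto)
  have vq: "v (-L) = w L / 2 * (\<gamma> + \<mu> * T)" using e by (simp add: even_dnoidal_profile_def)
  have s: "sqrt (\<mu>\<^sup>2 - (w L)\<^sup>2/2) = \<bar>\<mu> * T\<bar>"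
  proof -
    have "\<mu>\<^sup>2 - (w L)\<^sup>2/2 = (\<mu> * T)\<^sup>2" unfolding p2 by (simp add: field_simps power_mult_distrib)
    then show ?thesis by simp
  qed
  have p2': "(w L)\<^sup>2 = 2 * (\<mu>\<^sup>2 - (\<mu> * T)\<^sup>2)" unfolding p2 by (simp add: algebra_simps power_mult_distrib)
  have c: "\<mu>\<^sup>2 < (w 0)\<^sup>2" "(w 0)\<^sup>2 < 2 * \<mu>\<^sup>2" "v 0 = 0" using e by (auto simp: even_dnoidal_profile_def)
  have c0: "0 < w 0" using nonneg[OF ends(3)] c(1) \<mu> by (cases "w 0 = 0") auto
  obtain k where "dnoidal_type (\<mu>\<^sup>2) {-L..L} w k 0"
    using soliton_ode_dnoidal[OF ode L _ c(1,2) c0 c(3)] \<mu> by auto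
  then have "dnoidal_type (\<mu>\<^sup>2) {-L..L} uc k 0" using uc by (simp add: dnoidal_type_def)
  then have dn: "even_dnoidal (\<mu>\<^sup>2) L uc" unfolding even_dnoidal_def by blast
  have se: "sech_type (\<mu>\<^sup>2) {0..} uh b" using uh by (simp add: sech_type_def)
  show ?thesis
  proof (cases "\<gamma> < \<mu> * T")
    case True
    have "\<mu> * 0 < \<mu> * T" using True \<gamma> by simp
    then have T0: "0 < T" using \<mu> by (simp only: mult_less_cancel_left_pos)
    then have "0 < b" using b by simp
    then have tail: "tail_type (\<mu>\<^sup>2) uh" using se unfolding tail_type_def by blast
    have "v (-L) = q_plus (\<mu>\<^sup>2) \<gamma> (uc (-L))" unfolding q_plus_def up s using T0 \<mu> vq by simp
    with dq have d: "(uc has_real_derivative q_plus (\<mu>\<^sup>2) \<gamma> (uc (-L))) (at (-L) within {-L..L})" by simp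
    have "\<gamma>\<^sup>2 < (\<mu> * T)\<^sup>2" using True \<gamma> by (intro power_strict_mono) auto
    then have "uc (-L) < sqrt (2*(\<mu>\<^sup>2 - \<gamma>\<^sup>2))" unfolding up by (intro real_less_rsqrt) (simp add: p2')
    then show ?thesis using p0 up by (intro shape_A_tail[OF ev d _ _ tail dn]) auto
  next
    case False
    then have T': "- \<gamma> < \<mu> * T" "\<mu> * T < - \<gamma> / 3" using T by auto
    have "\<mu> * T < \<mu> * 0" using T' \<gamma> by simp
    then have T0: "T < 0" using \<mu> by (simp only: mult_less_cancel_left_pos)
    then have "b < 0" using b by simp
    then have bump: "bump_type (\<mu>\<^sup>2) uh" using se unfolding bump_type_def by blast
    have mT: "\<mu> * T < 0" using T0 \<mu> by (simp add: mult_pos_neg)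
    have "v (-L) = q_minus (\<mu>\<^sup>2) \<gamma> (uc (-L))" unfolding q_minus_def up s using mT vq by simp
    with dq have d: "(uc has_real_derivative q_minus (\<mu>\<^sup>2) \<gamma> (uc (-L))) (at (-L) within {-L..L})" by simp
    have "(- (\<mu> * T))\<^sup>2 < \<gamma>\<^sup>2" using T' mT by (intro power_strict_mono) auto
    then have "2 * (\<mu>\<^sup>2 - \<gamma>\<^sup>2) < (w L)\<^sup>2" by (simp add: p2')
    then have 1: "sqrt (2*(\<mu>\<^sup>2 - \<gamma>\<^sup>2)) < uc (-L)" unfolding up using p0 by (intro real_less_lsqrt) auto
    have "(\<gamma> / 3)\<^sup>2 < (- (\<mu> * T))\<^sup>2" using T' \<gamma> by (intro power_strict_mono) auto
    then have 2: "uc (-L) < sqrt (2*(\<mu>\<^sup>2 - \<gamma>\<^sup>2/9))" unfolding up by (intro real_less_rsqrt) (simp add: p2' power_divide)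
    show ?thesis using p0 up by (intro shape_A_bump[OF ev d _ 1 2 \<gamma> bump dn]) simp
  qed
qed

text \<open>Isolates what depends on the size of L: a test function below the constant of the line
  and the analysis of the loop. Existence and the passage from arbitrary non-negative ground states
  to loop profiles are common to both regimes.\<close>

lemma regime:
  assumes \<mu>: "0 < \<mu>" and \<gamma>: "0 < \<gamma>" and L: "0 < L"
    and test: "admissible L f0 g0" "(quad (\<mu>\<^sup>2) \<gamma> L f0 g0)\<^sup>2 < 16/3 * \<mu>^3 * quart L f0"
    and profile: "\<And>T w v. loop_profile \<mu> \<gamma> L T w v \<Longrightarrow>
      loop_profile.even_dnoidal_profile \<mu> \<gamma> L T w v \<and> (\<gamma> < \<mu> * T \<or> - \<gamma> < \<mu> * T \<and> \<mu> * T < - \<gamma> / 3)"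
  shows "(\<exists>u. action_ground_state (\<mu>\<^sup>2) \<gamma> L u \<and> tadpole_nonneg L u) \<and>
    (\<forall>u. action_ground_state (\<mu>\<^sup>2) \<gamma> L u \<and> tadpole_nonneg L u \<longrightarrow> ground_state_shape (\<mu>\<^sup>2) \<gamma> L u)"
proof -
  have \<omega>0: "0 \<le> \<mu>\<^sup>2" and \<gamma>0: "0 \<le> \<gamma>" using \<gamma> by auto
  obtain w g where w: "ground (\<mu>\<^sup>2) \<gamma> L w g" "\<And>x. 0 \<le> w x" and \<Lambda>: "best_const (\<mu>\<^sup>2) \<gamma> L < 16/3 * \<mu>^3"
  proof (rule ground_exists[OF refl \<mu> \<gamma>0 L test])
    fix w g assume "ground (\<mu>\<^sup>2) \<gamma> L w g" "\<And>x. 0 \<le> w x" "best_const (\<mu>\<^sup>2) \<gamma> L < 16/3 * \<mu>^3"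
    then show thesis by (rule that)
  qed
  note gs = ground_state_from_ground[OF L \<omega>0 \<gamma>0 w]
  have \<Lambda>0: "0 < best_const (\<mu>\<^sup>2) \<gamma> L" using w(1) by (simp add: ground_def)
  have "ground_state_shape (\<mu>\<^sup>2) \<gamma> L u" if u: "action_ground_state (\<mu>\<^sup>2) \<gamma> L u" "tadpole_nonneg L u" for u
  proof -
    define z where "z = (\<lambda>x. Re (glue L u x))"
    obtain g' where z: "ground (\<mu>\<^sup>2) \<gamma> L z g'" "\<And>x. -L \<le> x \<Longrightarrow> 0 \<le> z x"
      unfolding z_def by (rule ground_from_ground_state[OF L \<omega>0 \<gamma>0 gs(3) \<Lambda>0 u]) blast
    obtain v b where lp: "loop_profile \<mu> \<gamma> L (tanh b) z v" and half: "\<And>y. 0 \<le> y \<Longrightarrow> z (y + L) = sech_profile (\<mu>\<^sup>2) b y"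
    proof (rule ground_loop_profile[OF z(1) \<mu> \<gamma> L \<Lambda>])
      show "0 \<le> z x" if "-L \<le> x" for x by (rule z(2)[OF that])
      fix v b assume "loop_profile \<mu> \<gamma> L (tanh b) z v" "\<And>y. 0 \<le> y \<Longrightarrow> z (y + L) = sech_profile (\<mu>\<^sup>2) b y"
      then show thesis by (rule that)
    qed
    interpret loop_profile \<mu> \<gamma> L "tanh b" z v by (rule lp)
    have uH: "u \<in> H1D L" using u(1) by (simp add: action_ground_state_def nehari_set_def)
    have uc: "Re (fst u x) = z x" if "x \<in> {-L..L}" for x using that by (simp add: z_def glue_def)
    have uh: "Re (snd u y) = sech_profile (\<mu>\<^sup>2) b y" if "0 \<le> y" for y
    proof -
      have "Re (snd u y) = z (y + L)" using that uH by (auto simp: z_def glue_def H1D_def)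
      then show ?thesis using half[OF that] by simp
    qed
    have "shape_A (\<mu>\<^sup>2) \<gamma> L (\<lambda>x. Re (fst u x)) (\<lambda>x. Re (snd u x))"
      using profile[OF lp] by (intro shape_A_of_profile[OF _ refl _ uc uh]) auto
    then show ?thesis by (simp add: ground_state_shape_def)
  qed
  then show ?thesis using gs(1,2) by blast
qed

lemma root_bound: "root 3 (1 - sqrt 3 / 2) < 53/100"
proof -
  \<comment> \<open>The cube of 53/100 is 0.148877, so sqrt 3 must exceed 1.702246.\<close>
  have "17023/10000 < sqrt 3" by (rule real_less_rsqrt) (simp add: power2_eq_square)
  then have "1 - sqrt 3 / 2 < (53/100)^3" by (simp add: power3_eq_cube)
  then have "root 3 (1 - sqrt 3 / 2) < root 3 ((53/100)^3)" by (subst real_root_less_iff) auto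
  then show ?thesis by (simp add: real_root_power_cancel)
qed

text \<open>The bounds on L are those of the loop estimate; the first one also keeps
  \<open>2 * L * \<mu>\<^sup>2\<close> below \<mu>/600, so that the plateau condition with 55/100
  holds.\<close>

lemma small_regime:
  assumes \<mu>: "0 < \<mu>" and \<gamma>: "0 < \<gamma>" "\<gamma> < 53/100 * \<mu>" and L: "0 < L" "L < 1 / (1200 * \<mu>)" "L < \<gamma> / (18 * \<mu>\<^sup>2)"
  shows "(\<exists>u. action_ground_state (\<mu>\<^sup>2) \<gamma> L u \<and> tadpole_nonneg L u) \<and>
    (\<forall>u. action_ground_state (\<mu>\<^sup>2) \<gamma> L u \<and> tadpole_nonneg L u \<longrightarrow> ground_state_shape (\<mu>\<^sup>2) \<gamma> L u)"
proof -
  have L1: "L * \<mu> < 1/1200" using L(2) \<mu> by (simp add: field_simps)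
  have L2: "L * \<mu>\<^sup>2 < \<gamma> / 18" using L(3) \<mu> by (simp add: field_simps)
  have "L * \<mu> * \<mu> < 1/1200 * \<mu>" using L1 \<mu> by (rule mult_strict_right_mono)
  then have "2 * (L * \<mu>\<^sup>2) < 1/600 * \<mu>" by (simp add: power2_eq_square mult.assoc)
  moreover have "2 * L * \<mu>\<^sup>2 = 2 * (L * \<mu>\<^sup>2)" by simp
  ultimately have "\<gamma> + 2 * L * \<mu>\<^sup>2 \<le> 55/100 * \<mu>" using \<gamma>(2) \<mu> by linarith
  then obtain f g where "admissible L f g" "(quad (\<mu>\<^sup>2) \<gamma> L f g)\<^sup>2 < 16/3 * \<mu>^3 * quart L f"
    by (rule plateau_test_function[OF \<mu> less_imp_le[OF \<gamma>(1)] _ L(1)])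
  then show ?thesis
  proof (rule regime[OF \<mu> \<gamma>(1) L(1)])
    fix T w v assume "loop_profile \<mu> \<gamma> L T w v"
    note s = loop_profile.small_loop[OF this \<gamma>(2) L1 L2]
    show "loop_profile.even_dnoidal_profile \<mu> \<gamma> L T w v \<and> (\<gamma> < \<mu> * T \<or> - \<gamma> < \<mu> * T \<and> \<mu> * T < - \<gamma> / 3)"
      using s by blast
  qed
qed

lemma large_regime:
  assumes \<mu>: "0 < \<mu>" and \<gamma>: "0 < \<gamma>" "\<gamma> < \<mu>"
  obtains Ls where "0 < Ls" "\<And>L. Ls \<le> L \<Longrightarrow> (\<exists>u. action_ground_state (\<mu>\<^sup>2) \<gamma> L u \<and> tadpole_nonneg L u) \<and>
    (\<forall>u. action_ground_state (\<mu>\<^sup>2) \<gamma> L u \<and> tadpole_nonneg L u \<longrightarrow> ground_state_shape (\<mu>\<^sup>2) \<gamma> L u)"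
proof -
  have "\<bar>\<gamma> / \<mu>\<bar> < 1" using \<mu> \<gamma> by simp
  then obtain \<xi> where \<xi>: "tanh \<xi> = \<gamma> / \<mu>" by (rule tanh_surj)
  \<comment> \<open>The second entry makes a vertex height below \<delta> \<mu> incompatible with
    \<open>|\<mu> * T| \<le> \<gamma>\<close>.\<close>
  define \<delta> where "\<delta> = min (1/10) (sqrt (\<mu>\<^sup>2 - \<gamma>\<^sup>2) / \<mu>)"
  have g2: "0 < \<mu>\<^sup>2 - \<gamma>\<^sup>2" using \<gamma> \<mu> by (simp add: power_strict_mono)
  have \<delta>: "0 < \<delta>" "\<delta> \<le> 1/10"
  proof -
    show "0 < \<delta>" unfolding \<delta>_def using g2 \<mu> by simp
    show "\<delta> \<le> 1/10" unfolding \<delta>_def by (rule min.cobounded1)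
  qed
  have "\<delta> * \<mu> \<le> sqrt (\<mu>\<^sup>2 - \<gamma>\<^sup>2) / \<mu> * \<mu>" using \<mu> by (intro mult_right_mono) (auto simp: \<delta>_def)
  then have "\<delta> * \<mu> \<le> sqrt (\<mu>\<^sup>2 - \<gamma>\<^sup>2)" using \<mu> by simp
  then have "(\<delta> * \<mu>)\<^sup>2 \<le> (sqrt (\<mu>\<^sup>2 - \<gamma>\<^sup>2))\<^sup>2" using \<delta> \<mu> by (intro power_mono) auto
  then have \<delta>2: "\<delta>\<^sup>2 * \<mu>\<^sup>2 < 2 * (\<mu>\<^sup>2 - \<gamma>\<^sup>2)" using g2 by (simp add: power_mult_distrib)
  \<comment> \<open>The three bounds on \<open>L * \<mu>\<close> serve the growth from the minimum,
    the soliton test function and the smallness of the minimum.\<close>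
  define M where "M = max 2 (max (\<bar>\<xi>\<bar> + 1) (8/3 / \<delta>^4))"
  show ?thesis
  proof (rule that[of "M / \<mu>"])
    show "0 < M / \<mu>" using \<mu> by (simp add: M_def)
    fix L assume "M / \<mu> \<le> L"
    then have "M \<le> L * \<mu>" using \<mu> by (simp add: pos_divide_le_eq)
    then have L\<mu>: "2 \<le> L * \<mu>" "\<bar>\<xi>\<bar> + 1 \<le> L * \<mu>" "8/3 / \<delta>^4 \<le> L * \<mu>" unfolding M_def by auto
    have "0 * \<mu> < L * \<mu>" using L\<mu>(1) by simp
    then have L: "0 < L" using \<mu> by (simp only: mult_less_cancel_right_pos)
    have L\<delta>: "16/3 \<le> 2 * (L * \<mu>) * \<delta>^4" using L\<mu>(3) \<delta>(1) by (simp add: pos_divide_le_eq)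
    have "\<xi> < \<mu> * L" using L\<mu>(2) by (simp add: mult.commute)
    then have "\<gamma> / \<mu> < tanh (\<mu> * L)" unfolding \<xi>[symmetric] by simp
    then have "\<gamma> < \<mu> * tanh (\<mu> * L)" using \<mu> by (simp add: pos_divide_less_eq mult.commute)
    note test = soliton_test_function[OF \<mu> this L less_imp_le[OF \<gamma>(1)]]
    show "(\<exists>u. action_ground_state (\<mu>\<^sup>2) \<gamma> L u \<and> tadpole_nonneg L u) \<and>
      (\<forall>u. action_ground_state (\<mu>\<^sup>2) \<gamma> L u \<and> tadpole_nonneg L u \<longrightarrow> ground_state_shape (\<mu>\<^sup>2) \<gamma> L u)"
    proof (rule regime[OF \<mu> \<gamma>(1) L test])
      fix T w v assume "loop_profile \<mu> \<gamma> L T w v"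
      note l = loop_profile.large_loop[OF this \<gamma>(2) \<delta> \<delta>2 L\<delta> L\<mu>(1)]
      show "loop_profile.even_dnoidal_profile \<mu> \<gamma> L T w v \<and> (\<gamma> < \<mu> * T \<or> - \<gamma> < \<mu> * T \<and> \<mu> * T < - \<gamma> / 3)"
        using l by blast
    qed
  qed
qed

theorem theorem1p1:
  shows
    "(\<forall>\<omega> \<gamma> :: real. 0 < \<omega> \<and> 0 < \<gamma> \<and> \<gamma> < root 3 (1 - sqrt 3 / 2) * sqrt \<omega> \<longrightarrow>
        (\<exists>Ls>0. \<forall>L. 0 < L \<and> L < Ls \<longrightarrow>
           (\<exists>u. action_ground_state \<omega> \<gamma> L u \<and> tadpole_nonneg L u) \<and>
           (\<forall>u. action_ground_state \<omega> \<gamma> L u \<and> tadpole_nonneg L u \<longrightarrow>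
                ground_state_shape \<omega> \<gamma> L u))) \<and>
     (\<forall>\<omega> \<gamma> :: real. 0 < \<omega> \<and> 0 < \<gamma> \<and> \<gamma> < sqrt \<omega> \<longrightarrow>
        (\<exists>Ls>0. \<forall>L\<ge>Ls.
           (\<exists>u. action_ground_state \<omega> \<gamma> L u \<and> tadpole_nonneg L u) \<and>
           (\<forall>u. action_ground_state \<omega> \<gamma> L u \<and> tadpole_nonneg L u \<longrightarrow>
                ground_state_shape \<omega> \<gamma> L u)))"
proof (intro conjI allI impI)
  fix \<omega> \<gamma> :: real
  assume a: "0 < \<omega> \<and> 0 < \<gamma> \<and> \<gamma> < root 3 (1 - sqrt 3 / 2) * sqrt \<omega>"
  define \<mu> where "\<mu> = sqrt \<omega>"
  have \<mu>: "0 < \<mu>" and \<omega>: "\<omega> = \<mu>\<^sup>2" using a by (auto simp: \<mu>_def)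
  have "root 3 (1 - sqrt 3 / 2) * \<mu> < 53/100 * \<mu>" using root_bound \<mu> by (rule mult_strict_right_mono)
  then have "\<gamma> < 53/100 * \<mu>" using a unfolding \<mu>_def by (blast intro: less_trans)
  then have \<gamma>: "0 < \<gamma>" "\<gamma> < 53/100 * \<mu>" using a by blast+
  have "0 < min (1 / (1200 * \<mu>)) (\<gamma> / (18 * \<mu>\<^sup>2))" using \<mu> \<gamma> by simp
  then show "\<exists>Ls>0. \<forall>L. 0 < L \<and> L < Ls \<longrightarrow>
     (\<exists>u. action_ground_state \<omega> \<gamma> L u \<and> tadpole_nonneg L u) \<and>
     (\<forall>u. action_ground_state \<omega> \<gamma> L u \<and> tadpole_nonneg L u \<longrightarrow> ground_state_shape \<omega> \<gamma> L u)"
    unfolding \<omega> using small_regime[OF \<mu> \<gamma>] by (intro exI[of _ "min (1 / (1200 * \<mu>)) (\<gamma> / (18 * \<mu>\<^sup>2))"] conjI allI impI) auto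
next
  fix \<omega> \<gamma> :: real
  assume a: "0 < \<omega> \<and> 0 < \<gamma> \<and> \<gamma> < sqrt \<omega>"
  define \<mu> where "\<mu> = sqrt \<omega>"
  have \<mu>: "0 < \<mu>" and \<omega>: "\<omega> = \<mu>\<^sup>2" and \<gamma>: "0 < \<gamma>" "\<gamma> < \<mu>" using a by (auto simp: \<mu>_def)
  show "\<exists>Ls>0. \<forall>L\<ge>Ls.
     (\<exists>u. action_ground_state \<omega> \<gamma> L u \<and> tadpole_nonneg L u) \<and>
     (\<forall>u. action_ground_state \<omega> \<gamma> L u \<and> tadpole_nonneg L u \<longrightarrow> ground_state_shape \<omega> \<gamma> L u)"
    unfolding \<omega> by (rule large_regime[OF \<mu> \<gamma>]) blast
qed

end
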